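(* Let $X_1$ and $X_2$ be compact connected graphs with fins whose universal covers $\widetilde{X}_1$ and $\widetilde{X}_2$ are isomorphic. Then $X_1$ and $X_2$ have isomorphic finite-index common covers; that is, there exist finite-sheeted covers $\widehat{X}_1 \to X_1$ and $\widehat{X}_2 \to X_2$ such that $\widehat{X}_1 \cong \widehat{X}_2$.
   Context: A graph with fins is a compact square complex constructed as follows. Let $Y$ be a finite graph, let $n \geq 0$, and for $1 \leq i \leq n$ let $S_i$ be a circle subdivided into $\ell_i \geq 1$ edges. Let $\gamma_i : S_i \to Y$ be a combinatorial (closed) geodesic of length $\ell_i$, i.e. a map sending vertices to vertices and open edges homeomorphically to open edges, which is locally injective. Let $\gamma : \bigsqcup_{i=1}^n S_i \to Y$ be the map restricting to $\gamma_i$ on $S_i$. The graph with fins is the mapping cylinder $$X = \Big( Y \sqcup \bigsqcup_{i=1}^n S_i \times [0,1] \Big) \Big/ \big( (x,0) \sim \gamma(x) \big),$$ which is a square complex: each edge of $S_i$ contributes one square (edge)$\times[0,1]$. The case $n = 0$ (no fins) gives an ordinary finite graph. Isomorphisms are isomorphisms of square complexes (cellular homeomorphisms taking cubes isometrically to cubes), and covers carry the lifted square complex structure. *)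

theory Defs
  imports "HOL-Analysis.Analysis" "Graph_Theory.Digraph"
begin

section \<open>Topological preliminaries\<close>

definition quotient_topology :: "'a topology \<Rightarrow> ('a \<Rightarrow> 'b) \<Rightarrow> 'b topology" where
  "quotient_topology X f =
     topology (\<lambda>U. U \<subseteq> f ` topspace X \<and> openin X {x \<in> topspace X. f x \<in> U})"

lemma openin_quotient_topology:
  "openin (quotient_topology X f) U \<longleftrightarrow>
     U \<subseteq> f ` topspace X \<and> openin X {x \<in> topspace X. f x \<in> U}"
proof -
  have 1: "{x \<in> topspace X. f x \<in> S \<inter> T} =
      {x \<in> topspace X. f x \<in> S} \<inter> {x \<in> topspace X. f x \<in> T}" for S T
    by auto
  have 2: "{x \<in> topspace X. f x \<in> \<Union>K} = (\<Union>S\<in>K. {x \<in> topspace X. f x \<in> S})" for K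
    by auto
  have "istopology (\<lambda>U. U \<subseteq> f ` topspace X \<and> openin X {x \<in> topspace X. f x \<in> U})"
    unfolding istopology_def 1 2 by blast
  then show ?thesis
    by (simp add: quotient_topology_def)
qed

lemma topspace_quotient_topology [simp]: "topspace (quotient_topology X f) = f ` topspace X"
proof -
  have "{x \<in> topspace X. f x \<in> f ` topspace X} = topspace X"
    by auto
  then have "openin (quotient_topology X f) (f ` topspace X)"
    by (simp add: openin_quotient_topology)
  then show ?thesis
    by (metis openin_quotient_topology openin_subset openin_topspace subset_antisym)
qed

lemma quotient_map_quotient_topology: "quotient_map X (quotient_topology X f) f"
  by (auto simp: quotient_map_def openin_quotient_topology)

text \<open>The disjoint union of two spaces with different point types.\<close>

definition plus_topology :: "'a topology \<Rightarrow> 'b topology \<Rightarrow> ('a + 'b) topology" where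
  "plus_topology X Y =
     topology (\<lambda>U. openin X {x. Inl x \<in> U} \<and> openin Y {y. Inr y \<in> U})"

lemma openin_plus_topology:
  "openin (plus_topology X Y) U \<longleftrightarrow> openin X {x. Inl x \<in> U} \<and> openin Y {y. Inr y \<in> U}"
proof -
  have 1: "{x. c x \<in> S \<inter> T} = {x. c x \<in> S} \<inter> {x. c x \<in> T}"
    for c :: "'z \<Rightarrow> 'a + 'b" and S T
    by auto
  have 2: "{x. c x \<in> \<Union>K} = (\<Union>S\<in>K. {x. c x \<in> S})" for c :: "'z \<Rightarrow> 'a + 'b" and K
    by auto
  have "istopology (\<lambda>U. openin X {x. Inl x \<in> U} \<and> openin Y {y. Inr y \<in> U})"
    unfolding istopology_def 1 2 by blast
  then show ?thesis
    by (simp add: plus_topology_def)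
qed

lemma topspace_plus_topology [simp]:
  "topspace (plus_topology X Y) = topspace X <+> topspace Y"
proof (rule subset_antisym)
  have *: "openin X {x. Inl x \<in> topspace (plus_topology X Y)}"
    "openin Y {y. Inr y \<in> topspace (plus_topology X Y)}"
    using openin_topspace[of "plus_topology X Y"] unfolding openin_plus_topology by blast+
  show "topspace (plus_topology X Y) \<subseteq> topspace X <+> topspace Y"
  proof
    fix z
    assume "z \<in> topspace (plus_topology X Y)"
    then show "z \<in> topspace X <+> topspace Y"
      using openin_subset[OF *(1)] openin_subset[OF *(2)] by (cases z) auto
  qed
  have "{x. Inl x \<in> topspace X <+> topspace Y} = topspace X"
    "{y. Inr y \<in> topspace X <+> topspace Y} = topspace Y"
    by auto
  then have "openin (plus_topology X Y) (topspace X <+> topspace Y)"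
    by (simp add: openin_plus_topology)
  then show "topspace X <+> topspace Y \<subseteq> topspace (plus_topology X Y)"
    by (rule openin_subset)
qed

text \<open>
  The next two notions are the library's \<^const>\<open>covering_space\<close> and
  \<^const>\<open>simply_connected\<close>, transferred from subsets of a topological type to
  abstract topologies; the lemmas show that they agree on such subsets.
\<close>

definition covering_map :: "'a topology \<Rightarrow> ('a \<Rightarrow> 'b) \<Rightarrow> 'b topology \<Rightarrow> bool" where
  "covering_map E p X \<longleftrightarrow>
     continuous_map E X p \<and> p ` topspace E = topspace X \<and>
     (\<forall>x \<in> topspace X. \<exists>T. x \<in> T \<and> openin X T \<and>
        (\<exists>v. \<Union>v = {e \<in> topspace E. p e \<in> T} \<and>
             (\<forall>u \<in> v. openin E u) \<and>
             pairwise disjnt v \<and>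
             (\<forall>u \<in> v. homeomorphic_map (subtopology E u) (subtopology X T) p)))"

definition simply_connected_space :: "'a topology \<Rightarrow> bool" where
  "simply_connected_space X \<longleftrightarrow>
     (\<forall>p q. pathin X p \<and> p 1 = p 0 \<and> pathin X q \<and> q 1 = q 0 \<longrightarrow>
        homotopic_with (\<lambda>r. r 1 = r 0) (top_of_set {0..1}) X p q)"

lemma simply_connected_space_top_of_set:
  "simply_connected_space (top_of_set S) \<longleftrightarrow> simply_connected S"
proof -
  have "pathin (top_of_set S) p \<longleftrightarrow> path p \<and> path_image p \<subseteq> S" for p
    by (simp add: pathin_def path_def path_image_def continuous_map_in_subtopology
        image_subset_iff_funcset)
  then show ?thesis
    unfolding simply_connected_space_def simply_connected_def homotopic_loops_def
      pathstart_def pathfinish_def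
    by (simp only: conj_ac)
qed

lemma homeomorphic_map_top_of_set:
  "homeomorphic_map (top_of_set S) (top_of_set T) p \<longleftrightarrow> (\<exists>q. homeomorphism S T p q)"
proof -
  have "homeomorphic_maps (top_of_set S) (top_of_set T) p q \<longleftrightarrow> homeomorphism S T p q" for q
  proof
    assume h: "homeomorphic_maps (top_of_set S) (top_of_set T) p q"
    then have "p ` S \<subseteq> T" "q ` T \<subseteq> S" "continuous_on S p" "continuous_on T q"
      "\<And>x. x \<in> S \<Longrightarrow> q (p x) = x" "\<And>y. y \<in> T \<Longrightarrow> p (q y) = y"
      by (auto simp: homeomorphic_maps_def continuous_map_in_subtopology)
    then show "homeomorphism S T p q"
      by (intro homeomorphismI) auto
  next
    assume "homeomorphism S T p q"
    then show "homeomorphic_maps (top_of_set S) (top_of_set T) p q"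
      by (auto simp: homeomorphic_maps_def homeomorphism_def continuous_map_in_subtopology)
  qed
  then show ?thesis
    by (simp add: homeomorphic_map_maps)
qed

lemma covering_map_top_of_set:
  "covering_map (top_of_set C) p (top_of_set S) \<longleftrightarrow> covering_space C p S"
proof -
  have 1: "continuous_map (top_of_set C) (top_of_set S) p \<and> p ` C = S
      \<longleftrightarrow> continuous_on C p \<and> p ` C = S"
    by (auto simp: continuous_map_in_subtopology)
  have 2: "(\<forall>u\<in>v. homeomorphic_map (subtopology (top_of_set C) u) (subtopology (top_of_set S) T) p)
      \<longleftrightarrow> (\<forall>u\<in>v. \<exists>q. homeomorphism u T p q)"
    if T: "openin (top_of_set S) T" and v: "\<forall>u\<in>v. openin (top_of_set C) u" for T v
  proof (intro ball_cong refl)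
    fix u assume "u \<in> v"
    have "C \<inter> u = u"
      using v \<open>u \<in> v\<close> openin_imp_subset by blast
    moreover have "S \<inter> T = T"
      using T openin_imp_subset by blast
    ultimately show "homeomorphic_map (subtopology (top_of_set C) u) (subtopology (top_of_set S) T) p
      \<longleftrightarrow> (\<exists>q. homeomorphism u T p q)"
      by (simp add: subtopology_subtopology homeomorphic_map_top_of_set)
  qed
  have 3: "{e \<in> topspace (top_of_set C). p e \<in> T} = C \<inter> p -` T" for T
    by auto
  show ?thesis
    unfolding covering_map_def covering_space_def 3
    unfolding topspace_euclidean_subtopology conj_assoc[symmetric] 1
    using 2 by (simp cong: conj_cong)
qed


section \<open>Square complexes\<close>

text \<open>
  A square complex is given by its underlying space, its set of vertices, and characteristic
  maps \<open>[0,1] \<rightarrow> X\<close> and \<open>[0,1]\<^sup>2 \<rightarrow> X\<close> for its edges and squares. Only the values of a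
  characteristic map on the cube matter, and a cell is determined by its characteristic map up
  to an isometry of the cube.
\<close>

record 'a square_complex =
  complex_space :: "'a topology"
  vertices :: "'a set"
  edge_maps :: "(real \<Rightarrow> 'a) set"
  square_maps :: "(real \<times> real \<Rightarrow> 'a) set"

abbreviation unit_interval :: "real set" where
  "unit_interval \<equiv> {0..1}"

abbreviation unit_square :: "(real \<times> real) set" where
  "unit_square \<equiv> {0..1} \<times> {0..1}"

definition self_isometry :: "'m::metric_space set \<Rightarrow> ('m \<Rightarrow> 'm) \<Rightarrow> bool" where
  "self_isometry C g \<longleftrightarrow> g ` C = C \<and> (\<forall>x\<in>C. \<forall>y\<in>C. dist (g x) (g y) = dist x y)"

text \<open>
  \<open>f\<close> takes every cell with a characteristic map in \<open>\<Phi>\<close> isometrically to a cell with a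
  characteristic map in \<open>\<Psi>\<close>.
\<close>

definition maps_cells ::
    "'m::metric_space set \<Rightarrow> ('a \<Rightarrow> 'b) \<Rightarrow> ('m \<Rightarrow> 'a) set \<Rightarrow> ('m \<Rightarrow> 'b) set \<Rightarrow> bool" where
  "maps_cells C f \<Phi> \<Psi> \<longleftrightarrow>
     (\<forall>\<phi>\<in>\<Phi>. \<exists>\<psi>\<in>\<Psi>. \<exists>g. self_isometry C g \<and> (\<forall>x\<in>C. f (\<phi> x) = \<psi> (g x)))"

definition cubical_map ::
    "'a square_complex \<Rightarrow> 'b square_complex \<Rightarrow> ('a \<Rightarrow> 'b) \<Rightarrow> bool" where
  "cubical_map X Y f \<longleftrightarrow>
     continuous_map (complex_space X) (complex_space Y) f \<and>
     f ` vertices X \<subseteq> vertices Y \<and>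
     maps_cells unit_interval f (edge_maps X) (edge_maps Y) \<and>
     maps_cells unit_square f (square_maps X) (square_maps Y)"

definition isomorphic_complexes :: "'a square_complex \<Rightarrow> 'b square_complex \<Rightarrow> bool" where
  "isomorphic_complexes X Y \<longleftrightarrow>
     (\<exists>f g. homeomorphic_maps (complex_space X) (complex_space Y) f g \<and>
            cubical_map X Y f \<and> cubical_map Y X g)"

text \<open>The characteristic maps of a cover are the lifts of those of the base.\<close>

definition lifted_cells ::
    "'m::topological_space set \<Rightarrow> 'a topology \<Rightarrow> ('a \<Rightarrow> 'b) \<Rightarrow> ('m \<Rightarrow> 'b) set \<Rightarrow> ('m \<Rightarrow> 'a) set" where
  "lifted_cells C E p \<Psi> =
     {\<phi>. continuous_map (top_of_set C) E \<phi> \<and> (\<exists>\<psi>\<in>\<Psi>. \<forall>x\<in>C. p (\<phi> x) = \<psi> x)}"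

definition lifted_complex ::
    "'a topology \<Rightarrow> ('a \<Rightarrow> 'b) \<Rightarrow> 'b square_complex \<Rightarrow> 'a square_complex" where
  "lifted_complex E p X =
     \<lparr> complex_space = E,
       vertices = {x \<in> topspace E. p x \<in> vertices X},
       edge_maps = lifted_cells unit_interval E p (edge_maps X),
       square_maps = lifted_cells unit_square E p (square_maps X) \<rparr>"

definition universal_cover :: "'a topology \<Rightarrow> ('a \<Rightarrow> 'b) \<Rightarrow> 'b square_complex \<Rightarrow> bool" where
  "universal_cover E p X \<longleftrightarrow> covering_map E p (complex_space X) \<and> simply_connected_space E"

text \<open>
  Covers of finite index are understood to be connected. Since the fibres are finite, every such
  cover of a space with point type \<open>'b\<close> is isomorphic to one with point type \<open>'b \<times> nat\<close>, so
  existence of a cover may be stated for the latter type without loss of generality.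
\<close>

definition finite_index_cover :: "'a topology \<Rightarrow> ('a \<Rightarrow> 'b) \<Rightarrow> 'b square_complex \<Rightarrow> bool" where
  "finite_index_cover E p X \<longleftrightarrow>
     covering_map E p (complex_space X) \<and> connected_space E \<and>
     (\<forall>x \<in> topspace (complex_space X). finite {e \<in> topspace E. p e = x})"


section \<open>Graphs as one-dimensional complexes\<close>

text \<open>
  An undirected graph, possibly with loops and multiple edges, is represented by a digraph in
  which every edge occurs as one arc, with an arbitrary orientation.
\<close>

datatype ('v, 'e) graph_point = Vertex 'v | Inner 'e real

definition edge_map :: "('v, 'e) pre_digraph \<Rightarrow> 'e \<Rightarrow> real \<Rightarrow> ('v, 'e) graph_point" where
  "edge_map G e t =
     (if t = 0 then Vertex (tail G e) else if t = 1 then Vertex (head G e) else Inner e t)"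

definition realization :: "('v, 'e) pre_digraph \<Rightarrow> ('v, 'e) graph_point topology" where
  "realization G =
     quotient_topology
       (plus_topology (discrete_topology (verts G))
          (prod_topology (discrete_topology (arcs G)) (top_of_set unit_interval)))
       (case_sum Vertex (\<lambda>(e, t). edge_map G e t))"

definition cycle_graph :: "nat \<Rightarrow> (nat, nat) pre_digraph" where
  "cycle_graph l = \<lparr> verts = {..<l}, arcs = {..<l}, tail = (\<lambda>k. k), head = (\<lambda>k. Suc k mod l) \<rparr>"

text \<open>
  Edges of \<open>G\<close> are mapped to edges of \<open>H\<close> isometrically, not merely homeomorphically on their
  interiors, so that mapping cylinders of such maps are square complexes.
\<close>

definition combinatorial_map ::
    "('v, 'e) pre_digraph \<Rightarrow> ('w, 'f) pre_digraph \<Rightarrow>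
     (('v, 'e) graph_point \<Rightarrow> ('w, 'f) graph_point) \<Rightarrow> bool" where
  "combinatorial_map G H f \<longleftrightarrow>
     continuous_map (realization G) (realization H) f \<and>
     f ` Vertex ` verts G \<subseteq> Vertex ` verts H \<and>
     maps_cells unit_interval f (edge_map G ` arcs G) (edge_map H ` arcs H)"

definition locally_injective :: "'a topology \<Rightarrow> ('a \<Rightarrow> 'b) \<Rightarrow> bool" where
  "locally_injective X f \<longleftrightarrow> (\<forall>x \<in> topspace X. \<exists>U. openin X U \<and> x \<in> U \<and> inj_on f U)"

definition closed_geodesic ::
    "nat \<Rightarrow> ('v, 'e) pre_digraph \<Rightarrow> ((nat, nat) graph_point \<Rightarrow> ('v, 'e) graph_point) \<Rightarrow> bool" where
  "closed_geodesic l G f \<longleftrightarrow>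
     l \<ge> 1 \<and> combinatorial_map (cycle_graph l) G f \<and>
     locally_injective (realization (cycle_graph l)) f"


section \<open>Graphs with fins\<close>

record ('v, 'e) fin_data =
  base_graph :: "('v, 'e) pre_digraph"
  num_fins :: nat
  fin_length :: "nat \<Rightarrow> nat"
  fin_map :: "nat \<Rightarrow> (nat, nat) graph_point \<Rightarrow> ('v, 'e) graph_point"

definition fin_circle :: "('v, 'e) fin_data \<Rightarrow> nat \<Rightarrow> (nat, nat) pre_digraph" where
  "fin_circle F i = cycle_graph (fin_length F i)"

definition graph_with_fins :: "('v, 'e) fin_data \<Rightarrow> bool" where
  "graph_with_fins F \<longleftrightarrow>
     fin_digraph (base_graph F) \<and>
     (\<forall>i < num_fins F. closed_geodesic (fin_length F i) (base_graph F) (fin_map F i))"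

text \<open>
  The points of the mapping cylinder are those of the base graph together with the points
  \<open>(x, t)\<close> of the \<open>i\<close>-th fin with \<open>t > 0\<close>; \<open>fin_point\<close> sends a point of the \<open>i\<close>-th cylinder to
  its class.
\<close>

datatype ('v, 'e) cylinder_point =
  Base "('v, 'e) graph_point" | Fin nat "(nat, nat) graph_point" real

definition fin_point ::
    "('v, 'e) fin_data \<Rightarrow> nat \<Rightarrow> (nat, nat) graph_point \<Rightarrow> real \<Rightarrow> ('v, 'e) cylinder_point" where
  "fin_point F i x t = (if t = 0 then Base (fin_map F i x) else Fin i x t)"

definition mapping_cylinder :: "('v, 'e) fin_data \<Rightarrow> ('v, 'e) cylinder_point topology" where
  "mapping_cylinder F =
     quotient_topology
       (plus_topology (realization (base_graph F))
          (sum_topology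
             (\<lambda>i. prod_topology (realization (fin_circle F i)) (top_of_set unit_interval))
             {..<num_fins F}))
       (case_sum Base (\<lambda>(i, x, t). fin_point F i x t))"

text \<open>
  The edges are those of the base graph, the outer boundary edges of the fins, and the edges
  \<open>{v} \<times> [0,1]\<close> for the vertices \<open>v\<close> of the circles.
\<close>

definition fin_complex :: "('v, 'e) fin_data \<Rightarrow> ('v, 'e) cylinder_point square_complex" where
  "fin_complex F =
     \<lparr> complex_space = mapping_cylinder F,
       vertices =
         (Base \<circ> Vertex) ` verts (base_graph F) \<union>
         {fin_point F i (Vertex k) 1 | i k. i < num_fins F \<and> k \<in> verts (fin_circle F i)},
       edge_maps =
         {\<lambda>t. Base (edge_map (base_graph F) e t) | e. e \<in> arcs (base_graph F)} \<union>
         {\<lambda>t. fin_point F i (edge_map (fin_circle F i) k t) 1 | i k.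
            i < num_fins F \<and> k \<in> arcs (fin_circle F i)} \<union>
         {\<lambda>t. fin_point F i (Vertex k) t | i k.
            i < num_fins F \<and> k \<in> verts (fin_circle F i)},
       square_maps =
         {\<lambda>(s, t). fin_point F i (edge_map (fin_circle F i) k s) t | i k.
            i < num_fins F \<and> k \<in> arcs (fin_circle F i)} \<rparr>"

end

theory Submission
  imports Defs
begin

text \<open>
  The proof is a version of Leighton's theorem for graphs: finite data describing both complexes
  near the vertices of their base graphs are glued, in suitable multiplicities, to a finite
  object that covers both.

  \<^bold>\<open>Local data.\<close> A graph with fins is determined by the following items: the vertices of the base
  graph; its darts, which are its edges with a direction; and the corners, which are the squares
  with a choice of one of their two vertices in the base graph. A corner is attached to the dart
  that runs along its square. The two corners at a vertical edge are opposite to each other, and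
  reflecting a square exchanges its two corners. A local isomorphism from a vertex \<open>v\<close> of the first
  base graph to a vertex \<open>w\<close> of the second one matches the items at \<open>v\<close> with those at \<open>w\<close> and
  respects these relations. A bisimulation is a set of local isomorphisms in which each member
  can be continued across every dart: some member at the other end of the dart agrees with it on
  the dart and on the squares along the dart.

  \<^bold>\<open>From covers to a bisimulation.\<close> An isomorphism \<open>f\<close> between covers restricts at each vertex \<open>x\<close>
  to a local isomorphism between the stars of the images of \<open>x\<close> and \<open>f x\<close>, because cells in a cover
  are lifts of cells, and these local isomorphisms form a bisimulation. This needs that \<open>f\<close> sends
  vertices over the base graph to vertices over the base graph. Vertical edges are recognizable,
  since they are contained in all squares at their outer end, whereas an edge of the base graph
  is never contained in all squares at one of its ends, unless there are none. If nevertheless \<open>f\<close> sends some vertex over the base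
  graph to the outer boundary of a fin, then by connectedness all stars in both complexes are
  those of a strip, and all possible matchings of such stars form a bisimulation. In both cases
  there is a nonempty bisimulation (\<open>bisimilar_nonempty\<close>).

  \<^bold>\<open>Gluing.\<close> There are only finitely many local isomorphisms. Those in the greatest bisimulation are
  closed under composition and inversion, so that the number of those which start at \<open>v\<close> and have
  a prescribed behaviour along a dart \<open>d\<close> at \<open>v\<close> is \<open>M v / b d\<close>, where \<open>M v\<close> and \<open>b d\<close> do not depend
  on the prescribed behaviour and \<open>b\<close> takes the same value on a dart and its reverse. If \<open>L\<close> is a
  common multiple of all \<open>M v\<close>, then with \<open>L / M v\<close> copies of each local isomorphism at \<open>v\<close> each
  behaviour along \<open>d\<close> occurs \<open>L / b d\<close> times, as often as the matching behaviour along the reverse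
  of \<open>d\<close>. So the copies can be joined in pairs along all darts, and a minimal subset closed under
  this joining is finite and connected (\<open>weighted_gluing\<close>, \<open>finite_gluing\<close>). This counting takes the
  place of the automorphism group of the universal cover and its Haar measure.

  \<^bold>\<open>Realization.\<close> The glued set \<open>Z\<close> is the set of base vertices of two complexes, one projecting to
  each of the given graphs with fins. Such a complex is realized as the quotient of a finite
  disjoint union of squares, one family of copies for each cell below; it is a connected covering
  space with finite fibres (\<open>finite_index_cover\<close>). The local isomorphisms attached to the members of
  \<open>Z\<close> agree on darts and squares, hence define an isomorphism between both covers
  (\<open>matched_covers_isomorphic\<close>).
\<close>

section \<open>Lifting through covering maps\<close>

lemma covering_map_surj: "covering_map E p X \<Longrightarrow> p ` topspace E = topspace X"
  by (simp add: covering_map_def)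

lemma covering_map_in_topspace: "covering_map E p X \<Longrightarrow> e \<in> topspace E \<Longrightarrow> p e \<in> topspace X"
  using covering_map_surj by fastforce

definition evenly_covered :: "'a topology \<Rightarrow> ('a \<Rightarrow> 'b) \<Rightarrow> 'b topology \<Rightarrow> 'b set \<Rightarrow> 'a set set \<Rightarrow> bool" where
  "evenly_covered E p X T v \<longleftrightarrow>
     openin X T \<and> \<Union>v = {e \<in> topspace E. p e \<in> T} \<and> (\<forall>u\<in>v. openin E u) \<and> pairwise disjnt v \<and>
     (\<forall>u\<in>v. homeomorphic_map (subtopology E u) (subtopology X T) p)"

lemma covering_map_evenly_covered:
  assumes "covering_map E p X" and "x \<in> topspace X"
  shows "\<exists>T v. x \<in> T \<and> evenly_covered E p X T v"
proof -
  have "\<exists>T. x \<in> T \<and> openin X T \<and>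
        (\<exists>v. \<Union>v = {e \<in> topspace E. p e \<in> T} \<and> (\<forall>u \<in> v. openin E u) \<and> pairwise disjnt v \<and>
             (\<forall>u \<in> v. homeomorphic_map (subtopology E u) (subtopology X T) p))"
    using assms unfolding covering_map_def by (elim conjE) (drule (1) bspec)
  then show ?thesis
    unfolding evenly_covered_def by (elim exE conjE) (intro exI conjI; assumption)
qed

lemma homeomorphic_map_inj_on_subset:
  assumes "homeomorphic_map (subtopology E u) Y p" and "openin E u"
  shows "inj_on p u"
proof -
  have "topspace (subtopology E u) = u"
    using openin_subset[OF assms(2)] by (simp add: Int_absorb1)
  then show ?thesis
    using assms(1) homeomorphic_imp_injective_map by metis
qed

text \<open>
  The set on which two lifts agree is open, since \<open>p\<close> is injective on every sheet, and closed,
  since distinct sheets over the same set are disjoint.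
\<close>

lemma covering_map_lift_unique:
  assumes cov: "covering_map E p X" and S: "connected_space S"
    and f: "continuous_map S E f" and g: "continuous_map S E g"
    and eq: "\<And>s. s \<in> topspace S \<Longrightarrow> p (f s) = p (g s)"
    and a: "a \<in> topspace S" "f a = g a" and s: "s \<in> topspace S"
  shows "f s = g s"
proof -
  define A where "A = {s \<in> topspace S. f s = g s}"
  have fE: "f s \<in> topspace E" and gE: "g s \<in> topspace E" if "s \<in> topspace S" for s
    using that f g by (auto simp: continuous_map_def)
  have nbhd: "\<exists>U. openin S U \<and> s \<in> U \<and> (if f s = g s then U \<subseteq> A else U \<subseteq> topspace S - A)"
    if s: "s \<in> topspace S" for s
  proof -
    obtain T v where Tv: "p (f s) \<in> T" "evenly_covered E p X T v"
      using covering_map_evenly_covered[OF cov covering_map_in_topspace[OF cov fE[OF s]]] by blast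
    then have T: "p (f s) \<in> T" "openin X T" "\<Union>v = {e \<in> topspace E. p e \<in> T}"
      and v: "\<And>u. u \<in> v \<Longrightarrow> openin E u" "\<And>u. u \<in> v \<Longrightarrow> inj_on p u"
      unfolding evenly_covered_def using homeomorphic_map_inj_on_subset by blast+
    have disj: "u \<inter> u' = {}" if "u \<in> v" "u' \<in> v" "u \<noteq> u'" for u u'
      using Tv(2) that by (simp add: evenly_covered_def pairwise_def disjnt_def)
    have "f s \<in> \<Union>v" "g s \<in> \<Union>v"
      using T fE gE eq s by auto
    then obtain u u' where u: "u \<in> v" "f s \<in> u" "u' \<in> v" "g s \<in> u'"
      by blast
    have inj: "inj_on p u"
      using v(2) u(1) .
    let ?U = "{s \<in> topspace S. f s \<in> u} \<inter> {s \<in> topspace S. g s \<in> u'}"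
    have "openin S ?U"
      using f g u v by (intro openin_Int) (auto simp: continuous_map_def)
    moreover have "s \<in> ?U"
      using s u by auto
    moreover have "?U \<subseteq> A" if "f s = g s"
    proof -
      have "u = u'"
        using disj[OF u(1) u(3)] u that by auto
      then show ?thesis
        using inj eq by (auto simp: A_def inj_on_def)
    qed
    moreover have "?U \<subseteq> topspace S - A" if "f s \<noteq> g s"
    proof -
      have "u \<noteq> u'"
        using that inj eq s u by (auto simp: inj_on_def)
      then have "u \<inter> u' = {}"
        using disj u by blast
      then show ?thesis
        by (auto simp: A_def)
    qed
    ultimately show ?thesis
      by (intro exI[of _ ?U]) simp
  qed
  have "\<exists>U. openin S U \<and> s \<in> U \<and> U \<subseteq> A" if "s \<in> A" for s
    using nbhd[of s] that by (auto simp: A_def)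
  then have "openin S A"
    using openin_subopen[of S A] by blast
  moreover have "\<exists>U. openin S U \<and> s \<in> U \<and> U \<subseteq> topspace S - A" if "s \<in> topspace S - A" for s
    using nbhd[of s] that by (auto simp: A_def)
  then have "openin S (topspace S - A)"
    using openin_subopen[of S "topspace S - A"] by blast
  then have "closedin S A"
    by (simp add: closedin_def A_def)
  ultimately have "A = {} \<or> A = topspace S"
    using S connected_space_clopen_in by blast
  then show ?thesis
    using a s by (auto simp: A_def)
qed

text \<open>
  The point \<open>a\<close> at which the lift is prescribed is arbitrary, so that lifts over two sets can be
  joined at any common point.
\<close>

definition lifts_over ::
    "'a topology \<Rightarrow> ('a \<Rightarrow> 'b) \<Rightarrow> ('m::topological_space \<Rightarrow> 'b) \<Rightarrow> 'm set \<Rightarrow> bool" where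
  "lifts_over E p h A \<longleftrightarrow>
     (\<forall>a\<in>A. \<forall>e\<in>topspace E. p e = h a \<longrightarrow>
        (\<exists>\<phi>. continuous_map (top_of_set A) E \<phi> \<and> \<phi> a = e \<and> (\<forall>x\<in>A. p (\<phi> x) = h x)))"

text \<open>
  The inverse of \<open>p\<close> on the sheet through \<open>e\<close> is composed with \<open>h\<close>.
\<close>

lemma lifts_over_evenly_covered:
  assumes h: "continuous_map (top_of_set A) X h" and hA: "h ` A \<subseteq> T"
    and T: "\<Union>v = {e \<in> topspace E. p e \<in> T}"
    and v: "\<And>u. u \<in> v \<Longrightarrow> openin E u"
      "\<And>u. u \<in> v \<Longrightarrow> homeomorphic_map (subtopology E u) (subtopology X T) p"
  shows "lifts_over E p h A"
  unfolding lifts_over_def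
proof (intro ballI impI)
  fix a e
  assume a: "a \<in> A" and e: "e \<in> topspace E" "p e = h a"
  then have "e \<in> \<Union>v"
    using T hA by auto
  then obtain u where u: "u \<in> v" "e \<in> u"
    by blast
  obtain q where q: "homeomorphic_maps (subtopology E u) (subtopology X T) p q"
    using v(2)[OF u(1)] homeomorphic_map_maps by blast
  have hT: "continuous_map (top_of_set A) (subtopology X T) h"
    using h hA by (auto simp: continuous_map_in_subtopology)
  have qE: "continuous_map (subtopology X T) E q"
    using q by (auto simp: homeomorphic_maps_def continuous_map_in_subtopology)
  have "continuous_map (top_of_set A) E (q \<circ> h)"
    using hT qE by (rule continuous_map_compose)
  moreover have "(q \<circ> h) a = e"
    using q e u by (simp flip: e(2)) (simp add: homeomorphic_maps_def)
  moreover have "\<forall>x\<in>A. p ((q \<circ> h) x) = h x"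
    using q hT by (auto simp: homeomorphic_maps_def continuous_map_def Pi_iff)
  ultimately show "\<exists>\<phi>. continuous_map (top_of_set A) E \<phi> \<and> \<phi> a = e \<and> (\<forall>x\<in>A. p (\<phi> x) = h x)"
    by blast
qed

text \<open>
  The lift over the second set is prescribed at a point of the intersection; both lifts agree
  on the intersection because it is connected.
\<close>

lemma lifts_over_Un:
  fixes h :: "'m::euclidean_space \<Rightarrow> 'b"
  assumes cov: "covering_map E p X"
    and A: "closed A" "lifts_over E p h A" and B: "closed B" "lifts_over E p h B"
    and AB: "connected (A \<inter> B)" "A \<inter> B \<noteq> {}"
  shows "lifts_over E p h (A \<union> B)"
proof -
  have half: "\<exists>\<phi>. continuous_map (top_of_set (A \<union> B)) E \<phi> \<and> \<phi> a = e \<and> (\<forall>x\<in>A \<union> B. p (\<phi> x) = h x)"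
    if A: "closed A" "lifts_over E p h A" and B: "closed B" "lifts_over E p h B"
      and AB: "connected (A \<inter> B)" "A \<inter> B \<noteq> {}"
      and a: "a \<in> A" and e: "e \<in> topspace E" "p e = h a" for A B a e
  proof -
    obtain \<phi> where \<phi>: "continuous_map (top_of_set A) E \<phi>" "\<phi> a = e" "\<forall>x\<in>A. p (\<phi> x) = h x"
      using A a e unfolding lifts_over_def by blast
    obtain c where c: "c \<in> A" "c \<in> B"
      using AB by blast
    have "\<phi> c \<in> topspace E"
      using \<phi>(1) c by (auto simp: continuous_map_def)
    then obtain \<psi> where \<psi>: "continuous_map (top_of_set B) E \<psi>" "\<psi> c = \<phi> c" "\<forall>x\<in>B. p (\<psi> x) = h x"
      using B c \<phi> unfolding lifts_over_def by metis
    have agree: "\<phi> x = \<psi> x" if "x \<in> A \<inter> B" for x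
    proof (rule covering_map_lift_unique[OF cov, where S = "top_of_set (A \<inter> B)" and a = c])
      show "connected_space (top_of_set (A \<inter> B))"
        using AB by (simp add: connected_space_subtopology)
      show "continuous_map (top_of_set (A \<inter> B)) E \<phi>"
        using continuous_map_from_subtopology_mono[OF \<phi>(1)] by blast
      show "continuous_map (top_of_set (A \<inter> B)) E \<psi>"
        using continuous_map_from_subtopology_mono[OF \<psi>(1)] by blast
    qed (use that c \<phi> \<psi> in auto)
    let ?g = "\<lambda>x. if x \<in> A then \<phi> x else \<psi> x"
    have "continuous_map (top_of_set (A \<union> B)) E ?g"
    proof (rule pasting_lemma_closed[where I = "UNIV :: bool set" and T = "\<lambda>b. if b then A else B"
          and f = "\<lambda>b. if b then \<phi> else \<psi>"])
      fix i :: bool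
      show "closedin (top_of_set (A \<union> B)) (if i then A else B)"
        using A B by (simp add: closed_subset)
      have "A \<inter> (A \<union> B) = A" "B \<inter> (A \<union> B) = B" "(A \<union> B) \<inter> A = A" "(A \<union> B) \<inter> B = B"
        by auto
      then show "continuous_map (subtopology (top_of_set (A \<union> B)) (if i then A else B)) E (if i then \<phi> else \<psi>)"
        using \<phi> \<psi> by (simp add: subtopology_subtopology)
    qed (use agree in \<open>auto split: if_splits\<close>)
    then show ?thesis
      using \<phi> \<psi> a by (intro exI[of _ ?g]) auto
  qed
  show ?thesis
    unfolding lifts_over_def
  proof (intro ballI impI)
    fix a e
    assume "a \<in> A \<union> B" "e \<in> topspace E" "p e = h a"
    then show "\<exists>\<phi>. continuous_map (top_of_set (A \<union> B)) E \<phi> \<and> \<phi> a = e \<and> (\<forall>x\<in>A \<union> B. p (\<phi> x) = h x)"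
      using half[OF A B AB] half[OF B A] AB by (auto simp: Int_commute Un_commute)
  qed
qed

text \<open>
  By compactness the square is divided into a grid of small squares that are mapped to evenly
  covered sets. They are joined one after the other to rows, and the rows to the whole square.
\<close>

lemma covering_map_lifts_over_square:
  assumes cov: "covering_map E p X" and h: "continuous_map (top_of_set unit_square) X h"
  shows "lifts_over E p h unit_square"
proof -
  define \<G> where "\<G> = {G. open G \<and> (\<exists>T v. evenly_covered E p X T v \<and> h ` (G \<inter> unit_square) \<subseteq> T)}"
  have "unit_square \<subseteq> \<Union>\<G>"
  proof
    fix x :: "real \<times> real"
    assume x: "x \<in> unit_square"
    then have "h x \<in> topspace X"
      using h by (auto simp: continuous_map_def)
    then obtain T v where T: "h x \<in> T" "evenly_covered E p X T v"
      using covering_map_evenly_covered[OF cov] by blast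
    have "openin (top_of_set unit_square) {y \<in> unit_square. h y \<in> T}"
      using h T(2) unfolding evenly_covered_def continuous_map_def by auto
    then obtain G where "open G" "{y \<in> unit_square. h y \<in> T} = unit_square \<inter> G"
      unfolding openin_open by blast
    then have "x \<in> G" "G \<in> \<G>"
      using x T unfolding \<G>_def by blast+
    then show "x \<in> \<Union>\<G>"
      by blast
  qed
  moreover have "compact unit_square"
    by (simp add: compact_Times)
  ultimately obtain \<epsilon> where \<epsilon>: "\<epsilon> > 0" "\<And>x. x \<in> unit_square \<Longrightarrow> \<exists>G\<in>\<G>. ball x \<epsilon> \<subseteq> G"
    using Heine_Borel_lemma[of unit_square \<G>] unfolding \<G>_def by blast
  have small: "lifts_over E p h A" if x: "x \<in> unit_square" "A \<subseteq> ball x \<epsilon>" "A \<subseteq> unit_square" for x A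
  proof -
    obtain G where G: "G \<in> \<G>" "ball x \<epsilon> \<subseteq> G"
      using \<epsilon> x by blast
    then obtain T v where T: "evenly_covered E p X T v" "h ` A \<subseteq> T"
      using x unfolding \<G>_def by blast
    show ?thesis
      using continuous_map_from_subtopology_mono[OF h x(3)] T(2)
    proof (rule lifts_over_evenly_covered)
      show "\<Union>v = {e \<in> topspace E. p e \<in> T}"
        using T(1) by (simp add: evenly_covered_def)
    qed (use T(1) in \<open>auto simp: evenly_covered_def\<close>)
  qed
  \<comment> \<open>A small square with side \<open>1 / N\<close> has diameter at most \<open>2 / N\<close>.\<close>
  obtain N :: nat where N: "N > 0" "2 / real N < \<epsilon>"
  proof -
    obtain N :: nat where N: "2 / \<epsilon> < real N"
      using reals_Archimedean2 by blast
    moreover from this have "real N > 0"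
      using \<epsilon>(1) by (smt (verit) divide_pos_pos)
    ultimately show thesis
      using \<epsilon>(1) by (intro that[of N]) (auto simp: field_simps)
  qed
  have cell: "{real i / N..real (Suc i) / N} \<times> {real j / N..real (Suc j) / N} \<subseteq> ball (real i / N, real j / N) \<epsilon>"
    for i j
  proof
    fix y
    assume "y \<in> {real i / N..real (Suc i) / N} \<times> {real j / N..real (Suc j) / N}"
    then have "\<bar>real i / N - fst y\<bar> \<le> 1 / N" "\<bar>real j / N - snd y\<bar> \<le> 1 / N"
      by (auto simp: add_divide_distrib)
    moreover have "dist (real i / N, real j / N) y \<le> \<bar>real i / N - fst y\<bar> + \<bar>real j / N - snd y\<bar>"
      using sqrt_sum_squares_le_sum_abs by (cases y) (simp add: dist_Pair_Pair dist_real_def)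
    moreover have "2 / real N = 1 / N + 1 / N"
      by simp
    ultimately show "y \<in> ball (real i / N, real j / N) \<epsilon>"
      using N by simp
  qed
  have mono: "real i / N \<le> real (Suc i) / N" for i
    by (rule divide_right_mono) auto
  have J_sub: "{real i / N..real (Suc i) / N} \<subseteq> {0..1}" if "i < N" for i
  proof -
    have "real (Suc i) / N \<le> 1"
      using that N by simp
    then show ?thesis
      by (auto intro: order_trans[rotated])
  qed
  have cell_sub: "{real i / N..real (Suc i) / N} \<times> {real j / N..real (Suc j) / N} \<subseteq> unit_square"
    if "i < N" "j < N" for i j
    using J_sub that by (intro Sigma_mono) auto
  have corner: "(real i / N, real j / N) \<in> unit_square" if "i < N" "j < N" for i j
    using cell_sub[OF that] mono[of i] mono[of j] by (meson SigmaI atLeastAtMost_iff order_refl subsetD)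
  have row: "lifts_over E p h ({0..real k / N} \<times> {real j / N..real (Suc j) / N})"
    if "j < N" "k \<le> N" for j k
    using that
  proof (induction k)
    case 0
    have "{0..real 0 / N} \<times> {real j / N..real (Suc j) / N} \<subseteq> {real 0 / N..real (Suc 0) / N} \<times> {real j / N..real (Suc j) / N}"
      by (intro Sigma_mono) auto
    with cell[of 0 j] cell_sub[of 0 j] corner[of 0 j] N 0 show ?case
      by (intro small[of "(real 0 / N, real j / N)"]) blast+
  next
    case (Suc k)
    let ?J = "{real j / N..real (Suc j) / N}"
    note leq = mono[of k] mono[of j]
    have "{0..real (Suc k) / N} = {0..real k / N} \<union> {real k / N..real (Suc k) / N}"
      by (intro ivl_disj_un_two_touch(4)[symmetric] leq) simp
    then have eq: "{0..real (Suc k) / N} \<times> ?J = {0..real k / N} \<times> ?J \<union> {real k / N..real (Suc k) / N} \<times> ?J"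
      by (simp add: Sigma_Un_distrib1)
    have int: "{0..real k / N} \<times> ?J \<inter> {real k / N..real (Suc k) / N} \<times> ?J = {real k / N} \<times> ?J"
      using leq by auto
    show ?case
      unfolding eq
    proof (rule lifts_over_Un[OF cov])
      show "lifts_over E p h ({real k / N..real (Suc k) / N} \<times> ?J)"
        using Suc.prems by (intro small[OF corner cell cell_sub]) auto
      show "connected ({0..real k / N} \<times> ?J \<inter> {real k / N..real (Suc k) / N} \<times> ?J)"
        unfolding int by (simp add: connected_Times)
      show "{0..real k / N} \<times> ?J \<inter> {real k / N..real (Suc k) / N} \<times> ?J \<noteq> {}"
        unfolding int using leq by auto
    qed (use Suc in \<open>auto intro: closed_Times\<close>)
  qed
  have "lifts_over E p h ({0..1} \<times> {0..real (Suc k) / N})" if "Suc k \<le> N" for k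
    using that
  proof (induction k)
    case 0
    then show ?case
      using row[of 0 N] N by simp
  next
    case (Suc k)
    note leq = mono[of "Suc k"]
    have "{0..real (Suc (Suc k)) / N} = {0..real (Suc k) / N} \<union> {real (Suc k) / N..real (Suc (Suc k)) / N}"
      by (intro ivl_disj_un_two_touch(4)[symmetric] leq) simp
    then have eq: "{0..1::real} \<times> {0..real (Suc (Suc k)) / N} =
        {0..1} \<times> {0..real (Suc k) / N} \<union> {0..1} \<times> {real (Suc k) / N..real (Suc (Suc k)) / N}"
      by (simp only: Sigma_Un_distrib2)
    have int: "{0..1::real} \<times> {0..real (Suc k) / N} \<inter> {0..1} \<times> {real (Suc k) / N..real (Suc (Suc k)) / N} = {0..1} \<times> {real (Suc k) / N}"
      using leq by auto
    show ?case
      unfolding eq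
    proof (rule lifts_over_Un[OF cov])
      show "lifts_over E p h ({0..1} \<times> {real (Suc k) / N..real (Suc (Suc k)) / N})"
        using row[of "Suc k" N] Suc.prems N by simp
      show "connected ({0..1} \<times> {0..real (Suc k) / N} \<inter> {0..1::real} \<times> {real (Suc k) / N..real (Suc (Suc k)) / N})"
        unfolding int by (simp add: connected_Times)
      show "{0..1} \<times> {0..real (Suc k) / N} \<inter> {0..1::real} \<times> {real (Suc k) / N..real (Suc (Suc k)) / N} \<noteq> {}"
        unfolding int by auto
    qed (use Suc in \<open>auto intro: closed_Times\<close>)
  qed
  from this[of "N - 1"] show ?thesis
    using N by simp
qed

lemma covering_map_square_lift:
  assumes "covering_map E p X" "continuous_map (top_of_set unit_square) X h"
    and "e \<in> topspace E" "p e = h (0, 0)"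
  obtains \<phi> where "continuous_map (top_of_set unit_square) E \<phi>" "\<phi> (0, 0) = e"
    "\<And>x. x \<in> unit_square \<Longrightarrow> p (\<phi> x) = h x"
proof -
  have "(0, 0) \<in> unit_square"
    by simp
  then show thesis
    using covering_map_lifts_over_square[OF assms(1,2)] assms(3,4) that
    unfolding lifts_over_def by blast
qed

lemma covering_map_path_lift:
  assumes "covering_map E p X" "continuous_map (top_of_set unit_interval) X h"
    and "e \<in> topspace E" "p e = h 0"
  obtains \<phi> where "continuous_map (top_of_set unit_interval) E \<phi>" "\<phi> 0 = e"
    "\<And>x. x \<in> unit_interval \<Longrightarrow> p (\<phi> x) = h x"
proof -
  have "continuous_map (top_of_set unit_square) (top_of_set unit_interval) fst"
    by (auto simp: continuous_map_in_subtopology intro!: continuous_on_fst continuous_on_id)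
  then have "continuous_map (top_of_set unit_square) X (h \<circ> fst)"
    using assms(2) by (rule continuous_map_compose)
  then obtain \<phi> where \<phi>: "continuous_map (top_of_set unit_square) E \<phi>" "\<phi> (0, 0) = e"
    "\<And>x. x \<in> unit_square \<Longrightarrow> p (\<phi> x) = (h \<circ> fst) x"
    using covering_map_square_lift[OF assms(1) _ assms(3), of "h \<circ> fst"] assms(4)
    by (metis comp_apply fst_conv)
  have "continuous_map (top_of_set unit_interval) (top_of_set unit_square) (\<lambda>s. (s, 0))"
    by (auto simp: continuous_map_in_subtopology intro!: continuous_intros)
  then have "continuous_map (top_of_set unit_interval) E (\<phi> \<circ> (\<lambda>s. (s, 0)))"
    using \<phi>(1) by (rule continuous_map_compose)
  then show thesis
    using \<phi> by (intro that[of "\<phi> \<circ> (\<lambda>s. (s, 0))"]) auto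
qed

section \<open>Isometries of the interval and the square\<close>

lemma self_isometry_interval:
  assumes "self_isometry unit_interval g"
  shows "(\<forall>s\<in>unit_interval. g s = s) \<or> (\<forall>s\<in>unit_interval. g s = 1 - s)"
proof -
  have im: "g s \<in> {0..1}" if "s \<in> {0..1}" for s
    using assms that unfolding self_isometry_def by blast
  have d: "\<bar>g s - g t\<bar> = \<bar>s - t\<bar>" if "s \<in> {0..1}" "t \<in> {0..1}" for s t
    using assms that unfolding self_isometry_def dist_real_def by blast
  have "\<bar>g 0 - g 1\<bar> = 1"
    using d[of 0 1] by simp
  then consider "g 0 = 0" "g 1 = 1" | "g 0 = 1" "g 1 = 0"
    using im[of 0] im[of 1] by force
  then show ?thesis
  proof cases
    case 1
    have "g s = s" if "s \<in> {0..1}" for s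
      using d[of s 0] im[of s] that 1 by auto
    then show ?thesis by blast
  next
    case 2
    have "g s = 1 - s" if "s \<in> {0..1}" for s
      using d[of s 1] im[of s] that 2 by auto
    then show ?thesis by blast
  qed
qed

text \<open>
  An isometry is determined by the images of three corners: differences of the equations for
  the squared distances to these corners are linear in the coordinates.
\<close>

lemma self_isometry_square:
  assumes "self_isometry unit_square g"
  shows "\<exists>a b c. \<forall>s\<in>unit_interval. \<forall>t\<in>unit_interval.
     g (s, t) = (let s' = (if a then 1 - s else s); t' = (if b then 1 - t else t)
                 in if c then (t', s') else (s', t'))"
proof -
  let ?I = "{0..1::real}"
  have im: "fst (g (s, t)) \<in> ?I" "snd (g (s, t)) \<in> ?I" if "s \<in> ?I" "t \<in> ?I" for s t
    using assms that unfolding self_isometry_def by (metis SigmaI imageI mem_Times_iff)+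
  have d: "(fst (g (s, t)) - fst (g (s', t')))\<^sup>2 + (snd (g (s, t)) - snd (g (s', t')))\<^sup>2
      = (s - s')\<^sup>2 + (t - t')\<^sup>2"
    if "s \<in> ?I" "t \<in> ?I" "s' \<in> ?I" "t' \<in> ?I" for s t s' t'
  proof -
    have "dist (g (s, t)) (g (s', t')) = dist (s, t) (s', t')"
      using assms that unfolding self_isometry_def by blast
    then show ?thesis
      by (simp add: dist_Pair_Pair dist_real_def dist_prod_def)
  qed
  obtain x0 y0 x1 y1 x2 y2 where g: "g (0, 0) = (x0, y0)" "g (1, 0) = (x1, y1)" "g (0, 1) = (x2, y2)"
    by (metis surj_pair)
  have I: "x0 \<in> ?I" "y0 \<in> ?I" "x1 \<in> ?I" "y1 \<in> ?I" "x2 \<in> ?I" "y2 \<in> ?I"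
    using im[of 0 0] im[of 1 0] im[of 0 1] g by auto
  have sq: "(u - v)\<^sup>2 \<le> 1" "(u - v)\<^sup>2 = 1 \<Longrightarrow> (u = 0 \<and> v = 1 \<or> u = 1 \<and> v = 0)" if "u \<in> ?I" "v \<in> ?I" for u v :: real
  proof -
    have "\<bar>u - v\<bar> \<le> 1"
      using that by auto
    then show "(u - v)\<^sup>2 \<le> 1"
      by (simp add: abs_square_le_1)
    assume "(u - v)\<^sup>2 = 1"
    then have "u - v = 1 \<or> u - v = -1"
      by (simp add: power2_eq_1_iff)
    then show "u = 0 \<and> v = 1 \<or> u = 1 \<and> v = 0"
      using that by auto
  qed
  have e12: "(x1 - x2)\<^sup>2 + (y1 - y2)\<^sup>2 = 2" and e01: "(x0 - x1)\<^sup>2 + (y0 - y1)\<^sup>2 = 1"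
    and e02: "(x0 - x2)\<^sup>2 + (y0 - y2)\<^sup>2 = 1"
    using d[of 1 0 0 1] d[of 0 0 1 0] d[of 0 0 0 1] g by auto
  have "(x1 - x2)\<^sup>2 = 1" "(y1 - y2)\<^sup>2 = 1"
    using e12 sq(1)[of x1 x2] sq(1)[of y1 y2] I by linarith+
  then have c12: "x1 = 0 \<and> x2 = 1 \<or> x1 = 1 \<and> x2 = 0" "y1 = 0 \<and> y2 = 1 \<or> y1 = 1 \<and> y2 = 0"
    using sq(2) I by blast+
  have e03: "(x0 - fst (g (1,1)))\<^sup>2 + (y0 - snd (g (1,1)))\<^sup>2 = 2"
    using d[of 0 0 1 1] g by auto
  have "(x0 - fst (g (1,1)))\<^sup>2 = 1" "(y0 - snd (g (1,1)))\<^sup>2 = 1"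
    using e03 sq(1)[of x0 "fst (g (1,1))"] sq(1)[of y0 "snd (g (1,1))"] I im[of 1 1] by auto
  then have c0: "x0 \<in> {0, 1}" "y0 \<in> {0, 1}"
    using sq(2) I im[of 1 1] by fastforce+
  have tri: "(fst (g (s,t)) - x0)\<^sup>2 + (snd (g (s,t)) - y0)\<^sup>2 = s\<^sup>2 + t\<^sup>2"
    "(fst (g (s,t)) - x1)\<^sup>2 + (snd (g (s,t)) - y1)\<^sup>2 = (s - 1)\<^sup>2 + t\<^sup>2"
    "(fst (g (s,t)) - x2)\<^sup>2 + (snd (g (s,t)) - y2)\<^sup>2 = s\<^sup>2 + (t - 1)\<^sup>2"
    if "s \<in> ?I" "t \<in> ?I" for s t
    using d[of s t 0 0] d[of s t 1 0] d[of s t 0 1] that g by auto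
  \<comment> \<open>\<open>c\<close> says that the coordinates are exchanged, \<open>a\<close> and \<open>b\<close> that \<open>s\<close> and \<open>t\<close> are reversed.\<close>
  define a where "a \<longleftrightarrow> (if x1 \<noteq> x0 then x0 = 1 else y0 = 1)"
  define b where "b \<longleftrightarrow> (if x1 \<noteq> x0 then y0 = 1 else x0 = 1)"
  define c where "c \<longleftrightarrow> x1 = x0"
  have "g (s, t) = (let s' = (if a then 1 - s else s); t' = (if b then 1 - t else t)
                 in if c then (t', s') else (s', t'))" if st: "s \<in> ?I" "t \<in> ?I" for s t
  proof -
    obtain u v where uv: "g (s, t) = (u, v)"
      by (metis surj_pair)
    have t3: "(u - x0)\<^sup>2 + (v - y0)\<^sup>2 = s\<^sup>2 + t\<^sup>2" "(u - x1)\<^sup>2 + (v - y1)\<^sup>2 = (s - 1)\<^sup>2 + t\<^sup>2"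
      "(u - x2)\<^sup>2 + (v - y2)\<^sup>2 = s\<^sup>2 + (t - 1)\<^sup>2"
      using tri[OF st] uv by auto
    have lin: "2 * u * (x1 - x0) + 2 * v * (y1 - y0) + x0\<^sup>2 + y0\<^sup>2 - x1\<^sup>2 - y1\<^sup>2 = 2 * s - 1"
      "2 * u * (x2 - x0) + 2 * v * (y2 - y0) + x0\<^sup>2 + y0\<^sup>2 - x2\<^sup>2 - y2\<^sup>2 = 2 * t - 1"
      using t3 by (simp_all add: power2_eq_square algebra_simps)
    consider "x0 = 0" "y0 = 0" | "x0 = 0" "y0 = 1" | "x0 = 1" "y0 = 0" | "x0 = 1" "y0 = 1"
      using c0 by blast
    note 0 = this
    consider "x1 = 0" "x2 = 1" "y1 = 0" "y2 = 1" | "x1 = 0" "x2 = 1" "y1 = 1" "y2 = 0"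
      | "x1 = 1" "x2 = 0" "y1 = 0" "y2 = 1" | "x1 = 1" "x2 = 0" "y1 = 1" "y2 = 0"
      using c12 by blast
    then show ?thesis
      using lin e01 e02 unfolding uv a_def b_def c_def Let_def
      by cases (cases rule: 0; simp; linarith?)+
  qed
  then have "\<forall>s\<in>?I. \<forall>t\<in>?I.
     g (s, t) = (let s' = (if a then 1 - s else s); t' = (if b then 1 - t else t)
                 in if c then (t', s') else (s', t'))"
    by (intro ballI)
  then show ?thesis
    by (intro exI)
qed

section \<open>Gluing pieces in suitable multiplicities\<close>

text \<open>
  A piece \<open>\<phi>\<close> lies over \<open>s \<phi>\<close>, its behaviour along a dart \<open>d\<close> there is \<open>germ \<phi> d\<close>, and it may be
  joined across \<open>d\<close> to pieces whose germ along \<open>rev d\<close> is the \<open>\<rho>\<close>-image of this germ. By \<open>count\<close>,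
  if \<open>L\<close> is a common multiple of the values of \<open>M\<close> and \<open>L div M (s \<phi>)\<close> copies of each piece \<open>\<phi>\<close> are
  taken, then each germ that occurs along \<open>d\<close> occurs \<open>L / b d\<close> times. This is symmetric under
  reversal of \<open>d\<close>, so there are bijections between the copies to be joined.
\<close>

lemma weighted_gluing:
  fixes P :: "'p set" and s :: "'p \<Rightarrow> 'v" and D :: "'d set" and src :: "'d \<Rightarrow> 'v"
    and rev :: "'d \<Rightarrow> 'd" and pos :: "'d \<Rightarrow> bool" and germ :: "'p \<Rightarrow> 'd \<Rightarrow> 'g"
    and \<rho> :: "'g \<Rightarrow> 'g" and M :: "'v \<Rightarrow> nat" and b :: "'d \<Rightarrow> nat"
  assumes fin: "finite P" and ne: "P \<noteq> {}"
    and rev: "\<And>d. d \<in> D \<Longrightarrow> rev d \<in> D" "\<And>d. d \<in> D \<Longrightarrow> rev (rev d) = d"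
      "\<And>d. d \<in> D \<Longrightarrow> pos (rev d) \<longleftrightarrow> \<not> pos d"
    and M: "\<And>\<phi>. \<phi> \<in> P \<Longrightarrow> M (s \<phi>) > 0"
    and b: "\<And>d. d \<in> D \<Longrightarrow> b (rev d) = b d"
    and count: "\<And>\<phi> d. \<phi> \<in> P \<Longrightarrow> d \<in> D \<Longrightarrow> src d = s \<phi> \<Longrightarrow>
       card {\<psi> \<in> P. s \<psi> = src d \<and> germ \<psi> d = germ \<phi> d} * b d = M (src d)"
    and bisim: "\<And>\<phi> d. \<phi> \<in> P \<Longrightarrow> d \<in> D \<Longrightarrow> src d = s \<phi> \<Longrightarrow>
       \<exists>\<psi>\<in>P. s \<psi> = src (rev d) \<and> germ \<psi> (rev d) = \<rho> (germ \<phi> d)"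
    and invol: "\<And>\<phi> d. \<phi> \<in> P \<Longrightarrow> d \<in> D \<Longrightarrow> src d = s \<phi> \<Longrightarrow> \<rho> (\<rho> (germ \<phi> d)) = germ \<phi> d"
  obtains Z :: "nat set" and \<pi> :: "nat \<Rightarrow> 'p" and N :: "nat \<Rightarrow> 'd \<Rightarrow> nat"
  where "finite Z" "Z \<noteq> {}" "\<And>z. z \<in> Z \<Longrightarrow> \<pi> z \<in> P"
    "\<And>z d. z \<in> Z \<Longrightarrow> d \<in> D \<Longrightarrow> src d = s (\<pi> z) \<Longrightarrow>
       N z d \<in> Z \<and> s (\<pi> (N z d)) = src (rev d) \<and>
       germ (\<pi> (N z d)) (rev d) = \<rho> (germ (\<pi> z) d) \<and> N (N z d) (rev d) = z"
    "\<And>W. W \<subseteq> Z \<Longrightarrow> W \<noteq> {} \<Longrightarrow>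
       (\<And>z d. z \<in> W \<Longrightarrow> d \<in> D \<Longrightarrow> src d = s (\<pi> z) \<Longrightarrow> N z d \<in> W) \<Longrightarrow> W = Z"
proof -
  define L where "L = (\<Prod>v\<in>s ` P. M v)"
  have L: "M (s \<phi>) * (L div M (s \<phi>)) = L" and Lpos: "L div M (s \<phi>) > 0" if "\<phi> \<in> P" for \<phi>
  proof -
    have "M (s \<phi>) dvd L"
      unfolding L_def using that fin by (intro dvd_prodI) auto
    then show 1: "M (s \<phi>) * (L div M (s \<phi>)) = L"
      by simp
    have "L > 0"
      unfolding L_def using M by (intro prod_pos) auto
    then show "L div M (s \<phi>) > 0"
      using 1 by (metis mult_0_right neq0_conv)
  qed
  define Y where "Y = (SIGMA \<phi>:P. {..<L div M (s \<phi>)})"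
  define C where "C d \<gamma> = {y \<in> Y. s (fst y) = src d \<and> germ (fst y) d = \<gamma>}" for d \<gamma>
  have Y_P: "fst y \<in> P" if "y \<in> Y" for y
    using that by (auto simp: Y_def)
  have finY: "finite Y"
    using fin by (auto simp: Y_def)
  obtain \<phi>0 where \<phi>0: "\<phi>0 \<in> P"
    using ne by blast
  have "(\<phi>0, 0) \<in> Y"
    using \<phi>0 Lpos by (simp add: Y_def)
  then have Yne: "Y \<noteq> {}"
    by blast
  have finC: "finite (C d \<gamma>)" for d \<gamma>
    using finY by (simp add: C_def)
  have cardC: "card (C d (germ \<phi> d)) * b d = L" if "\<phi> \<in> P" "d \<in> D" "src d = s \<phi>" for \<phi> d
  proof -
    have "C d (germ \<phi> d) = {\<psi> \<in> P. s \<psi> = src d \<and> germ \<psi> d = germ \<phi> d} \<times> {..<L div M (src d)}"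
      by (auto simp: C_def Y_def)
    then have "card (C d (germ \<phi> d)) =
        card {\<psi> \<in> P. s \<psi> = src d \<and> germ \<psi> d = germ \<phi> d} * (L div M (src d))"
      by (simp add: card_cartesian_product)
    then have "card (C d (germ \<phi> d)) * b d =
        (card {\<psi> \<in> P. s \<psi> = src d \<and> germ \<psi> d = germ \<phi> d} * b d) * (L div M (src d))"
      by simp
    then have "card (C d (germ \<phi> d)) * b d = M (src d) * (L div M (src d))"
      unfolding count[OF that] .
    then show ?thesis
      using L[OF that(1)] that by simp
  qed
  have eqC: "card (C d (germ \<phi> d)) = card (C (rev d) (\<rho> (germ \<phi> d)))"
    if d: "\<phi> \<in> P" "d \<in> D" "src d = s \<phi>" for \<phi> d
  proof -
    obtain \<psi> where \<psi>: "\<psi> \<in> P" "s \<psi> = src (rev d)" "germ \<psi> (rev d) = \<rho> (germ \<phi> d)"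
      using bisim[OF d] by blast
    have "card (C (rev d) (germ \<psi> (rev d))) * b (rev d) = L"
      using \<psi> d rev by (intro cardC) auto
    then have "card (C (rev d) (\<rho> (germ \<phi> d))) * b d = card (C d (germ \<phi> d)) * b d"
      using \<psi>(3) b[OF d(2)] cardC[OF d] by simp
    moreover have "b d > 0"
      using count[OF d] M[OF d(1)] d(3) by (metis mult_0_right neq0_conv)
    ultimately show ?thesis
      by simp
  qed
  define h where "h d \<gamma> = (SOME h. bij_betw h (C d \<gamma>) (C (rev d) (\<rho> \<gamma>)))" for d \<gamma>
  have h: "bij_betw (h d (germ \<phi> d)) (C d (germ \<phi> d)) (C (rev d) (\<rho> (germ \<phi> d)))"
    if "\<phi> \<in> P" "d \<in> D" "src d = s \<phi>" for \<phi> d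
    unfolding h_def using finite_same_card_bij[OF finC finC eqC[OF that]] by (rule someI_ex)
  \<comment> \<open>The bijection of the positive dart is used in both directions, so that crossing an edge twice is the identity.\<close>
  define N0 where "N0 y d = (let \<gamma> = germ (fst y) d in if pos d then h d \<gamma> y
      else inv_into (C (rev d) (\<rho> \<gamma>)) (h (rev d) (\<rho> \<gamma>)) y)" for y d
  have N0: "N0 y d \<in> C (rev d) (\<rho> (germ (fst y) d)) \<and> N0 (N0 y d) (rev d) = y"
    if y: "y \<in> Y" "d \<in> D" "src d = s (fst y)" for y d
  proof -
    note d = Y_P[OF y(1)] y(2,3)
    let ?\<gamma> = "germ (fst y) d"
    have yC: "y \<in> C d ?\<gamma>"
      using y by (simp add: C_def)
    show ?thesis
    proof (cases "pos d")
      case True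
      have N: "N0 y d = h d ?\<gamma> y"
        using True by (simp add: N0_def Let_def)
      have in_C: "N0 y d \<in> C (rev d) (\<rho> ?\<gamma>)"
        unfolding N using h[OF d] yC by (rule bij_betwE[THEN bspec])
      then have "germ (fst (N0 y d)) (rev d) = \<rho> ?\<gamma>"
        by (simp add: C_def)
      then have "N0 (N0 y d) (rev d) = inv_into (C d ?\<gamma>) (h d ?\<gamma>) (h d ?\<gamma> y)"
        using True rev(2,3)[OF d(2)] invol[OF d] N unfolding N0_def[of "N0 y d"] by simp
      also have "\<dots> = y"
        using h[OF d] yC by (rule bij_betw_inv_into_left)
      finally show ?thesis
        using in_C by blast
    next
      case False
      obtain \<psi> where \<psi>: "\<psi> \<in> P" "s \<psi> = src (rev d)" "germ \<psi> (rev d) = \<rho> ?\<gamma>"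
        using bisim[OF d] by blast
      have h': "bij_betw (h (rev d) (\<rho> ?\<gamma>)) (C (rev d) (\<rho> ?\<gamma>)) (C d ?\<gamma>)"
        using h[of \<psi> "rev d"] \<psi> rev(1,2)[OF d(2)] invol[OF d] by simp
      have N: "N0 y d = inv_into (C (rev d) (\<rho> ?\<gamma>)) (h (rev d) (\<rho> ?\<gamma>)) y"
        using False by (simp add: N0_def Let_def)
      have in_C: "N0 y d \<in> C (rev d) (\<rho> ?\<gamma>)"
        unfolding N using h' yC by (metis bij_betw_def inv_into_into)
      then have "germ (fst (N0 y d)) (rev d) = \<rho> ?\<gamma>"
        by (simp add: C_def)
      then have "N0 (N0 y d) (rev d) = h (rev d) (\<rho> ?\<gamma>) (N0 y d)"
        using False rev(3)[OF d(2)] unfolding N0_def[of "N0 y d"] by simp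
      also have "\<dots> = y"
        unfolding N using h' yC by (rule bij_betw_inv_into_right)
      finally show ?thesis
        using in_C by blast
    qed
  qed
  obtain e where e: "bij_betw e Y {0..<card Y}"
    using ex_bij_betw_finite_nat[OF finY] by blast
  define u where "u = inv_into Y e"
  have u: "u z \<in> Y" "e (u z) = z" if "z \<in> e ` Y" for z
    using that by (auto simp: u_def inv_into_into f_inv_into_f)
  have ue: "u (e y) = y" if "y \<in> Y" for y
    using that e by (simp add: u_def bij_betw_def)
  define N where "N z d = e (N0 (u z) d)" for z d
  have N: "N z d \<in> e ` Y \<and> s (fst (u (N z d))) = src (rev d) \<and>
       germ (fst (u (N z d))) (rev d) = \<rho> (germ (fst (u z)) d) \<and> N (N z d) (rev d) = z"
    if z: "z \<in> e ` Y" "d \<in> D" "src d = s (fst (u z))" for z d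
  proof -
    have 1: "N0 (u z) d \<in> C (rev d) (\<rho> (germ (fst (u z)) d))" "N0 (N0 (u z) d) (rev d) = u z"
      using N0[OF u(1)[OF z(1)] z(2,3)] by auto
    then have "N0 (u z) d \<in> Y"
      by (simp add: C_def)
    then show ?thesis
      using 1 u[OF z(1)] by (auto simp: N_def ue C_def)
  qed
  \<comment> \<open>A nonempty closed set of least cardinality contains no smaller one.\<close>
  define closed where "closed W \<longleftrightarrow> W \<subseteq> e ` Y \<and> W \<noteq> {} \<and>
     (\<forall>z d. z \<in> W \<longrightarrow> d \<in> D \<longrightarrow> src d = s (fst (u z)) \<longrightarrow> N z d \<in> W)" for W
  have "closed (e ` Y)"
    using Yne N by (auto simp: closed_def)
  then obtain Z where Z: "closed Z" "\<And>W. card W < card Z \<Longrightarrow> \<not> closed W"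
    using ex_has_least_nat[of closed "e ` Y" card] by (metis not_less)
  have finZ: "finite Z"
    using Z(1) finY by (auto simp: closed_def intro: finite_subset)
  show thesis
  proof (rule that[of Z "fst \<circ> u" N])
    show "W = Z" if W: "W \<subseteq> Z" "W \<noteq> {}"
      "\<And>z d. z \<in> W \<Longrightarrow> d \<in> D \<Longrightarrow> src d = s ((fst \<circ> u) z) \<Longrightarrow> N z d \<in> W" for W
    proof -
      have "closed W"
        using W Z(1) unfolding closed_def by auto
      then have "\<not> card W < card Z"
        using Z(2) by blast
      then show ?thesis
        using W(1) finZ psubset_card_mono by blast
    qed
    show "N z d \<in> Z \<and> s ((fst \<circ> u) (N z d)) = src (rev d) \<and>
       germ ((fst \<circ> u) (N z d)) (rev d) = \<rho> (germ ((fst \<circ> u) z) d) \<and> N (N z d) (rev d) = z"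
      if "z \<in> Z" "d \<in> D" "src d = s ((fst \<circ> u) z)" for z d
    proof -
      have "z \<in> e ` Y" "N z d \<in> Z"
        using that Z(1) unfolding closed_def by auto
      then show ?thesis
        using N[of z d] that by simp
    qed
    show "(fst \<circ> u) z \<in> P" if "z \<in> Z" for z
    proof -
      have "z \<in> e ` Y"
        using that Z(1) unfolding closed_def by blast
      then show ?thesis
        using Y_P[OF u(1)] by simp
    qed
  qed (use finZ Z(1) in \<open>auto simp: closed_def\<close>)
qed

section \<open>Local isomorphisms and bisimulations\<close>

text \<open>
  The finite data of a graph with fins. Items of level 0, 1 and 2 are vertices, darts and
  corners; \<open>att\<close> sends a corner to its dart, a dart to its source, and fixes vertices; \<open>opp\<close> exchanges
  opposite corners; \<open>flip\<close> reverses darts and reflects squares; exactly one of a dart and its reverse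
  is \<open>positive\<close>.
\<close>

record 'h local_structure =
  items :: "'h set"
  att :: "'h \<Rightarrow> 'h"
  opp :: "'h \<Rightarrow> 'h"
  flip :: "'h \<Rightarrow> 'h"
  level :: "'h \<Rightarrow> nat"
  positive :: "'h \<Rightarrow> bool"

definition wf_structure :: "'h local_structure \<Rightarrow> bool" where
  "wf_structure S \<longleftrightarrow> finite (items S) \<and>
     (\<forall>x\<in>items S. att S x \<in> items S \<and> level S x \<le> 2 \<and> level S (att S x) = level S x - 1 \<and>
        (level S x = 0 \<longrightarrow> att S x = x) \<and>
        opp S x \<in> items S \<and> level S (opp S x) = level S x \<and> att S (att S (opp S x)) = att S (att S x) \<and>
        (level S x \<noteq> 0 \<longrightarrow> flip S x \<in> items S \<and> level S (flip S x) = level S x \<and> flip S (flip S x) = x) \<and>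
        (level S x = 1 \<longrightarrow> (positive S (flip S x) \<longleftrightarrow> \<not> positive S x)) \<and>
        (level S x = 2 \<longrightarrow> att S (flip S x) = flip S (att S x)))"

text \<open>
  Since \<open>att\<close> fixes vertices, two applications lead from an item of any level to its vertex.
\<close>

definition at_vertex :: "'h local_structure \<Rightarrow> 'h \<Rightarrow> 'h set" where
  "at_vertex S v = {x \<in> items S. att S (att S x) = v}"

definition at_dart :: "'h local_structure \<Rightarrow> 'h \<Rightarrow> 'h set" where
  "at_dart S d = {x \<in> items S. x = d \<or> level S x = 2 \<and> att S x = d}"

text \<open>
  A local isomorphism is represented by its graph: then it is determined by its values on the
  star, and composition and inversion are those of relations.
\<close>

definition local_iso :: "'h local_structure \<Rightarrow> 'k local_structure \<Rightarrow> 'h \<Rightarrow> 'k \<Rightarrow> ('h \<times> 'k) set \<Rightarrow> bool" where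
  "local_iso S S' v v' r \<longleftrightarrow>
     v \<in> items S \<and> level S v = 0 \<and> v' \<in> items S' \<and> level S' v' = 0 \<and>
     r \<subseteq> at_vertex S v \<times> at_vertex S' v' \<and>
     r O r\<inverse> = Id_on (at_vertex S v) \<and> r\<inverse> O r = Id_on (at_vertex S' v') \<and>
     (\<forall>(x, y)\<in>r. level S x = level S' y \<and> (att S x, att S' y) \<in> r \<and> (opp S x, opp S' y) \<in> r)"

definition germ :: "'h local_structure \<Rightarrow> 'h \<Rightarrow> ('h \<times> 'k) set \<Rightarrow> ('h \<times> 'k) set" where
  "germ S d r = {(x, y) \<in> r. x \<in> at_dart S d}"

definition flip_germ :: "'h local_structure \<Rightarrow> 'k local_structure \<Rightarrow> ('h \<times> 'k) set \<Rightarrow> ('h \<times> 'k) set" where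
  "flip_germ S S' g = map_prod (flip S) (flip S') ` g"

text \<open>
  The condition on germs says that the continuation across \<open>d\<close> agrees with \<open>r\<close> on the edge of \<open>d\<close>
  and on the squares along this edge.
\<close>

definition bisimulation :: "'h local_structure \<Rightarrow> 'k local_structure \<Rightarrow> ('h \<times> 'k \<times> ('h \<times> 'k) set) set \<Rightarrow> bool" where
  "bisimulation S S' \<Psi> \<longleftrightarrow>
     (\<forall>(v, v', r)\<in>\<Psi>. local_iso S S' v v' r \<and>
        (\<forall>d\<in>at_vertex S v. level S d = 1 \<longrightarrow>
           (\<exists>w' r'. (att S (flip S d), w', r') \<in> \<Psi> \<and>
              germ S (flip S d) r' = flip_germ S S' (germ S d r))))"

definition bisimilar :: "'h local_structure \<Rightarrow> 'k local_structure \<Rightarrow> ('h \<times> 'k \<times> ('h \<times> 'k) set) set" where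
  "bisimilar S S' = \<Union>{\<Psi>. bisimulation S S' \<Psi>}"

lemma bisimilarI: "bisimulation S S' \<Psi> \<Longrightarrow> \<Psi> \<subseteq> bisimilar S S'"
  by (auto simp: bisimilar_def)

lemma bisimulation_bisimilar: "bisimulation S S' (bisimilar S S')"
  unfolding bisimulation_def
proof (clarify, intro conjI ballI impI)
  fix v v' r
  assume "(v, v', r) \<in> bisimilar S S'"
  then obtain \<Psi> where \<Psi>: "bisimulation S S' \<Psi>" "(v, v', r) \<in> \<Psi>"
    by (auto simp: bisimilar_def)
  show "local_iso S S' v v' r"
    using \<Psi> unfolding bisimulation_def by blast
  fix d
  assume "d \<in> at_vertex S v" "level S d = 1"
  then have "\<exists>w' r'. (att S (flip S d), w', r') \<in> \<Psi> \<and> germ S (flip S d) r' = flip_germ S S' (germ S d r)"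
    using \<Psi> unfolding bisimulation_def by blast
  then show "\<exists>w' r'. (att S (flip S d), w', r') \<in> bisimilar S S' \<and> germ S (flip S d) r' = flip_germ S S' (germ S d r)"
    using bisimilarI[OF \<Psi>(1)] by blast
qed

lemma bisimilar_local_iso: "(v, v', r) \<in> bisimilar S S' \<Longrightarrow> local_iso S S' v v' r"
  using bisimulation_bisimilar[of S S'] unfolding bisimulation_def by blast

lemma bisimilar_step:
  "(v, v', r) \<in> bisimilar S S' \<Longrightarrow> d \<in> at_vertex S v \<Longrightarrow> level S d = 1 \<Longrightarrow>
   \<exists>w' r'. (att S (flip S d), w', r') \<in> bisimilar S S' \<and> germ S (flip S d) r' = flip_germ S S' (germ S d r)"
  using bisimulation_bisimilar[of S S'] unfolding bisimulation_def by blast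

lemma local_iso_left_total:
  assumes "local_iso S S' v v' r" "x \<in> at_vertex S v"
  obtains y where "(x, y) \<in> r" "y \<in> at_vertex S' v'"
proof -
  have "(x, x) \<in> r O r\<inverse>" "r \<subseteq> at_vertex S v \<times> at_vertex S' v'"
    using assms by (auto simp: local_iso_def)
  then show thesis
    using that by blast
qed

lemma local_iso_right_total:
  assumes "local_iso S S' v v' r" "y \<in> at_vertex S' v'"
  obtains x where "(x, y) \<in> r" "x \<in> at_vertex S v"
proof -
  have "(y, y) \<in> r\<inverse> O r" "r \<subseteq> at_vertex S v \<times> at_vertex S' v'"
    using assms by (auto simp: local_iso_def)
  then show thesis
    using that by blast
qed

lemma local_iso_right_unique:
  assumes "local_iso S S' v v' r" "(x, y) \<in> r" "(x, y') \<in> r"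
  shows "y = y'"
proof -
  have "(y, y') \<in> r\<inverse> O r"
    using assms(2,3) by blast
  then show ?thesis
    using assms(1) unfolding local_iso_def by auto
qed

lemma local_iso_left_unique:
  assumes "local_iso S S' v v' r" "(x, y) \<in> r" "(x', y) \<in> r"
  shows "x = x'"
proof -
  have "(x, x') \<in> r O r\<inverse>"
    using assms(2,3) by blast
  then show ?thesis
    using assms(1) unfolding local_iso_def by auto
qed

lemma local_iso_mem:
  assumes "local_iso S S' v v' r" "(x, y) \<in> r"
  shows "x \<in> at_vertex S v" "y \<in> at_vertex S' v'" "level S x = level S' y"
    "(att S x, att S' y) \<in> r" "(opp S x, opp S' y) \<in> r"
  using assms unfolding local_iso_def by blast+

lemma local_iso_converse: "local_iso S S' v v' r \<Longrightarrow> local_iso S' S v' v (r\<inverse>)"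
  unfolding local_iso_def by auto

lemma local_iso_comp:
  assumes r: "local_iso S S' v v' r" and r': "local_iso S' S'' v' v'' r'"
  shows "local_iso S S'' v v'' (r O r')"
proof -
  have "(r O r') O (r O r')\<inverse> = r O (r' O r'\<inverse>) O r\<inverse>"
    by (simp add: converse_relcomp O_assoc)
  also have "\<dots> = r O Id_on (at_vertex S' v') O r\<inverse>"
    using r' by (simp add: local_iso_def)
  also have "\<dots> = r O r\<inverse>"
    using local_iso_mem(2)[OF r] by blast
  also have "\<dots> = Id_on (at_vertex S v)"
    using r by (simp add: local_iso_def)
  finally have 1: "(r O r') O (r O r')\<inverse> = Id_on (at_vertex S v)" .
  have "(r O r')\<inverse> O (r O r') = r'\<inverse> O (r\<inverse> O r) O r'"
    by (simp add: converse_relcomp O_assoc)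
  also have "\<dots> = r'\<inverse> O Id_on (at_vertex S' v') O r'"
    using r by (simp add: local_iso_def)
  also have "\<dots> = r'\<inverse> O r'"
    using local_iso_mem(1)[OF r'] by blast
  also have "\<dots> = Id_on (at_vertex S'' v'')"
    using r' by (simp add: local_iso_def)
  finally have 2: "(r O r')\<inverse> O (r O r') = Id_on (at_vertex S'' v'')" .
  have 3: "r O r' \<subseteq> at_vertex S v \<times> at_vertex S'' v''"
    using local_iso_mem(1)[OF r] local_iso_mem(2)[OF r'] by blast
  have 4: "\<forall>(x, y)\<in>r O r'. level S x = level S'' y \<and> (att S x, att S'' y) \<in> r O r' \<and> (opp S x, opp S'' y) \<in> r O r'"
    using local_iso_mem(3-5)[OF r] local_iso_mem(3-5)[OF r'] by fastforce
  show ?thesis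
    using 1 2 3 4 r r' unfolding local_iso_def by blast
qed

lemma local_iso_Id:
  assumes "wf_structure S" "v \<in> items S" "level S v = 0"
  shows "local_iso S S v v (Id_on (at_vertex S v))"
proof -
  have "att S x \<in> at_vertex S v \<and> opp S x \<in> at_vertex S v" if "x \<in> at_vertex S v" for x
  proof -
    have x: "x \<in> items S" "att S (att S x) = v"
      using that by (auto simp: at_vertex_def)
    then have "att S v = v"
      using assms by (auto simp: wf_structure_def)
    then show ?thesis
      using assms(1) x unfolding wf_structure_def at_vertex_def by auto
  qed
  then show ?thesis
    using assms by (auto simp: local_iso_def)
qed

lemma at_dart_subset_at_vertex: "d \<in> at_vertex S v \<Longrightarrow> wf_structure S \<Longrightarrow> level S d = 1 \<Longrightarrow> at_dart S d \<subseteq> at_vertex S v"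
proof
  fix x
  assume a: "d \<in> at_vertex S v" "wf_structure S" "level S d = 1" "x \<in> at_dart S d"
  then have d: "d \<in> items S" "att S (att S d) = v" "level S (att S d) = 0" "att S (att S (att S d)) = att S (att S d)"
    unfolding wf_structure_def at_vertex_def by auto
  then have "att S d = v"
    using a(2) unfolding wf_structure_def by auto
  then show "x \<in> at_vertex S v"
    using a d by (auto simp: at_vertex_def at_dart_def)
qed

lemma at_vertex_dart:
  assumes "wf_structure S" "level S d = 1"
  shows "d \<in> at_vertex S v \<longleftrightarrow> d \<in> items S \<and> att S d = v"
  using assms unfolding wf_structure_def at_vertex_def by auto

lemma at_dart_image:
  assumes r: "local_iso S S' v v' r" and dd: "(d, d') \<in> r" and xy: "(x, y) \<in> r"
  shows "x \<in> at_dart S d \<longleftrightarrow> y \<in> at_dart S' d'"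
proof -
  have items: "x \<in> items S" "y \<in> items S'"
    using local_iso_mem[OF r xy] by (auto simp: at_vertex_def)
  have "x = d \<longleftrightarrow> y = d'"
    using local_iso_left_unique[OF r] local_iso_right_unique[OF r] dd xy by blast
  moreover have "att S x = d \<longleftrightarrow> att S' y = d'"
    using local_iso_left_unique[OF r] local_iso_right_unique[OF r] dd local_iso_mem(4)[OF r xy] by metis
  moreover have "level S x = level S' y"
    using local_iso_mem(3)[OF r xy] .
  ultimately show ?thesis
    using items by (auto simp: at_dart_def)
qed

lemma germ_comp:
  assumes "local_iso S S' v v' r" "(d, d') \<in> r"
  shows "germ S d (r O r') = germ S d r O germ S' d' r'"
  using at_dart_image[OF assms] unfolding germ_def by auto

lemma germ_converse:
  assumes "local_iso S S' v v' r" "(d, d') \<in> r"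
  shows "germ S' d' (r\<inverse>) = (germ S d r)\<inverse>"
  using at_dart_image[OF assms] unfolding germ_def by auto

lemma flip_germ_comp:
  assumes "\<And>x y. (x, y) \<in> g \<Longrightarrow> flip S' (flip S' y) = y" "\<And>x y. (x, y) \<in> g' \<Longrightarrow> flip S' (flip S' x) = x"
  shows "flip_germ S S'' (g O g') = flip_germ S S' g O flip_germ S' S'' g'"
proof (intro set_eqI iffI; clarify)
  fix a c assume "(a, c) \<in> flip_germ S S'' (g O g')"
  then show "(a, c) \<in> flip_germ S S' g O flip_germ S' S'' g'"
    unfolding flip_germ_def by force
next
  fix a b b' c assume "(a, b) \<in> flip_germ S S' g" "(b, c) \<in> flip_germ S' S'' g'"
  then obtain x y x' y' where *: "(x, y) \<in> g" "(x', y') \<in> g'" "a = flip S x" "b = flip S' y" "b = flip S' x'" "c = flip S'' y'"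
    unfolding flip_germ_def by auto
  then have "y = x'"
    using assms by metis
  then have "(x, y') \<in> g O g'"
    using * by blast
  then show "(a, c) \<in> flip_germ S S'' (g O g')"
    unfolding flip_germ_def using * by force
qed

lemma flip_germ_converse: "flip_germ S' S (g\<inverse>) = (flip_germ S S' g)\<inverse>"
  unfolding flip_germ_def by force

lemma germ_mem:
  assumes "wf_structure S" "wf_structure S'" "local_iso S S' v v' r" "(x, y) \<in> germ S d r" "level S d = 1"
  shows "flip S (flip S x) = x" "flip S' (flip S' y) = y"
proof -
  have "(x, y) \<in> r" "x \<in> at_dart S d"
    using assms by (auto simp: germ_def)
  then have "x \<in> items S" "y \<in> items S'" "level S x \<noteq> 0" "level S' y \<noteq> 0"
    using local_iso_mem[OF assms(3), of x y] assms(5) by (auto simp: at_dart_def at_vertex_def)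
  then show "flip S (flip S x) = x" "flip S' (flip S' y) = y"
    using assms(1,2) by (auto simp: wf_structure_def)
qed

lemma germ_step_dart:
  assumes "germ S (flip S d) r1 = flip_germ S S' (germ S d r)" "(d, d') \<in> r" "d \<in> items S"
  shows "(flip S d, flip S' d') \<in> r1"
proof -
  have "(d, d') \<in> germ S d r"
    using assms by (auto simp: germ_def at_dart_def)
  then have "(flip S d, flip S' d') \<in> germ S (flip S d) r1"
    unfolding assms(1) flip_germ_def by force
  then show ?thesis
    by (simp add: germ_def)
qed

lemma local_iso_target:
  assumes "wf_structure S" "wf_structure S'" "local_iso S S' v v' r" "(d, d') \<in> r" "level S d = 1"
  shows "v = att S d" "v' = att S' d'"
proof -
  have "d \<in> at_vertex S v" "d' \<in> at_vertex S' v'" "level S' d' = 1"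
    using local_iso_mem[OF assms(3,4)] assms(5) by auto
  then show "v = att S d" "v' = att S' d'"
    using at_vertex_dart assms(1,2,5) by metis+
qed

lemma flip_dart:
  assumes "wf_structure S" "d \<in> items S" "level S d = 1"
  shows "flip S d \<in> items S" "level S (flip S d) = 1" "flip S (flip S d) = d"
    "flip S d \<in> at_vertex S (att S (flip S d))"
proof -
  show *: "flip S d \<in> items S" "level S (flip S d) = 1" "flip S (flip S d) = d"
    using assms by (auto simp: wf_structure_def)
  show "flip S d \<in> at_vertex S (att S (flip S d))"
    using at_vertex_dart[OF assms(1) *(2)] * by blast
qed

text \<open>
  Composites of members of two bisimulations form a bisimulation: the continuation of a
  composite is the composite of the continuations. With the next two facts, the greatest
  bisimulations are the morphisms of a groupoid.
\<close>

lemma bisimilar_comp: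
  assumes wf: "wf_structure S" "wf_structure S'" "wf_structure S''"
    and "(v, v', r) \<in> bisimilar S S'" "(v', v'', r') \<in> bisimilar S' S''"
  shows "(v, v'', r O r') \<in> bisimilar S S''"
proof -
  define \<Psi> where "\<Psi> = {(v, v'', r O r') | v v' v'' r r'. (v, v', r) \<in> bisimilar S S' \<and> (v', v'', r') \<in> bisimilar S' S''}"
  have "local_iso S S'' v v'' (r O r') \<and> (\<forall>d\<in>at_vertex S v. level S d = 1 \<longrightarrow>
           (\<exists>w' q. (att S (flip S d), w', q) \<in> \<Psi> \<and>
              germ S (flip S d) q = flip_germ S S'' (germ S d (r O r'))))"
    if r: "(v, v', r) \<in> bisimilar S S'" and r': "(v', v'', r') \<in> bisimilar S' S''" for v v' v'' r r'
  proof (intro conjI ballI impI)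
    note i = bisimilar_local_iso[OF r] and i' = bisimilar_local_iso[OF r']
    show "local_iso S S'' v v'' (r O r')"
      using i i' by (rule local_iso_comp)
    fix d
    assume d: "d \<in> at_vertex S v" "level S d = 1"
    obtain d' where d': "(d, d') \<in> r" "d' \<in> at_vertex S' v'"
      using local_iso_left_total[OF i d(1)] .
    have dI: "d \<in> items S" "d' \<in> items S'"
      using d(1) d'(2) by (auto simp: at_vertex_def)
    have sd': "level S' d' = 1"
      using local_iso_mem(3)[OF i d'(1)] d by simp
    obtain w' q where q: "(att S (flip S d), w', q) \<in> bisimilar S S'" "germ S (flip S d) q = flip_germ S S' (germ S d r)"
      using bisimilar_step[OF r d] by blast
    obtain w'' q' where q': "(att S' (flip S' d'), w'', q') \<in> bisimilar S' S''"
      "germ S' (flip S' d') q' = flip_germ S' S'' (germ S' d' r')"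
      using bisimilar_step[OF r' d'(2) sd'] by blast
    note iq = bisimilar_local_iso[OF q(1)]
    have fd: "(flip S d, flip S' d') \<in> q"
      using germ_step_dart[OF q(2) d'(1)] dI by simp
    have "w' = att S' (flip S' d')"
      using local_iso_target(2)[OF wf(1,2) iq fd] flip_dart[OF wf(1) dI(1) d(2)] by simp
    then have mem: "(att S (flip S d), w'', q O q') \<in> \<Psi>"
      using q q' unfolding \<Psi>_def by blast
    have "germ S (flip S d) (q O q') = germ S (flip S d) q O germ S' (flip S' d') q'"
      using iq fd by (rule germ_comp)
    also have "\<dots> = flip_germ S S'' (germ S d r O germ S' d' r')"
      unfolding q(2) q'(2)
      by (rule flip_germ_comp[symmetric]; erule germ_mem[OF wf(1,2) i _ d(2)] germ_mem[OF wf(2,3) i' _ sd'])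
    also have "germ S d r O germ S' d' r' = germ S d (r O r')"
      by (rule germ_comp[OF i d'(1), symmetric])
    finally show "\<exists>w' q. (att S (flip S d), w', q) \<in> \<Psi> \<and>
              germ S (flip S d) q = flip_germ S S'' (germ S d (r O r'))"
      using mem by blast
  qed
  then have "bisimulation S S'' \<Psi>"
    unfolding bisimulation_def \<Psi>_def by (auto 4 3)
  then show ?thesis
    using bisimilarI assms unfolding \<Psi>_def by blast
qed

lemma bisimilar_converse:
  assumes wf: "wf_structure S" "wf_structure S'" and "(v, v', r) \<in> bisimilar S S'"
  shows "(v', v, r\<inverse>) \<in> bisimilar S' S"
proof -
  define \<Psi> where "\<Psi> = {(v', v, r\<inverse>) | v v' r. (v, v', r) \<in> bisimilar S S'}"
  have "local_iso S' S v' v (r\<inverse>) \<and> (\<forall>d'\<in>at_vertex S' v'. level S' d' = 1 \<longrightarrow>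
           (\<exists>w' q. (att S' (flip S' d'), w', q) \<in> \<Psi> \<and>
              germ S' (flip S' d') q = flip_germ S' S (germ S' d' (r\<inverse>))))"
    if r: "(v, v', r) \<in> bisimilar S S'" for v v' r
  proof (intro conjI ballI impI)
    note i = bisimilar_local_iso[OF r]
    show "local_iso S' S v' v (r\<inverse>)"
      using i by (rule local_iso_converse)
    fix d'
    assume d': "d' \<in> at_vertex S' v'" "level S' d' = 1"
    obtain d where d: "(d, d') \<in> r" "d \<in> at_vertex S v"
      using local_iso_right_total[OF i d'(1)] .
    have dI: "d \<in> items S" "d' \<in> items S'"
      using d'(1) d(2) by (auto simp: at_vertex_def)
    have sd: "level S d = 1"
      using local_iso_mem(3)[OF i d(1)] d' by simp
    obtain w' q where q: "(att S (flip S d), w', q) \<in> bisimilar S S'" "germ S (flip S d) q = flip_germ S S' (germ S d r)"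
      using bisimilar_step[OF r d(2) sd] by blast
    note iq = bisimilar_local_iso[OF q(1)]
    have fd: "(flip S d, flip S' d') \<in> q"
      using germ_step_dart[OF q(2) d(1)] dI by simp
    have "w' = att S' (flip S' d')"
      using local_iso_target(2)[OF wf(1,2) iq fd] flip_dart[OF wf(1) dI(1) sd] by simp
    then have mem: "(att S' (flip S' d'), att S (flip S d), q\<inverse>) \<in> \<Psi>"
      using q unfolding \<Psi>_def by blast
    have "germ S' (flip S' d') (q\<inverse>) = flip_germ S' S (germ S' d' (r\<inverse>))"
      unfolding germ_converse[OF iq fd] germ_converse[OF i d(1)] q(2) flip_germ_converse ..
    then show "\<exists>w' q. (att S' (flip S' d'), w', q) \<in> \<Psi> \<and>
              germ S' (flip S' d') q = flip_germ S' S (germ S' d' (r\<inverse>))"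
      using mem by blast
  qed
  then have "bisimulation S' S \<Psi>"
    unfolding bisimulation_def \<Psi>_def by (auto 4 3)
  then show ?thesis
    using bisimilarI assms unfolding \<Psi>_def by blast
qed

lemma germ_Id_on:
  assumes "wf_structure S" "d \<in> at_vertex S v" "level S d = 1"
  shows "germ S d (Id_on (at_vertex S v)) = Id_on (at_dart S d)"
  using at_dart_subset_at_vertex[OF assms(2,1,3)] by (auto simp: germ_def)

lemma flip_at_dart:
  assumes wf: "wf_structure S" and d: "d \<in> items S" "level S d = 1"
  shows "flip S ` at_dart S d = at_dart S (flip S d)"
proof -
  have "flip S ` at_dart S d \<subseteq> at_dart S (flip S d)" if d: "d \<in> items S" "level S d = 1" for d
  proof
    fix y assume "y \<in> flip S ` at_dart S d"
    then obtain x where x: "y = flip S x" "x \<in> items S" "x = d \<or> level S x = 2 \<and> att S x = d"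
      by (auto simp: at_dart_def)
    then have "level S x \<noteq> 0"
      using d by auto
    then have "flip S x \<in> items S" "level S (flip S x) = level S x" "level S x = 2 \<Longrightarrow> att S (flip S x) = flip S (att S x)"
      using wf x(2) by (auto simp: wf_structure_def)
    then show "y \<in> at_dart S (flip S d)"
      using x by (auto simp: at_dart_def)
  qed
  note sub = this[OF d] this[OF flip_dart(1,2)[OF wf d]]
  have "at_dart S (flip S d) \<subseteq> flip S ` at_dart S d"
  proof
    fix x assume x: "x \<in> at_dart S (flip S d)"
    then have "flip S x \<in> at_dart S d"
      using sub(2) flip_dart[OF wf d] by auto
    moreover have "flip S (flip S x) = x"
    proof -
      have "x \<in> items S" "level S x \<noteq> 0"
        using x flip_dart[OF wf d] by (auto simp: at_dart_def)
      then show ?thesis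
        using wf by (simp add: wf_structure_def)
    qed
    ultimately show "x \<in> flip S ` at_dart S d"
      by (metis imageI)
  qed
  then show ?thesis
    using sub by blast
qed

lemma bisimilar_Id:
  assumes wf: "wf_structure S" and "v \<in> items S" "level S v = 0"
  shows "(v, v, Id_on (at_vertex S v)) \<in> bisimilar S S"
proof -
  define \<Psi> where "\<Psi> = {(v, v, Id_on (at_vertex S v)) | v. v \<in> items S \<and> level S v = 0}"
  have "local_iso S S v v (Id_on (at_vertex S v)) \<and> (\<forall>d\<in>at_vertex S v. level S d = 1 \<longrightarrow>
           (\<exists>w' q. (att S (flip S d), w', q) \<in> \<Psi> \<and>
              germ S (flip S d) q = flip_germ S S (germ S d (Id_on (at_vertex S v)))))"
    if "v \<in> items S" "level S v = 0" for v
  proof (intro conjI ballI impI)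
    show "local_iso S S v v (Id_on (at_vertex S v))"
      using local_iso_Id[OF wf that] .
    fix d
    assume d: "d \<in> at_vertex S v" "level S d = 1"
    then have dI: "d \<in> items S"
      by (auto simp: at_vertex_def)
    let ?w = "att S (flip S d)"
    note fd = flip_dart[OF wf dI d(2)]
    have "?w \<in> items S" "level S ?w = 0"
      using fd wf unfolding wf_structure_def by auto
    then have "(?w, ?w, Id_on (at_vertex S ?w)) \<in> \<Psi>"
      by (auto simp: \<Psi>_def)
    moreover have "germ S (flip S d) (Id_on (at_vertex S ?w)) = flip_germ S S (germ S d (Id_on (at_vertex S v)))"
      unfolding germ_Id_on[OF wf fd(4,2)] germ_Id_on[OF wf d] flip_germ_def
      by (simp add: flip_at_dart[OF wf dI d(2), symmetric] Id_on_def image_UN)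
    ultimately show "\<exists>w' q. (att S (flip S d), w', q) \<in> \<Psi> \<and>
              germ S (flip S d) q = flip_germ S S (germ S d (Id_on (at_vertex S v)))"
      by blast
  qed
  then have "bisimulation S S \<Psi>"
    unfolding bisimulation_def \<Psi>_def by (auto 4 3)
  then show ?thesis
    using bisimilarI assms unfolding \<Psi>_def by blast
qed

section \<open>Counting local isomorphisms by their germs\<close>

lemma finite_bisimilar:
  assumes "wf_structure S" "wf_structure S'"
  shows "finite (bisimilar S S')"
proof (rule finite_subset)
  show "bisimilar S S' \<subseteq> items S \<times> items S' \<times> Pow (items S \<times> items S')"
    using bisimilar_local_iso[of _ _ _ S S'] unfolding local_iso_def at_vertex_def by fast
  show "finite (items S \<times> items S' \<times> Pow (items S \<times> items S'))"
    using assms by (simp add: wf_structure_def)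
qed

definition germ_class where
  "germ_class S S' d \<gamma> = {\<phi> \<in> bisimilar S S'. fst \<phi> = att S d \<and> germ S d (snd (snd \<phi>)) = \<gamma>}"

text \<open>
  Composition with \<open>r0\<inverse> O s0\<close> on the right is injective, and it sends local isomorphisms with the
  germ of \<open>r0\<close> to local isomorphisms with the germ of \<open>s0\<close>.
\<close>

lemma card_germ_class_le:
  assumes wf: "wf_structure S" "wf_structure S1" "wf_structure S2"
    and d: "d \<in> items S" "level S d = 1"
    and r0: "(att S d, v1, r0) \<in> bisimilar S S1" and s0: "(att S d, v2, s0) \<in> bisimilar S S2"
  shows "card (germ_class S S1 d (germ S d r0)) \<le> card (germ_class S S2 d (germ S d s0))"
proof (rule card_inj_on_le)
  note i0 = bisimilar_local_iso[OF r0] and j0 = bisimilar_local_iso[OF s0]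
  have dv: "d \<in> at_vertex S (att S d)"
    using at_vertex_dart[OF wf(1) d(2)] d by blast
  obtain d1 where d1: "(d, d1) \<in> r0"
    using local_iso_left_total[OF i0 dv] by blast
  let ?f = "\<lambda>(v, u, r). (v, v2, r O (r0\<inverse> O s0))"
  have key: "u = v1 \<and> local_iso S S1 (att S d) v1 r \<and>
      (att S d, v2, r O (r0\<inverse> O s0)) \<in> bisimilar S S2 \<and> germ S d (r O (r0\<inverse> O s0)) = germ S d s0"
    if r: "(att S d, u, r) \<in> bisimilar S S1" "germ S d r = germ S d r0" for u r
  proof -
    note i = bisimilar_local_iso[OF r(1)]
    have "(d, d1) \<in> germ S d r"
      unfolding r(2) using d1 d by (auto simp: germ_def at_dart_def)
    then have d1r: "(d, d1) \<in> r"
      by (simp add: germ_def)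
    have u: "u = v1"
      using local_iso_target(2)[OF wf(1,2) i d1r d(2)] local_iso_target(2)[OF wf(1,2) i0 d1 d(2)] by simp
    have c: "(v1, att S d, r0\<inverse>) \<in> bisimilar S1 S"
      using bisimilar_converse[OF wf(1,2) r0] .
    have c2: "(v1, v2, r0\<inverse> O s0) \<in> bisimilar S1 S2"
      using bisimilar_comp[OF wf(2,1,3) c s0] .
    have "germ S d (r O (r0\<inverse> O s0)) = germ S d r O germ S1 d1 (r0\<inverse> O s0)"
      using germ_comp[OF i d1r] .
    also have "germ S1 d1 (r0\<inverse> O s0) = germ S1 d1 (r0\<inverse>) O germ S d s0"
      using germ_comp[OF bisimilar_local_iso[OF c]] d1 by blast
    also have "germ S1 d1 (r0\<inverse>) = (germ S d r)\<inverse>"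
      using germ_converse[OF i0 d1] r(2) by simp
    also have "germ S d r O (germ S d r)\<inverse> O germ S d s0 = germ S d s0"
    proof -
      have "germ S d r O (germ S d r)\<inverse> = Id_on (at_dart S d)"
      proof -
        have "x \<in> Domain r" if "x \<in> at_dart S d" for x
          using local_iso_left_total[OF i, of x] at_dart_subset_at_vertex[OF dv wf(1) d(2)] that by blast
        then show ?thesis
          using local_iso_left_unique[OF i] unfolding germ_def by blast
      qed
      then have "germ S d r O (germ S d r)\<inverse> O germ S d s0 = Id_on (at_dart S d) O germ S d s0"
        by (simp add: O_assoc[symmetric])
      also have "\<dots> = germ S d s0"
        by (auto simp: germ_def)
      finally show ?thesis .
    qed
    finally show ?thesis
      using u i bisimilar_comp[OF wf(1,2,3) _ c2] r(1) by blast
  qed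
  show "?f ` germ_class S S1 d (germ S d r0) \<subseteq> germ_class S S2 d (germ S d s0)"
    using key by (auto simp: germ_class_def)
  show "finite (germ_class S S2 d (germ S d s0))"
    using finite_bisimilar[OF wf(1,3)] by (simp add: germ_class_def)
  \<comment> \<open>Composition with \<open>r0\<inverse> O s0\<close> can be undone.\<close>
  have inv: "r O (r0\<inverse> O s0) O (s0\<inverse> O r0) = r"
    if "local_iso S S1 (att S d) v1 r" for r
  proof -
    have "r O (r0\<inverse> O s0) O (s0\<inverse> O r0) = r O r0\<inverse> O (s0 O s0\<inverse>) O r0"
      by (simp add: O_assoc)
    also have "s0 O s0\<inverse> = Id_on (at_vertex S (att S d))"
      using j0 by (simp add: local_iso_def)
    also have "Id_on (at_vertex S (att S d)) O r0 = r0"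
      by (auto dest: local_iso_mem(1)[OF i0])
    also have "r0\<inverse> O r0 = Id_on (at_vertex S1 v1)"
      using i0 by (simp add: local_iso_def)
    also have "r O Id_on (at_vertex S1 v1) = r"
      by (auto dest: local_iso_mem(2)[OF that])
    finally show ?thesis .
  qed
  show "inj_on ?f (germ_class S S1 d (germ S d r0))"
  proof (rule inj_onI)
    fix \<phi> \<psi>
    assume a: "\<phi> \<in> germ_class S S1 d (germ S d r0)" "\<psi> \<in> germ_class S S1 d (germ S d r0)" "?f \<phi> = ?f \<psi>"
    obtain v u r v' u' r' where e: "\<phi> = (v, u, r)" "\<psi> = (v', u', r')"
      by (metis prod_cases3)
    have v: "v = att S d" "v' = att S d"
      using a by (auto simp: e germ_class_def)
    have k: "u = v1" "u' = v1" "local_iso S S1 (att S d) v1 r" "local_iso S S1 (att S d) v1 r'"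
      using key[of u r] key[of u' r'] a by (auto simp: e germ_class_def)
    have "r O (r0\<inverse> O s0) = r' O (r0\<inverse> O s0)"
      using a(3) by (simp add: e)
    then have "(r O (r0\<inverse> O s0)) O (s0\<inverse> O r0) = (r' O (r0\<inverse> O s0)) O (s0\<inverse> O r0)"
      by simp
    then have "r = r'"
      using inv[OF k(3)] inv[OF k(4)] by (simp only: O_assoc)
    then show "\<phi> = \<psi>"
      using k v e by simp
  qed
qed

definition dart_germs where
  "dart_germs S d = {germ S d (snd (snd \<phi>)) | \<phi>. \<phi> \<in> bisimilar S S \<and> fst \<phi> = att S d}"

lemma flip_germ_flip_germ:
  assumes "wf_structure S" "wf_structure S'" "local_iso S S' v v' r" "level S d = 1"
  shows "flip_germ S S' (flip_germ S S' (germ S d r)) = germ S d r"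
proof -
  have "map_prod (flip S) (flip S') (map_prod (flip S) (flip S') p) = p" if "p \<in> germ S d r" for p
    using germ_mem[OF assms(1-3) _ assms(4), of "fst p" "snd p"] that by (cases p) auto
  then show ?thesis
    unfolding flip_germ_def image_image by simp
qed

lemma card_dart_germs_flip:
  assumes wf: "wf_structure S" and d: "d \<in> items S" "level S d = 1"
  shows "card (dart_germs S (flip S d)) = card (dart_germs S d)"
proof -
  have le: "card (dart_germs S d) \<le> card (dart_germs S (flip S d))" if d: "d \<in> items S" "level S d = 1" for d
  proof (rule card_inj_on_le[where f = "flip_germ S S"])
    have dv: "d \<in> at_vertex S (att S d)"
      using at_vertex_dart[OF wf d(2)] d by blast
    show "inj_on (flip_germ S S) (dart_germs S d)"
    proof (rule inj_on_inverseI[where g = "flip_germ S S"])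
      fix g assume "g \<in> dart_germs S d"
      then obtain w r where "(att S d, w, r) \<in> bisimilar S S" "g = germ S d r"
        by (auto simp: dart_germs_def)
      then show "flip_germ S S (flip_germ S S g) = g"
        using flip_germ_flip_germ[OF wf wf bisimilar_local_iso d(2)] by simp
    qed
    show "flip_germ S S ` dart_germs S d \<subseteq> dart_germs S (flip S d)"
    proof
      fix g assume "g \<in> flip_germ S S ` dart_germs S d"
      then obtain w r where r: "(att S d, w, r) \<in> bisimilar S S" "g = flip_germ S S (germ S d r)"
        by (auto simp: dart_germs_def)
      obtain w' r' where "(att S (flip S d), w', r') \<in> bisimilar S S" "germ S (flip S d) r' = g"
        using bisimilar_step[OF r(1) dv d(2)] r(2) by blast
      then show "g \<in> dart_germs S (flip S d)"
        unfolding dart_germs_def by force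
    qed
    have "finite ((\<lambda>\<phi>. germ S (flip S d) (snd (snd \<phi>))) ` bisimilar S S)"
      using finite_bisimilar[OF wf wf] by simp
    then show "finite (dart_germs S (flip S d))"
      by (rule rev_finite_subset) (force simp: dart_germs_def)
  qed
  show ?thesis
    using le[OF d] le[OF flip_dart(1,2)[OF wf d]] flip_dart(3)[OF wf d] by simp
qed

text \<open>
  The local automorphisms at the source of \<open>d\<close> are divided by their germs into classes of equal
  size, which is also the size of every class of local isomorphisms to the other structure.
\<close>

lemma germ_class_count:
  assumes wf: "wf_structure S" "wf_structure S'" and d: "d \<in> items S" "level S d = 1"
    and r: "(att S d, v', r) \<in> bisimilar S S'"
  shows "card (germ_class S S' d (germ S d r)) * card (dart_germs S d) =
    card {\<phi> \<in> bisimilar S S. fst \<phi> = att S d}"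
proof -
  have "card (germ_class S S d \<gamma>) = card (germ_class S S' d (germ S d r))" if \<gamma>: "\<gamma> \<in> dart_germs S d" for \<gamma>
  proof -
    obtain w s where s: "(att S d, w, s) \<in> bisimilar S S" "\<gamma> = germ S d s"
      using \<gamma> by (auto simp: dart_germs_def)
    show ?thesis
      unfolding s(2) using card_germ_class_le[OF wf(1,1,2) d s(1) r] card_germ_class_le[OF wf(1,2,1) d r s(1)]
      by simp
  qed
  moreover have "{\<phi> \<in> bisimilar S S. fst \<phi> = att S d} = (\<Union>\<gamma>\<in>dart_germs S d. germ_class S S d \<gamma>)"
    by (auto simp: dart_germs_def germ_class_def) blast
  moreover have "card (\<Union>\<gamma>\<in>dart_germs S d. germ_class S S d \<gamma>) = (\<Sum>\<gamma>\<in>dart_germs S d. card (germ_class S S d \<gamma>))"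
  proof (rule card_UN_disjoint)
    have "finite ((\<lambda>\<phi>. germ S d (snd (snd \<phi>))) ` bisimilar S S)"
      using finite_bisimilar[OF wf(1,1)] by simp
    then show "finite (dart_germs S d)"
      by (rule rev_finite_subset) (force simp: dart_germs_def)
    show "\<forall>\<gamma>\<in>dart_germs S d. finite (germ_class S S d \<gamma>)"
      using finite_bisimilar[OF wf(1,1)] by (simp add: germ_class_def)
  qed (auto simp: germ_class_def)
  ultimately show ?thesis
    by simp
qed

text \<open>
  The pieces are the members of the greatest bisimulation, and \<open>germ_class_count\<close> provides the
  numbers: \<open>M v\<close> counts the local automorphisms at \<open>v\<close>, and \<open>b d\<close> their germs along \<open>d\<close>.
\<close>

theorem finite_gluing:
  assumes wf: "wf_structure S" "wf_structure S'" and ne: "bisimilar S S' \<noteq> {}"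
  obtains Z :: "nat set" and \<pi> :: "nat \<Rightarrow> 'h \<times> 'k \<times> ('h \<times> 'k) set" and N :: "nat \<Rightarrow> 'h \<Rightarrow> nat"
  where "finite Z" "Z \<noteq> {}" "\<And>z. z \<in> Z \<Longrightarrow> \<pi> z \<in> bisimilar S S'"
    "\<And>z d. z \<in> Z \<Longrightarrow> d \<in> items S \<Longrightarrow> level S d = 1 \<Longrightarrow> att S d = fst (\<pi> z) \<Longrightarrow>
       N z d \<in> Z \<and> fst (\<pi> (N z d)) = att S (flip S d) \<and>
       germ S (flip S d) (snd (snd (\<pi> (N z d)))) = flip_germ S S' (germ S d (snd (snd (\<pi> z)))) \<and>
       N (N z d) (flip S d) = z"
    "\<And>W. W \<subseteq> Z \<Longrightarrow> W \<noteq> {} \<Longrightarrow>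
       (\<And>z d. z \<in> W \<Longrightarrow> d \<in> items S \<Longrightarrow> level S d = 1 \<Longrightarrow> att S d = fst (\<pi> z) \<Longrightarrow> N z d \<in> W) \<Longrightarrow> W = Z"
proof -
  let ?P = "bisimilar S S'" and ?D = "{d \<in> items S. level S d = 1}"
    and ?M = "\<lambda>v. card {\<phi> \<in> bisimilar S S. fst \<phi> = v}" and ?g = "\<lambda>\<phi> d. germ S d (snd (snd \<phi>))"
  obtain Z \<pi> N where Z: "finite (Z :: nat set)" "Z \<noteq> {}" "\<And>z. z \<in> Z \<Longrightarrow> \<pi> z \<in> ?P"
    "\<And>z d. z \<in> Z \<Longrightarrow> d \<in> ?D \<Longrightarrow> att S d = fst (\<pi> z) \<Longrightarrow>
       N z d \<in> Z \<and> fst (\<pi> (N z d)) = att S (flip S d) \<and>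
       ?g (\<pi> (N z d)) (flip S d) = flip_germ S S' (?g (\<pi> z) d) \<and> N (N z d) (flip S d) = z"
    "\<And>W. W \<subseteq> Z \<Longrightarrow> W \<noteq> {} \<Longrightarrow>
       (\<And>z d. z \<in> W \<Longrightarrow> d \<in> ?D \<Longrightarrow> att S d = fst (\<pi> z) \<Longrightarrow> N z d \<in> W) \<Longrightarrow> W = Z"
  proof (rule weighted_gluing[where P = ?P and s = fst and D = ?D and src = "att S" and rev = "flip S"
        and pos = "positive S" and germ = ?g and \<rho> = "flip_germ S S'" and M = ?M
        and b = "\<lambda>d. card (dart_germs S d)"])
    show "finite ?P"
      using finite_bisimilar[OF wf] .
    show "flip S d \<in> ?D" "flip S (flip S d) = d" "positive S (flip S d) \<longleftrightarrow> \<not> positive S d" if "d \<in> ?D" for d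
      using that flip_dart[OF wf(1)] wf(1) by (auto simp: wf_structure_def)
    show "?M (fst \<phi>) > 0" if "\<phi> \<in> ?P" for \<phi>
    proof -
      have "local_iso S S' (fst \<phi>) (fst (snd \<phi>)) (snd (snd \<phi>))"
        using that by (simp add: bisimilar_local_iso)
      then have "(fst \<phi>, fst \<phi>, Id_on (at_vertex S (fst \<phi>))) \<in> {\<psi> \<in> bisimilar S S. fst \<psi> = fst \<phi>}"
        using bisimilar_Id[OF wf(1)] by (auto simp: local_iso_def)
      then have "{\<psi> \<in> bisimilar S S. fst \<psi> = fst \<phi>} \<noteq> {}"
        by blast
      then show ?thesis
        using finite_bisimilar[OF wf(1,1)] by (subst card_gt_0_iff) simp
    qed
    show "card (dart_germs S (flip S d)) = card (dart_germs S d)" if "d \<in> ?D" for d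
      using that card_dart_germs_flip[OF wf(1)] by simp
    show "card {\<psi> \<in> ?P. fst \<psi> = att S d \<and> ?g \<psi> d = ?g \<phi> d} * card (dart_germs S d) = ?M (att S d)"
      if "\<phi> \<in> ?P" "d \<in> ?D" "att S d = fst \<phi>" for \<phi> d
    proof -
      have "(att S d, fst (snd \<phi>), snd (snd \<phi>)) \<in> bisimilar S S'"
        using that by simp
      from germ_class_count[OF wf _ _ this] that show ?thesis
        by (simp add: germ_class_def)
    qed
    show "\<exists>\<psi>\<in>?P. fst \<psi> = att S (flip S d) \<and> ?g \<psi> (flip S d) = flip_germ S S' (?g \<phi> d)"
      if "\<phi> \<in> ?P" "d \<in> ?D" "att S d = fst \<phi>" for \<phi> d
    proof -
      have 1: "(fst \<phi>, fst (snd \<phi>), snd (snd \<phi>)) \<in> bisimilar S S'"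
        using that by simp
      have "d \<in> at_vertex S (fst \<phi>)"
        using that at_vertex_dart[OF wf(1)] by simp
      from bisimilar_step[OF 1 this] that show ?thesis
        by force
    qed
    show "flip_germ S S' (flip_germ S S' (?g \<phi> d)) = ?g \<phi> d" if "\<phi> \<in> ?P" "d \<in> ?D" "att S d = fst \<phi>" for \<phi> d
      using that flip_germ_flip_germ[OF wf, of "fst \<phi>" "fst (snd \<phi>)" "snd (snd \<phi>)" d]
      by (simp add: bisimilar_local_iso)
  qed (use ne in auto)
  show thesis
    by (rule that[of Z \<pi> N]) (use Z in auto)
qed

section \<open>Open subsets of products with graphs\<close>

lemma openin_prod_discrete:
  "openin (prod_topology (discrete_topology A) Y) W \<longleftrightarrow>
     W \<subseteq> A \<times> topspace Y \<and> (\<forall>a\<in>A. openin Y {y. (a, y) \<in> W})"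
proof
  assume W: "openin (prod_topology (discrete_topology A) Y) W"
  then have sub: "W \<subseteq> A \<times> topspace Y"
    using openin_subset by fastforce
  have "openin Y {y. (a, y) \<in> W}" if "a \<in> A" for a
  proof -
    have "continuous_map Y (prod_topology (discrete_topology A) Y) (\<lambda>y. (a, y))"
      using that by (intro continuous_map_pairedI) auto
    then have "openin Y {y \<in> topspace Y. (a, y) \<in> W}"
      using W by (rule openin_continuous_map_preimage)
    moreover have "{y \<in> topspace Y. (a, y) \<in> W} = {y. (a, y) \<in> W}"
      using sub by auto
    ultimately show ?thesis
      by simp
  qed
  then show "W \<subseteq> A \<times> topspace Y \<and> (\<forall>a\<in>A. openin Y {y. (a, y) \<in> W})"
    using sub by blast
next
  assume W: "W \<subseteq> A \<times> topspace Y \<and> (\<forall>a\<in>A. openin Y {y. (a, y) \<in> W})"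
  then have "W = (\<Union>a\<in>A. {a} \<times> {y. (a, y) \<in> W})"
    by blast
  moreover have "openin (prod_topology (discrete_topology A) Y) ({a} \<times> {y. (a, y) \<in> W})" if "a \<in> A" for a
    using W that by (subst openin_prod_Times_iff) auto
  ultimately show "openin (prod_topology (discrete_topology A) Y) W"
    by (metis (no_types, lifting) imageE openin_Union)
qed

lemma openin_prod_plus:
  "openin (prod_topology (plus_topology A B) Y) W \<longleftrightarrow>
     W \<subseteq> (topspace A <+> topspace B) \<times> topspace Y \<and>
     openin (prod_topology A Y) {(a, y). (Inl a, y) \<in> W} \<and>
     openin (prod_topology B Y) {(b, y). (Inr b, y) \<in> W}"
proof
  assume W: "openin (prod_topology (plus_topology A B) Y) W"
  then have sub: "W \<subseteq> (topspace A <+> topspace B) \<times> topspace Y"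
    using openin_subset by fastforce
  have "openin A U" if "openin (plus_topology A B) V" "U = {x. Inl x \<in> V}" for U V
    using that by (simp add: openin_plus_topology)
  moreover have "openin B U" if "openin (plus_topology A B) V" "U = {x. Inr x \<in> V}" for U V
    using that by (simp add: openin_plus_topology)
  ultimately have cl: "continuous_map A (plus_topology A B) Inl" "continuous_map B (plus_topology A B) Inr"
    by (auto simp: continuous_map_def openin_plus_topology) (metis (no_types, lifting) Collect_cong openin_subset subsetD mem_Collect_eq)+
  have c1: "continuous_map (prod_topology A Y) (prod_topology (plus_topology A B) Y) (\<lambda>z. (Inl (fst z), snd z))"
    using continuous_map_compose[OF continuous_map_fst cl(1), of Y]
    by (intro continuous_map_pairedI) (auto simp: continuous_map_snd o_def)
  have c2: "continuous_map (prod_topology B Y) (prod_topology (plus_topology A B) Y) (\<lambda>z. (Inr (fst z), snd z))"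
    using continuous_map_compose[OF continuous_map_fst cl(2), of Y]
    by (intro continuous_map_pairedI) (auto simp: continuous_map_snd o_def)
  have "{(a, y). (Inl a, y) \<in> W} = {z \<in> topspace (prod_topology A Y). (Inl (fst z), snd z) \<in> W}"
    "{(b, y). (Inr b, y) \<in> W} = {z \<in> topspace (prod_topology B Y). (Inr (fst z), snd z) \<in> W}"
    using sub by auto
  then show "W \<subseteq> (topspace A <+> topspace B) \<times> topspace Y \<and>
     openin (prod_topology A Y) {(a, y). (Inl a, y) \<in> W} \<and>
     openin (prod_topology B Y) {(b, y). (Inr b, y) \<in> W}"
    using sub openin_continuous_map_preimage[OF c1 W] openin_continuous_map_preimage[OF c2 W] by simp
next
  assume W: "W \<subseteq> (topspace A <+> topspace B) \<times> topspace Y \<and>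
     openin (prod_topology A Y) {(a, y). (Inl a, y) \<in> W} \<and>
     openin (prod_topology B Y) {(b, y). (Inr b, y) \<in> W}"
  show "openin (prod_topology (plus_topology A B) Y) W"
    unfolding openin_prod_topology_alt
  proof (intro allI impI)
    fix x y
    assume xy: "(x, y) \<in> W"
    show "\<exists>U V. openin (plus_topology A B) U \<and> openin Y V \<and> x \<in> U \<and> y \<in> V \<and> U \<times> V \<subseteq> W"
    proof (cases x)
      case (Inl a)
      then have "(a, y) \<in> {(a, y). (Inl a, y) \<in> W}"
        using xy by simp
      then obtain U V where UV: "openin A U" "openin Y V" "a \<in> U" "y \<in> V" "U \<times> V \<subseteq> {(a, y). (Inl a, y) \<in> W}"
        using W unfolding openin_prod_topology_alt by meson
      have "openin (plus_topology A B) (Inl ` U)"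
        using UV(1) by (simp add: openin_plus_topology image_iff)
      moreover have "Inl ` U \<times> V \<subseteq> W"
        using UV(5) by auto
      ultimately show ?thesis
        using UV Inl by blast
    next
      case (Inr b)
      then have "(b, y) \<in> {(b, y). (Inr b, y) \<in> W}"
        using xy by simp
      then obtain U V where UV: "openin B U" "openin Y V" "b \<in> U" "y \<in> V" "U \<times> V \<subseteq> {(b, y). (Inr b, y) \<in> W}"
        using W unfolding openin_prod_topology_alt by meson
      have "openin (plus_topology A B) (Inr ` U)"
        using UV(1) by (simp add: openin_plus_topology image_iff)
      moreover have "Inr ` U \<times> V \<subseteq> W"
        using UV(5) by auto
      ultimately show ?thesis
        using UV Inr by blast
    qed
  qed
qed

lemma openin_prod_prod_discrete:
  "openin (prod_topology (prod_topology (discrete_topology A) Y) Z) W \<longleftrightarrow>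
     W \<subseteq> (A \<times> topspace Y) \<times> topspace Z \<and>
     (\<forall>a\<in>A. openin (prod_topology Y Z) {(y, z). ((a, y), z) \<in> W})"
proof
  assume W: "openin (prod_topology (prod_topology (discrete_topology A) Y) Z) W"
  then have sub: "W \<subseteq> (A \<times> topspace Y) \<times> topspace Z"
    using openin_subset by fastforce
  have "openin (prod_topology Y Z) {(y, z). ((a, y), z) \<in> W}" if "a \<in> A" for a
  proof -
    have "continuous_map (prod_topology Y Z) (prod_topology (prod_topology (discrete_topology A) Y) Z)
        (\<lambda>x. ((a, fst x), snd x))"
      using that by (intro continuous_map_pairedI) (auto simp: continuous_map_fst continuous_map_snd)
    then have "openin (prod_topology Y Z) {x \<in> topspace (prod_topology Y Z). ((a, fst x), snd x) \<in> W}"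
      using W by (rule openin_continuous_map_preimage)
    moreover have "{x \<in> topspace (prod_topology Y Z). ((a, fst x), snd x) \<in> W} = {(y, z). ((a, y), z) \<in> W}"
      using sub by auto
    ultimately show ?thesis
      by simp
  qed
  then show "W \<subseteq> (A \<times> topspace Y) \<times> topspace Z \<and>
     (\<forall>a\<in>A. openin (prod_topology Y Z) {(y, z). ((a, y), z) \<in> W})"
    using sub by blast
next
  assume W: "W \<subseteq> (A \<times> topspace Y) \<times> topspace Z \<and>
     (\<forall>a\<in>A. openin (prod_topology Y Z) {(y, z). ((a, y), z) \<in> W})"
  show "openin (prod_topology (prod_topology (discrete_topology A) Y) Z) W"
    unfolding openin_prod_topology_alt[of "prod_topology (discrete_topology A) Y"]
  proof (intro allI impI)
    fix x z
    assume xz: "(x, z) \<in> W"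
    obtain a y where x: "x = (a, y)"
      by (cases x)
    have "a \<in> A" "(y, z) \<in> {(y, z). ((a, y), z) \<in> W}"
      using W xz x by auto
    then obtain U V where UV: "openin Y U" "openin Z V" "y \<in> U" "z \<in> V" "U \<times> V \<subseteq> {(y, z). ((a, y), z) \<in> W}"
      using W unfolding openin_prod_topology_alt by meson
    have "openin (prod_topology (discrete_topology A) Y) ({a} \<times> U)"
      using UV(1) \<open>a \<in> A\<close> by (subst openin_prod_Times_iff) auto
    then show "\<exists>U V. openin (prod_topology (discrete_topology A) Y) U \<and> openin Z V \<and> x \<in> U \<and> z \<in> V \<and> U \<times> V \<subseteq> W"
      using UV x by (intro exI[of _ "{a} \<times> U"] exI[of _ V]) auto
  qed
qed

lemma openin_realization:
  "openin (realization G) U \<longleftrightarrow>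
     U \<subseteq> topspace (realization G) \<and>
     (\<forall>e\<in>arcs G. openin (top_of_set unit_interval) {t \<in> unit_interval. edge_map G e t \<in> U})"
  unfolding realization_def openin_quotient_topology topspace_quotient_topology openin_plus_topology
    openin_prod_discrete
  by (auto simp: Plus_def image_iff intro!: arg_cong[where f = "openin (top_of_set unit_interval)", THEN iffD1])

text \<open>
  The product of the quotient map that defines a graph with the identity of the interval is
  again a quotient map, since the interval is locally compact.
\<close>

lemma openin_prod_realization:
  "openin (prod_topology (realization G) (top_of_set unit_interval)) W \<longleftrightarrow>
     W \<subseteq> topspace (realization G) \<times> unit_interval \<and>
     (\<forall>v\<in>verts G. openin (top_of_set unit_interval) {t. (Vertex v, t) \<in> W}) \<and>
     (\<forall>e\<in>arcs G. openin (top_of_set unit_square) {x \<in> unit_square. (edge_map G e (fst x), snd x) \<in> W})"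
proof -
  let ?I = "top_of_set unit_interval"
  let ?P = "plus_topology (discrete_topology (verts G)) (prod_topology (discrete_topology (arcs G)) ?I)"
  let ?f = "case_sum Vertex (\<lambda>(e, t). edge_map G e t)"
  have loc: "locally_compact_space ?I"
    by (simp add: compact_imp_locally_compact_space compact_space_subtopology)
  have haus: "Hausdorff_space ?I \<or> regular_space ?I"
    by (simp add: Hausdorff_space_subtopology)
  have q: "quotient_map (prod_topology ?P ?I) (prod_topology (realization G) ?I) (\<lambda>(x, y). (?f x, y))"
    unfolding realization_def
    by (rule quotient_map_prod_left[OF loc haus quotient_map_quotient_topology])
  have top: "topspace (prod_topology (realization G) ?I) = topspace (realization G) \<times> unit_interval"
    by simp
  show ?thesis
  proof (cases "W \<subseteq> topspace (realization G) \<times> unit_interval")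
    case False
    then show ?thesis
      using openin_subset top by metis
  next
    case True
    let ?W = "{z \<in> topspace (prod_topology ?P ?I). (\<lambda>(x, y). (?f x, y)) z \<in> W}"
    have "openin (prod_topology (realization G) ?I) W \<longleftrightarrow> openin (prod_topology ?P ?I) ?W"
      using q True unfolding quotient_map_def top by blast
    also have "\<dots> \<longleftrightarrow> openin (prod_topology (discrete_topology (verts G)) ?I) {(a, y). (Inl a, y) \<in> ?W} \<and>
        openin (prod_topology (prod_topology (discrete_topology (arcs G)) ?I) ?I) {(b, y). (Inr b, y) \<in> ?W}"
      unfolding openin_prod_plus by auto
    also have "openin (prod_topology (discrete_topology (verts G)) ?I) {(a, y). (Inl a, y) \<in> ?W} \<longleftrightarrow>
        (\<forall>v\<in>verts G. openin ?I {t. (Vertex v, t) \<in> W})"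
    proof -
      have "{t. (v, t) \<in> {(a, y). (Inl a, y) \<in> ?W}} = {t. (Vertex v, t) \<in> W}" if "v \<in> verts G" for v
        using True that by auto
      then show ?thesis
        unfolding openin_prod_discrete by auto
    qed
    also have "openin (prod_topology (prod_topology (discrete_topology (arcs G)) ?I) ?I) {(b, y). (Inr b, y) \<in> ?W} \<longleftrightarrow>
        (\<forall>e\<in>arcs G. openin (top_of_set unit_square) {x \<in> unit_square. (edge_map G e (fst x), snd x) \<in> W})"
    proof -
      have "{(s, t). ((e, s), t) \<in> {(b, y). (Inr b, y) \<in> ?W}} = {x \<in> unit_square. (edge_map G e (fst x), snd x) \<in> W}"
        if "e \<in> arcs G" for e
        using that by auto
      moreover have "prod_topology ?I ?I = top_of_set unit_square"
        by (rule prod_topology_subtopology_eu)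
      ultimately show ?thesis
        unfolding openin_prod_prod_discrete by auto
    qed
    finally show ?thesis
      using True by simp
  qed
qed

lemma topspace_realization:
  "topspace (realization G) = Vertex ` verts G \<union> (\<Union>e\<in>arcs G. edge_map G e ` unit_interval)"
  unfolding realization_def by (force simp: Plus_def)

lemma edge_map_in_realization:
  "e \<in> arcs G \<Longrightarrow> t \<in> unit_interval \<Longrightarrow> edge_map G e t \<in> topspace (realization G)"
  unfolding topspace_realization by blast

section \<open>Darts\<close>

definition darts :: "('v, 'e) pre_digraph \<Rightarrow> ('e \<times> bool) set" where
  "darts G = arcs G \<times> UNIV"

definition dart_src :: "('v, 'e) pre_digraph \<Rightarrow> 'e \<times> bool \<Rightarrow> 'v" where
  "dart_src G d = (if snd d then tail G (fst d) else head G (fst d))"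

definition dart_rev :: "'e \<times> bool \<Rightarrow> 'e \<times> bool" where
  "dart_rev d = (fst d, \<not> snd d)"

definition dart_map :: "('v, 'e) pre_digraph \<Rightarrow> 'e \<times> bool \<Rightarrow> real \<Rightarrow> ('v, 'e) graph_point" where
  "dart_map G d s = edge_map G (fst d) (if snd d then s else 1 - s)"

lemma dart_rev_rev [simp]: "dart_rev (dart_rev d) = d"
  by (simp add: dart_rev_def)

lemma dart_rev_neq [simp]: "dart_rev d \<noteq> d"
  by (auto simp: dart_rev_def prod_eq_iff)

lemma dart_rev_in_darts [simp]: "dart_rev d \<in> darts G \<longleftrightarrow> d \<in> darts G"
  by (cases d) (auto simp: dart_rev_def darts_def)

lemma dart_rev_fst_snd [simp]: "fst (dart_rev d) = fst d" "snd (dart_rev d) \<longleftrightarrow> \<not> snd d"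
  by (auto simp: dart_rev_def)

lemma dart_map_0: "dart_map G d 0 = Vertex (dart_src G d)"
  by (simp add: dart_map_def edge_map_def dart_src_def)

lemma dart_map_1: "dart_map G d 1 = Vertex (dart_src G (dart_rev d))"
  by (simp add: dart_map_def edge_map_def dart_src_def dart_rev_def)

lemma dart_map_rev: "dart_map G (dart_rev d) s = dart_map G d (1 - s)"
  by (simp add: dart_map_def dart_rev_def)

lemma dart_map_inner:
  "0 < s \<Longrightarrow> s < 1 \<Longrightarrow> dart_map G d s = Inner (fst d) (if snd d then s else 1 - s)"
  by (simp add: dart_map_def edge_map_def)

text \<open>
  At \<open>1/3\<close> the two directions of an edge are at different points.
\<close>

lemma dart_map_inj:
  assumes "dart_map G d (1/3) = dart_map G d' (1/3)"
  shows "d = d'"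
  using assms by (auto simp: dart_map_inner prod_eq_iff split: if_splits)

lemma dart_map_positive: "dart_map G (e, True) = edge_map G e"
  by (auto simp: dart_map_def fun_eq_iff)

section \<open>Corners of squares\<close>

definition circle_prev :: "nat \<Rightarrow> nat \<Rightarrow> nat" where
  "circle_prev l k = (if k = 0 then l - 1 else k - 1)"

definition circle_next :: "nat \<Rightarrow> nat \<Rightarrow> nat" where
  "circle_next l k = Suc k mod l"

lemma circle_next_prev: "k < l \<Longrightarrow> circle_next l (circle_prev l k) = k"
  by (auto simp: circle_next_def circle_prev_def)

lemma circle_prev_next: "k < l \<Longrightarrow> circle_prev l (circle_next l k) = k"
  by (cases "Suc k = l") (auto simp: circle_next_def circle_prev_def)

lemma circle_next_less: "k < l \<Longrightarrow> circle_next l k < l"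
  by (auto simp: circle_next_def)

lemma circle_prev_less: "k < l \<Longrightarrow> circle_prev l k < l"
  by (auto simp: circle_prev_def)

lemma edge_map_cycle:
  "edge_map (cycle_graph l) k 0 = Vertex k" "edge_map (cycle_graph l) k 1 = Vertex (circle_next l k)"
  "0 < s \<Longrightarrow> s < 1 \<Longrightarrow> edge_map (cycle_graph l) k s = Inner k s"
  by (auto simp: edge_map_def cycle_graph_def circle_next_def)

text \<open>
  The dart along which the \<open>k\<close>-th edge of the \<open>i\<close>-th circle is mapped.
\<close>

definition fin_dart :: "('v, 'e) fin_data \<Rightarrow> nat \<Rightarrow> nat \<Rightarrow> 'e \<times> bool" where
  "fin_dart F i k = (SOME d. d \<in> darts (base_graph F) \<and>
     (\<forall>s\<in>unit_interval. fin_map F i (edge_map (fin_circle F i) k s) = dart_map (base_graph F) d s))"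

text \<open>
  The corner \<open>(i, k, b)\<close> lies at the vertex \<open>k\<close> of the \<open>i\<close>-th circle, in the square over the edge
  that starts at \<open>k\<close> if \<open>b\<close> holds and over the edge that ends at \<open>k\<close> otherwise.
\<close>

definition corners :: "('v, 'e) fin_data \<Rightarrow> (nat \<times> nat \<times> bool) set" where
  "corners F = {(i, k, b). i < num_fins F \<and> k < fin_length F i}"

fun corner_dart :: "('v, 'e) fin_data \<Rightarrow> nat \<times> nat \<times> bool \<Rightarrow> 'e \<times> bool" where
  "corner_dart F (i, k, b) =
     (if b then fin_dart F i k else dart_rev (fin_dart F i (circle_prev (fin_length F i) k)))"

fun corner_flip :: "('v, 'e) fin_data \<Rightarrow> nat \<times> nat \<times> bool \<Rightarrow> nat \<times> nat \<times> bool" where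
  "corner_flip F (i, k, b) =
     (if b then (i, circle_next (fin_length F i) k, False) else (i, circle_prev (fin_length F i) k, True))"

fun corner_opp :: "nat \<times> nat \<times> bool \<Rightarrow> nat \<times> nat \<times> bool" where
  "corner_opp (i, k, b) = (i, k, \<not> b)"

definition square_map :: "('v, 'e) fin_data \<Rightarrow> nat \<Rightarrow> nat \<Rightarrow> real \<times> real \<Rightarrow> ('v, 'e) cylinder_point" where
  "square_map F i k x = fin_point F i (edge_map (fin_circle F i) k (fst x)) (snd x)"

text \<open>
  The characteristic map of the square, reparametrized such that the corner is the image of the
  origin and the first coordinate runs along the base graph.
\<close>

fun corner_map :: "('v, 'e) fin_data \<Rightarrow> nat \<times> nat \<times> bool \<Rightarrow> real \<times> real \<Rightarrow> ('v, 'e) cylinder_point" where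
  "corner_map F (i, k, b) x =
     (if b then square_map F i k x
      else square_map F i (circle_prev (fin_length F i) k) (1 - fst x, snd x))"

fun vertical_map :: "('v, 'e) fin_data \<Rightarrow> nat \<times> nat \<times> bool \<Rightarrow> real \<Rightarrow> ('v, 'e) cylinder_point" where
  "vertical_map F (i, k, b) t = fin_point F i (Vertex k) t"

lemma corner_opp_opp [simp]: "corner_opp (corner_opp q) = q"
  by (cases q) auto

lemma corner_opp_neq [simp]: "corner_opp q \<noteq> q"
  by (cases q) auto

lemma vertical_map_opp: "vertical_map F (corner_opp q) = vertical_map F q"
  by (cases q) auto

lemma corner_opp_in [simp]: "corner_opp q \<in> corners F \<longleftrightarrow> q \<in> corners F"
  by (cases q) (auto simp: corners_def)

lemma vertical_map_eq:
  assumes "0 < t" "vertical_map F q t = vertical_map F q' t'"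
  shows "q' = q \<or> q' = corner_opp q"
  using assms by (cases q; cases q') (auto simp: fin_point_def split: if_splits)

locale fin_graph =
  fixes F :: "('v, 'e) fin_data"
  assumes F: "graph_with_fins F"
begin

abbreviation G where "G \<equiv> base_graph F"

lemma finite_verts: "finite (verts G)" and finite_arcs: "finite (arcs G)"
  and tail_in: "e \<in> arcs G \<Longrightarrow> tail G e \<in> verts G" and head_in: "e \<in> arcs G \<Longrightarrow> head G e \<in> verts G"
proof -
  interpret fin_digraph G
    using F by (simp add: graph_with_fins_def)
  show "finite (verts G)" "finite (arcs G)" "e \<in> arcs G \<Longrightarrow> tail G e \<in> verts G" "e \<in> arcs G \<Longrightarrow> head G e \<in> verts G"
    by auto
qed

lemma dart_src_in: "d \<in> darts G \<Longrightarrow> dart_src G d \<in> verts G"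
  using tail_in head_in by (auto simp: darts_def dart_src_def)

lemma fin_map_combinatorial:
  assumes "i < num_fins F"
  shows "fin_length F i \<ge> 1" "combinatorial_map (fin_circle F i) G (fin_map F i)"
    "locally_injective (realization (fin_circle F i)) (fin_map F i)"
  using F assms by (auto simp: graph_with_fins_def closed_geodesic_def fin_circle_def)

lemma fin_dart:
  assumes "i < num_fins F" "k < fin_length F i"
  shows "fin_dart F i k \<in> darts G"
    "\<And>s. s \<in> unit_interval \<Longrightarrow> fin_map F i (edge_map (fin_circle F i) k s) = dart_map G (fin_dart F i k) s"
proof -
  have "edge_map (fin_circle F i) k \<in> edge_map (fin_circle F i) ` arcs (fin_circle F i)"
    using assms by (auto simp: fin_circle_def cycle_graph_def)
  then have "\<exists>\<psi>\<in>edge_map G ` arcs G. \<exists>g. self_isometry unit_interval g \<and>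
      (\<forall>s\<in>unit_interval. fin_map F i (edge_map (fin_circle F i) k s) = \<psi> (g s))"
    using fin_map_combinatorial(2)[OF assms(1)] unfolding combinatorial_map_def maps_cells_def by blast
  then obtain e g where e: "e \<in> arcs G" "self_isometry unit_interval g"
      "\<And>s. s \<in> unit_interval \<Longrightarrow> fin_map F i (edge_map (fin_circle F i) k s) = edge_map G e (g s)"
    by blast
  have "\<exists>d. d \<in> darts G \<and> (\<forall>s\<in>unit_interval. fin_map F i (edge_map (fin_circle F i) k s) = dart_map G d s)"
    using self_isometry_interval[OF e(2)]
  proof
    assume "\<forall>s\<in>unit_interval. g s = s"
    then show ?thesis
      using e by (intro exI[of _ "(e, True)"]) (auto simp: darts_def dart_map_def)
  next
    assume "\<forall>s\<in>unit_interval. g s = 1 - s"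
    then show ?thesis
      using e by (intro exI[of _ "(e, False)"]) (auto simp: darts_def dart_map_def)
  qed
  from someI_ex[OF this] show "fin_dart F i k \<in> darts G"
    "\<And>s. s \<in> unit_interval \<Longrightarrow> fin_map F i (edge_map (fin_circle F i) k s) = dart_map G (fin_dart F i k) s"
    unfolding fin_dart_def by auto
qed

lemma fin_map_vertex:
  assumes "i < num_fins F" "k < fin_length F i"
  shows "fin_map F i (Vertex k) = Vertex (dart_src G (fin_dart F i k))"
    "fin_map F i (Vertex (circle_next (fin_length F i) k)) = Vertex (dart_src G (dart_rev (fin_dart F i k)))"
  using fin_dart(2)[OF assms, of 0] fin_dart(2)[OF assms, of 1]
  by (auto simp: fin_circle_def edge_map_cycle dart_map_0 dart_map_1)

lemma fin_dart_next:
  assumes "i < num_fins F" "k < fin_length F i"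
  shows "dart_src G (fin_dart F i (circle_next (fin_length F i) k)) = dart_src G (dart_rev (fin_dart F i k))"
  using fin_map_vertex[OF assms] fin_map_vertex(1)[OF assms(1) circle_next_less[OF assms(2)]] by simp

text \<open>
  Otherwise points just before and just after the vertex of the circle have the same image,
  against local injectivity.
\<close>

lemma fin_dart_no_backtracking:
  assumes i: "i < num_fins F" and k: "k < fin_length F i"
  shows "fin_dart F i (circle_next (fin_length F i) k) \<noteq> dart_rev (fin_dart F i k)"
proof
  let ?C = "fin_circle F i" and ?k = "circle_next (fin_length F i) k"
  assume eq: "fin_dart F i ?k = dart_rev (fin_dart F i k)"
  have k': "?k < fin_length F i"
    using k by (rule circle_next_less)
  have arcs: "arcs ?C = {..<fin_length F i}" "verts ?C = {..<fin_length F i}"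
    by (auto simp: fin_circle_def cycle_graph_def)
  have "Vertex ?k \<in> topspace (realization ?C)"
    using k' by (auto simp: topspace_realization arcs)
  then obtain U where U: "openin (realization ?C) U" "Vertex ?k \<in> U" "inj_on (fin_map F i) U"
    using fin_map_combinatorial(3)[OF i] unfolding locally_injective_def by blast
  have near: "\<exists>\<epsilon>>0. \<forall>s\<in>unit_interval. dist s a < \<epsilon> \<longrightarrow> edge_map ?C j s \<in> U"
    if "j < fin_length F i" "a \<in> unit_interval" "edge_map ?C j a = Vertex ?k" for j a
  proof -
    have "openin (top_of_set unit_interval) {s \<in> unit_interval. edge_map ?C j s \<in> U}"
      using U(1) that(1) unfolding openin_realization arcs by blast
    then have "\<forall>x\<in>{s \<in> unit_interval. edge_map ?C j s \<in> U}.
        \<exists>e>0. \<forall>x'\<in>unit_interval. dist x' x < e \<longrightarrow> x' \<in> {s \<in> unit_interval. edge_map ?C j s \<in> U}"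
      unfolding openin_euclidean_subtopology_iff by blast
    moreover have "a \<in> {s \<in> unit_interval. edge_map ?C j s \<in> U}"
      using that U(2) by simp
    ultimately show ?thesis
      by blast
  qed
  obtain \<epsilon>1 where e1: "\<epsilon>1 > 0" "\<And>s. s \<in> unit_interval \<Longrightarrow> dist s 1 < \<epsilon>1 \<Longrightarrow> edge_map ?C k s \<in> U"
    using near[OF k, of 1] by (auto simp: fin_circle_def edge_map_cycle)
  obtain \<epsilon>2 where e2: "\<epsilon>2 > 0" "\<And>s. s \<in> unit_interval \<Longrightarrow> dist s 0 < \<epsilon>2 \<Longrightarrow> edge_map ?C ?k s \<in> U"
    using near[OF k', of 0] by (auto simp: fin_circle_def edge_map_cycle)
  define \<delta> where "\<delta> = min (1/3) (min (\<epsilon>1/2) (\<epsilon>2/2))"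
  have \<delta>: "0 < \<delta>" "\<delta> < 1/2" "\<delta> < \<epsilon>1" "\<delta> < \<epsilon>2"
    using e1(1) e2(1) by (auto simp: \<delta>_def min_def)
  have "edge_map ?C k (1 - \<delta>) \<in> U" "edge_map ?C ?k \<delta> \<in> U"
    using \<delta> by (auto intro!: e1(2) e2(2) simp: dist_real_def)
  moreover have "fin_map F i (edge_map ?C k (1 - \<delta>)) = fin_map F i (edge_map ?C ?k \<delta>)"
    using fin_dart(2)[OF i k, of "1 - \<delta>"] fin_dart(2)[OF i k', of \<delta>] \<delta> eq by (simp add: dart_map_rev)
  ultimately have "edge_map ?C k (1 - \<delta>) = edge_map ?C ?k \<delta>"
    using U(3) by (auto simp: inj_on_def)
  then show False
    using \<delta> by (auto simp: fin_circle_def edge_map_cycle)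
qed

lemma corner_dart_in: "q \<in> corners F \<Longrightarrow> corner_dart F q \<in> darts G"
  by (cases q) (auto simp: corners_def fin_dart circle_prev_less)

lemma corner_flip_in: "q \<in> corners F \<Longrightarrow> corner_flip F q \<in> corners F"
  by (cases q) (auto simp: corners_def circle_prev_less circle_next_less)

lemma corner_flip_flip: "q \<in> corners F \<Longrightarrow> corner_flip F (corner_flip F q) = q"
  by (cases q) (auto simp: corners_def circle_prev_next circle_next_prev)

lemma corner_dart_flip: "q \<in> corners F \<Longrightarrow> corner_dart F (corner_flip F q) = dart_rev (corner_dart F q)"
  by (cases q) (auto simp: corners_def circle_prev_next circle_next_prev)

lemma corner_dart_opp_neq: "q \<in> corners F \<Longrightarrow> corner_dart F (corner_opp q) \<noteq> corner_dart F q"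
proof -
  assume q: "q \<in> corners F"
  have "fin_dart F i k \<noteq> dart_rev (fin_dart F i (circle_prev (fin_length F i) k))"
    if "i < num_fins F" "k < fin_length F i" for i k
    using fin_dart_no_backtracking[OF that(1) circle_prev_less[OF that(2)]] that by (simp add: circle_next_prev)
  then show ?thesis
    using q by (cases q) (auto simp: corners_def dest: sym)
qed

lemma corner_src:
  assumes "i < num_fins F" "k < fin_length F i"
  shows "dart_src G (corner_dart F (i, k, b)) = dart_src G (fin_dart F i k)"
  using fin_dart_next[OF assms(1) circle_prev_less[OF assms(2)]] assms by (simp add: circle_next_prev)

lemma corner_src_opp: "q \<in> corners F \<Longrightarrow> dart_src G (corner_dart F (corner_opp q)) = dart_src G (corner_dart F q)"
  by (cases q) (simp only: corner_opp.simps corner_src corners_def mem_Collect_eq case_prod_conv)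

lemma square_map_bottom:
  assumes "i < num_fins F" "k < fin_length F i" "s \<in> unit_interval"
  shows "square_map F i k (s, 0) = Base (dart_map G (fin_dart F i k) s)"
  using fin_dart(2)[OF assms] by (simp add: square_map_def fin_point_def)

lemma corner_map_bottom:
  assumes "q \<in> corners F" "s \<in> unit_interval"
  shows "corner_map F q (s, 0) = Base (dart_map G (corner_dart F q) s)"
  using assms square_map_bottom by (cases q) (auto simp: corners_def circle_prev_less dart_map_rev)

lemma corner_map_side:
  assumes "q \<in> corners F"
  shows "corner_map F q (0, t) = vertical_map F q t"
  using assms by (cases q) (auto simp: corners_def square_map_def fin_circle_def edge_map_cycle circle_next_prev)

lemma corner_map_flip:
  assumes "q \<in> corners F"
  shows "corner_map F (corner_flip F q) (s, t) = corner_map F q (1 - s, t)"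
  using assms by (cases q) (auto simp: corners_def circle_prev_next)

lemma vertical_map_0:
  assumes "q \<in> corners F"
  shows "vertical_map F q 0 = Base (Vertex (dart_src G (corner_dart F q)))"
  using corner_map_bottom[OF assms, of 0] corner_map_side[OF assms, of 0] by (simp add: dart_map_0)

lemma finite_corners: "finite (corners F)"
proof -
  have "corners F = (SIGMA i:{..<num_fins F}. {..<fin_length F i} \<times> UNIV)"
    by (auto simp: corners_def)
  then show ?thesis
    by simp
qed

end

section \<open>The local structure of a graph with fins\<close>

datatype ('v, 'e) item = VertexItem 'v | DartItem "'e \<times> bool" | CornerItem "nat \<times> nat \<times> bool"

definition fin_structure :: "('v, 'e) fin_data \<Rightarrow> ('v, 'e) item local_structure" where
  "fin_structure F =
     \<lparr> items = VertexItem ` verts (base_graph F) \<union> DartItem ` darts (base_graph F) \<union> CornerItem ` corners F,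
       att = (\<lambda>x. case x of VertexItem v \<Rightarrow> x | DartItem d \<Rightarrow> VertexItem (dart_src (base_graph F) d)
         | CornerItem q \<Rightarrow> DartItem (corner_dart F q)),
       opp = (\<lambda>x. case x of CornerItem q \<Rightarrow> CornerItem (corner_opp q) | _ \<Rightarrow> x),
       flip = (\<lambda>x. case x of VertexItem v \<Rightarrow> x | DartItem d \<Rightarrow> DartItem (dart_rev d)
         | CornerItem q \<Rightarrow> CornerItem (corner_flip F q)),
       level = (\<lambda>x. case x of VertexItem v \<Rightarrow> 0 | DartItem d \<Rightarrow> 1 | CornerItem q \<Rightarrow> 2),
       positive = (\<lambda>x. case x of DartItem d \<Rightarrow> snd d | _ \<Rightarrow> True) \<rparr>"

lemma (in fin_graph) wf_fin_structure: "wf_structure (fin_structure F)"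
  unfolding wf_structure_def
proof (intro conjI)
  show "finite (items (fin_structure F))"
    using finite_verts finite_arcs finite_corners by (simp add: fin_structure_def darts_def)
  show "\<forall>x\<in>items (fin_structure F). att (fin_structure F) x \<in> items (fin_structure F) \<and> level (fin_structure F) x \<le> 2 \<and>
        level (fin_structure F) (att (fin_structure F) x) = level (fin_structure F) x - 1 \<and>
        (level (fin_structure F) x = 0 \<longrightarrow> att (fin_structure F) x = x) \<and>
        opp (fin_structure F) x \<in> items (fin_structure F) \<and> level (fin_structure F) (opp (fin_structure F) x) = level (fin_structure F) x \<and>
        att (fin_structure F) (att (fin_structure F) (opp (fin_structure F) x)) = att (fin_structure F) (att (fin_structure F) x) \<and>
        (level (fin_structure F) x \<noteq> 0 \<longrightarrow> flip (fin_structure F) x \<in> items (fin_structure F) \<and>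
          level (fin_structure F) (flip (fin_structure F) x) = level (fin_structure F) x \<and> flip (fin_structure F) (flip (fin_structure F) x) = x) \<and>
        (level (fin_structure F) x = 1 \<longrightarrow> (positive (fin_structure F) (flip (fin_structure F) x) \<longleftrightarrow> \<not> positive (fin_structure F) x)) \<and>
        (level (fin_structure F) x = 2 \<longrightarrow> att (fin_structure F) (flip (fin_structure F) x) = flip (fin_structure F) (att (fin_structure F) x))"
    (is "\<forall>x\<in>_. ?P x")
  proof
    fix x assume x: "x \<in> items (fin_structure F)"
    show "?P x"
    proof (cases x)
      case (VertexItem v)
      then show ?thesis
        using x by (simp add: fin_structure_def)
    next
      case (DartItem d)
      then have "d \<in> darts G"
        using x by (auto simp: fin_structure_def)
      then show ?thesis
        using DartItem dart_src_in by (simp add: fin_structure_def)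
    next
      case (CornerItem q)
      then have q: "q \<in> corners F"
        using x by (auto simp: fin_structure_def)
      show ?thesis
        using CornerItem corner_dart_in[OF q] corner_flip_in[OF q] corner_flip_flip[OF q] corner_dart_flip[OF q]
          corner_src_opp[OF q] q by (simp add: fin_structure_def)
    qed
  qed
qed

section \<open>Mapping cylinders as quotients of squares\<close>

datatype ('v, 'e) cell = VertexCell 'v | EdgeCell 'e | SquareCell nat nat

definition cells :: "('v, 'e) fin_data \<Rightarrow> ('v, 'e) cell set" where
  "cells F = VertexCell ` verts (base_graph F) \<union> EdgeCell ` arcs (base_graph F) \<union>
     {SquareCell i k | i k. i < num_fins F \<and> k < fin_length F i}"

fun cell_map :: "('v, 'e) fin_data \<Rightarrow> ('v, 'e) cell \<Rightarrow> real \<times> real \<Rightarrow> ('v, 'e) cylinder_point" where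
  "cell_map F (VertexCell v) x = Base (Vertex v)"
| "cell_map F (EdgeCell e) x = Base (edge_map (base_graph F) e (fst x))"
| "cell_map F (SquareCell i k) x = square_map F i k x"

text \<open>
  Vertices and edges are parametrized by the square as well, by maps that do not depend on all
  coordinates. So a single family of maps suffices, and openness is tested on squares only.
\<close>

definition cell_topology :: "'c set \<Rightarrow> ('c \<Rightarrow> real \<times> real \<Rightarrow> 'p) \<Rightarrow> 'p topology" where
  "cell_topology C \<kappa> =
     quotient_topology (prod_topology (discrete_topology C) (top_of_set unit_square)) (\<lambda>(c, x). \<kappa> c x)"

lemma topspace_cell_topology: "topspace (cell_topology C \<kappa>) = (\<Union>c\<in>C. \<kappa> c ` unit_square)"
  by (auto simp: cell_topology_def image_iff)

lemma openin_cell_topology: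
  "openin (cell_topology C \<kappa>) U \<longleftrightarrow> U \<subseteq> (\<Union>c\<in>C. \<kappa> c ` unit_square) \<and>
     (\<forall>c\<in>C. openin (top_of_set unit_square) {x \<in> unit_square. \<kappa> c x \<in> U})"
proof -
  have *: "(\<lambda>(c, x). \<kappa> c x) ` (C \<times> unit_square) = (\<Union>c\<in>C. \<kappa> c ` unit_square)"
    by (auto simp: image_iff)
  have "{y. (a, y) \<in> {x \<in> C \<times> unit_square. (case x of (c, x) \<Rightarrow> \<kappa> c x) \<in> U}} = {x \<in> unit_square. \<kappa> a x \<in> U}"
    if "a \<in> C" for a
    using that by auto
  then show ?thesis
    unfolding cell_topology_def openin_quotient_topology openin_prod_discrete topspace_prod_topology
      topspace_discrete_topology topspace_euclidean_subtopology *
    by auto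
qed

lemma continuous_map_cell: "c \<in> C \<Longrightarrow> continuous_map (top_of_set unit_square) (cell_topology C \<kappa>) (\<kappa> c)"
  unfolding continuous_map_def openin_cell_topology topspace_cell_topology by auto

lemma continuous_map_from_cell_topology:
  assumes "\<And>c. c \<in> C \<Longrightarrow> continuous_map (top_of_set unit_square) Y (\<lambda>x. f (\<kappa> c x))"
  shows "continuous_map (cell_topology C \<kappa>) Y f"
  unfolding continuous_map_def
proof (intro conjI allI impI)
  show "f \<in> topspace (cell_topology C \<kappa>) \<rightarrow> topspace Y"
    using assms by (auto simp: topspace_cell_topology continuous_map_def)
  fix U assume U: "openin Y U"
  have "{x \<in> unit_square. \<kappa> c x \<in> {x \<in> topspace (cell_topology C \<kappa>). f x \<in> U}} = {x \<in> unit_square. f (\<kappa> c x) \<in> U}"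
    if "c \<in> C" for c
    using that by (auto simp: topspace_cell_topology)
  moreover have "openin (top_of_set unit_square) {x \<in> unit_square. f (\<kappa> c x) \<in> U}" if "c \<in> C" for c
    using assms[OF that] U by (auto simp: continuous_map_def)
  ultimately show "openin (cell_topology C \<kappa>) {x \<in> topspace (cell_topology C \<kappa>). f x \<in> U}"
    unfolding openin_cell_topology by (auto simp: topspace_cell_topology)
qed

text \<open>
  Both topologies are quotient topologies, so openness in both means openness of all preimages
  in cells. The preimages in vertical edges are slices of those in squares.
\<close>

lemma (in fin_graph) mapping_cylinder_cells: "mapping_cylinder F = cell_topology (cells F) (cell_map F)"
proof -
  let ?I = "top_of_set unit_interval"
  let ?S = "sum_topology (\<lambda>i. prod_topology (realization (fin_circle F i)) ?I) {..<num_fins F}"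
  let ?f = "case_sum Base (\<lambda>(i, x, t). fin_point F i x t)"
  let ?X = "mapping_cylinder F"
  have arcs: "arcs (fin_circle F i) = {..<fin_length F i}" "verts (fin_circle F i) = {..<fin_length F i}" for i
    by (auto simp: fin_circle_def cycle_graph_def)
  have pts: "topspace (realization (fin_circle F i)) = (\<Union>k\<in>{..<fin_length F i}. edge_map (fin_circle F i) k ` unit_interval)" for i
  proof -
    have "Vertex k \<in> edge_map (fin_circle F i) k ` unit_interval" for k
      by (rule image_eqI[of _ _ 0]) (auto simp: fin_circle_def edge_map_cycle)
    then show ?thesis
      unfolding topspace_realization arcs by blast
  qed
  have base: "{x \<in> topspace (realization G). Base x \<in> U} = {x. Inl x \<in> {x \<in> topspace (plus_topology (realization G) ?S). ?f x \<in> U}}" for U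
    by auto
  have top: "topspace ?X = (\<Union>c\<in>cells F. cell_map F c ` unit_square)"
  proof -
    have "topspace ?X = Base ` topspace (realization G) \<union>
        {fin_point F i x t | i x t. i < num_fins F \<and> x \<in> topspace (realization (fin_circle F i)) \<and> t \<in> unit_interval}"
      unfolding mapping_cylinder_def by (force simp: Plus_def)
    also have "Base ` topspace (realization G) = (\<Union>v\<in>verts G. cell_map F (VertexCell v) ` unit_square) \<union>
        (\<Union>e\<in>arcs G. cell_map F (EdgeCell e) ` unit_square)"
    proof -
      have e: "cell_map F (EdgeCell e) ` unit_square = Base ` edge_map G e ` unit_interval" for e
        by (force simp: image_iff)
      have v: "cell_map F (VertexCell v) ` unit_square = {Base (Vertex v)}" for v
        by (simp add: image_constant_conv)
      show ?thesis
        unfolding topspace_realization e v by auto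
    qed
    also have "{fin_point F i x t | i x t. i < num_fins F \<and> x \<in> topspace (realization (fin_circle F i)) \<and> t \<in> unit_interval}
        = (\<Union>c\<in>{SquareCell i k | i k. i < num_fins F \<and> k < fin_length F i}. cell_map F c ` unit_square)"
      unfolding pts by (force simp: square_map_def)
    finally show ?thesis
      unfolding cells_def by auto
  qed
  have sq: "openin (prod_topology (realization (fin_circle F i)) ?I) W \<longleftrightarrow>
      (\<forall>k<fin_length F i. openin (top_of_set unit_square) {x \<in> unit_square. square_map F i k x \<in> U})"
    if W: "W = {(x, t). x \<in> topspace (realization (fin_circle F i)) \<and> t \<in> unit_interval \<and> fin_point F i x t \<in> U}" for W i U
  proof -
    have 1: "{x \<in> unit_square. (edge_map (fin_circle F i) k (fst x), snd x) \<in> W} = {x \<in> unit_square. square_map F i k x \<in> U}"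
      if "k < fin_length F i" for k
      using edge_map_in_realization[of k "fin_circle F i"] that unfolding W square_map_def by (auto simp: arcs)
    have 2: "openin ?I {t. (Vertex k, t) \<in> W}"
      if o: "openin (top_of_set unit_square) {x \<in> unit_square. square_map F i k x \<in> U}" and k: "k < fin_length F i" for k
    proof -
      have "continuous_map ?I (top_of_set unit_square) (\<lambda>t. (0, t))"
        by (auto simp: continuous_map_in_subtopology intro!: continuous_intros)
      from openin_continuous_map_preimage[OF this o]
      have "openin ?I {t \<in> unit_interval. square_map F i k (0, t) \<in> U}"
        by (rule back_subst[of "openin ?I"]) auto
      moreover have "{t. (Vertex k, t) \<in> W} = {t \<in> unit_interval. square_map F i k (0, t) \<in> U}"
      proof -
        have ek: "edge_map (fin_circle F i) k 0 = Vertex k"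
          by (simp add: fin_circle_def edge_map_cycle)
        have "Vertex k \<in> topspace (realization (fin_circle F i))"
          using edge_map_in_realization[of k "fin_circle F i" 0] k by (simp add: arcs ek)
        then show ?thesis
          unfolding W by (simp add: square_map_def ek)
      qed
      ultimately show ?thesis
        by simp
    qed
    have 3: "W \<subseteq> topspace (realization (fin_circle F i)) \<times> unit_interval"
      unfolding W by auto
    show ?thesis
      unfolding openin_prod_realization arcs using 1 2 3 by auto
  qed
  have "openin ?X U \<longleftrightarrow> openin (cell_topology (cells F) (cell_map F)) U" for U
  proof (cases "U \<subseteq> topspace ?X")
    case False
    then show ?thesis
      using openin_subset[of ?X U] unfolding openin_cell_topology top by blast
  next
    case U: True
    let ?W = "{x \<in> topspace (plus_topology (realization G) ?S). ?f x \<in> U}"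
    have "openin ?X U \<longleftrightarrow> openin (plus_topology (realization G) ?S) ?W"
      using U unfolding mapping_cylinder_def openin_quotient_topology topspace_quotient_topology by blast
    also have "\<dots> \<longleftrightarrow> openin (realization G) {x. Inl x \<in> ?W} \<and> openin ?S {y. Inr y \<in> ?W}"
      by (rule openin_plus_topology)
    also have "openin (realization G) {x. Inl x \<in> ?W} \<longleftrightarrow>
        (\<forall>c\<in>VertexCell ` verts G \<union> EdgeCell ` arcs G. openin (top_of_set unit_square) {x \<in> unit_square. cell_map F c x \<in> U})"
    proof -
      have e: "openin ?I {t \<in> unit_interval. edge_map G e t \<in> {x. Inl x \<in> ?W}} \<longleftrightarrow>
          openin (top_of_set unit_square) {x \<in> unit_square. cell_map F (EdgeCell e) x \<in> U}" if "e \<in> arcs G" for e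
      proof -
        have 1: "{t \<in> unit_interval. edge_map G e t \<in> {x. Inl x \<in> ?W}} = {t \<in> unit_interval. Base (edge_map G e t) \<in> U}"
          using edge_map_in_realization[OF that] by auto
        have 2: "{x \<in> unit_square. cell_map F (EdgeCell e) x \<in> U} = {t \<in> unit_interval. Base (edge_map G e t) \<in> U} \<times> unit_interval"
          by auto
        have 3: "top_of_set unit_square = prod_topology ?I ?I"
          by (rule prod_topology_subtopology_eu[symmetric])
        have 4: "openin ?I unit_interval" "unit_interval \<noteq> {}"
          by auto
        show ?thesis
          unfolding 1 2 3 openin_prod_Times_iff using 4 openin_empty[of ?I] by metis
      qed
      have v: "openin (top_of_set unit_square) {x \<in> unit_square. cell_map F (VertexCell v) x \<in> U}" for v
      proof (cases "Base (Vertex v) \<in> U")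
        case True
        then have "{x \<in> unit_square. cell_map F (VertexCell v) x \<in> U} = unit_square"
          by simp
        then show ?thesis
          by simp
      qed simp
      have "{x. Inl x \<in> ?W} \<subseteq> topspace (realization G)"
        by auto
      then have "openin (realization G) {x. Inl x \<in> ?W} \<longleftrightarrow>
          (\<forall>e\<in>arcs G. openin ?I {t \<in> unit_interval. edge_map G e t \<in> {x. Inl x \<in> ?W}})"
        unfolding openin_realization[of G] by (simp only: simp_thms)
      also have "\<dots> \<longleftrightarrow> (\<forall>e\<in>arcs G. openin (top_of_set unit_square) {x \<in> unit_square. cell_map F (EdgeCell e) x \<in> U})"
        using e by (intro ball_cong refl)
      also have "\<dots> \<longleftrightarrow> (\<forall>c\<in>VertexCell ` verts G \<union> EdgeCell ` arcs G. openin (top_of_set unit_square) {x \<in> unit_square. cell_map F c x \<in> U})"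
        using v by blast
      finally show ?thesis .
    qed
    also have "openin ?S {y. Inr y \<in> ?W} \<longleftrightarrow> (\<forall>i<num_fins F. \<forall>k<fin_length F i. openin (top_of_set unit_square) {x \<in> unit_square. square_map F i k x \<in> U})"
    proof -
      have "{x. (i, x) \<in> {y. Inr y \<in> ?W}} = {(x, t). x \<in> topspace (realization (fin_circle F i)) \<and> t \<in> unit_interval \<and> fin_point F i x t \<in> U}"
        if "i < num_fins F" for i
        using that by auto
      then have "openin (prod_topology (realization (fin_circle F i)) ?I) {x. (i, x) \<in> {y. Inr y \<in> ?W}} \<longleftrightarrow>
          (\<forall>k<fin_length F i. openin (top_of_set unit_square) {x \<in> unit_square. square_map F i k x \<in> U})"
        if "i < num_fins F" for i
        using that by (intro sq)
      then have "openin ?S {y. Inr y \<in> ?W} \<longleftrightarrow> {y. Inr y \<in> ?W} \<subseteq> topspace ?S \<and>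
          (\<forall>i<num_fins F. \<forall>k<fin_length F i. openin (top_of_set unit_square) {x \<in> unit_square. square_map F i k x \<in> U})"
        unfolding openin_sum_topology topspace_sum_topology by (simp only: lessThan_iff Ball_def) blast
      moreover have "{y. Inr y \<in> ?W} \<subseteq> topspace ?S"
        by (simp only: topspace_plus_topology) auto
      ultimately show ?thesis
        by blast
    qed
    finally have "openin ?X U \<longleftrightarrow>
        (\<forall>c\<in>VertexCell ` verts G \<union> EdgeCell ` arcs G. openin (top_of_set unit_square) {x \<in> unit_square. cell_map F c x \<in> U}) \<and>
        (\<forall>i<num_fins F. \<forall>k<fin_length F i. openin (top_of_set unit_square) {x \<in> unit_square. cell_map F (SquareCell i k) x \<in> U})"
      by (simp only: cell_map.simps)
    also have "\<dots> \<longleftrightarrow> (\<forall>c\<in>cells F. openin (top_of_set unit_square) {x \<in> unit_square. cell_map F c x \<in> U})"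
      unfolding cells_def by blast
    finally show ?thesis
      using U unfolding openin_cell_topology top by blast
  qed
  then show ?thesis
    by (simp add: topology_eq)
qed

section \<open>Connectedness and coverings of quotients of squares\<close>

lemma connected_cell_image_split:
  assumes "c \<in> C" "openin (cell_topology C \<kappa>) W" "closedin (cell_topology C \<kappa>) W"
  shows "\<kappa> c ` unit_square \<subseteq> W \<or> \<kappa> c ` unit_square \<inter> W = {}"
proof -
  let ?P = "{x \<in> unit_square. \<kappa> c x \<in> W}"
  have "connected_space (top_of_set unit_square)"
    by (simp add: connected_space_subtopology connected_Times)
  moreover have "openin (top_of_set unit_square) ?P" "closedin (top_of_set unit_square) ?P"
    using openin_continuous_map_preimage[OF continuous_map_cell[OF assms(1)] assms(2)]
      closedin_continuous_map_preimage[OF continuous_map_cell[OF assms(1)] assms(3)] by auto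
  ultimately have "?P = {} \<or> ?P = topspace (top_of_set unit_square)"
    unfolding connected_space_clopen_in by blast
  then have "?P = {} \<or> ?P = unit_square"
    by simp
  then show ?thesis
    by blast
qed

lemma connected_space_clopenD:
  "connected_space X \<Longrightarrow> openin X W \<Longrightarrow> closedin X W \<Longrightarrow> W \<noteq> {} \<Longrightarrow> W = topspace X"
  by (auto simp: connected_space_clopen_in)

lemma disjoint_union_Diff: "T - A = B" "A \<subseteq> T" if "A \<inter> B = {}" "A \<union> B = T"
  using that by blast+

text \<open>
  A clopen set contains every cell that it meets. Conversely, the union of a set of cells that
  contains all cells meeting one of its members is clopen.
\<close>

lemma connected_cell_topology:
  "connected_space (cell_topology C \<kappa>) \<longleftrightarrow>
     (\<forall>S\<subseteq>C. S \<noteq> {} \<longrightarrow>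
        (\<forall>c\<in>S. \<forall>c'\<in>C. \<kappa> c ` unit_square \<inter> \<kappa> c' ` unit_square \<noteq> {} \<longrightarrow> c' \<in> S) \<longrightarrow> S = C)"
proof (intro iffI allI impI)
  fix S
  assume conn: "connected_space (cell_topology C \<kappa>)" and S: "S \<subseteq> C" "S \<noteq> {}"
    and cl: "\<forall>c\<in>S. \<forall>c'\<in>C. \<kappa> c ` unit_square \<inter> \<kappa> c' ` unit_square \<noteq> {} \<longrightarrow> c' \<in> S"
  have op: "openin (cell_topology C \<kappa>) (\<Union>c\<in>S. \<kappa> c ` unit_square)"
    if S: "S \<subseteq> C" and cl: "\<And>c c'. c \<in> S \<Longrightarrow> c' \<in> C \<Longrightarrow> \<kappa> c ` unit_square \<inter> \<kappa> c' ` unit_square \<noteq> {} \<Longrightarrow> c' \<in> S" for S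
  proof -
    have "openin (top_of_set unit_square) {x \<in> unit_square. \<kappa> c x \<in> (\<Union>c\<in>S. \<kappa> c ` unit_square)}" if c: "c \<in> C" for c
    proof (cases "c \<in> S")
      case True
      then have "{x \<in> unit_square. \<kappa> c x \<in> (\<Union>c\<in>S. \<kappa> c ` unit_square)} = unit_square"
        by auto
      then show ?thesis
        by simp
    next
      case False
      have "{x \<in> unit_square. \<kappa> c x \<in> (\<Union>c\<in>S. \<kappa> c ` unit_square)} = {}"
      proof (rule ccontr)
        assume "{x \<in> unit_square. \<kappa> c x \<in> (\<Union>c\<in>S. \<kappa> c ` unit_square)} \<noteq> {}"
        then obtain x c' where x: "x \<in> unit_square" "c' \<in> S" "\<kappa> c x \<in> \<kappa> c' ` unit_square"
          by blast
        then have "\<kappa> c' ` unit_square \<inter> \<kappa> c ` unit_square \<noteq> {}"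
          by blast
        then show False
          using cl[OF x(2) c] False by blast
      qed
      then show ?thesis
        by (metis openin_empty)
    qed
    then show ?thesis
      unfolding openin_cell_topology using S by blast
  qed
  let ?W = "\<Union>c\<in>S. \<kappa> c ` unit_square" and ?W' = "\<Union>c\<in>C - S. \<kappa> c ` unit_square"
  have disj: "?W \<inter> ?W' = {}"
    using cl by blast
  have un: "?W \<union> ?W' = topspace (cell_topology C \<kappa>)"
    unfolding topspace_cell_topology using S by blast
  have "openin (cell_topology C \<kappa>) ?W" "openin (cell_topology C \<kappa>) ?W'"
    using S cl by (intro op; blast)+
  then have "openin (cell_topology C \<kappa>) ?W" "closedin (cell_topology C \<kappa>) ?W"
    unfolding closedin_def using disjoint_union_Diff[OF disj un] by simp_all
  moreover have pt: "\<kappa> c (0, 0) \<in> \<kappa> c ` unit_square" for c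
    by (rule imageI) simp
  obtain c0 where "c0 \<in> S"
    using S(2) by blast
  then have "\<kappa> c0 (0, 0) \<in> ?W"
    using pt by (rule UN_I)
  ultimately have W: "?W = topspace (cell_topology C \<kappa>)"
    using connected_space_clopenD[OF conn] by blast
  have "c \<in> S" if c: "c \<in> C" for c
  proof (rule ccontr)
    assume "c \<notin> S"
    then have "\<kappa> c (0, 0) \<in> ?W'"
      using c pt by (intro UN_I[of c]) auto
    then show False
      using W disj un by (metis IntI UnCI emptyE)
  qed
  then show "S = C"
    using S by blast
next
  assume h: "\<forall>S\<subseteq>C. S \<noteq> {} \<longrightarrow>
        (\<forall>c\<in>S. \<forall>c'\<in>C. \<kappa> c ` unit_square \<inter> \<kappa> c' ` unit_square \<noteq> {} \<longrightarrow> c' \<in> S) \<longrightarrow> S = C"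
  show "connected_space (cell_topology C \<kappa>)"
    unfolding connected_space_clopen_in
  proof (intro allI impI)
    fix W
    assume W: "openin (cell_topology C \<kappa>) W \<and> closedin (cell_topology C \<kappa>) W"
    define S where "S = {c \<in> C. \<kappa> c ` unit_square \<subseteq> W}"
    have split: "\<kappa> c ` unit_square \<subseteq> W \<or> \<kappa> c ` unit_square \<inter> W = {}" if "c \<in> C" for c
      using connected_cell_image_split[OF that] W by blast
    have W_sub: "W \<subseteq> (\<Union>c\<in>C. \<kappa> c ` unit_square)"
      using W openin_subset topspace_cell_topology by metis
    show "W = {} \<or> W = topspace (cell_topology C \<kappa>)"
    proof (cases "S = {}")
      case True
      then have "\<kappa> c ` unit_square \<inter> W = {}" if "c \<in> C" for c
        using split[OF that] that unfolding S_def by blast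
      then have "W = {}"
        using W_sub by blast
      then show ?thesis ..
    next
      case False
      have "\<forall>c\<in>S. \<forall>c'\<in>C. \<kappa> c ` unit_square \<inter> \<kappa> c' ` unit_square \<noteq> {} \<longrightarrow> c' \<in> S"
      proof (intro ballI impI)
        fix c c' assume c: "c \<in> S" "c' \<in> C" "\<kappa> c ` unit_square \<inter> \<kappa> c' ` unit_square \<noteq> {}"
        then have "\<kappa> c ` unit_square \<subseteq> W"
          by (simp add: S_def)
        then show "c' \<in> S"
          using split[OF c(2)] c unfolding S_def by blast
      qed
      moreover have "S \<subseteq> C"
        by (auto simp: S_def)
      ultimately have "S = C"
        using h False by blast
      then have "W = (\<Union>c\<in>C. \<kappa> c ` unit_square)"
        using W_sub unfolding S_def by blast
      then show ?thesis
        by (simp add: topspace_cell_topology)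
    qed
  qed
qed

text \<open>
  A copy \<open>(c, z)\<close> of the cell \<open>c\<close> is mapped to \<open>X \<times> 'z\<close> such that the second coordinate
  \<open>lab c z x\<close> names a point of the fibre over \<open>\<kappa> c x\<close>; the names in that fibre are
  \<open>Zf (pb (\<kappa> c x))\<close>. Over \<open>T\<close> the sheets are the graphs of the functions \<open>\<lambda>y. \<theta> y w\<close>, and the last
  condition in \<open>triv\<close> says that they are open.
\<close>

lemma covering_map_cell_topology:
  fixes C :: "'c set" and \<kappa> :: "'c \<Rightarrow> real \<times> real \<Rightarrow> 'p" and lab :: "'c \<Rightarrow> 'z \<Rightarrow> real \<times> real \<Rightarrow> 'z"
    and Zf :: "'v \<Rightarrow> 'z set" and B :: "'c \<Rightarrow> 'v" and pb :: "'p \<Rightarrow> 'v"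
  defines "X \<equiv> cell_topology C \<kappa>"
    and "E \<equiv> cell_topology {(c, z). c \<in> C \<and> z \<in> Zf (B c)} (\<lambda>(c, z) x. (\<kappa> c x, lab c z x))"
  assumes bij: "\<And>c x. c \<in> C \<Longrightarrow> x \<in> unit_square \<Longrightarrow> bij_betw (\<lambda>z. lab c z x) (Zf (B c)) (Zf (pb (\<kappa> c x)))"
    and ne: "\<And>c. c \<in> C \<Longrightarrow> Zf (B c) \<noteq> {}"
    and triv: "\<And>y. y \<in> topspace X \<Longrightarrow> \<exists>T (\<Phi> :: 'z set) \<theta>. y \<in> T \<and> openin X T \<and>
       (\<forall>y\<in>T. bij_betw (\<theta> y) \<Phi> (Zf (pb y))) \<and>
       (\<forall>w\<in>\<Phi>. \<forall>c\<in>C. \<forall>z\<in>Zf (B c).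
          openin (top_of_set unit_square) {x \<in> unit_square. \<kappa> c x \<in> T \<and> lab c z x = \<theta> (\<kappa> c x) w})"
  shows "covering_map E fst X" "topspace E = {(y, m). y \<in> topspace X \<and> m \<in> Zf (pb y)}"
proof -
  have topX: "topspace X = (\<Union>c\<in>C. \<kappa> c ` unit_square)"
    by (simp add: X_def topspace_cell_topology)
  have in_E: "(\<kappa> c x, lab c z x) \<in> topspace E" if "c \<in> C" "z \<in> Zf (B c)" "x \<in> unit_square" for c z x
    unfolding E_def topspace_cell_topology using that by (intro UN_I[of "(c, z)"]) auto
  show topE: "topspace E = {(y, m). y \<in> topspace X \<and> m \<in> Zf (pb y)}"
  proof (intro set_eqI iffI)
    fix p assume "p \<in> topspace E"
    then obtain c z x where c: "c \<in> C" "z \<in> Zf (B c)" "x \<in> unit_square" "p = (\<kappa> c x, lab c z x)"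
      unfolding E_def topspace_cell_topology by auto
    have "lab c z x \<in> Zf (pb (\<kappa> c x))"
      using bij_betw_apply[OF bij[OF c(1,3)] c(2)] .
    moreover have "\<kappa> c x \<in> topspace X"
      unfolding topX using c by blast
    ultimately show "p \<in> {(y, m). y \<in> topspace X \<and> m \<in> Zf (pb y)}"
      using c by simp
  next
    fix p assume "p \<in> {(y, m). y \<in> topspace X \<and> m \<in> Zf (pb y)}"
    then obtain y m where y: "p = (y, m)" "y \<in> topspace X" "m \<in> Zf (pb y)"
      by blast
    then obtain c x where c: "c \<in> C" "x \<in> unit_square" "y = \<kappa> c x"
      unfolding topX by blast
    have "m \<in> (\<lambda>z. lab c z x) ` Zf (B c)"
      using bij_betw_imp_surj_on[OF bij[OF c(1,2)]] y c by simp
    then show "p \<in> topspace E"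
      using in_E c y by blast
  qed
  have preim: "{x \<in> unit_square. \<kappa> c x \<in> fst ` W} = (\<Union>z\<in>Zf (B c). {x \<in> unit_square. (\<kappa> c x, lab c z x) \<in> W})"
    if W: "W \<subseteq> topspace E" and c: "c \<in> C" for W c
  proof (intro set_eqI iffI)
    fix x assume x: "x \<in> {x \<in> unit_square. \<kappa> c x \<in> fst ` W}"
    then obtain m where m: "(\<kappa> c x, m) \<in> W"
      by auto
    then have "m \<in> Zf (pb (\<kappa> c x))"
      using W unfolding topE by auto
    then have "m \<in> (\<lambda>z. lab c z x) ` Zf (B c)"
      using bij_betw_imp_surj_on[OF bij[OF c]] x by simp
    then show "x \<in> (\<Union>z\<in>Zf (B c). {x \<in> unit_square. (\<kappa> c x, lab c z x) \<in> W})"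
      using m x by auto
  qed force
  have open_fst: "openin X (fst ` W)" if W: "openin E W" for W
  proof -
    have WE: "W \<subseteq> topspace E"
      using W openin_subset by blast
    have "openin (top_of_set unit_square) {x \<in> unit_square. \<kappa> c x \<in> fst ` W}" if c: "c \<in> C" for c
    proof -
      have "openin (top_of_set unit_square) {x \<in> unit_square. (\<kappa> c x, lab c z x) \<in> W}" if "z \<in> Zf (B c)" for z
        using W c that unfolding E_def openin_cell_topology by auto
      then show ?thesis
        unfolding preim[OF WE c] by (intro openin_Union) auto
    qed
    moreover have "fst ` W \<subseteq> topspace X"
      using WE unfolding topE by auto
    ultimately show ?thesis
      unfolding X_def openin_cell_topology topX[unfolded X_def] by (simp add: topspace_cell_topology)
  qed
  have cont: "continuous_map E X fst"
    unfolding E_def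
  proof (rule continuous_map_from_cell_topology)
    fix p assume "p \<in> {(c, z). c \<in> C \<and> z \<in> Zf (B c)}"
    then obtain c z where "p = (c, z)" "c \<in> C"
      by blast
    then show "continuous_map (top_of_set unit_square) X (\<lambda>x. fst ((case p of (c, z) \<Rightarrow> \<lambda>x. (\<kappa> c x, lab c z x)) x))"
      unfolding X_def using continuous_map_cell[of c C \<kappa>] by simp
  qed
  show "covering_map E fst X"
    unfolding covering_map_def
  proof (intro conjI ballI)
    show "continuous_map E X fst"
      by (rule cont)
    have "y \<in> fst ` topspace E" if y: "y \<in> topspace X" for y
    proof -
      obtain c x where c: "c \<in> C" "x \<in> unit_square" "y = \<kappa> c x"
        using y unfolding topX by blast
      obtain z where "z \<in> Zf (B c)"
        using ne[OF c(1)] by blast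
      then show ?thesis
        using in_E[OF c(1) _ c(2)] c(3) by force
    qed
    moreover have "fst ` topspace E \<subseteq> topspace X"
      unfolding topE by auto
    ultimately show "fst ` topspace E = topspace X"
      by blast
    fix y assume "y \<in> topspace X"
    from triv[OF this] obtain T and \<Phi> :: "'z set" and \<theta> where *: "y \<in> T \<and> openin X T \<and>
       (\<forall>y\<in>T. bij_betw (\<theta> y) \<Phi> (Zf (pb y))) \<and>
       (\<forall>w\<in>\<Phi>. \<forall>c\<in>C. \<forall>z\<in>Zf (B c).
          openin (top_of_set unit_square) {x \<in> unit_square. \<kappa> c x \<in> T \<and> lab c z x = \<theta> (\<kappa> c x) w})"
      by blast
    then have T: "y \<in> T" "openin X T"
      and th: "\<And>y. y \<in> T \<Longrightarrow> bij_betw (\<theta> y) \<Phi> (Zf (pb y))"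
      and op: "\<And>w c z. w \<in> \<Phi> \<Longrightarrow> c \<in> C \<Longrightarrow> z \<in> Zf (B c) \<Longrightarrow>
          openin (top_of_set unit_square) {x \<in> unit_square. \<kappa> c x \<in> T \<and> lab c z x = \<theta> (\<kappa> c x) w}"
      by blast+
    have TX: "T \<subseteq> topspace X"
      using T openin_subset by blast
    \<comment> \<open>the sheet over \<open>T\<close> with index \<open>w\<close>\<close>
    define u where "u w = (\<lambda>y. (y, \<theta> y w)) ` T" for w
    have uE: "u w \<subseteq> topspace E" if "w \<in> \<Phi>" for w
    proof -
      have "\<theta> y w \<in> Zf (pb y)" if "y \<in> T" for y
        using bij_betw_apply[OF th[OF that] \<open>w \<in> \<Phi>\<close>] .
      then show ?thesis
        using TX unfolding topE u_def by auto
    qed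
    have u_open: "openin E (u w)" if w: "w \<in> \<Phi>" for w
    proof -
      have "{x \<in> unit_square. (\<kappa> c x, lab c z x) \<in> u w} = {x \<in> unit_square. \<kappa> c x \<in> T \<and> lab c z x = \<theta> (\<kappa> c x) w}" for c z
        by (auto simp: u_def)
      then show ?thesis
        using op[OF w] uE[OF w] unfolding E_def openin_cell_topology by (auto simp: topspace_cell_topology)
    qed
    have union: "\<Union>(u ` \<Phi>) = {e \<in> topspace E. fst e \<in> T}"
    proof (intro set_eqI iffI)
      fix e assume "e \<in> \<Union>(u ` \<Phi>)"
      then obtain w where w: "w \<in> \<Phi>" "e \<in> u w"
        by blast
      then have "e \<in> topspace E" "fst e \<in> T"
        using uE[OF w(1)] by (auto simp: u_def)
      then show "e \<in> {e \<in> topspace E. fst e \<in> T}"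
        by blast
    next
      fix e assume e: "e \<in> {e \<in> topspace E. fst e \<in> T}"
      obtain y m where ym: "e = (y, m)"
        by (cases e)
      then have "y \<in> T" "m \<in> Zf (pb y)"
        using e unfolding topE by auto
      then have "m \<in> \<theta> y ` \<Phi>"
        using bij_betw_imp_surj_on[OF th] by blast
      then show "e \<in> \<Union>(u ` \<Phi>)"
        using ym \<open>y \<in> T\<close> by (auto simp: u_def)
    qed
    have "pairwise disjnt (u ` \<Phi>)"
    proof -
      have "disjnt (u w) (u w')" if w: "w \<in> \<Phi>" "w' \<in> \<Phi>" "u w \<noteq> u w'" for w w'
      proof -
        have "\<theta> y w \<noteq> \<theta> y w'" if "y \<in> T" for y
          using bij_betw_imp_inj_on[OF th[OF that]] w by (auto simp: inj_on_def)
        then show ?thesis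
          by (auto simp: u_def disjnt_iff)
      qed
      then show ?thesis
        unfolding pairwise_def by blast
    qed
    moreover have "homeomorphic_map (subtopology E (u w)) (subtopology X T) fst" if w: "w \<in> \<Phi>" for w
    proof (rule bijective_open_imp_homeomorphic_map)
      have top: "topspace (subtopology E (u w)) = u w" "topspace (subtopology X T) = T"
        using uE[OF w] TX by auto
      show "continuous_map (subtopology E (u w)) (subtopology X T) fst"
        using cont by (auto simp: continuous_map_in_subtopology u_def continuous_map_from_subtopology)
      show "open_map (subtopology E (u w)) (subtopology X T) fst"
        unfolding open_map_def
      proof (intro allI impI)
        fix W assume "openin (subtopology E (u w)) W"
        then have W: "openin E W" "W \<subseteq> u w"
          using u_open[OF w] openin_open_subtopology by blast+
        then have "fst ` W \<subseteq> T"
          by (auto simp: u_def)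
        then show "openin (subtopology X T) (fst ` W)"
          using open_fst[OF W(1)] T(2) openin_open_subtopology by blast
      qed
      show "fst ` topspace (subtopology E (u w)) = topspace (subtopology X T)"
        unfolding top by (force simp: u_def)
      show "inj_on fst (topspace (subtopology E (u w)))"
        unfolding top by (auto simp: u_def inj_on_def)
    qed
    ultimately have "\<Union>(u ` \<Phi>) = {e \<in> topspace E. fst e \<in> T} \<and> (\<forall>w\<in>u ` \<Phi>. openin E w) \<and> pairwise disjnt (u ` \<Phi>) \<and>
        (\<forall>w\<in>u ` \<Phi>. homeomorphic_map (subtopology E w) (subtopology X T) fst)"
      using union u_open by blast
    then show "\<exists>T. y \<in> T \<and> openin X T \<and> (\<exists>v. \<Union>v = {e \<in> topspace E. fst e \<in> T} \<and> (\<forall>u\<in>v. openin E u) \<and>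
        pairwise disjnt v \<and> (\<forall>u\<in>v. homeomorphic_map (subtopology E u) (subtopology X T) fst))"
      using T by (intro exI[of _ T] exI[of _ "u ` \<Phi>"] conjI) simp_all
  qed
qed

section \<open>The cover assembled from a gluing pattern\<close>

fun cell_base :: "('v, 'e) fin_data \<Rightarrow> ('v, 'e) cell \<Rightarrow> 'v" where
  "cell_base F (VertexCell v) = v"
| "cell_base F (EdgeCell e) = tail (base_graph F) e"
| "cell_base F (SquareCell i k) = dart_src (base_graph F) (fin_dart F i k)"

text \<open>
  The vertex whose copies name the points in the fibre over a given point. For inner points of
  an edge this has to be a choice that depends on the edge only; it is its tail.
\<close>

fun point_base :: "('v, 'e) fin_data \<Rightarrow> ('v, 'e) cylinder_point \<Rightarrow> 'v" where
  "point_base F (Base (Vertex v)) = v"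
| "point_base F (Base (Inner e s)) = tail (base_graph F) e"
| "point_base F (Fin i (Vertex k) t) = dart_src (base_graph F) (fin_dart F i k)"
| "point_base F (Fin i (Inner k s) t) = dart_src (base_graph F) (fin_dart F i k)"

text \<open>
  The copy \<open>z\<close> of a cell has its origin in the star \<open>z\<close>. A point of this copy is named after the
  star prescribed by \<open>point_base\<close>, which is \<open>z\<close> or the neighbour of \<open>z\<close> across the cell. In squares
  the bottom edge is exceptional: its points are named by the tail of an edge of the base graph,
  which is the far end if the geodesic runs against the direction of the edge.
\<close>

fun label :: "('v, 'e) fin_data \<Rightarrow> (nat \<Rightarrow> 'e \<times> bool \<Rightarrow> nat) \<Rightarrow> ('v, 'e) cell \<Rightarrow> nat \<Rightarrow> real \<times> real \<Rightarrow> nat" where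
  "label F N (VertexCell v) z x = z"
| "label F N (EdgeCell e) z x = (if fst x = 1 then N z (e, True) else z)"
| "label F N (SquareCell i k) z x =
     (if fst x = 1 \<or> (0 < fst x \<and> snd x = 0 \<and> \<not> snd (fin_dart F i k)) then N z (fin_dart F i k) else z)"

text \<open>
  The vertices of the base graph of the cover are the members of \<open>Z\<close>; \<open>z\<close> lies over \<open>a z\<close>, and the
  lift at \<open>z\<close> of a dart \<open>d\<close> ends in \<open>N z d\<close>. Connectedness is expressed by \<open>minimal\<close>.
\<close>

locale fin_cover = fin_graph F for F :: "('v, 'e) fin_data" +
  fixes Z :: "nat set" and a :: "nat \<Rightarrow> 'v" and N :: "nat \<Rightarrow> 'e \<times> bool \<Rightarrow> nat"
  assumes fin_Z: "finite Z" and a_in: "z \<in> Z \<Longrightarrow> a z \<in> verts (base_graph F)"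
    and N_in: "z \<in> Z \<Longrightarrow> d \<in> darts (base_graph F) \<Longrightarrow> dart_src (base_graph F) d = a z \<Longrightarrow> N z d \<in> Z"
    and a_N: "z \<in> Z \<Longrightarrow> d \<in> darts (base_graph F) \<Longrightarrow> dart_src (base_graph F) d = a z \<Longrightarrow>
      a (N z d) = dart_src (base_graph F) (dart_rev d)"
    and N_N: "z \<in> Z \<Longrightarrow> d \<in> darts (base_graph F) \<Longrightarrow> dart_src (base_graph F) d = a z \<Longrightarrow> N (N z d) (dart_rev d) = z"
    and minimal: "W \<subseteq> Z \<Longrightarrow> W \<noteq> {} \<Longrightarrow>
      (\<And>z d. z \<in> W \<Longrightarrow> d \<in> darts (base_graph F) \<Longrightarrow> dart_src (base_graph F) d = a z \<Longrightarrow> N z d \<in> W) \<Longrightarrow> W = Z"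
    and a_surj: "v \<in> verts (base_graph F) \<Longrightarrow> \<exists>z\<in>Z. a z = v"
begin

abbreviation Zf where "Zf v \<equiv> {z \<in> Z. a z = v}"
abbreviation lab where "lab \<equiv> label F N"

definition lift_cells where
  "lift_cells = {(c, z). c \<in> cells F \<and> z \<in> Zf (cell_base F c)}"

definition cover_map where
  "cover_map p x = (cell_map F (fst p) x, lab (fst p) (snd p) x)"

definition cover where
  "cover = cell_topology lift_cells cover_map"

lemma N_Zf: "d \<in> darts G \<Longrightarrow> z \<in> Zf (dart_src G d) \<Longrightarrow> N z d \<in> Zf (dart_src G (dart_rev d))"
  using N_in a_N by auto

lemma N_rev: "d \<in> darts G \<Longrightarrow> z \<in> Zf (dart_src G d) \<Longrightarrow> N (N z d) (dart_rev d) = z"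
  using N_N by auto

lemma N_rev': "d \<in> darts G \<Longrightarrow> z \<in> Zf (dart_src G (dart_rev d)) \<Longrightarrow> N (N z (dart_rev d)) d = z"
  using N_rev[of "dart_rev d"] by simp

lemma N_bij: "d \<in> darts G \<Longrightarrow> bij_betw (\<lambda>z. N z d) (Zf (dart_src G d)) (Zf (dart_src G (dart_rev d)))"
proof (rule bij_betwI[where g = "\<lambda>z. N z (dart_rev d)"])
  assume d: "d \<in> darts G"
  show "(\<lambda>z. N z d) \<in> Zf (dart_src G d) \<rightarrow> Zf (dart_src G (dart_rev d))"
    using N_Zf[OF d] by blast
  show "(\<lambda>z. N z (dart_rev d)) \<in> Zf (dart_src G (dart_rev d)) \<rightarrow> Zf (dart_src G d)"
    using N_Zf[of "dart_rev d"] d by simp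
  show "N (N z d) (dart_rev d) = z" if "z \<in> Zf (dart_src G d)" for z
    using N_rev[OF d that] .
  show "N (N z (dart_rev d)) d = z" if "z \<in> Zf (dart_src G (dart_rev d))" for z
    using N_rev'[OF d that] .
qed

end

lemma (in fin_graph) cell_cases [consumes 1, case_names vertex edge square]:
  assumes c: "c \<in> cells F"
  obtains (vertex) v where "c = VertexCell v" "v \<in> verts G"
    | (edge) e where "c = EdgeCell e" "e \<in> arcs G"
    | (square) i k where "c = SquareCell i k" "i < num_fins F" "k < fin_length F i"
  using c unfolding cells_def by blast

lemma edge_point [consumes 1, case_names start finish inner]:
  assumes "s \<in> unit_interval"
  obtains (start) "s = 0" "edge_map G e s = Vertex (tail G e)" | (finish) "s = 1" "edge_map G e s = Vertex (head G e)"
    | (inner) "0 < s" "s < 1" "edge_map G e s = Inner e s"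
  using assms by (cases "s = 0"; cases "s = 1") (auto simp: edge_map_def)

lemma (in fin_graph) square_point [consumes 3, case_names start finish bottom inner]:
  assumes i: "i < num_fins F" "k < fin_length F i" and x: "x \<in> unit_square"
  obtains
    (start) "fst x = 0" "square_map F i k x = (if snd x = 0 then Base (Vertex (dart_src G (fin_dart F i k))) else Fin i (Vertex k) (snd x))"
  | (finish) "fst x = 1" "square_map F i k x = (if snd x = 0 then Base (Vertex (dart_src G (dart_rev (fin_dart F i k))))
        else Fin i (Vertex (circle_next (fin_length F i) k)) (snd x))"
  | (bottom) "0 < fst x" "fst x < 1" "snd x = 0"
      "square_map F i k x = Base (Inner (fst (fin_dart F i k)) (if snd (fin_dart F i k) then fst x else 1 - fst x))"
  | (inner) "0 < fst x" "fst x < 1" "snd x \<noteq> 0" "square_map F i k x = Fin i (Inner k (fst x)) (snd x)"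
proof -
  obtain s t where x': "x = (s, t)" "s \<in> unit_interval" "t \<in> unit_interval"
    using x by blast
  note b = square_map_bottom[OF i x'(2)]
  have t: "square_map F i k (s, t) = Fin i (edge_map (fin_circle F i) k s) t" if "t \<noteq> 0"
    using that by (simp add: square_map_def fin_point_def)
  consider "s = 0" | "s = 1" | "0 < s" "s < 1"
    using x'(2) by fastforce
  then show thesis
  proof cases
    case 1
    then show thesis
      using start b t by (cases "t = 0") (simp_all add: x' dart_map_0 fin_circle_def edge_map_cycle)
  next
    case 2
    then show thesis
      using finish b t by (cases "t = 0") (simp_all add: x' dart_map_1 fin_circle_def edge_map_cycle)
  next
    case 3
    then show thesis
      using bottom inner b t by (cases "t = 0") (simp_all add: x' dart_map_inner fin_circle_def edge_map_cycle)
  qed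
qed

lemma (in fin_graph) tail_fst_dart: "tail G (fst d) = (if snd d then dart_src G d else dart_src G (dart_rev d))"
  "head G (fst d) = (if snd d then dart_src G (dart_rev d) else dart_src G d)"
  by (auto simp: dart_src_def)

context fin_cover
begin

lemma label_bij:
  assumes c: "c \<in> cells F" and x: "x \<in> unit_square"
  shows "bij_betw (\<lambda>z. lab c z x) (Zf (cell_base F c)) (Zf (point_base F (cell_map F c x)))"
  using c
proof (cases rule: cell_cases)
  case (vertex v)
  then show ?thesis
    by (simp add: bij_betw_def)
next
  case (edge e)
  have "fst x \<in> unit_interval"
    using x by auto
  then show ?thesis
    using N_bij[of "(e, True)"] edge by (cases rule: edge_point[of _ G e])
      (auto simp: bij_betw_def inj_on_def dart_src_def darts_def)
next
  case (square i k)
  let ?d = "fin_dart F i k"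
  note d = fin_dart(1)[OF square(2,3)]
  have id: "bij_betw (\<lambda>z. z) A A" for A :: "nat set"
    by (simp add: bij_betw_def)
  show ?thesis
    using square(2,3) x
  proof (cases rule: square_point)
    case start
    then show ?thesis
      using id by (simp add: square(1))
  next
    case finish
    then show ?thesis
      using N_bij[OF d] fin_dart_next[OF square(2,3)] by (simp add: square(1))
  next
    case bottom
    then show ?thesis
      using N_bij[OF d] id by (simp add: square(1) tail_fst_dart)
  next
    case inner
    then show ?thesis
      using id by (simp add: square(1))
  qed
qed

end

text \<open>
  The set where \<open>near F\<close> has the value \<open>Some v\<close> is the open star of \<open>v\<close>, which extends up to the
  middle of the edges, together with the part of the fins above it. The set where \<open>middle F\<close> has the
  value \<open>Some e\<close> is the interior of \<open>e\<close> together with the part of the fins above it. These open sets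
  are evenly covered, and each point lies in one of them.
\<close>

fun near :: "('v, 'e) fin_data \<Rightarrow> ('v, 'e) cylinder_point \<Rightarrow> 'v option" where
  "near F (Base (Vertex v)) = Some v"
| "near F (Base (Inner e s)) =
     (if s < 1/2 then Some (tail (base_graph F) e) else if s > 1/2 then Some (head (base_graph F) e) else None)"
| "near F (Fin i (Vertex k) t) = Some (dart_src (base_graph F) (fin_dart F i k))"
| "near F (Fin i (Inner k s) t) =
     (if s < 1/2 then Some (dart_src (base_graph F) (fin_dart F i k))
      else if s > 1/2 then Some (dart_src (base_graph F) (dart_rev (fin_dart F i k))) else None)"

text \<open>
  The name of the point over \<open>y\<close> in the sheet that contains the star \<open>w\<close>.
\<close>

fun near_label :: "('v, 'e) fin_data \<Rightarrow> (nat \<Rightarrow> 'e \<times> bool \<Rightarrow> nat) \<Rightarrow> ('v, 'e) cylinder_point \<Rightarrow> nat \<Rightarrow> nat" where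
  "near_label F N (Base (Vertex v)) w = w"
| "near_label F N (Base (Inner e s)) w = (if s < 1/2 then w else N w (e, False))"
| "near_label F N (Fin i (Vertex k) t) w = w"
| "near_label F N (Fin i (Inner k s) t) w = (if s < 1/2 then w else N w (dart_rev (fin_dart F i k)))"

fun middle :: "('v, 'e) fin_data \<Rightarrow> ('v, 'e) cylinder_point \<Rightarrow> 'e option" where
  "middle F (Base (Inner e s)) = Some e"
| "middle F (Fin i (Inner k s) t) = Some (fst (fin_dart F i k))"
| "middle F _ = None"

text \<open>
  The name of the point over \<open>y\<close> in the sheet that contains the beginning of the edge at the
  star \<open>w\<close>, where \<open>w\<close> lies over the tail of this edge.
\<close>

fun middle_label :: "('v, 'e) fin_data \<Rightarrow> (nat \<Rightarrow> 'e \<times> bool \<Rightarrow> nat) \<Rightarrow> ('v, 'e) cylinder_point \<Rightarrow> nat \<Rightarrow> nat" where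
  "middle_label F N (Fin i (Inner k s) t) w =
     (if snd (fin_dart F i k) then w else N w (dart_rev (fin_dart F i k)))"
| "middle_label F N _ w = w"

fun cell_dart :: "('v, 'e) fin_data \<Rightarrow> ('v, 'e) cell \<Rightarrow> 'e \<times> bool" where
  "cell_dart F (EdgeCell e) = (e, True)"
| "cell_dart F (SquareCell i k) = fin_dart F i k"

context fin_graph
begin

lemma cell_dart:
  assumes "c \<in> cells F" "c \<notin> range VertexCell"
  shows "cell_dart F c \<in> darts G" "dart_src G (cell_dart F c) = cell_base F c"
  using assms fin_dart(1) by (auto simp: cells_def darts_def dart_src_def)

lemma topspace_mapping_cylinder: "topspace (mapping_cylinder F) = (\<Union>c\<in>cells F. cell_map F c ` unit_square)"
  by (simp add: mapping_cylinder_cells topspace_cell_topology)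

lemma mapping_cylinder_points:
  assumes "y \<in> topspace (mapping_cylinder F)"
  shows "y = Base (Inner e s) \<Longrightarrow> e \<in> arcs G" "y = Fin i p t \<Longrightarrow> i < num_fins F"
    "y = Fin i (Vertex k) t \<Longrightarrow> k < fin_length F i" "y = Fin i (Inner k s) t \<Longrightarrow> k < fin_length F i"
    "y = Base (Vertex v) \<Longrightarrow> v \<in> verts G"
proof -
  obtain c x where c: "c \<in> cells F" and x: "x \<in> unit_square" "y = cell_map F c x"
    using assms unfolding topspace_mapping_cylinder by blast
  have "(\<forall>e s. y = Base (Inner e s) \<longrightarrow> e \<in> arcs G) \<and> (\<forall>i p t. y = Fin i p t \<longrightarrow> i < num_fins F) \<and>
    (\<forall>i k t. y = Fin i (Vertex k) t \<longrightarrow> k < fin_length F i) \<and> (\<forall>i k s t. y = Fin i (Inner k s) t \<longrightarrow> k < fin_length F i) \<and>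
    (\<forall>v. y = Base (Vertex v) \<longrightarrow> v \<in> verts G)"
    using c
  proof (cases rule: cell_cases)
    case (vertex v)
    then show ?thesis
      using x by simp
  next
    case (edge e)
    have "fst x \<in> unit_interval"
      using x by auto
    then show ?thesis
      using edge x(2) tail_in head_in by (cases rule: edge_point[of _ G e]) auto
  next
    case (square i k)
    have d: "fin_dart F i k \<in> darts G"
      using fin_dart(1) square by blast
    have "dart_src G (fin_dart F i k) \<in> verts G" "dart_src G (dart_rev (fin_dart F i k)) \<in> verts G"
      using dart_src_in[of "fin_dart F i k"] dart_src_in[of "dart_rev (fin_dart F i k)"] d by simp_all
    moreover have "fst (fin_dart F i k) \<in> arcs G"
      using d by (simp add: darts_def mem_Times_iff)
    moreover note circle_next_less[OF square(3)]
    ultimately have *: "dart_src G (fin_dart F i k) \<in> verts G \<and> dart_src G (dart_rev (fin_dart F i k)) \<in> verts G \<and>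
        fst (fin_dart F i k) \<in> arcs G \<and> circle_next (fin_length F i) k < fin_length F i"
      by blast
    show ?thesis
      using square(2,3) x(1)
      by (cases rule: square_point) (use * square x(2) in auto)
  qed
  then show "y = Base (Inner e s) \<Longrightarrow> e \<in> arcs G" "y = Fin i p t \<Longrightarrow> i < num_fins F"
    "y = Fin i (Vertex k) t \<Longrightarrow> k < fin_length F i" "y = Fin i (Inner k s) t \<Longrightarrow> k < fin_length F i"
    "y = Base (Vertex v) \<Longrightarrow> v \<in> verts G"
    by blast+
qed

lemma near_cell:
  assumes c: "c \<in> cells F" "c \<notin> range VertexCell" and x: "x \<in> unit_square"
  shows "near F (cell_map F c x) =
    (if fst x < 1/2 then Some (cell_base F c) else if fst x > 1/2 then Some (dart_src G (dart_rev (cell_dart F c))) else None)"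
  using c(1)
proof (cases rule: cell_cases)
  case (vertex v)
  then show ?thesis
    using c by auto
next
  case (edge e)
  have "fst x \<in> unit_interval"
    using x by auto
  then show ?thesis
    using edge by (cases rule: edge_point[of _ G e]) (auto simp: dart_src_def)
next
  case (square i k)
  show ?thesis
    using square(2,3) x
  proof (cases rule: square_point)
    case bottom
    then show ?thesis
      by (auto simp: square(1) tail_fst_dart)
  qed (use fin_dart_next[OF square(2,3)] in \<open>auto simp: square(1)\<close>)
qed

lemma middle_cell:
  assumes c: "c \<in> cells F" "c \<notin> range VertexCell" and x: "x \<in> unit_square"
  shows "middle F (cell_map F c x) = (if 0 < fst x \<and> fst x < 1 then Some (fst (cell_dart F c)) else None)"
  using c(1)
proof (cases rule: cell_cases)
  case (vertex v)
  then show ?thesis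
    using c by auto
next
  case (edge e)
  have "fst x \<in> unit_interval"
    using x by auto
  then show ?thesis
    using edge by (cases rule: edge_point[of _ G e]) auto
next
  case (square i k)
  show ?thesis
    using square(2,3) x by (cases rule: square_point) (auto simp: square(1))
qed

lemma adjacent_cell_base:
  assumes "c \<in> cells F" "x \<in> unit_square"
  shows "point_base F (cell_map F c x) = cell_base F c \<or>
    (c \<notin> range VertexCell \<and> point_base F (cell_map F c x) = dart_src G (dart_rev (cell_dart F c)))"
  using assms(1)
proof (cases rule: cell_cases)
  case (vertex v)
  then show ?thesis
    by auto
next
  case (edge e)
  have "fst x \<in> unit_interval"
    using assms(2) by auto
  then show ?thesis
    using edge by (cases rule: edge_point[of _ G e]) (auto simp: dart_src_def)
next
  case (square i k)
  show ?thesis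
    using square(2,3) assms(2) by (cases rule: square_point)
      (use fin_dart_next[OF square(2,3)] in \<open>auto simp: square(1) tail_fst_dart\<close>)
qed

lemma cell_map_origin: "c \<in> cells F \<Longrightarrow> cell_map F c (0, 0) = Base (Vertex (cell_base F c))"
  by (erule cell_cases) (auto simp: edge_map_def square_map_bottom dart_map_0)

text \<open>
  A set of vertices that is closed under passing to neighbours gives a set of cells that is
  closed under passing to cells with a common point.
\<close>

lemma connected_graph:
  assumes conn: "connected_space (mapping_cylinder F)" and V: "V \<subseteq> verts G" "V \<noteq> {}"
    and cl: "\<And>d. d \<in> darts G \<Longrightarrow> dart_src G d \<in> V \<Longrightarrow> dart_src G (dart_rev d) \<in> V"
  shows "V = verts G"
proof -
  have cl': "dart_src G d \<in> V \<longleftrightarrow> dart_src G (dart_rev d) \<in> V" if "d \<in> darts G" for d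
    using cl[of d] cl[of "dart_rev d"] that by auto
  define S where "S = {c \<in> cells F. cell_base F c \<in> V}"
  have base: "cell_base F c \<in> V \<longleftrightarrow> point_base F (cell_map F c x) \<in> V" if "c \<in> cells F" "x \<in> unit_square" for c x
    using adjacent_cell_base[OF that] cl'[OF cell_dart(1)] cell_dart(2) that(1) by metis
  have "\<forall>c\<in>S. \<forall>c'\<in>cells F. cell_map F c ` unit_square \<inter> cell_map F c' ` unit_square \<noteq> {} \<longrightarrow> c' \<in> S"
  proof (intro ballI impI)
    fix c c' assume c: "c \<in> S" "c' \<in> cells F" "cell_map F c ` unit_square \<inter> cell_map F c' ` unit_square \<noteq> {}"
    then obtain x x' where "x \<in> unit_square" "x' \<in> unit_square" "cell_map F c x = cell_map F c' x'"
      by blast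
    then show "c' \<in> S"
      using base[of c x] base[of c' x'] c by (auto simp: S_def)
  qed
  moreover have "S \<subseteq> cells F"
    by (auto simp: S_def)
  moreover obtain v where "v \<in> V"
    using V by blast
  then have "VertexCell v \<in> S"
    using V by (auto simp: S_def cells_def)
  then have "S \<noteq> {}"
    by blast
  ultimately have "S = cells F"
    using conn unfolding mapping_cylinder_cells connected_cell_topology by blast
  moreover have "VertexCell v \<in> cells F" if "v \<in> verts G" for v
    using that by (auto simp: cells_def)
  ultimately have "verts G \<subseteq> V"
    unfolding S_def by force
  then show ?thesis
    using V by blast
qed

end

lemma openin_unit_square_fst:
  "openin (top_of_set unit_square) {x \<in> unit_square. fst x < r}"
  "openin (top_of_set unit_square) {x \<in> unit_square. r < fst x}"
proof -
  have "open {x :: real \<times> real. fst x < r}" "open {x :: real \<times> real. r < fst x}"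
    by (auto intro!: open_Collect_less continuous_intros)
  moreover have "{x \<in> unit_square. fst x < r} = unit_square \<inter> {x. fst x < r}"
    "{x \<in> unit_square. r < fst x} = unit_square \<inter> {x. r < fst x}"
    by auto
  ultimately show "openin (top_of_set unit_square) {x \<in> unit_square. fst x < r}"
    "openin (top_of_set unit_square) {x \<in> unit_square. r < fst x}"
    using openin_open_Int by metis+
qed

context fin_cover
begin

lemma N_eq_iff: "d \<in> darts G \<Longrightarrow> z \<in> Zf (dart_src G d) \<Longrightarrow> w \<in> Zf (dart_src G (dart_rev d)) \<Longrightarrow>
    z = N w (dart_rev d) \<longleftrightarrow> N z d = w"
  using N_rev N_rev' by metis

text \<open>
  Both labels name the same point if and only if the copy \<open>z\<close> of the cell begins or ends in the
  star \<open>w\<close>, depending on the half of the cell that contains \<open>x\<close>.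
\<close>

lemma near_label_cell:
  assumes c: "c \<in> cells F" "c \<notin> range VertexCell" and x: "x \<in> unit_square" and z: "z \<in> Zf (cell_base F c)"
    and w: "near F (cell_map F c x) = Some (a w)" "w \<in> Z"
  shows "lab c z x = near_label F N (cell_map F c x) w \<longleftrightarrow> (if fst x < 1/2 then z = w else N z (cell_dart F c) = w)"
  using c(1)
proof (cases rule: cell_cases)
  case (vertex v)
  then show ?thesis
    using c by auto
next
  case (edge e)
  have x1: "fst x \<in> unit_interval"
    using x by auto
  have w': "fst x > 1/2 \<Longrightarrow> w \<in> Zf (dart_src G (dart_rev (e, True)))" "fst x \<noteq> 1/2"
    using w near_cell[OF c x] edge by (auto split: if_splits)
  have eq: "fst x > 1/2 \<Longrightarrow> z = N w (e, False) \<longleftrightarrow> N z (e, True) = w"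
    using N_eq_iff[of "(e, True)" z w] z w' edge by (auto simp: dart_src_def darts_def dart_rev_def)
  show ?thesis
    using x1
  proof (cases rule: edge_point[of _ G e])
    case inner
    then show ?thesis
      using eq w' edge by auto
  qed (use edge in auto)
next
  case (square i k)
  let ?d = "fin_dart F i k"
  note d = fin_dart(1)[OF square(2,3)]
  have w': "fst x > 1/2 \<Longrightarrow> w \<in> Zf (dart_src G (dart_rev ?d))" "fst x < 1/2 \<Longrightarrow> w \<in> Zf (dart_src G ?d)" "fst x \<noteq> 1/2"
    using w near_cell[OF c x] square by (auto split: if_splits)
  have zd: "z \<in> Zf (dart_src G ?d)"
    using z square by simp
  have eq: "fst x > 1/2 \<Longrightarrow> z = N w (dart_rev ?d) \<longleftrightarrow> N z ?d = w"
    using N_eq_iff[OF d zd] w'(1) by blast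
  have eq': "fst x < 1/2 \<Longrightarrow> N z ?d = N w ?d \<longleftrightarrow> z = w"
    using N_rev[OF d zd] N_rev[OF d w'(2)] by metis
  show ?thesis
    using square(2,3) x
  proof (cases rule: square_point)
    case start
    then show ?thesis
      by (auto simp: square(1))
  next
    case finish
    then show ?thesis
      by (auto simp: square(1))
  next
    case bottom
    show ?thesis
    proof (cases "snd ?d")
      case True
      then have "(fst ?d, False) = dart_rev ?d"
        by (simp add: dart_rev_def)
      then show ?thesis
        using bottom True eq w'(3) by (auto simp: square(1))
    next
      case False
      then have "(fst ?d, False) = ?d"
        by (simp add: prod_eq_iff)
      then show ?thesis
        using bottom False eq' w'(3) by (auto simp: square(1))
    qed
  next
    case inner
    then show ?thesis
      using eq w'(3) by (auto simp: square(1))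
  qed
qed

lemma middle_label_cell:
  assumes c: "c \<in> cells F" "c \<notin> range VertexCell" and x: "x \<in> unit_square" and z: "z \<in> Zf (cell_base F c)"
    and w: "middle F (cell_map F c x) = Some e" "w \<in> Zf (tail G e)"
  shows "lab c z x = middle_label F N (cell_map F c x) w \<longleftrightarrow> (if snd (cell_dart F c) then z = w else N z (cell_dart F c) = w)"
  using c(1)
proof (cases rule: cell_cases)
  case (vertex v)
  then show ?thesis
    using c by auto
next
  case (edge e')
  have "fst x \<in> unit_interval"
    using x by auto
  then show ?thesis
    using edge w by (cases rule: edge_point[of _ G e']) auto
next
  case (square i k)
  let ?d = "fin_dart F i k"
  note d = fin_dart(1)[OF square(2,3)]
  have zd: "z \<in> Zf (dart_src G ?d)"
    using z square by simp
  have "fst ?d = e"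
    using w middle_cell[OF c x] square(1) by (auto split: if_splits)
  then have "\<not> snd ?d \<Longrightarrow> w \<in> Zf (dart_src G (dart_rev ?d))"
    using w(2) by (auto simp: dart_src_def)
  then have eq: "\<not> snd ?d \<Longrightarrow> z = N w (dart_rev ?d) \<longleftrightarrow> N z ?d = w"
    using N_eq_iff[OF d zd] by blast
  show ?thesis
    using square(2,3) x by (cases rule: square_point) (use eq w(1) in \<open>auto simp: square(1) split: if_splits\<close>)
qed

lemma near_label_bij:
  assumes "y \<in> topspace (mapping_cylinder F)" "near F y = Some v"
  shows "bij_betw (near_label F N y) (Zf v) (Zf (point_base F y))"
proof -
  note y = mapping_cylinder_points[OF assms(1)]
  have id: "bij_betw (\<lambda>z. z) A A" for A :: "nat set"
    by (simp add: bij_betw_def)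
  consider v' where "y = Base (Vertex v')" | e s where "y = Base (Inner e s)"
    | i k t where "y = Fin i (Vertex k) t" | i k s t where "y = Fin i (Inner k s) t"
    by (metis cylinder_point.exhaust graph_point.exhaust)
  then show ?thesis
  proof cases
    case (2 e s)
    then have "(e, False) \<in> darts G"
      using y(1) by (simp add: darts_def)
    from N_bij[OF this] have N: "bij_betw (\<lambda>z. N z (e, False)) (Zf (head G e)) (Zf (tail G e))"
      by (simp add: dart_src_def)
    have "near_label F N y = (if s < 1/2 then (\<lambda>w. w) else (\<lambda>w. N w (e, False)))"
      using 2 by (simp add: fun_eq_iff)
    then show ?thesis
      using id N assms(2) 2 by (simp split: if_splits)
  next
    case (4 i k s t)
    then have "dart_rev (fin_dart F i k) \<in> darts G"
      using y fin_dart(1) by simp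
    note N = N_bij[OF this, simplified]
    have "near_label F N y = (if s < 1/2 then (\<lambda>w. w) else (\<lambda>w. N w (dart_rev (fin_dart F i k))))"
      using 4 by (simp add: fun_eq_iff)
    then show ?thesis
      using id N assms(2) 4 by (simp split: if_splits)
  next
    case 1
    then have "near_label F N y = (\<lambda>w. w)"
      by (simp add: fun_eq_iff)
    then show ?thesis
      using id assms(2) 1 by simp
  next
    case 3
    then have "near_label F N y = (\<lambda>w. w)"
      by (simp add: fun_eq_iff)
    then show ?thesis
      using id assms(2) 3 by simp
  qed
qed

lemma middle_label_bij:
  assumes "y \<in> topspace (mapping_cylinder F)" "middle F y = Some e"
  shows "bij_betw (middle_label F N y) (Zf (tail G e)) (Zf (point_base F y))"
proof -
  note y = mapping_cylinder_points[OF assms(1)]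
  have id: "bij_betw (\<lambda>z. z) A A" for A :: "nat set"
    by (simp add: bij_betw_def)
  consider v' where "y = Base (Vertex v')" | e s where "y = Base (Inner e s)"
    | i k t where "y = Fin i (Vertex k) t" | i k s t where "y = Fin i (Inner k s) t"
    by (metis cylinder_point.exhaust graph_point.exhaust)
  then show ?thesis
  proof cases
    case (4 i k s t)
    then have "dart_rev (fin_dart F i k) \<in> darts G"
      using y fin_dart(1) by simp
    note N = N_bij[OF this, simplified]
    have "middle_label F N y = (if snd (fin_dart F i k) then (\<lambda>w. w) else (\<lambda>w. N w (dart_rev (fin_dart F i k))))"
      using 4 by (simp add: fun_eq_iff)
    moreover have "e = fst (fin_dart F i k)"
      using 4 assms(2) by simp
    ultimately show ?thesis
      using id N 4 by (simp add: tail_fst_dart)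
  next
    case 2
    then have "middle_label F N y = (\<lambda>w. w)"
      by (simp add: fun_eq_iff)
    then show ?thesis
      using id assms(2) 2 by simp
  qed (use assms(2) in simp_all)
qed

lemma trivialization:
  assumes y: "y \<in> topspace (mapping_cylinder F)"
  shows "\<exists>T (\<Phi> :: nat set) \<theta>. y \<in> T \<and> openin (mapping_cylinder F) T \<and>
       (\<forall>y\<in>T. bij_betw (\<theta> y) \<Phi> (Zf (point_base F y))) \<and>
       (\<forall>w\<in>\<Phi>. \<forall>c\<in>cells F. \<forall>z\<in>Zf (cell_base F c).
          openin (top_of_set unit_square) {x \<in> unit_square. cell_map F c x \<in> T \<and> lab c z x = \<theta> (cell_map F c x) w})"
proof -
  let ?S = "top_of_set unit_square"
  have in_top: "cell_map F c x \<in> topspace (mapping_cylinder F)" if "c \<in> cells F" "x \<in> unit_square" for c x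
    using that unfolding topspace_mapping_cylinder by blast
  have open_const: "openin ?S {x \<in> unit_square. P}" for P
    by (cases P) auto
  have o: "openin ?S {x \<in> unit_square. fst x < 1/2 \<and> P \<or> fst x > 1/2 \<and> Q}" for P Q
  proof -
    have "{x \<in> unit_square. fst x < 1/2 \<and> P \<or> fst x > 1/2 \<and> Q} =
        ({x \<in> unit_square. fst x < 1/2} \<inter> {x \<in> unit_square. P}) \<union> ({x \<in> unit_square. fst x > 1/2} \<inter> {x \<in> unit_square. Q})"
      by blast
    then show ?thesis
      using open_const openin_unit_square_fst by (simp only:) (intro openin_Un openin_Int)
  qed
  have o': "openin ?S {x \<in> unit_square. (0 < fst x \<and> fst x < 1) \<and> P}" for P
  proof -
    have "{x \<in> unit_square. (0 < fst x \<and> fst x < 1) \<and> P} =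
        {x \<in> unit_square. 0 < fst x} \<inter> {x \<in> unit_square. fst x < 1} \<inter> {x \<in> unit_square. P}"
      by blast
    then show ?thesis
      using open_const openin_unit_square_fst by (simp only:) (intro openin_Int)
  qed
  have openI: "openin (mapping_cylinder F) {y \<in> topspace (mapping_cylinder F). P y}"
    if "\<And>c. c \<in> cells F \<Longrightarrow> openin ?S {x \<in> unit_square. P (cell_map F c x)}" for P
  proof -
    let ?U = "{y \<in> topspace (mapping_cylinder F). P y}"
    have "{x \<in> unit_square. cell_map F c x \<in> ?U} = {x \<in> unit_square. P (cell_map F c x)}" if "c \<in> cells F" for c
      using in_top[OF that] by blast
    then have 1: "\<forall>c\<in>cells F. openin ?S {x \<in> unit_square. cell_map F c x \<in> ?U}"
      using that by simp
    have 2: "?U \<subseteq> (\<Union>c\<in>cells F. cell_map F c ` unit_square)"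
      using topspace_mapping_cylinder by blast
    have "openin (cell_topology (cells F) (cell_map F)) ?U"
      unfolding openin_cell_topology using 1 2 by (rule conjI[rotated])
    then show ?thesis
      unfolding mapping_cylinder_cells[symmetric] .
  qed
  show ?thesis
  proof (cases "near F y")
    case (Some v)
    define T where "T = {y \<in> topspace (mapping_cylinder F). near F y = Some v}"
    have "openin (mapping_cylinder F) T"
      unfolding T_def
    proof (rule openI)
      fix c assume c: "c \<in> cells F"
      show "openin ?S {x \<in> unit_square. near F (cell_map F c x) = Some v}"
      proof (cases "c \<in> range VertexCell")
        case True
        then show ?thesis
          using open_const by auto
      next
        case False
        have "{x \<in> unit_square. near F (cell_map F c x) = Some v} =
            {x \<in> unit_square. fst x < 1/2 \<and> cell_base F c = v \<or> fst x > 1/2 \<and> dart_src G (dart_rev (cell_dart F c)) = v}"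
          by (rule Collect_cong, rule conj_cong[OF refl], subst near_cell[OF c False]) auto
        then show ?thesis
          using o by simp
      qed
    qed
    moreover have "openin ?S {x \<in> unit_square. cell_map F c x \<in> T \<and> lab c z x = near_label F N (cell_map F c x) w}"
      if w: "w \<in> Zf v" and c: "c \<in> cells F" and z: "z \<in> Zf (cell_base F c)" for w c z
    proof (cases "c \<in> range VertexCell")
      case True
      then obtain u where u: "c = VertexCell u"
        by blast
      have "{x \<in> unit_square. cell_map F c x \<in> T \<and> lab c z x = near_label F N (cell_map F c x) w} =
          {x \<in> unit_square. Base (Vertex u) \<in> T \<and> z = w}"
        unfolding u by simp
      then show ?thesis
        using open_const by simp
    next
      case False
      have "{x \<in> unit_square. cell_map F c x \<in> T \<and> lab c z x = near_label F N (cell_map F c x) w} =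
            {x \<in> unit_square. fst x < 1/2 \<and> (cell_base F c = v \<and> z = w) \<or>
               fst x > 1/2 \<and> (dart_src G (dart_rev (cell_dart F c)) = v \<and> N z (cell_dart F c) = w)}"
      proof (rule Collect_cong, rule conj_cong[OF refl])
        fix x assume x: "x \<in> unit_square"
        have "lab c z x = near_label F N (cell_map F c x) w \<longleftrightarrow> (if fst x < 1/2 then z = w else N z (cell_dart F c) = w)"
          if "near F (cell_map F c x) = Some v"
          using near_label_cell[OF c False x z] that w by simp
        then show "(cell_map F c x \<in> T \<and> lab c z x = near_label F N (cell_map F c x) w) =
          (fst x < 1/2 \<and> (cell_base F c = v \<and> z = w) \<or>
               fst x > 1/2 \<and> (dart_src G (dart_rev (cell_dart F c)) = v \<and> N z (cell_dart F c) = w))"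
          using near_cell[OF c False x] in_top[OF c x] unfolding T_def by (auto split: if_splits)
      qed
      then show ?thesis
        using o by simp
    qed
    moreover have "bij_betw (near_label F N y) (Zf v) (Zf (point_base F y))" if "y \<in> T" for y
      using near_label_bij that unfolding T_def by blast
    moreover have "y \<in> T"
      using y Some by (simp add: T_def)
    ultimately show ?thesis
      by (intro exI[of _ T] exI[of _ "Zf v"] exI[of _ "near_label F N"] conjI ballI)
  next
    case None
    obtain c x where c: "c \<in> cells F" and x: "x \<in> unit_square" "y = cell_map F c x"
      using y unfolding topspace_mapping_cylinder by blast
    have nv: "c \<notin> range VertexCell"
      using None x by auto
    then have "fst x = 1/2"
      using None near_cell[OF c nv x(1)] x(2) by (auto split: if_splits)
    then obtain e where e: "middle F y = Some e"
      using middle_cell[OF c nv x(1)] x(2) by simp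
    define T where "T = {y \<in> topspace (mapping_cylinder F). middle F y = Some e}"
    have "openin (mapping_cylinder F) T"
      unfolding T_def
    proof (rule openI)
      fix c assume c: "c \<in> cells F"
      show "openin ?S {x \<in> unit_square. middle F (cell_map F c x) = Some e}"
      proof (cases "c \<in> range VertexCell")
        case True
        then show ?thesis
          using open_const by auto
      next
        case False
        have "{x \<in> unit_square. middle F (cell_map F c x) = Some e} =
            {x \<in> unit_square. (0 < fst x \<and> fst x < 1) \<and> fst (cell_dart F c) = e}"
          by (rule Collect_cong, rule conj_cong[OF refl], subst middle_cell[OF c False]) auto
        then show ?thesis
          using o' by simp
      qed
    qed
    moreover have "openin ?S {x \<in> unit_square. cell_map F c x \<in> T \<and> lab c z x = middle_label F N (cell_map F c x) w}"
      if w: "w \<in> Zf (tail G e)" and c: "c \<in> cells F" and z: "z \<in> Zf (cell_base F c)" for w c z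
    proof (cases "c \<in> range VertexCell")
      case True
      then have "{x \<in> unit_square. cell_map F c x \<in> T \<and> lab c z x = middle_label F N (cell_map F c x) w} = {}"
        unfolding T_def by auto
      then show ?thesis
        by (simp only: openin_empty)
    next
      case False
      have "{x \<in> unit_square. cell_map F c x \<in> T \<and> lab c z x = middle_label F N (cell_map F c x) w} =
            {x \<in> unit_square. (0 < fst x \<and> fst x < 1) \<and>
               (fst (cell_dart F c) = e \<and> (if snd (cell_dart F c) then z = w else N z (cell_dart F c) = w))}"
      proof (rule Collect_cong, rule conj_cong[OF refl])
        fix x assume x: "x \<in> unit_square"
        show "(cell_map F c x \<in> T \<and> lab c z x = middle_label F N (cell_map F c x) w) =
          ((0 < fst x \<and> fst x < 1) \<and>
               (fst (cell_dart F c) = e \<and> (if snd (cell_dart F c) then z = w else N z (cell_dart F c) = w)))"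
          using middle_cell[OF c False x] in_top[OF c x] middle_label_cell[OF c False x z _ w] unfolding T_def
          by (auto split: if_splits)
      qed
      then show ?thesis
        using o' by simp
    qed
    moreover have "bij_betw (middle_label F N y) (Zf (tail G e)) (Zf (point_base F y))" if "y \<in> T" for y
      using middle_label_bij that unfolding T_def by blast
    moreover have "y \<in> T"
      using y e by (simp add: T_def)
    ultimately show ?thesis
      by (intro exI[of _ T] exI[of _ "Zf (tail G e)"] exI[of _ "middle_label F N"] conjI ballI)
  qed
qed

lemma cell_base_in: "c \<in> cells F \<Longrightarrow> cell_base F c \<in> verts G"
  using dart_src_in fin_dart(1) tail_in by (erule_tac cell_cases) auto

lemma cover_eq: "cover = cell_topology {(c, z). c \<in> cells F \<and> z \<in> Zf (cell_base F c)} (\<lambda>(c, z) x. (cell_map F c x, lab c z x))"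
proof -
  have "cover_map = (\<lambda>(c, z) x. (cell_map F c x, lab c z x))"
    by (auto simp: fun_eq_iff cover_map_def)
  then show ?thesis
    by (simp add: cover_def lift_cells_def)
qed

lemma covering_map_cover: "covering_map cover fst (mapping_cylinder F)"
  and topspace_cover: "topspace cover = {(y, m). y \<in> topspace (mapping_cylinder F) \<and> m \<in> Zf (point_base F y)}"
proof -
  have ne: "Zf (cell_base F c) \<noteq> {}" if "c \<in> cells F" for c
    using a_surj[OF cell_base_in[OF that]] by blast
  show "covering_map cover fst (mapping_cylinder F)"
    unfolding cover_eq mapping_cylinder_cells
    by (rule covering_map_cell_topology(1)[where pb = "point_base F"];
        (rule label_bij ne trivialization[unfolded mapping_cylinder_cells]; assumption))
  show "topspace cover = {(y, m). y \<in> topspace (mapping_cylinder F) \<and> m \<in> Zf (point_base F y)}"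
    unfolding cover_eq mapping_cylinder_cells
    by (rule covering_map_cell_topology(2)[where pb = "point_base F"];
        (rule label_bij ne trivialization[unfolded mapping_cylinder_cells]; assumption))
qed

lemma label_origin: "c \<in> cells F \<Longrightarrow> lab c z (0, 0) = z"
  by (erule cell_cases) auto

text \<open>
  The stars \<open>z\<close> of the copies in a set of cells closed under intersection form a set closed under
  \<open>N\<close>, and \<open>minimal\<close> applies.
\<close>

lemma connected_cover: "connected_space cover"
  unfolding cover_def connected_cell_topology
proof (intro allI impI)
  fix S
  assume S: "S \<subseteq> lift_cells" "S \<noteq> {}"
    and cl: "\<forall>p\<in>S. \<forall>p'\<in>lift_cells. cover_map p ` unit_square \<inter> cover_map p' ` unit_square \<noteq> {} \<longrightarrow> p' \<in> S"
  have cl: "p' \<in> S" if "p \<in> S" "p' \<in> lift_cells" "x \<in> unit_square" "x' \<in> unit_square" "cover_map p x = cover_map p' x'" for p p' x x'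
    using cl that by blast
  define W where "W = {z \<in> Z. (VertexCell (a z), z) \<in> S}"
  have vc: "(VertexCell (a z), z) \<in> lift_cells" if "z \<in> Z" for z
    using that a_in by (auto simp: lift_cells_def cells_def)
  have iff: "(c, z) \<in> S \<longleftrightarrow> z \<in> W" if "(c, z) \<in> lift_cells" for c z
  proof -
    have c: "c \<in> cells F" "z \<in> Z" "cell_base F c = a z"
      using that by (auto simp: lift_cells_def)
    have "cover_map (c, z) (0, 0) = cover_map (VertexCell (a z), z) (0, 0)"
      using c by (simp add: cover_map_def cell_map_origin label_origin)
    then show ?thesis
      using cl[of "(c, z)" "(VertexCell (a z), z)" "(0, 0)" "(0, 0)"] cl[of "(VertexCell (a z), z)" "(c, z)" "(0, 0)" "(0, 0)"]
        that vc[OF c(2)] c(2) by (auto simp: W_def)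
  qed
  have step: "z \<in> W \<longleftrightarrow> N z (e, True) \<in> W" if z: "z \<in> Z" "e \<in> arcs G" "tail G e = a z" for z e
  proof -
    have d: "(e, True) \<in> darts G" "dart_src G (e, True) = a z"
      using z by (auto simp: darts_def dart_src_def)
    have N: "N z (e, True) \<in> Z" "a (N z (e, True)) = head G e"
      using N_in[OF z(1) d] a_N[OF z(1) d] by (auto simp: dart_src_def)
    have ec: "(EdgeCell e, z) \<in> lift_cells"
      using z by (auto simp: lift_cells_def cells_def)
    have "cover_map (EdgeCell e, z) (1, 0) = cover_map (VertexCell (a (N z (e, True))), N z (e, True)) (0, 0)"
      using N by (simp add: cover_map_def edge_map_def)
    then have "(EdgeCell e, z) \<in> S \<longleftrightarrow> (VertexCell (a (N z (e, True))), N z (e, True)) \<in> S"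
      using cl[of "(EdgeCell e, z)" "(VertexCell (a (N z (e, True))), N z (e, True))" "(1, 0)" "(0, 0)"]
        cl[of "(VertexCell (a (N z (e, True))), N z (e, True))" "(EdgeCell e, z)" "(0, 0)" "(1, 0)"] ec vc[OF N(1)] by auto
    then show ?thesis
      using iff[OF ec] iff[OF vc[OF N(1)]] by blast
  qed
  have "W = Z"
  proof (rule minimal)
    show "W \<subseteq> Z"
      by (auto simp: W_def)
    obtain c z where "(c, z) \<in> S"
      using S(2) by auto
    then show "W \<noteq> {}"
      using iff[of c z] S(1) by blast
    fix z d assume z: "z \<in> W" and d: "d \<in> darts G" "dart_src G d = a z"
    have zZ: "z \<in> Z"
      using z by (simp add: W_def)
    show "N z d \<in> W"
    proof (cases "snd d")
      case True
      then have "d = (fst d, True)" "fst d \<in> arcs G" "tail G (fst d) = a z"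
        using d by (auto simp: darts_def dart_src_def prod_eq_iff)
      then show ?thesis
        using step[OF zZ] z by metis
    next
      case False
      then have e: "dart_rev d = (fst d, True)" "fst d \<in> arcs G" "tail G (fst d) = a (N z d)"
        using d a_N[OF zZ d] by (auto simp: darts_def dart_src_def dart_rev_def)
      then show ?thesis
        using step[OF N_in[OF zZ d] e(2,3)] N_N[OF zZ d] z by simp
    qed
  qed
  then have "lift_cells \<subseteq> S"
    using iff by (auto simp: lift_cells_def)
  then show "S = lift_cells"
    using S by blast
qed

lemma finite_index_cover: "finite_index_cover cover fst (fin_complex F)"
  unfolding finite_index_cover_def
proof (intro conjI ballI)
  have X: "complex_space (fin_complex F) = mapping_cylinder F"
    by (simp add: fin_complex_def)
  show "covering_map cover fst (complex_space (fin_complex F))"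
    unfolding X by (rule covering_map_cover)
  show "connected_space cover"
    by (rule connected_cover)
  fix x assume "x \<in> topspace (complex_space (fin_complex F))"
  have "{e \<in> topspace cover. fst e = x} \<subseteq> {x} \<times> Z"
    unfolding topspace_cover by auto
  then show "finite {e \<in> topspace cover. fst e = x}"
    using fin_Z finite_subset by blast
qed

end

section \<open>Cells of an assembled cover\<close>

lemma self_isometry_interval_refl: "self_isometry unit_interval (\<lambda>s. s)"
  by (simp add: self_isometry_def)

lemma self_isometry_interval_rev: "self_isometry unit_interval (\<lambda>s. 1 - s)"
proof -
  have "(\<lambda>s. 1 - s) ` unit_interval = unit_interval"
    by (auto simp: image_iff intro!: bexI[of _ "1 - _"])
  then show ?thesis
    by (auto simp: self_isometry_def dist_real_def)
qed

lemma self_isometry_square_refl: "self_isometry unit_square (\<lambda>x. x)"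
  by (simp add: self_isometry_def)

lemma self_isometry_square_rev: "self_isometry unit_square (\<lambda>x. (1 - fst x, snd x))"
proof -
  have "(\<lambda>x. (1 - fst x, snd x)) ` unit_square = unit_square"
  proof (intro set_eqI iffI)
    fix x :: "real \<times> real" assume "x \<in> unit_square"
    then show "x \<in> (\<lambda>x. (1 - fst x, snd x)) ` unit_square"
      by (intro image_eqI[of _ _ "(1 - fst x, snd x)"]) auto
  qed auto
  then show ?thesis
    by (auto simp: self_isometry_def dist_Pair_Pair dist_real_def abs_minus_commute)
qed

text \<open>
  Lifted cells are lifts of the characteristic maps themselves, without reparametrization. As \<open>g\<close>
  is an involution, composition with \<open>g\<close> turns \<open>f \<circ> \<phi>\<close> into such a lift.
\<close>

lemma maps_cells_lifted:
  assumes "\<And>\<phi>. \<phi> \<in> \<Phi> \<Longrightarrow> continuous_map (top_of_set C) E (\<lambda>x. f (\<phi> x)) \<and>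
     (\<exists>\<psi>\<in>\<Psi>. \<exists>g. self_isometry C g \<and> continuous_on C g \<and> (\<forall>x\<in>C. g (g x) = x) \<and> (\<forall>x\<in>C. p (f (\<phi> x)) = \<psi> (g x)))"
  shows "maps_cells C f \<Phi> (lifted_cells C E p \<Psi>)"
  unfolding maps_cells_def
proof
  fix \<phi> assume "\<phi> \<in> \<Phi>"
  note 1 = assms[OF this]
  note c = conjunct1[OF 1]
  from conjunct2[OF 1] obtain \<psi> g where \<psi>: "\<psi> \<in> \<Psi>"
    and *: "self_isometry C g \<and> continuous_on C g \<and> (\<forall>x\<in>C. g (g x) = x) \<and> (\<forall>x\<in>C. p (f (\<phi> x)) = \<psi> (g x))"
    by (elim bexE exE)
  then have g: "self_isometry C g" "continuous_on C g" "\<And>x. x \<in> C \<Longrightarrow> g (g x) = x" "\<And>x. x \<in> C \<Longrightarrow> p (f (\<phi> x)) = \<psi> (g x)"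
    by simp_all
  have gC: "g x \<in> C" if "x \<in> C" for x
    using g(1) that unfolding self_isometry_def by blast
  have "continuous_map (top_of_set C) (top_of_set C) g"
    using g(2) gC by (auto simp: continuous_map_in_subtopology)
  from continuous_map_compose[OF this c] have "continuous_map (top_of_set C) E (\<lambda>x. f (\<phi> (g x)))"
    by (simp add: o_def)
  moreover have "\<forall>x\<in>C. p (f (\<phi> (g x))) = \<psi> x"
    using g gC by simp
  ultimately have "(\<lambda>x. f (\<phi> (g x))) \<in> lifted_cells C E p \<Psi>"
    using \<psi> unfolding lifted_cells_def by blast
  moreover have "\<forall>x\<in>C. f (\<phi> x) = f (\<phi> (g (g x)))"
    using g by simp
  ultimately show "\<exists>\<psi>\<in>lifted_cells C E p \<Psi>. \<exists>g. self_isometry C g \<and> (\<forall>x\<in>C. f (\<phi> x) = \<psi> (g x))"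
    using g(1) by (intro bexI[of _ "\<lambda>x. f (\<phi> (g x))"] exI[of _ g] conjI)
qed

context fin_cover
begin

definition dart_lift where
  "dart_lift z d s = (if snd d then cover_map (EdgeCell (fst d), z) (s, 0)
     else cover_map (EdgeCell (fst d), N z d) (1 - s, 0))"

definition corner_lift where
  "corner_lift z q x = (case q of (i, k, b) \<Rightarrow> if b then cover_map (SquareCell i k, z) x
     else cover_map (SquareCell i (circle_prev (fin_length F i) k), N z (corner_dart F q)) (1 - fst x, snd x))"

lemma dart_lift_rev:
  assumes "z \<in> Z" "d \<in> darts G" "dart_src G d = a z"
  shows "dart_lift (N z d) (dart_rev d) s = dart_lift z d (1 - s)"
  using N_N[OF assms] by (simp add: dart_lift_def)

lemma fst_dart_lift: "fst (dart_lift z d s) = Base (dart_map G d s)"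
  by (auto simp: dart_lift_def cover_map_def dart_map_def)

lemma snd_dart_lift:
  assumes z: "z \<in> Z" "d \<in> darts G" "dart_src G d = a z"
  shows "snd (dart_lift z d s) = (if (if snd d then s = 1 else s \<noteq> 0) then N z d else z)"
proof (cases "snd d")
  case True
  then have "(fst d, True) = d"
    by (simp add: prod_eq_iff)
  then show ?thesis
    using True by (simp add: dart_lift_def cover_map_def)
next
  case False
  then have "(fst d, True) = dart_rev d"
    by (simp add: dart_rev_def)
  then show ?thesis
    using False N_N[OF z] by (simp add: dart_lift_def cover_map_def)
qed

lemma dart_lift_0:
  assumes "z \<in> Z" "d \<in> darts G" "dart_src G d = a z"
  shows "dart_lift z d 0 = (Base (Vertex (a z)), z)"
proof (rule prod_eqI)
  show "fst (dart_lift z d 0) = fst (Base (Vertex (a z)), z)"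
    by (simp add: fst_dart_lift dart_map_0 assms(3))
  show "snd (dart_lift z d 0) = snd (Base (Vertex (a z)), z)"
    by (simp add: snd_dart_lift[OF assms])
qed

lemma continuous_edge_slice:
  assumes "e \<in> arcs G" "z \<in> Z" "a z = tail G e"
  shows "continuous_map (top_of_set unit_interval) cover (\<lambda>s. cover_map (EdgeCell e, z) (s, 0))"
proof -
  have "(EdgeCell e, z) \<in> lift_cells"
    using assms by (auto simp: lift_cells_def cells_def)
  then have c: "continuous_map (top_of_set unit_square) cover (cover_map (EdgeCell e, z))"
    unfolding cover_def by (rule continuous_map_cell)
  have "continuous_map (top_of_set unit_interval) (top_of_set unit_square) (\<lambda>s. (s, 0))"
    by (auto simp: continuous_map_in_subtopology intro!: continuous_intros)
  from continuous_map_compose[OF this c] show ?thesis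
    by (simp add: o_def)
qed

lemma continuous_interval_rev:
  "continuous_map (top_of_set unit_interval) X \<phi> \<Longrightarrow> continuous_map (top_of_set unit_interval) X (\<lambda>s. \<phi> (1 - s))"
proof -
  assume c: "continuous_map (top_of_set unit_interval) X \<phi>"
  have "continuous_map (top_of_set unit_interval) (top_of_set unit_interval) (\<lambda>s. 1 - s)"
    by (auto simp: continuous_map_in_subtopology intro!: continuous_intros)
  from continuous_map_compose[OF this c] show ?thesis
    by (simp add: o_def)
qed

lemma continuous_dart_lift:
  assumes z: "z \<in> Z" "d \<in> darts G" "dart_src G d = a z"
  shows "continuous_map (top_of_set unit_interval) cover (dart_lift z d)"
proof -
  have e: "fst d \<in> arcs G"
    using z by (auto simp: darts_def)
  show ?thesis
  proof (cases "snd d")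
    case True
    then have "dart_lift z d = (\<lambda>s. cover_map (EdgeCell (fst d), z) (s, 0))"
      by (simp add: dart_lift_def fun_eq_iff)
    then show ?thesis
      using continuous_edge_slice[OF e z(1)] True z(3) by (simp add: dart_src_def)
  next
    case False
    then have "dart_lift z d = (\<lambda>s. cover_map (EdgeCell (fst d), N z d) (1 - s, 0))"
      by (simp add: dart_lift_def fun_eq_iff)
    moreover have "a (N z d) = tail G (fst d)"
      using a_N[OF z] False by (simp add: dart_src_def)
    ultimately show ?thesis
      using continuous_interval_rev[OF continuous_edge_slice[OF e N_in[OF z]]] by simp
  qed
qed

lemma corner_lift_flip:
  assumes z: "z \<in> Z" and q: "q \<in> corners F" "dart_src G (corner_dart F q) = a z"
  shows "corner_lift (N z (corner_dart F q)) (corner_flip F q) (s, t) = corner_lift z q (1 - s, t)"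
proof -
  obtain i k b where ikb: "q = (i, k, b)"
    by (metis prod_cases3)
  have ik: "i < num_fins F" "k < fin_length F i"
    using q ikb by (auto simp: corners_def)
  have NN: "N (N z (corner_dart F q)) (dart_rev (corner_dart F q)) = z"
    by (rule N_N[OF z corner_dart_in[OF q(1)] q(2)])
  show ?thesis
    using NN ik unfolding ikb corner_lift_def by (cases b) (simp_all add: circle_prev_next)
qed

lemma fst_corner_lift: "fst (corner_lift z q x) = corner_map F q x"
  by (cases q) (auto simp: corner_lift_def cover_map_def)

lemma corner_lift_side:
  assumes z: "z \<in> Z" and q: "q \<in> corners F" "dart_src G (corner_dart F q) = a z"
  shows "corner_lift z q (0, t) = (vertical_map F q t, z)"
proof -
  obtain i k b where ikb: "q = (i, k, b)"
    by (metis prod_cases3)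
  have NN: "N (N z (corner_dart F q)) (dart_rev (corner_dart F q)) = z"
    by (rule N_N[OF z corner_dart_in[OF q(1)] q(2)])
  have "fst (corner_lift z q (0, t)) = vertical_map F q t"
    unfolding fst_corner_lift by (rule corner_map_side[OF q(1)])
  moreover have "snd (corner_lift z q (0, t)) = z"
    using NN unfolding ikb corner_lift_def cover_map_def by (cases b) simp_all
  ultimately show ?thesis
    by (simp add: prod_eq_iff)
qed

lemma corner_lift_bottom:
  assumes z: "z \<in> Z" and q: "q \<in> corners F" "dart_src G (corner_dart F q) = a z" and s: "s \<in> unit_interval"
  shows "corner_lift z q (s, 0) = dart_lift z (corner_dart F q) s"
proof -
  have pos: "corner_lift z (i, k, True) (s, 0) = dart_lift z (fin_dart F i k) s"
    if "z \<in> Z" "(i, k, True) \<in> corners F" "dart_src G (fin_dart F i k) = a z" "s \<in> unit_interval" for i k z s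
  proof -
    have ik: "i < num_fins F" "k < fin_length F i"
      using that by (auto simp: corners_def)
    have "snd (corner_lift z (i, k, True) (s, 0)) = snd (dart_lift z (fin_dart F i k) s)"
      unfolding snd_dart_lift[OF that(1) fin_dart(1)[OF ik] that(3)] using that(4)
      by (auto simp: corner_lift_def cover_map_def)
    moreover have "fst (corner_lift z (i, k, True) (s, 0)) = fst (dart_lift z (fin_dart F i k) s)"
      unfolding fst_corner_lift fst_dart_lift using corner_map_bottom[OF that(2,4)] by simp
    ultimately show ?thesis
      by (simp add: prod_eq_iff)
  qed
  obtain i k b where ikb: "q = (i, k, b)"
    by (metis prod_cases3)
  show ?thesis
  proof (cases b)
    case True
    then show ?thesis
      using pos[OF z _ _ s] q ikb by simp
  next
    case False
    let ?d = "corner_dart F q"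
    note d = corner_dart_in[OF q(1)]
    have fl: "corner_flip F q = (i, circle_prev (fin_length F i) k, True)"
      using ikb False by simp
    have d': "fin_dart F i (circle_prev (fin_length F i) k) = dart_rev ?d"
      using ikb False by simp
    have s': "1 - s \<in> unit_interval"
      using s by auto
    have "corner_lift z q (s, 0) = corner_lift (N z ?d) (corner_flip F q) (1 - s, 0)"
      using corner_lift_flip[OF z q, of "1 - s" 0] by simp
    also have "\<dots> = dart_lift (N z ?d) (dart_rev ?d) (1 - s)"
      unfolding fl d'[symmetric]
    proof (rule pos[OF N_in[OF z d q(2)] _ _ s'])
      show "(i, circle_prev (fin_length F i) k, True) \<in> corners F"
        using corner_flip_in[OF q(1)] fl by simp
      show "dart_src G (fin_dart F i (circle_prev (fin_length F i) k)) = a (N z ?d)"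
        using a_N[OF z d q(2)] d' by simp
    qed
    also have "\<dots> = dart_lift z ?d s"
      using dart_lift_rev[OF z d q(2), of "1 - s"] by simp
    finally show ?thesis .
  qed
qed

lemma continuous_square_cell:
  assumes "i < num_fins F" "k < fin_length F i" "z \<in> Z" "a z = dart_src G (fin_dart F i k)"
  shows "continuous_map (top_of_set unit_square) cover (cover_map (SquareCell i k, z))"
proof -
  have "(SquareCell i k, z) \<in> lift_cells"
    using assms by (auto simp: lift_cells_def cells_def)
  then show ?thesis
    unfolding cover_def by (rule continuous_map_cell)
qed

lemma continuous_corner_lift:
  assumes z: "z \<in> Z" and q: "q \<in> corners F" "dart_src G (corner_dart F q) = a z"
  shows "continuous_map (top_of_set unit_square) cover (corner_lift z q)"
proof -
  obtain i k b where ikb: "q = (i, k, b)"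
    by (metis prod_cases3)
  have ik: "i < num_fins F" "k < fin_length F i"
    using q ikb by (auto simp: corners_def)
  show ?thesis
  proof (cases b)
    case True
    then have "corner_lift z q = cover_map (SquareCell i k, z)"
      by (simp add: corner_lift_def ikb fun_eq_iff)
    then show ?thesis
      using continuous_square_cell[OF ik z] q(2) ikb True by simp
  next
    case False
    let ?k = "circle_prev (fin_length F i) k" and ?z = "N z (corner_dart F q)"
    have eq: "corner_lift z q = (\<lambda>x. cover_map (SquareCell i ?k, ?z) (1 - fst x, snd x))"
      using False by (simp add: corner_lift_def ikb fun_eq_iff)
    have "a ?z = dart_src G (fin_dart F i ?k)"
      using a_N[OF z corner_dart_in[OF q(1)] q(2)] ikb False by simp
    then have c: "continuous_map (top_of_set unit_square) cover (cover_map (SquareCell i ?k, ?z))"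
      using continuous_square_cell[OF ik(1) circle_prev_less[OF ik(2)] N_in[OF z corner_dart_in[OF q(1)] q(2)]] by simp
    have "continuous_map (top_of_set unit_square) (top_of_set unit_square) (\<lambda>x. (1 - fst x, snd x))"
      by (auto simp: continuous_map_in_subtopology intro!: continuous_intros)
    from continuous_map_compose[OF this c] show ?thesis
      unfolding eq by (simp add: o_def)
  qed
qed

lemma cover_point:
  assumes "p \<in> topspace cover"
  obtains (vertex) z where "z \<in> Z" "p = (Base (Vertex (a z)), z)"
    | (dart) z e s where "z \<in> Z" "e \<in> arcs G" "a z = tail G e" "s \<in> unit_interval" "p = dart_lift z (e, True) s"
    | (corner) z i k x where "z \<in> Z" "(i, k, True) \<in> corners F" "a z = dart_src G (fin_dart F i k)" "x \<in> unit_square"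
       "p = corner_lift z (i, k, True) x"
proof -
  obtain c z x where c: "(c, z) \<in> lift_cells" and x: "x \<in> unit_square" "p = cover_map (c, z) x"
    using assms unfolding cover_def topspace_cell_topology by auto
  have z: "c \<in> cells F" "z \<in> Z" "a z = cell_base F c"
    using c by (auto simp: lift_cells_def)
  from z(1) show thesis
  proof (cases rule: cell_cases)
    case (vertex v)
    then show thesis
      using that(1)[of z] z x by (simp add: cover_map_def)
  next
    case (edge e)
    then have "p = dart_lift z (e, True) (fst x)" "fst x \<in> unit_interval"
      using x by (auto simp: cover_map_def dart_lift_def)
    then show thesis
      using that(2)[of z e "fst x"] z edge by simp
  next
    case (square i k)
    then have "p = corner_lift z (i, k, True) x" "(i, k, True) \<in> corners F"
      using x by (auto simp: corner_lift_def corners_def)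
    then show thesis
      using that(3)[of z i k x] z square x by simp
  qed
qed

end

section \<open>Isomorphisms between assembled covers\<close>

text \<open>
  Two covers with the same set \<open>Z\<close> of stars, and for each star \<open>z\<close> a bijection of its darts and
  corners in the first cover with those in the second one. The conditions on \<open>N1 z d\<close> say that the
  bijections at both ends of an edge agree on this edge and on its squares.
\<close>

locale matched_covers = C1: fin_cover F1 Z a1 N1 + C2: fin_cover F2 Z a2 N2
  for F1 :: "('v1, 'e1) fin_data" and F2 :: "('v2, 'e2) fin_data" and Z a1 N1 a2 N2 +
  fixes \<alpha> :: "nat \<Rightarrow> 'e1 \<times> bool \<Rightarrow> 'e2 \<times> bool" and \<gamma> :: "nat \<Rightarrow> nat \<times> nat \<times> bool \<Rightarrow> nat \<times> nat \<times> bool"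
  assumes \<alpha>: "z \<in> Z \<Longrightarrow> d \<in> darts (base_graph F1) \<Longrightarrow> dart_src (base_graph F1) d = a1 z \<Longrightarrow>
      \<alpha> z d \<in> darts (base_graph F2) \<and> dart_src (base_graph F2) (\<alpha> z d) = a2 z \<and>
      N2 z (\<alpha> z d) = N1 z d \<and> \<alpha> (N1 z d) (dart_rev d) = dart_rev (\<alpha> z d)"
    and \<gamma>: "z \<in> Z \<Longrightarrow> q \<in> corners F1 \<Longrightarrow> dart_src (base_graph F1) (corner_dart F1 q) = a1 z \<Longrightarrow>
      \<gamma> z q \<in> corners F2 \<and> corner_dart F2 (\<gamma> z q) = \<alpha> z (corner_dart F1 q) \<and>
      \<gamma> z (corner_opp q) = corner_opp (\<gamma> z q) \<and>
      \<gamma> (N1 z (corner_dart F1 q)) (corner_flip F1 q) = corner_flip F2 (\<gamma> z q)"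
begin

text \<open>
  Points on an edge or in a square are sent to the points with the same coordinates. The
  direction of the edge and of the circle makes the coordinates unambiguous.
\<close>

definition iso_map where
  "iso_map p = (let z = snd p in case fst p of
      Base y \<Rightarrow> (case y of Vertex v \<Rightarrow> (Base (Vertex (a2 z)), z) | Inner e s \<Rightarrow> C2.dart_lift z (\<alpha> z (e, True)) s)
    | Fin i y t \<Rightarrow> (case y of Vertex k \<Rightarrow> C2.corner_lift z (\<gamma> z (i, k, True)) (0, t)
        | Inner k s \<Rightarrow> C2.corner_lift z (\<gamma> z (i, k, True)) (s, t)))"

lemma iso_map_vertex: "iso_map (Base (Vertex v), z) = (Base (Vertex (a2 z)), z)"
  by (simp add: iso_map_def)

text \<open>
  For a negative dart the coordinates are taken at the other end, where the matching is the
  same by compatibility.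
\<close>

lemma iso_map_dart:
  assumes z: "z \<in> Z" and d: "d \<in> darts C1.G" "dart_src C1.G d = a1 z" and s: "s \<in> unit_interval"
  shows "iso_map (C1.dart_lift z d s) = C2.dart_lift z (\<alpha> z d) s"
proof -
  have pos: "iso_map (C1.dart_lift z d s) = C2.dart_lift z (\<alpha> z d) s"
    if z: "z \<in> Z" and d: "d \<in> darts C1.G" "dart_src C1.G d = a1 z" and s: "s \<in> unit_interval" and pos: "snd d" for z d s
  proof -
    note A = \<alpha>[OF z d]
    have e: "d = (fst d, True)"
      using pos by (simp add: prod_eq_iff)
    have s_cases: "s = 0 \<or> s = 1 \<or> 0 < s \<and> s < 1"
      using s by force
    consider "s = 0" | "s = 1" | "0 < s" "s < 1"
      using s_cases by blast
    then show ?thesis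
    proof cases
      case 1
      then show ?thesis
        using C1.dart_lift_0[OF z d] C2.dart_lift_0[OF z, of "\<alpha> z d"] A by (simp add: iso_map_vertex)
    next
      case 2
      have "C1.dart_lift z d 1 = C1.dart_lift (N1 z d) (dart_rev d) 0"
        using C1.dart_lift_rev[OF z d, of 0] by simp
      also have "\<dots> = (Base (Vertex (a1 (N1 z d))), N1 z d)"
        using C1.dart_lift_0[OF C1.N_in[OF z d], of "dart_rev d"] C1.a_N[OF z d] d by simp
      finally have "iso_map (C1.dart_lift z d 1) = (Base (Vertex (a2 (N1 z d))), N1 z d)"
        by (simp add: iso_map_vertex)
      moreover have "C2.dart_lift z (\<alpha> z d) 1 = C2.dart_lift (N2 z (\<alpha> z d)) (dart_rev (\<alpha> z d)) 0"
        using C2.dart_lift_rev[OF z, of "\<alpha> z d" 0] A by simp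
      moreover have "\<dots> = (Base (Vertex (a2 (N2 z (\<alpha> z d)))), N2 z (\<alpha> z d))"
        using C2.dart_lift_0[OF C2.N_in[OF z, of "\<alpha> z d"], of "dart_rev (\<alpha> z d)"] C2.a_N[OF z, of "\<alpha> z d"] A by simp
      ultimately show ?thesis
        using 2 A by simp
    next
      case 3
      have "C1.dart_lift z d s = (Base (Inner (fst d) s), z)"
        using pos 3 C1.fst_dart_lift[of z d s] C1.snd_dart_lift[OF z d, of s]
        by (simp add: prod_eq_iff dart_map_inner)
      then show ?thesis
        using e by (simp add: iso_map_def)
    qed
  qed
  show ?thesis
  proof (cases "snd d")
    case True
    then show ?thesis
      using pos[OF z d s] by simp
  next
    case False
    note A = \<alpha>[OF z d]
    have s': "1 - s \<in> unit_interval"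
      using s by auto
    have "C1.dart_lift z d s = C1.dart_lift (N1 z d) (dart_rev d) (1 - s)"
      using C1.dart_lift_rev[OF z d, of "1 - s"] by simp
    also have "iso_map \<dots> = C2.dart_lift (N1 z d) (\<alpha> (N1 z d) (dart_rev d)) (1 - s)"
      using pos[OF C1.N_in[OF z d], of "dart_rev d"] C1.a_N[OF z d] d(1) False s' by simp
    also have "\<dots> = C2.dart_lift (N2 z (\<alpha> z d)) (dart_rev (\<alpha> z d)) (1 - s)"
      using A by simp
    also have "\<dots> = C2.dart_lift z (\<alpha> z d) s"
      using C2.dart_lift_rev[OF z, of "\<alpha> z d" "1 - s"] A by simp
    finally show ?thesis .
  qed
qed

lemma iso_map_corner:
  assumes z: "z \<in> Z" and q: "q \<in> corners F1" "dart_src C1.G (corner_dart F1 q) = a1 z" and x: "x \<in> unit_square"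
  shows "iso_map (C1.corner_lift z q x) = C2.corner_lift z (\<gamma> z q) x"
proof -
  have \<gamma>': "\<gamma> z q \<in> corners F2" "corner_dart F2 (\<gamma> z q) = \<alpha> z (corner_dart F1 q)" "\<gamma> z (corner_opp q) = corner_opp (\<gamma> z q)"
    "\<gamma> (N1 z (corner_dart F1 q)) (corner_flip F1 q) = corner_flip F2 (\<gamma> z q)"
    "dart_src C2.G (corner_dart F2 (\<gamma> z q)) = a2 z" "N2 z (corner_dart F2 (\<gamma> z q)) = N1 z (corner_dart F1 q)"
    if "z \<in> Z" "q \<in> corners F1" "dart_src C1.G (corner_dart F1 q) = a1 z" for z q
    using \<gamma>[OF that] \<alpha>[OF that(1) C1.corner_dart_in[OF that(2)] that(3)] by simp_all
  have bottom: "iso_map (C1.corner_lift z q (s, 0)) = C2.corner_lift z (\<gamma> z q) (s, 0)"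
    if "z \<in> Z" "q \<in> corners F1" "dart_src C1.G (corner_dart F1 q) = a1 z" "s \<in> unit_interval" for z q s
    using C1.corner_lift_bottom[OF that] C2.corner_lift_bottom[OF that(1) \<gamma>'(1,5)[OF that(1-3)] that(4)]
      iso_map_dart[OF that(1) C1.corner_dart_in[OF that(2)] that(3,4)] \<gamma>'(2)[OF that(1-3)] by simp
  have side: "iso_map (C1.corner_lift z q (0, t)) = C2.corner_lift z (\<gamma> z q) (0, t)"
    if z: "z \<in> Z" and q: "q \<in> corners F1" "dart_src C1.G (corner_dart F1 q) = a1 z" and t: "t \<in> unit_interval" for z q t
  proof (cases "t = 0")
    case True
    then show ?thesis
      using bottom[OF z q, of 0] by simp
  next
    case False
    obtain i k b where ikb: "q = (i, k, b)"
      by (metis prod_cases3)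
    have "C1.corner_lift z q (0, t) = (Fin i (Vertex k) t, z)"
      using C1.corner_lift_side[OF z q] False by (simp add: ikb fin_point_def)
    then have 1: "iso_map (C1.corner_lift z q (0, t)) = C2.corner_lift z (\<gamma> z (i, k, True)) (0, t)"
      by (simp add: iso_map_def)
    show ?thesis
    proof (cases b)
      case True
      then show ?thesis
        using 1 ikb by simp
    next
      case False
      then have "(i, k, True) = corner_opp q"
        using ikb by simp
      then have 2: "\<gamma> z (i, k, True) = corner_opp (\<gamma> z q)"
        using \<gamma>'(3)[OF z q] by simp
      have "C2.corner_lift z (corner_opp (\<gamma> z q)) (0, t) = C2.corner_lift z (\<gamma> z q) (0, t)"
        using C2.corner_lift_side[OF z, of "corner_opp (\<gamma> z q)" t] C2.corner_lift_side[OF z, of "\<gamma> z q" t]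
          \<gamma>'(1,5)[OF z q] C2.corner_src_opp[OF \<gamma>'(1)[OF z q]] by (simp add: vertical_map_opp)
      then show ?thesis
        using 1 2 by simp
    qed
  qed
  have pos: "iso_map (C1.corner_lift z q x) = C2.corner_lift z (\<gamma> z q) x"
    if z: "z \<in> Z" and q: "q \<in> corners F1" "dart_src C1.G (corner_dart F1 q) = a1 z" and x: "x \<in> unit_square"
      and ikb: "q = (i, k, True)" for z q x i k
  proof -
    obtain s t where st: "x = (s, t)" "s \<in> unit_interval" "t \<in> unit_interval"
      using x by blast
    consider "t = 0" | "s = 0" | "s = 1" | "t \<noteq> 0" "0 < s" "s < 1"
      using st(2) by force
    then show ?thesis
    proof cases
      case 1
      then show ?thesis
        using bottom[OF z q st(2)] st by simp
    next
      case 2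
      then show ?thesis
        using side[OF z q st(3)] st by simp
    next
      case 3
      let ?z = "N1 z (corner_dart F1 q)"
      note d = C1.corner_dart_in[OF q(1)]
      have fq: "corner_flip F1 q \<in> corners F1" "dart_src C1.G (corner_dart F1 (corner_flip F1 q)) = a1 ?z"
        using C1.corner_flip_in[OF q(1)] C1.corner_dart_flip[OF q(1)] C1.a_N[OF z d q(2)] by simp_all
      have "C1.corner_lift z q (1, t) = C1.corner_lift ?z (corner_flip F1 q) (0, t)"
        using C1.corner_lift_flip[OF z q, of 0 t] by simp
      also have "iso_map \<dots> = C2.corner_lift ?z (\<gamma> ?z (corner_flip F1 q)) (0, t)"
        by (rule side[OF C1.N_in[OF z d q(2)] fq st(3)])
      also have "\<dots> = C2.corner_lift (N2 z (corner_dart F2 (\<gamma> z q))) (corner_flip F2 (\<gamma> z q)) (0, t)"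
        using \<gamma>'(4,6)[OF z q] by simp
      also have "\<dots> = C2.corner_lift z (\<gamma> z q) (1, t)"
        using C2.corner_lift_flip[OF z \<gamma>'(1,5)[OF z q], of 0 t] by simp
      finally show ?thesis
        using 3 st by simp
    next
      case 4
      have "C1.corner_lift z q x = (Fin i (Inner k s) t, z)"
        using 4 by (simp add: st(1) ikb C1.corner_lift_def C1.cover_map_def square_map_def fin_point_def fin_circle_def edge_map_cycle)
      then show ?thesis
        by (simp add: iso_map_def st(1) ikb)
    qed
  qed
  obtain i k b where ikb: "q = (i, k, b)"
    by (metis prod_cases3)
  show ?thesis
  proof (cases b)
    case True
    then show ?thesis
      using pos[OF z q x] ikb by simp
  next
    case False
    let ?z = "N1 z (corner_dart F1 q)"
    note d = C1.corner_dart_in[OF q(1)]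
    have fq: "corner_flip F1 q \<in> corners F1" "dart_src C1.G (corner_dart F1 (corner_flip F1 q)) = a1 ?z"
      using C1.corner_flip_in[OF q(1)] C1.corner_dart_flip[OF q(1)] C1.a_N[OF z d q(2)] by simp_all
    obtain s t where st: "x = (s, t)"
      by (cases x)
    have x': "(1 - s, t) \<in> unit_square"
      using x st by auto
    have fl: "corner_flip F1 q = (i, circle_prev (fin_length F1 i) k, True)"
      using ikb False by simp
    have "C1.corner_lift z q x = C1.corner_lift ?z (corner_flip F1 q) (1 - s, t)"
      using C1.corner_lift_flip[OF z q, of "1 - s" t] st by simp
    also have "iso_map \<dots> = C2.corner_lift ?z (\<gamma> ?z (corner_flip F1 q)) (1 - s, t)"
      by (rule pos[OF C1.N_in[OF z d q(2)] fq x' fl])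
    also have "\<dots> = C2.corner_lift (N2 z (corner_dart F2 (\<gamma> z q))) (corner_flip F2 (\<gamma> z q)) (1 - s, t)"
      using \<gamma>'(4,6)[OF z q] by simp
    also have "\<dots> = C2.corner_lift z (\<gamma> z q) x"
      using C2.corner_lift_flip[OF z \<gamma>'(1,5)[OF z q], of "1 - s" t] st by simp
    finally show ?thesis .
  qed
qed

lemma continuous_iso_map: "continuous_map C1.cover C2.cover iso_map"
  unfolding C1.cover_def
proof (rule continuous_map_from_cell_topology)
  fix p assume "p \<in> C1.lift_cells"
  then obtain c z where p: "p = (c, z)" "c \<in> cells F1" "z \<in> Z" "a1 z = cell_base F1 c"
    by (auto simp: C1.lift_cells_def)
  from p(2) show "continuous_map (top_of_set unit_square) C2.cover (\<lambda>x. iso_map (C1.cover_map p x))"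
  proof (cases rule: C1.cell_cases)
    case (vertex v)
    have 1: "iso_map (C1.cover_map p x) = C2.cover_map (VertexCell (a2 z), z) x" for x
      using p vertex by (simp add: C1.cover_map_def C2.cover_map_def iso_map_vertex)
    have "(VertexCell (a2 z), z) \<in> C2.lift_cells"
      using p C2.a_in by (auto simp: C2.lift_cells_def cells_def)
    then have "continuous_map (top_of_set unit_square) C2.cover (C2.cover_map (VertexCell (a2 z), z))"
      unfolding C2.cover_def by (rule continuous_map_cell)
    then show ?thesis
      by (simp add: 1)
  next
    case (edge e)
    have d: "(e, True) \<in> darts C1.G" "dart_src C1.G (e, True) = a1 z"
      using edge p by (auto simp: darts_def dart_src_def)
    have 1: "iso_map (C1.cover_map p x) = C2.dart_lift z (\<alpha> z (e, True)) (fst x)" if "x \<in> unit_square" for x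
    proof -
      have "C1.cover_map p x = C1.dart_lift z (e, True) (fst x)"
        by (simp add: p edge C1.dart_lift_def C1.cover_map_def)
      then show ?thesis
        using iso_map_dart[OF p(3) d, of "fst x"] that by auto
    qed
    have c: "continuous_map (top_of_set unit_interval) C2.cover (C2.dart_lift z (\<alpha> z (e, True)))"
      using C2.continuous_dart_lift[OF p(3)] \<alpha>[OF p(3) d] by blast
    have "continuous_map (top_of_set unit_square) (top_of_set unit_interval) fst"
      by (auto simp: continuous_map_in_subtopology intro!: continuous_on_fst continuous_on_id)
    from continuous_map_compose[OF this c] show ?thesis
      by (rule continuous_map_eq) (simp only: o_apply topspace_euclidean_subtopology 1)
  next
    case (square i k)
    have q: "(i, k, True) \<in> corners F1" "dart_src C1.G (corner_dart F1 (i, k, True)) = a1 z"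
      using square p by (auto simp: corners_def)
    have 1: "iso_map (C1.cover_map p x) = C2.corner_lift z (\<gamma> z (i, k, True)) x" if "x \<in> unit_square" for x
    proof -
      have "C1.cover_map p x = C1.corner_lift z (i, k, True) x"
        by (simp add: p square C1.corner_lift_def)
      then show ?thesis
        using iso_map_corner[OF p(3) q that] by simp
    qed
    have "\<gamma> z (i, k, True) \<in> corners F2" "dart_src C2.G (corner_dart F2 (\<gamma> z (i, k, True))) = a2 z"
      using \<gamma>[OF p(3) q] \<alpha>[OF p(3) C1.corner_dart_in[OF q(1)] q(2)] by simp_all
    from C2.continuous_corner_lift[OF p(3) this] show ?thesis
      by (rule continuous_map_eq) (simp only: topspace_euclidean_subtopology 1)
  qed
qed

lemma corner_image:
  assumes "z \<in> Z" "q \<in> corners F1" "dart_src C1.G (corner_dart F1 q) = a1 z"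
  shows "\<gamma> z q \<in> corners F2" "dart_src C2.G (corner_dart F2 (\<gamma> z q)) = a2 z"
proof -
  show "\<gamma> z q \<in> corners F2"
    using \<gamma>[OF assms] by blast
  have "corner_dart F2 (\<gamma> z q) = \<alpha> z (corner_dart F1 q)"
    using \<gamma>[OF assms] by blast
  then show "dart_src C2.G (corner_dart F2 (\<gamma> z q)) = a2 z"
    using \<alpha>[OF assms(1) C1.corner_dart_in[OF assms(2)] assms(3)] by simp
qed

end

section \<open>The isomorphism is cubical\<close>

text \<open>
  The parametrizations of edges that arise from darts and corners; in contrast to
  characteristic maps, each edge of the base graph or of the boundary is traversed in both directions.
\<close>

definition edge_paths :: "('v, 'e) fin_data \<Rightarrow> (real \<Rightarrow> ('v, 'e) cylinder_point) set" where
  "edge_paths F = {\<lambda>t. Base (dart_map (base_graph F) d t) | d. d \<in> darts (base_graph F)} \<union>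
     {\<lambda>t. corner_map F q (t, 1) | q. q \<in> corners F} \<union> {vertical_map F q | q. q \<in> corners F}"

lemma edge_paths_intros:
  "d \<in> darts (base_graph F) \<Longrightarrow> (\<lambda>t. Base (dart_map (base_graph F) d t)) \<in> edge_paths F"
  "q \<in> corners F \<Longrightarrow> (\<lambda>t. corner_map F q (t, 1)) \<in> edge_paths F"
  "q \<in> corners F \<Longrightarrow> vertical_map F q \<in> edge_paths F"
  unfolding edge_paths_def by blast+

lemma edge_maps_cases:
  assumes "\<psi> \<in> edge_maps (fin_complex F)"
  obtains (base) e where "e \<in> arcs (base_graph F)" "\<psi> = (\<lambda>t. Base (dart_map (base_graph F) (e, True) t))"
    | (outer) i k where "(i, k, True) \<in> corners F" "\<psi> = (\<lambda>t. corner_map F (i, k, True) (t, 1))"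
    | (vertical) i k where "(i, k, True) \<in> corners F" "\<psi> = vertical_map F (i, k, True)"
proof -
  have "\<psi> \<in> {\<lambda>t. Base (edge_map (base_graph F) e t) | e. e \<in> arcs (base_graph F)} \<union>
         {\<lambda>t. fin_point F i (edge_map (fin_circle F i) k t) 1 | i k.
            i < num_fins F \<and> k \<in> arcs (fin_circle F i)} \<union>
         {\<lambda>t. fin_point F i (Vertex k) t | i k.
            i < num_fins F \<and> k \<in> verts (fin_circle F i)}"
    using assms by (simp add: fin_complex_def)
  then consider e where "e \<in> arcs (base_graph F)" "\<psi> = (\<lambda>t. Base (edge_map (base_graph F) e t))"
    | i k where "i < num_fins F" "k < fin_length F i" "\<psi> = (\<lambda>t. fin_point F i (edge_map (fin_circle F i) k t) 1)"
    | i k where "i < num_fins F" "k < fin_length F i" "\<psi> = (\<lambda>t. fin_point F i (Vertex k) t)"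
    by (auto simp: fin_circle_def cycle_graph_def)
  then show thesis
  proof cases
    case (1 e)
    then show thesis
      using base by (simp add: dart_map_positive)
  next
    case (2 i k)
    then show thesis
      using outer[of i k] by (simp add: corners_def square_map_def)
  next
    case (3 i k)
    then show thesis
      using vertical[of i k] by (simp add: corners_def fun_eq_iff)
  qed
qed

lemma square_maps_eq: "square_maps (fin_complex F) = {square_map F i k | i k. i < num_fins F \<and> k < fin_length F i}"
proof -
  have "(\<lambda>(s, t). fin_point F i (edge_map (fin_circle F i) k s) t) = square_map F i k" for i k
    by (auto simp: square_map_def fun_eq_iff)
  then show ?thesis
    by (simp add: fin_complex_def fin_circle_def cycle_graph_def)
qed

lemma (in fin_graph) edge_path_isometry:
  assumes "\<psi> \<in> edge_paths F"
  shows "\<exists>\<psi>'\<in>edge_maps (fin_complex F). \<exists>g. self_isometry unit_interval g \<and> continuous_on unit_interval g \<and>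
    (\<forall>s\<in>unit_interval. g (g s) = s) \<and> (\<forall>s\<in>unit_interval. \<psi> s = \<psi>' (g s))"
proof -
  note r = self_isometry_interval_refl and v = self_isometry_interval_rev
  have e1: "(\<lambda>t. Base (edge_map G e t)) \<in> edge_maps (fin_complex F)" if "e \<in> arcs G" for e
    using that by (auto simp: fin_complex_def)
  have e2: "(\<lambda>t. square_map F i k (t, 1)) \<in> edge_maps (fin_complex F)" if "i < num_fins F" "k < fin_length F i" for i k
  proof -
    have "(\<lambda>t. square_map F i k (t, 1)) = (\<lambda>t. fin_point F i (edge_map (fin_circle F i) k t) 1)"
      by (simp add: square_map_def)
    then show ?thesis
      using that by (auto simp: fin_complex_def fin_circle_def cycle_graph_def)
  qed
  have e3: "vertical_map F q \<in> edge_maps (fin_complex F)" if "q \<in> corners F" for q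
  proof -
    obtain i k b where q: "q = (i, k, b)"
      by (metis prod_cases3)
    then have "vertical_map F q = (\<lambda>t. fin_point F i (Vertex k) t)"
      by (simp add: fun_eq_iff)
    then show ?thesis
      using that by (auto simp: q fin_complex_def fin_circle_def cycle_graph_def corners_def)
  qed
  have c: "continuous_on unit_interval (\<lambda>s. s)" "continuous_on unit_interval (\<lambda>s :: real. 1 - s)"
    by (auto intro!: continuous_intros)
  consider d where "d \<in> darts G" "\<psi> = (\<lambda>t. Base (dart_map G d t))"
    | i k b where "(i, k, b) \<in> corners F" "\<psi> = (\<lambda>t. corner_map F (i, k, b) (t, 1))"
    | q where "q \<in> corners F" "\<psi> = vertical_map F q"
    using assms unfolding edge_paths_def by (auto simp del: corner_map.simps vertical_map.simps)
  then show ?thesis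
  proof cases
    case (1 d)
    then have "fst d \<in> arcs G"
      by (auto simp: darts_def)
    then show ?thesis
      using 1 e1[of "fst d"] r v c
      by (cases "snd d") (auto simp: dart_map_def intro!: bexI[of _ "\<lambda>t. Base (edge_map G (fst d) t)"])
  next
    case (2 i k b)
    then have ik: "i < num_fins F" "k < fin_length F i"
      by (auto simp: corners_def)
    show ?thesis
    proof (cases b)
      case True
      then show ?thesis
        using 2(2) e2[OF ik] r c by (intro bexI[of _ "\<lambda>t. square_map F i k (t, 1)"] exI[of _ "\<lambda>s. s"]) auto
    next
      case False
      then show ?thesis
        using 2(2) e2[OF ik(1) circle_prev_less[OF ik(2)]] v c
        by (intro bexI[of _ "\<lambda>t. square_map F i (circle_prev (fin_length F i) k) (t, 1)"] exI[of _ "\<lambda>s. 1 - s"]) auto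
    qed
  next
    case (3 q)
    then show ?thesis
      using e3[of q] r c by (intro bexI[of _ "vertical_map F q"] exI[of _ "\<lambda>s. s"]) auto
  qed
qed

lemma (in fin_graph) corner_map_isometry:
  assumes "q \<in> corners F"
  shows "\<exists>\<psi>'\<in>square_maps (fin_complex F). \<exists>g. self_isometry unit_square g \<and> continuous_on unit_square g \<and>
    (\<forall>s\<in>unit_square. g (g s) = s) \<and> (\<forall>s\<in>unit_square. corner_map F q s = \<psi>' (g s))"
proof -
  obtain i k b where q: "q = (i, k, b)"
    by (metis prod_cases3)
  have ik: "i < num_fins F" "k < fin_length F i" "circle_prev (fin_length F i) k < fin_length F i"
    using assms q circle_prev_less by (auto simp: corners_def)
  have c: "continuous_on unit_square (\<lambda>s :: real \<times> real. s)" "continuous_on unit_square (\<lambda>x :: real \<times> real. (1 - fst x, snd x))"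
    by (auto intro!: continuous_intros)
  show ?thesis
  proof (cases b)
    case True
    then show ?thesis
      using ik q self_isometry_square_refl c
      by (intro bexI[of _ "square_map F i k"] exI[of _ "\<lambda>x. x"]) (auto simp: square_maps_eq)
  next
    case False
    then show ?thesis
      using ik q self_isometry_square_rev c
      by (intro bexI[of _ "square_map F i (circle_prev (fin_length F i) k)"] exI[of _ "\<lambda>x. (1 - fst x, snd x)"])
        (auto simp: square_maps_eq)
  qed
qed

context fin_cover
begin

text \<open>
  The covering map is the first projection, so this is uniqueness of lifts.
\<close>

lemma lift_eq:
  fixes C :: "'m::topological_space set"
  assumes "connected C" "continuous_map (top_of_set C) cover \<phi>" "continuous_map (top_of_set C) cover \<phi>'"
    and "\<And>x. x \<in> C \<Longrightarrow> fst (\<phi> x) = fst (\<phi>' x)" "x0 \<in> C" "snd (\<phi> x0) = snd (\<phi>' x0)" "x \<in> C"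
  shows "\<phi> x = \<phi>' x"
proof (rule covering_map_lift_unique[OF covering_map_cover, where S = "top_of_set C" and a = x0])
  show "connected_space (top_of_set C)"
    using assms by (simp add: connected_space_subtopology)
  show "\<phi> x0 = \<phi>' x0"
    using assms by (simp add: prod_eq_iff)
qed (use assms in auto)

lemma cover_label:
  assumes "p \<in> topspace cover"
  shows "snd p \<in> Z" "a (snd p) = point_base F (fst p)"
  using assms unfolding topspace_cover by auto

lemma lifted_edge_cases:
  assumes "\<phi> \<in> lifted_cells unit_interval cover fst (edge_maps (fin_complex F))"
  obtains (base) z d where "z \<in> Z" "d \<in> darts G" "dart_src G d = a z" "\<And>s. s \<in> unit_interval \<Longrightarrow> \<phi> s = dart_lift z d s"
    | (outer) z q where "z \<in> Z" "q \<in> corners F" "dart_src G (corner_dart F q) = a z" "\<And>s. s \<in> unit_interval \<Longrightarrow> \<phi> s = corner_lift z q (s, 1)"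
    | (vertical) z q where "z \<in> Z" "q \<in> corners F" "dart_src G (corner_dart F q) = a z" "\<And>s. s \<in> unit_interval \<Longrightarrow> \<phi> s = corner_lift z q (0, s)"
proof -
  obtain \<psi> where c: "continuous_map (top_of_set unit_interval) cover \<phi>" and \<psi>: "\<psi> \<in> edge_maps (fin_complex F)"
    "\<And>s. s \<in> unit_interval \<Longrightarrow> fst (\<phi> s) = \<psi> s"
    using assms unfolding lifted_cells_def by blast
  have "\<phi> 0 \<in> topspace cover"
    using c by (auto simp: continuous_map_def)
  note z = cover_label[OF this]
  have "fst (\<phi> 0) = \<psi> 0"
    using \<psi>(2) by simp
  note z' = z(2)[unfolded this]
  have slice: "continuous_map (top_of_set unit_interval) (top_of_set unit_square) (\<lambda>t. (t, 1))"
    "continuous_map (top_of_set unit_interval) (top_of_set unit_square) (\<lambda>t. (0, t))"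
    by (auto simp: continuous_map_in_subtopology intro!: continuous_intros)
  let ?z = "snd (\<phi> 0)"
  show thesis
    using \<psi>(1)
  proof (cases rule: edge_maps_cases)
    case (base e)
    let ?d = "(e, True)"
    have d: "?d \<in> darts G" "dart_src G ?d = a ?z"
      using base z' by (auto simp: darts_def dart_map_0)
    have "\<phi> s = dart_lift ?z ?d s" if "s \<in> unit_interval" for s
      by (rule lift_eq[OF _ c continuous_dart_lift[OF z(1) d], of 0])
        (use that \<psi>(2) base dart_lift_0[OF z(1) d] in \<open>auto simp: fst_dart_lift\<close>)
    then show thesis
      using that(1)[OF z(1) d] by blast
  next
    case (outer i k)
    let ?q = "(i, k, True)"
    have q: "?q \<in> corners F" "dart_src G (corner_dart F ?q) = a ?z"
      using outer z' by (auto simp: square_map_def fin_point_def fin_circle_def edge_map_cycle)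
    note c' = continuous_map_compose[OF slice(1) continuous_corner_lift[OF z(1) q], unfolded o_def]
    have "\<phi> s = corner_lift ?z ?q (s, 1)" if "s \<in> unit_interval" for s
      by (rule lift_eq[OF _ c c', of 0])
        (use that \<psi>(2) outer corner_lift_side[OF z(1) q, of 1] in \<open>auto simp: fst_corner_lift\<close>)
    then show thesis
      using that(2)[OF z(1) q] by blast
  next
    case (vertical i k)
    let ?q = "(i, k, True)"
    have q: "?q \<in> corners F" "dart_src G (corner_dart F ?q) = a ?z"
      using vertical z' vertical_map_0[OF vertical(1)] by auto
    note c' = continuous_map_compose[OF slice(2) continuous_corner_lift[OF z(1) q], unfolded o_def]
    have "\<phi> s = corner_lift ?z ?q (0, s)" if "s \<in> unit_interval" for s
      by (rule lift_eq[OF _ c c', of 0])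
        (use that \<psi>(2) vertical corner_lift_side[OF z(1) q] in \<open>auto\<close>)
    then show thesis
      using that(3)[OF z(1) q] by blast
  qed
qed

lemma lifted_square_cases:
  assumes "\<phi> \<in> lifted_cells unit_square cover fst (square_maps (fin_complex F))"
  obtains z q where "z \<in> Z" "q \<in> corners F" "dart_src G (corner_dart F q) = a z" "\<And>x. x \<in> unit_square \<Longrightarrow> \<phi> x = corner_lift z q x"
proof -
  obtain \<psi>' where c: "continuous_map (top_of_set unit_square) cover \<phi>" and \<psi>': "\<psi>' \<in> square_maps (fin_complex F)"
    "\<forall>x\<in>unit_square. fst (\<phi> x) = \<psi>' x"
    using assms unfolding lifted_cells_def mem_Collect_eq by (elim conjE bexE) (rule that)
  from \<psi>'(1) obtain i k where ik: "i < num_fins F" "k < fin_length F i" and eq: "\<psi>' = square_map F i k"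
    unfolding square_maps_eq by blast
  have \<psi>: "fst (\<phi> x) = square_map F i k x" if "x \<in> unit_square" for x
    using bspec[OF \<psi>'(2) that] unfolding eq .
  let ?z = "snd (\<phi> (0, 0))" and ?q = "(i, k, True)"
  have "\<phi> (0, 0) \<in> topspace cover"
    using c by (auto simp: continuous_map_def)
  note z = cover_label[OF this]
  have "fst (\<phi> (0, 0)) = Base (Vertex (dart_src G (fin_dart F i k)))"
    using \<psi>[of "(0, 0)"] square_map_bottom[OF ik, of 0] by (simp add: dart_map_0)
  then have q: "?q \<in> corners F" "dart_src G (corner_dart F ?q) = a ?z"
    using z ik by (auto simp: corners_def)
  have "\<phi> x = corner_lift ?z ?q x" if "x \<in> unit_square" for x
    by (rule lift_eq[OF _ c continuous_corner_lift[OF z(1) q], of "(0, 0)"])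
      (use that \<psi> corner_lift_side[OF z(1) q] in \<open>auto simp: fst_corner_lift connected_Times\<close>)
  then show thesis
    using that[OF z(1) q] by blast
qed

end

context matched_covers
begin

abbreviation "L1 \<equiv> lifted_complex C1.cover fst (fin_complex F1)"
abbreviation "L2 \<equiv> lifted_complex C2.cover fst (fin_complex F2)"

lemma iso_map_topspace: "p \<in> topspace C1.cover \<Longrightarrow> iso_map p \<in> topspace C2.cover"
  using continuous_iso_map by (auto simp: continuous_map_def)

lemma iso_map_vertices: "iso_map ` vertices L1 \<subseteq> vertices L2"
proof
  fix y assume "y \<in> iso_map ` vertices L1"
  then obtain p where p: "y = iso_map p" "p \<in> vertices L1"
    by blast
  have "vertices L1 = {x \<in> topspace C1.cover. fst x \<in> vertices (fin_complex F1)}"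
    by (simp add: lifted_complex_def)
  with p have p: "y = iso_map p" "p \<in> topspace C1.cover" "fst p \<in> vertices (fin_complex F1)"
    by blast+
  note z = C1.cover_label[OF p(2)]
  have "fst (iso_map p) \<in> vertices (fin_complex F2)"
  proof -
    have "fst p \<in> (Base \<circ> Vertex) ` verts (base_graph F1) \<union>
         {fin_point F1 i (Vertex k) 1 | i k. i < num_fins F1 \<and> k \<in> verts (fin_circle F1 i)}"
      using p(3) by (simp add: fin_complex_def)
    then consider v where "fst p = Base (Vertex v)"
      | i k where "i < num_fins F1" "k < fin_length F1 i" "fst p = Fin i (Vertex k) 1"
      by (auto simp: fin_circle_def cycle_graph_def fin_point_def)
    then show ?thesis
    proof cases
      case (1 v)
      then have "iso_map p = (Base (Vertex (a2 (snd p))), snd p)"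
        using iso_map_vertex[of v "snd p"] by (metis prod.collapse)
      then show ?thesis
        using C2.a_in[OF z(1)] by (simp add: fin_complex_def)
    next
      case (2 i k)
      let ?q = "(i, k, True)"
      have q: "?q \<in> corners F1" "dart_src C1.G (corner_dart F1 ?q) = a1 (snd p)"
        using 2 z by (auto simp: corners_def)
      have "p = C1.corner_lift (snd p) ?q (0, 1)"
        using C1.corner_lift_side[OF z(1) q, of 1] 2 by (simp add: prod_eq_iff fin_point_def)
      then have "iso_map p = C2.corner_lift (snd p) (\<gamma> (snd p) ?q) (0, 1)"
        using iso_map_corner[OF z(1) q, of "(0, 1)"] by simp
      then have "fst (iso_map p) = vertical_map F2 (\<gamma> (snd p) ?q) 1"
        using C2.corner_lift_side[OF z(1) corner_image[OF z(1) q]] by simp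
      moreover obtain j m b where "\<gamma> (snd p) ?q = (j, m, b)"
        by (metis prod_cases3)
      ultimately show ?thesis
        using corner_image(1)[OF z(1) q] by (auto simp: corners_def fin_complex_def fin_circle_def cycle_graph_def)
    qed
  qed
  then show "y \<in> vertices L2"
    using p iso_map_topspace[OF p(2)] by (simp add: lifted_complex_def)
qed

lemma iso_map_edges: "maps_cells unit_interval iso_map (edge_maps L1) (edge_maps L2)"
proof -
  have "continuous_map (top_of_set unit_interval) C2.cover (\<lambda>x. iso_map (\<phi> x)) \<and>
     (\<exists>\<psi>\<in>edge_maps (fin_complex F2). \<exists>g. self_isometry unit_interval g \<and> continuous_on unit_interval g \<and>
        (\<forall>x\<in>unit_interval. g (g x) = x) \<and> (\<forall>x\<in>unit_interval. fst (iso_map (\<phi> x)) = \<psi> (g x)))"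
    if \<phi>: "\<phi> \<in> lifted_cells unit_interval C1.cover fst (edge_maps (fin_complex F1))" for \<phi>
  proof
    have "continuous_map (top_of_set unit_interval) C1.cover \<phi>"
      using \<phi> by (auto simp: lifted_cells_def)
    from continuous_map_compose[OF this continuous_iso_map]
    show "continuous_map (top_of_set unit_interval) C2.cover (\<lambda>x. iso_map (\<phi> x))"
      by (simp add: o_def)
    have "\<exists>\<psi>\<in>edge_paths F2. \<forall>s\<in>unit_interval. fst (iso_map (\<phi> s)) = \<psi> s"
      using \<phi>
    proof (cases rule: C1.lifted_edge_cases)
      case (base z d)
      have "fst (iso_map (\<phi> s)) = Base (dart_map C2.G (\<alpha> z d) s)" if "s \<in> unit_interval" for s
        using base(4)[OF that] iso_map_dart[OF base(1-3) that] by (simp add: C2.fst_dart_lift)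
      moreover have "(\<lambda>s. Base (dart_map C2.G (\<alpha> z d) s)) \<in> edge_paths F2"
        using \<alpha>[OF base(1-3)] by (intro edge_paths_intros) blast
      ultimately show ?thesis
        by (intro bexI[of _ "\<lambda>s. Base (dart_map C2.G (\<alpha> z d) s)"]) auto
    next
      case (outer z q)
      have "fst (iso_map (\<phi> s)) = corner_map F2 (\<gamma> z q) (s, 1)" if "s \<in> unit_interval" for s
        using outer(4)[OF that] iso_map_corner[OF outer(1-3), of "(s, 1)"] that by (simp add: C2.fst_corner_lift)
      moreover have "(\<lambda>s. corner_map F2 (\<gamma> z q) (s, 1)) \<in> edge_paths F2"
        by (intro edge_paths_intros corner_image(1)[OF outer(1-3)])
      ultimately show ?thesis
        by (intro bexI[of _ "\<lambda>s. corner_map F2 (\<gamma> z q) (s, 1)"]) auto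
    next
      case (vertical z q)
      have "fst (iso_map (\<phi> s)) = vertical_map F2 (\<gamma> z q) s" if "s \<in> unit_interval" for s
        using vertical(4)[OF that] iso_map_corner[OF vertical(1-3), of "(0, s)"] that
          C2.corner_lift_side[OF vertical(1) corner_image[OF vertical(1-3)]] by simp
      moreover have "vertical_map F2 (\<gamma> z q) \<in> edge_paths F2"
        by (intro edge_paths_intros corner_image(1)[OF vertical(1-3)])
      ultimately show ?thesis
        by (intro bexI[of _ "vertical_map F2 (\<gamma> z q)"]) auto
    qed
    then obtain \<psi> where \<psi>: "\<psi> \<in> edge_paths F2" "\<And>s. s \<in> unit_interval \<Longrightarrow> fst (iso_map (\<phi> s)) = \<psi> s"
      by blast
    have eq: "(\<forall>x\<in>unit_interval. fst (iso_map (\<phi> x)) = \<psi>' (g x)) \<longleftrightarrow> (\<forall>s\<in>unit_interval. \<psi> s = \<psi>' (g s))" for \<psi>' g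
      by (rule ball_cong[OF refl]) (simp only: \<psi>(2))
    show "\<exists>\<psi>\<in>edge_maps (fin_complex F2). \<exists>g. self_isometry unit_interval g \<and> continuous_on unit_interval g \<and>
        (\<forall>x\<in>unit_interval. g (g x) = x) \<and> (\<forall>x\<in>unit_interval. fst (iso_map (\<phi> x)) = \<psi> (g x))"
      unfolding eq by (rule C2.edge_path_isometry[OF \<psi>(1)])
  qed
  then show ?thesis
    unfolding lifted_complex_def square_complex.simps by (rule maps_cells_lifted)
qed

lemma iso_map_squares: "maps_cells unit_square iso_map (square_maps L1) (square_maps L2)"
proof -
  have "continuous_map (top_of_set unit_square) C2.cover (\<lambda>x. iso_map (\<phi> x)) \<and>
     (\<exists>\<psi>\<in>square_maps (fin_complex F2). \<exists>g. self_isometry unit_square g \<and> continuous_on unit_square g \<and>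
        (\<forall>x\<in>unit_square. g (g x) = x) \<and> (\<forall>x\<in>unit_square. fst (iso_map (\<phi> x)) = \<psi> (g x)))"
    if \<phi>: "\<phi> \<in> lifted_cells unit_square C1.cover fst (square_maps (fin_complex F1))" for \<phi>
  proof
    have "continuous_map (top_of_set unit_square) C1.cover \<phi>"
      using \<phi> by (auto simp: lifted_cells_def)
    from continuous_map_compose[OF this continuous_iso_map]
    show "continuous_map (top_of_set unit_square) C2.cover (\<lambda>x. iso_map (\<phi> x))"
      by (simp add: o_def)
    obtain z q where q: "z \<in> Z" "q \<in> corners F1" "dart_src C1.G (corner_dart F1 q) = a1 z"
      "\<And>x. x \<in> unit_square \<Longrightarrow> \<phi> x = C1.corner_lift z q x"
      using C1.lifted_square_cases[OF \<phi>] by blast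
    have "fst (iso_map (\<phi> x)) = corner_map F2 (\<gamma> z q) x" if "x \<in> unit_square" for x
      using q(4)[OF that] iso_map_corner[OF q(1-3) that] by (simp add: C2.fst_corner_lift)
    then have eq: "(\<forall>x\<in>unit_square. fst (iso_map (\<phi> x)) = \<psi>' (g x)) \<longleftrightarrow>
        (\<forall>s\<in>unit_square. corner_map F2 (\<gamma> z q) s = \<psi>' (g s))" for \<psi>' g
      by (intro ball_cong[OF refl]) (simp only:)
    show "\<exists>\<psi>\<in>square_maps (fin_complex F2). \<exists>g. self_isometry unit_square g \<and> continuous_on unit_square g \<and>
        (\<forall>x\<in>unit_square. g (g x) = x) \<and> (\<forall>x\<in>unit_square. fst (iso_map (\<phi> x)) = \<psi> (g x))"
      unfolding eq by (rule C2.corner_map_isometry[OF corner_image(1)[OF q(1-3)]])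
  qed
  then show ?thesis
    unfolding lifted_complex_def square_complex.simps by (rule maps_cells_lifted)
qed

lemma cubical_iso_map: "cubical_map L1 L2 iso_map"
  unfolding cubical_map_def using iso_map_vertices iso_map_edges iso_map_squares continuous_iso_map
  by (simp add: lifted_complex_def)

end

text \<open>
  The inverse bijections of stars define the inverse map.
\<close>

lemma matched_covers_isomorphic:
  assumes "matched_covers F1 F2 Z a1 N1 a2 N2 \<alpha> \<gamma>" and "matched_covers F2 F1 Z a2 N2 a1 N1 \<alpha>' \<gamma>'"
    and inv: "\<And>z d. z \<in> Z \<Longrightarrow> d \<in> darts (base_graph F1) \<Longrightarrow> dart_src (base_graph F1) d = a1 z \<Longrightarrow> \<alpha>' z (\<alpha> z d) = d"
      "\<And>z q. z \<in> Z \<Longrightarrow> q \<in> corners F1 \<Longrightarrow> dart_src (base_graph F1) (corner_dart F1 q) = a1 z \<Longrightarrow> \<gamma>' z (\<gamma> z q) = q"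
    and inv': "\<And>z d. z \<in> Z \<Longrightarrow> d \<in> darts (base_graph F2) \<Longrightarrow> dart_src (base_graph F2) d = a2 z \<Longrightarrow> \<alpha> z (\<alpha>' z d) = d"
      "\<And>z q. z \<in> Z \<Longrightarrow> q \<in> corners F2 \<Longrightarrow> dart_src (base_graph F2) (corner_dart F2 q) = a2 z \<Longrightarrow> \<gamma> z (\<gamma>' z q) = q"
  shows "isomorphic_complexes (lifted_complex (fin_cover.cover F1 Z a1 N1) fst (fin_complex F1))
     (lifted_complex (fin_cover.cover F2 Z a2 N2) fst (fin_complex F2))"
proof -
  interpret M: matched_covers F1 F2 Z a1 N1 a2 N2 \<alpha> \<gamma>
    by fact
  interpret M': matched_covers F2 F1 Z a2 N2 a1 N1 \<alpha>' \<gamma>'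
    by fact
  have 1: "M'.iso_map (M.iso_map p) = p" if "p \<in> topspace M.C1.cover" for p
    using that
  proof (cases rule: M.C1.cover_point)
    case (vertex z)
    then show ?thesis
      by (simp add: M.iso_map_vertex M'.iso_map_vertex)
  next
    case (dart z e s)
    have d: "(e, True) \<in> darts (base_graph F1)" "dart_src (base_graph F1) (e, True) = a1 z"
      using dart by (auto simp: darts_def dart_src_def)
    show ?thesis
      using M.iso_map_dart[OF dart(1) d dart(4)] M'.iso_map_dart[OF dart(1) _ _ dart(4), of "\<alpha> z (e, True)"]
        M.\<alpha>[OF dart(1) d] inv(1)[OF dart(1) d] dart(5) by simp
  next
    case (corner z i k x)
    have q: "dart_src (base_graph F1) (corner_dart F1 (i, k, True)) = a1 z"
      using corner by simp
    show ?thesis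
      using M.iso_map_corner[OF corner(1,2) q corner(4)]
        M'.iso_map_corner[OF corner(1) M.corner_image[OF corner(1,2) q] corner(4)]
        inv(2)[OF corner(1,2) q] corner(5) by simp
  qed
  have 2: "M.iso_map (M'.iso_map p) = p" if "p \<in> topspace M.C2.cover" for p
    using that
  proof (cases rule: M.C2.cover_point)
    case (vertex z)
    then show ?thesis
      by (simp add: M.iso_map_vertex M'.iso_map_vertex)
  next
    case (dart z e s)
    have d: "(e, True) \<in> darts (base_graph F2)" "dart_src (base_graph F2) (e, True) = a2 z"
      using dart by (auto simp: darts_def dart_src_def)
    show ?thesis
      using M'.iso_map_dart[OF dart(1) d dart(4)] M.iso_map_dart[OF dart(1) _ _ dart(4), of "\<alpha>' z (e, True)"]
        M'.\<alpha>[OF dart(1) d] inv'(1)[OF dart(1) d] dart(5) by simp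
  next
    case (corner z i k x)
    have q: "dart_src (base_graph F2) (corner_dart F2 (i, k, True)) = a2 z"
      using corner by simp
    show ?thesis
      using M'.iso_map_corner[OF corner(1,2) q corner(4)]
        M.iso_map_corner[OF corner(1) M'.corner_image[OF corner(1,2) q] corner(4)]
        inv'(2)[OF corner(1,2) q] corner(5) by simp
  qed
  have "homeomorphic_maps M.C1.cover M.C2.cover M.iso_map M'.iso_map"
    unfolding homeomorphic_maps_def using M.continuous_iso_map M'.continuous_iso_map 1 2 by blast
  then show ?thesis
    unfolding isomorphic_complexes_def using M.cubical_iso_map M'.cubical_iso_map
    by (intro exI[of _ M.iso_map] exI[of _ M'.iso_map]) (simp add: lifted_complex_def)
qed

section \<open>Charts and corners\<close>

lemma self_isometry_comp:
  assumes "self_isometry C g" "self_isometry C h"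
  shows "self_isometry C (\<lambda>x. g (h x))"
proof -
  have "(\<lambda>x. g (h x)) ` C = g ` h ` C"
    by (simp add: image_image)
  moreover have "h x \<in> C" if "x \<in> C" for x
    using assms(2) that by (auto simp: self_isometry_def)
  ultimately show ?thesis
    using assms by (simp add: self_isometry_def)
qed

lemma self_isometry_in: "self_isometry C g \<Longrightarrow> x \<in> C \<Longrightarrow> g x \<in> C"
  by (auto simp: self_isometry_def)

lemma self_isometry_continuous:
  assumes "self_isometry C g"
  shows "continuous_map (top_of_set C) (top_of_set C) g"
proof -
  have "continuous_on C g"
    unfolding continuous_on_iff
  proof (intro ballI allI impI)
    fix x and \<epsilon> :: real assume x: "x \<in> C" and \<epsilon>: "0 < \<epsilon>"
    have "dist (g x') (g x) = dist x' x" if "x' \<in> C" for x'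
      using assms x that by (simp add: self_isometry_def)
    then show "\<exists>d>0. \<forall>x'\<in>C. dist x' x < d \<longrightarrow> dist (g x') (g x) < \<epsilon>"
      using \<epsilon> by (intro exI[of _ \<epsilon>]) simp
  qed
  then show ?thesis
    using self_isometry_in[OF assms] by (auto simp: continuous_map_in_subtopology)
qed

text \<open>
  Characteristic maps up to isometries of the cube. Unlike the set of characteristic maps itself,
  this set is preserved by cubical maps.
\<close>

definition charts :: "'m::metric_space set \<Rightarrow> ('m \<Rightarrow> 'a) set \<Rightarrow> ('m \<Rightarrow> 'a) set" where
  "charts C \<Phi> = {K. \<exists>\<psi>\<in>\<Phi>. \<exists>h. self_isometry C h \<and> (\<forall>x\<in>C. K x = \<psi> (h x))}"

lemma charts_image:
  assumes "maps_cells C f \<Phi> \<Psi>" "K \<in> charts C \<Phi>"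
  shows "(\<lambda>x. f (K x)) \<in> charts C \<Psi>"
proof -
  obtain \<psi> h where K: "\<psi> \<in> \<Phi>" "self_isometry C h" "\<forall>x\<in>C. K x = \<psi> (h x)"
    using assms(2) unfolding charts_def mem_Collect_eq by (elim bexE exE conjE) (rule that)
  obtain \<psi>' g where g: "\<psi>' \<in> \<Psi>" "self_isometry C g" "\<forall>x\<in>C. f (\<psi> x) = \<psi>' (g x)"
    using bspec[OF assms(1)[unfolded maps_cells_def] K(1)] by (elim bexE exE conjE) (rule that)
  have "\<forall>x\<in>C. f (K x) = \<psi>' (g (h x))"
    using K g self_isometry_in[OF K(2)] by simp
  then show ?thesis
    unfolding charts_def mem_Collect_eq using g(1) self_isometry_comp[OF g(2) K(2)]
    by (intro bexI[of _ \<psi>'] exI[of _ "\<lambda>x. g (h x)"] conjI)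
qed

lemma continuous_square_slices:
  assumes "continuous_map (top_of_set unit_square) X K"
  shows "t \<in> unit_interval \<Longrightarrow> continuous_map (top_of_set unit_interval) X (\<lambda>s. K (s, t))"
    "s \<in> unit_interval \<Longrightarrow> continuous_map (top_of_set unit_interval) X (\<lambda>t. K (s, t))"
proof -
  show "continuous_map (top_of_set unit_interval) X (\<lambda>s. K (s, t))" if t: "t \<in> unit_interval"
  proof -
    have "continuous_map (top_of_set unit_interval) (top_of_set unit_square) (\<lambda>s. (s, t))"
      using t by (auto simp: continuous_map_in_subtopology intro!: continuous_intros)
    from continuous_map_compose[OF this assms] show ?thesis
      by (simp add: o_def)
  qed
  show "continuous_map (top_of_set unit_interval) X (\<lambda>t. K (s, t))" if s: "s \<in> unit_interval"
  proof -
    have "continuous_map (top_of_set unit_interval) (top_of_set unit_square) (\<lambda>t. (s, t))"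
      using s by (auto simp: continuous_map_in_subtopology intro!: continuous_intros)
    from continuous_map_compose[OF this assms] show ?thesis
      by (simp add: o_def)
  qed
qed

lemma continuous_path_rev:
  assumes "continuous_map (top_of_set unit_interval) X c"
  shows "continuous_map (top_of_set unit_interval) X (\<lambda>t. c (1 - t))"
  using continuous_map_compose[OF self_isometry_continuous[OF self_isometry_interval_rev] assms] by (simp add: o_def)

lemma continuous_square_rev:
  assumes "continuous_map (top_of_set unit_square) X K"
  shows "continuous_map (top_of_set unit_square) X (\<lambda>x. K (1 - fst x, snd x))"
    "continuous_map (top_of_set unit_square) X (\<lambda>x. K (fst x, 1 - snd x))"
proof -
  show "continuous_map (top_of_set unit_square) X (\<lambda>x. K (1 - fst x, snd x))"
    using continuous_map_compose[OF self_isometry_continuous[OF self_isometry_square_rev] assms] by (simp add: o_def)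
  have "continuous_map (top_of_set unit_square) (top_of_set unit_square) (\<lambda>x. (fst x, 1 - snd x))"
    by (auto simp: continuous_map_in_subtopology intro!: continuous_intros)
  from continuous_map_compose[OF this assms] show "continuous_map (top_of_set unit_square) X (\<lambda>x. K (fst x, 1 - snd x))"
    by (simp add: o_def)
qed

lemma involution_image:
  assumes "\<And>x. x \<in> C \<Longrightarrow> g x \<in> C" "\<And>x. x \<in> C \<Longrightarrow> g (g x) = x"
  shows "g ` C = C"
proof (intro set_eqI iffI)
  fix x assume x: "x \<in> C"
  then have "g (g x) \<in> g ` C"
    using assms(1) by (intro imageI)
  then show "x \<in> g ` C"
    using assms(2)[OF x] by simp
qed (use assms(1) in blast)

lemma self_isometry_square_flips:
  "self_isometry unit_square (\<lambda>x. (if a then 1 - fst x else fst x, if b then 1 - snd x else snd x))"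
proof -
  let ?g = "\<lambda>x :: real \<times> real. (if a then 1 - fst x else fst x, if b then 1 - snd x else snd x)"
  have "?g ` unit_square = unit_square"
    by (rule involution_image) (auto simp: mem_Times_iff prod_eq_iff)
  moreover have "dist (?g x) (?g y) = dist x y" for x y
    by (simp add: dist_prod_def dist_real_def power2_commute[of "fst y"] power2_commute[of "snd y"])
  ultimately show ?thesis
    by (simp add: self_isometry_def)
qed

context fin_graph
begin

lemma continuous_square_map:
  assumes "i < num_fins F" "k < fin_length F i"
  shows "continuous_map (top_of_set unit_square) (mapping_cylinder F) (square_map F i k)"
proof -
  have "SquareCell i k \<in> cells F"
    using assms by (auto simp: cells_def)
  from continuous_map_cell[OF this, of "cell_map F"]
  have "continuous_map (top_of_set unit_square) (mapping_cylinder F) (cell_map F (SquareCell i k))"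
    unfolding mapping_cylinder_cells .
  moreover have "cell_map F (SquareCell i k) = square_map F i k"
    by (rule ext) simp
  ultimately show ?thesis
    by simp
qed

lemma continuous_corner_map:
  assumes "q \<in> corners F"
  shows "continuous_map (top_of_set unit_square) (mapping_cylinder F) (corner_map F q)"
proof -
  obtain i k b where q: "q = (i, k, b)"
    by (metis prod_cases3)
  have ik: "i < num_fins F" "k < fin_length F i" "circle_prev (fin_length F i) k < fin_length F i"
    using assms q circle_prev_less by (auto simp: corners_def)
  have "corner_map F q = (if b then square_map F i k
      else (\<lambda>x. square_map F i (circle_prev (fin_length F i) k) (1 - fst x, snd x)))"
    by (simp add: q fun_eq_iff)
  then show ?thesis
    using continuous_square_map[OF ik(1,2)] continuous_square_rev(1)[OF continuous_square_map[OF ik(1,3)]] by simp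
qed

lemma continuous_dart_map:
  assumes "d \<in> darts G"
  shows "continuous_map (top_of_set unit_interval) (mapping_cylinder F) (\<lambda>s. Base (dart_map G d s))"
proof -
  have "EdgeCell (fst d) \<in> cells F"
    using assms by (auto simp: cells_def darts_def)
  from continuous_map_cell[OF this, of "cell_map F"]
  have "continuous_map (top_of_set unit_square) (mapping_cylinder F) (cell_map F (EdgeCell (fst d)))"
    unfolding mapping_cylinder_cells .
  moreover have "cell_map F (EdgeCell (fst d)) = (\<lambda>x. Base (edge_map G (fst d) (fst x)))"
    by (rule ext) simp
  ultimately have "continuous_map (top_of_set unit_square) (mapping_cylinder F) (\<lambda>x. Base (edge_map G (fst d) (fst x)))"
    by simp
  from continuous_square_slices(1)[OF this, of 0]
  have c: "continuous_map (top_of_set unit_interval) (mapping_cylinder F) (\<lambda>s. Base (edge_map G (fst d) s))"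
    by simp
  show ?thesis
    using c continuous_path_rev[OF c] by (cases "snd d") (simp_all add: dart_map_def)
qed

text \<open>
  The point \<open>(1/3, 1/2)\<close> lies in the interior of the square and is not fixed by the reflection.
\<close>

lemma corner_map_inj:
  assumes "corner_map F q (1/3, 1/2) = corner_map F q' (1/3, 1/2)" "q \<in> corners F" "q' \<in> corners F"
  shows "q = q'"
proof -
  obtain i k b j m c where q: "q = (i, k, b)" "q' = (j, m, c)"
    by (metis prod_cases3)
  have e: "square_map F i k (1/3, 1/2) = Fin i (Inner k (1/3)) (1/2)"
    "square_map F i k (2/3, 1/2) = Fin i (Inner k (2/3)) (1/2)" for i k
    by (simp_all add: square_map_def fin_point_def fin_circle_def edge_map_def)
  have inj: "k = m" if "circle_prev (fin_length F i) k = circle_prev (fin_length F i) m" "i = j"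
  proof -
    have "k < fin_length F i" "m < fin_length F i"
      using assms(2,3) that(2) by (simp_all add: q corners_def)
    then show ?thesis
      using circle_next_prev that(1) by metis
  qed
  show ?thesis
  proof (cases b; cases c)
    assume "b" "c"
    then show ?thesis
      using assms(1) by (simp add: q e)
  next
    assume "\<not> b" "\<not> c"
    then show ?thesis
      using assms(1) inj by (auto simp: q e)
  qed (use assms(1) in \<open>simp_all add: q e\<close>)
qed

lemma corner_map_top:
  assumes "q \<in> corners F"
  shows "corner_map F q (1/3, 1) \<noteq> corner_map F (corner_opp q) (1/3, 1)"
    "corner_map F q (1/3, 1) \<noteq> vertical_map F q' t"
proof -
  obtain i k b where q: "q = (i, k, b)"
    by (metis prod_cases3)
  have e: "square_map F i k (1/3, 1) = Fin i (Inner k (1/3)) 1"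
    "square_map F i k (2/3, 1) = Fin i (Inner k (2/3)) 1" for i k
    by (simp_all add: square_map_def fin_point_def fin_circle_def edge_map_def)
  show "corner_map F q (1/3, 1) \<noteq> corner_map F (corner_opp q) (1/3, 1)"
    by (auto simp: q e)
  obtain j m c where q': "q' = (j, m, c)"
    by (metis prod_cases3)
  show "corner_map F q (1/3, 1) \<noteq> vertical_map F q' t"
    by (auto simp: q q' e fin_point_def)
qed

lemma corner_map_origin:
  assumes "q \<in> corners F"
  shows "corner_map F q (0, 0) = Base (Vertex (dart_src G (corner_dart F q)))"
  using corner_map_side[OF assms, of 0] vertical_map_0[OF assms] by simp

text \<open>
  Each of the eight isometries of the square puts one of the four corners at the origin; the
  corner lies in the base graph or on the outer boundary, and the first coordinate runs along the
  fin or vertically.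
\<close>

lemma square_chart_corner:
  assumes ik: "i < num_fins F" "k < fin_length F i" and h: "self_isometry unit_square h"
  obtains q where "q \<in> corners F" "\<And>s t. s \<in> unit_interval \<Longrightarrow> t \<in> unit_interval \<Longrightarrow> square_map F i k (h (s, t)) = corner_map F q (s, t)"
    | q where "q \<in> corners F" "\<And>s t. s \<in> unit_interval \<Longrightarrow> t \<in> unit_interval \<Longrightarrow> square_map F i k (h (s, t)) = corner_map F q (s, 1 - t)"
    | q where "q \<in> corners F" "\<And>s t. s \<in> unit_interval \<Longrightarrow> t \<in> unit_interval \<Longrightarrow> square_map F i k (h (s, t)) = corner_map F q (t, s)"
    | q where "q \<in> corners F" "\<And>s t. s \<in> unit_interval \<Longrightarrow> t \<in> unit_interval \<Longrightarrow> square_map F i k (h (s, t)) = corner_map F q (t, 1 - s)"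
proof -
  obtain a b c where abc: "\<And>s t. s \<in> unit_interval \<Longrightarrow> t \<in> unit_interval \<Longrightarrow>
     h (s, t) = (let s' = (if a then 1 - s else s); t' = (if b then 1 - t else t)
                 in if c then (t', s') else (s', t'))"
    using self_isometry_square[OF h] by blast
  let ?q = "(i, k, True)"
  have q: "?q \<in> corners F" "corner_flip F ?q \<in> corners F"
    using ik corner_flip_in[of ?q] by (auto simp: corners_def)
  have e: "square_map F i k (x, y) = corner_map F ?q (x, y)" "square_map F i k (1 - x, y) = corner_map F (corner_flip F ?q) (x, y)" for x y
    using corner_map_flip[OF q(1)] by simp_all
  show thesis
  proof (cases c)
    case False
    show thesis
    proof (cases b)
      case True
      show thesis
        by (rule that(2)[of "if a then corner_flip F ?q else ?q"]) (use q abc e True False in \<open>auto simp: Let_def\<close>)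
    next
      case b: False
      show thesis
        by (rule that(1)[of "if a then corner_flip F ?q else ?q"]) (use q abc e b False in \<open>auto simp: Let_def\<close>)
    qed
  next
    case True
    show thesis
    proof (cases a)
      case a: True
      show thesis
        by (rule that(4)[of "if b then corner_flip F ?q else ?q"]) (use q abc e a True in \<open>auto simp: Let_def\<close>)
    next
      case False
      show thesis
        by (rule that(3)[of "if b then corner_flip F ?q else ?q"]) (use q abc e True False in \<open>auto simp: Let_def\<close>)
    qed
  qed
qed

end

section \<open>Lifting darts and corners to an arbitrary cover\<close>

locale fin_covering = fin_graph F for F :: "('v, 'e) fin_data" +
  fixes U :: "'a topology" and p :: "'a \<Rightarrow> ('v, 'e) cylinder_point"
  assumes covering: "covering_map U p (mapping_cylinder F)"
begin

abbreviation "L \<equiv> lifted_complex U p (fin_complex F)"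
abbreviation "edge_charts \<equiv> charts unit_interval (edge_maps L)"
abbreviation "square_charts \<equiv> charts unit_square (square_maps L)"
abbreviation "is_path c \<equiv> continuous_map (top_of_set unit_interval) U c"

lemma path_in: "is_path c \<Longrightarrow> s \<in> unit_interval \<Longrightarrow> c s \<in> topspace U"
  by (auto simp: continuous_map_def)

lemma square_in: "continuous_map (top_of_set unit_square) U K \<Longrightarrow> x \<in> unit_square \<Longrightarrow> K x \<in> topspace U"
  by (auto simp: continuous_map_def)

lemma path_unique:
  assumes "is_path c" "is_path c'" "\<And>s. s \<in> unit_interval \<Longrightarrow> p (c s) = p (c' s)" "c 0 = c' 0" "s \<in> unit_interval"
  shows "c s = c' s"
  by (rule covering_map_lift_unique[OF covering, where S = "top_of_set unit_interval" and a = 0])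
    (use assms in \<open>auto simp: connected_space_subtopology\<close>)

lemma square_unique:
  assumes "continuous_map (top_of_set unit_square) U K" "continuous_map (top_of_set unit_square) U K'"
    "\<And>x. x \<in> unit_square \<Longrightarrow> p (K x) = p (K' x)" "K (0, 0) = K' (0, 0)" "x \<in> unit_square"
  shows "K x = K' x"
proof (rule covering_map_lift_unique[OF covering, where S = "top_of_set unit_square" and a = "(0, 0)"])
  show "connected_space (top_of_set unit_square)"
    by (simp add: connected_space_subtopology connected_Times)
  show "p (K x) = p (K' x)" if "x \<in> topspace (top_of_set unit_square)" for x
    using assms(3) that by simp
qed (use assms in simp_all)

definition dart_lift where
  "dart_lift x d = (SOME c. is_path c \<and> c 0 = x \<and> (\<forall>s\<in>unit_interval. p (c s) = Base (dart_map G d s)))"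

definition corner_lift where
  "corner_lift x q = (SOME K. continuous_map (top_of_set unit_square) U K \<and> K (0, 0) = x \<and>
     (\<forall>y\<in>unit_square. p (K y) = corner_map F q y))"

lemma dart_lift:
  assumes "x \<in> topspace U" "p x = Base (Vertex (dart_src G d))" "d \<in> darts G"
  shows "is_path (dart_lift x d)" "dart_lift x d 0 = x"
    "\<And>s. s \<in> unit_interval \<Longrightarrow> p (dart_lift x d s) = Base (dart_map G d s)"
proof -
  obtain c where "is_path c" "c 0 = x" "\<And>s. s \<in> unit_interval \<Longrightarrow> p (c s) = Base (dart_map G d s)"
    using covering_map_path_lift[OF covering continuous_dart_map[OF assms(3)] assms(1)] assms(2)
    by (metis dart_map_0)
  then have "\<exists>c. is_path c \<and> c 0 = x \<and> (\<forall>s\<in>unit_interval. p (c s) = Base (dart_map G d s))"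
    by (intro exI[of _ c] conjI ballI)
  from someI_ex[OF this] show "is_path (dart_lift x d)" "dart_lift x d 0 = x"
    "\<And>s. s \<in> unit_interval \<Longrightarrow> p (dart_lift x d s) = Base (dart_map G d s)"
    unfolding dart_lift_def[symmetric] by simp_all
qed

lemma corner_lift:
  assumes "x \<in> topspace U" "p x = Base (Vertex (dart_src G (corner_dart F q)))" "q \<in> corners F"
  shows "continuous_map (top_of_set unit_square) U (corner_lift x q)" "corner_lift x q (0, 0) = x"
    "\<And>y. y \<in> unit_square \<Longrightarrow> p (corner_lift x q y) = corner_map F q y"
proof -
  have "p x = corner_map F q (0, 0)"
    using assms(2) corner_map_origin[OF assms(3)] by simp
  then obtain K where "continuous_map (top_of_set unit_square) U K" "K (0, 0) = x"
    "\<And>y. y \<in> unit_square \<Longrightarrow> p (K y) = corner_map F q y"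
    using covering_map_square_lift[OF covering continuous_corner_map[OF assms(3)] assms(1)] by blast
  then have "\<exists>K. continuous_map (top_of_set unit_square) U K \<and> K (0, 0) = x \<and>
     (\<forall>y\<in>unit_square. p (K y) = corner_map F q y)"
    by (intro exI[of _ K] conjI ballI)
  from someI_ex[OF this] show "continuous_map (top_of_set unit_square) U (corner_lift x q)" "corner_lift x q (0, 0) = x"
    "\<And>y. y \<in> unit_square \<Longrightarrow> p (corner_lift x q y) = corner_map F q y"
    unfolding corner_lift_def[symmetric] by blast+
qed

lemma dart_lift_eq:
  assumes "is_path c" "d \<in> darts G" "\<And>s. s \<in> unit_interval \<Longrightarrow> p (c s) = Base (dart_map G d s)" "s \<in> unit_interval"
  shows "c s = dart_lift (c 0) d s"
proof -
  have "p (c 0) = Base (Vertex (dart_src G d))"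
    using assms(3)[of 0] by (simp add: dart_map_0)
  moreover have "c 0 \<in> topspace U"
    by (rule path_in[OF assms(1)]) simp
  ultimately have l: "is_path (dart_lift (c 0) d)" "dart_lift (c 0) d 0 = c 0"
    "\<And>s. s \<in> unit_interval \<Longrightarrow> p (dart_lift (c 0) d s) = Base (dart_map G d s)"
    using dart_lift[OF _ _ assms(2)] by blast+
  show ?thesis
    by (rule path_unique[OF assms(1) l(1) _ _ assms(4)]) (use assms(3) l(2,3) in auto)
qed

lemma corner_lift_eq:
  assumes "continuous_map (top_of_set unit_square) U K" "q \<in> corners F"
    "\<And>x. x \<in> unit_square \<Longrightarrow> p (K x) = corner_map F q x" "x \<in> unit_square"
  shows "K x = corner_lift (K (0, 0)) q x"
proof -
  have "p (K (0, 0)) = Base (Vertex (dart_src G (corner_dart F q)))"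
    using assms(3)[of "(0, 0)"] corner_map_origin[OF assms(2)] by simp
  moreover have "(0, 0) \<in> unit_square"
    by simp
  ultimately have l: "continuous_map (top_of_set unit_square) U (corner_lift (K (0, 0)) q)" "corner_lift (K (0, 0)) q (0, 0) = K (0, 0)"
    "\<And>y. y \<in> unit_square \<Longrightarrow> p (corner_lift (K (0, 0)) q y) = corner_map F q y"
    using corner_lift[OF square_in[OF assms(1)] _ assms(2)] by blast+
  show ?thesis
  proof (rule square_unique[OF assms(1) l(1) _ _ assms(4)])
    show "K (0, 0) = corner_lift (K (0, 0)) q (0, 0)"
      using l(2) by simp
    show "p (K y) = p (corner_lift (K (0, 0)) q y)" if "y \<in> unit_square" for y
      using assms(3)[OF that] l(3)[OF that] by simp
  qed
qed

lemma corner_lift_bottom: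
  assumes x: "x \<in> topspace U" "p x = Base (Vertex (dart_src G (corner_dart F q)))" "q \<in> corners F" and s: "s \<in> unit_interval"
  shows "corner_lift x q (s, 0) = dart_lift x (corner_dart F q) s"
proof -
  note l = corner_lift[OF x]
  have 1: "is_path (\<lambda>s. corner_lift x q (s, 0))"
    by (rule continuous_square_slices(1)[OF l(1)]) simp
  have "p (corner_lift x q (s, 0)) = Base (dart_map G (corner_dart F q) s)" if "s \<in> unit_interval" for s
    using l(3)[of "(s, 0)"] corner_map_bottom[OF x(3) that] that by simp
  from dart_lift_eq[OF 1 corner_dart_in[OF x(3)] this s] show ?thesis
    using l(2) by simp
qed

lemma corner_lift_side:
  assumes x: "x \<in> topspace U" "p x = Base (Vertex (dart_src G (corner_dart F q)))" "q \<in> corners F" and t: "t \<in> unit_interval"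
  shows "corner_lift x q (0, t) = corner_lift x (corner_opp q) (0, t)"
proof -
  note l = corner_lift[OF x]
  have q': "corner_opp q \<in> corners F" "p x = Base (Vertex (dart_src G (corner_dart F (corner_opp q))))"
    using x corner_src_opp by simp_all
  note l' = corner_lift[OF x(1) q'(2,1)]
  show ?thesis
  proof (rule path_unique[OF continuous_square_slices(2)[OF l(1)] continuous_square_slices(2)[OF l'(1)]])
    show "p (corner_lift x q (0, s)) = p (corner_lift x (corner_opp q) (0, s))" if "s \<in> unit_interval" for s
      using l(3)[of "(0, s)"] l'(3)[of "(0, s)"] corner_map_side[OF x(3), of s] corner_map_side[OF q'(1), of s] that
      by (simp add: vertical_map_opp)
    show "corner_lift x q (0, 0) = corner_lift x (corner_opp q) (0, 0)"
      using l(2) l'(2) by simp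
  qed (use t in auto)
qed

lemma dart_lift_end:
  assumes "x \<in> topspace U" "p x = Base (Vertex (dart_src G d))" "d \<in> darts G"
  shows "dart_lift x d 1 \<in> topspace U" "p (dart_lift x d 1) = Base (Vertex (dart_src G (dart_rev d)))"
proof -
  show "dart_lift x d 1 \<in> topspace U"
    using path_in[OF dart_lift(1)[OF assms]] by simp
  show "p (dart_lift x d 1) = Base (Vertex (dart_src G (dart_rev d)))"
    using dart_lift(3)[OF assms, of 1] by (simp add: dart_map_1)
qed

lemma dart_lift_rev:
  assumes x: "x \<in> topspace U" "p x = Base (Vertex (dart_src G d))" "d \<in> darts G" and s: "s \<in> unit_interval"
  shows "dart_lift (dart_lift x d 1) (dart_rev d) s = dart_lift x d (1 - s)"
proof -
  have "is_path (\<lambda>s. dart_lift x d (1 - s))"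
    by (rule continuous_path_rev[OF dart_lift(1)[OF x]])
  moreover have "p (dart_lift x d (1 - s)) = Base (dart_map G (dart_rev d) s)" if "s \<in> unit_interval" for s
    using dart_lift(3)[OF x, of "1 - s"] that by (simp add: dart_map_rev)
  ultimately show ?thesis
    using dart_lift_eq[of "\<lambda>s. dart_lift x d (1 - s)" "dart_rev d" s] x(3) s by simp
qed

lemma corner_lift_flip:
  assumes x: "x \<in> topspace U" "p x = Base (Vertex (dart_src G (corner_dart F q)))" "q \<in> corners F" and y: "y \<in> unit_square"
  shows "corner_lift (dart_lift x (corner_dart F q) 1) (corner_flip F q) y = corner_lift x q (1 - fst y, snd y)"
proof -
  note l = corner_lift[OF x]
  have "continuous_map (top_of_set unit_square) U (\<lambda>y. corner_lift x q (1 - fst y, snd y))"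
    by (rule continuous_square_rev(1)[OF l(1)])
  moreover have "p (corner_lift x q (1 - fst y, snd y)) = corner_map F (corner_flip F q) y" if "y \<in> unit_square" for y
  proof -
    have "(1 - fst y, snd y) \<in> unit_square"
      using that by (auto simp: mem_Times_iff)
    then show ?thesis
      using l(3) corner_map_flip[OF x(3), of "fst y" "snd y"] by simp
  qed
  moreover have "corner_lift x q (1, 0) = dart_lift x (corner_dart F q) 1"
    using corner_lift_bottom[OF x, of 1] by simp
  ultimately show ?thesis
    using corner_lift_eq[of "\<lambda>y. corner_lift x q (1 - fst y, snd y)" "corner_flip F q" y] corner_flip_in[OF x(3)] y by simp
qed

lemma dart_lift_inj:
  assumes "x \<in> topspace U" "p x = Base (Vertex (dart_src G d))" "d \<in> darts G"
    and "p x = Base (Vertex (dart_src G d'))" "d' \<in> darts G"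
    and "\<And>s. s \<in> unit_interval \<Longrightarrow> dart_lift x d s = dart_lift x d' s"
  shows "d = d'"
proof -
  have "dart_map G d (1/3) = dart_map G d' (1/3)"
    using dart_lift(3)[OF assms(1-3), of "1/3"] dart_lift(3)[OF assms(1,4,5), of "1/3"] assms(6)[of "1/3"] by simp
  then show ?thesis
    by (rule dart_map_inj)
qed

lemma corner_lift_inj:
  assumes "x \<in> topspace U" "p x = Base (Vertex (dart_src G (corner_dart F q)))" "q \<in> corners F"
    and "p x = Base (Vertex (dart_src G (corner_dart F q')))" "q' \<in> corners F"
    and "\<And>y. y \<in> unit_square \<Longrightarrow> corner_lift x q y = corner_lift x q' y"
  shows "q = q'"
proof -
  have "corner_map F q (1/3, 1/2) = corner_map F q' (1/3, 1/2)"
    using corner_lift(3)[OF assms(1-3), of "(1/3, 1/2)"] corner_lift(3)[OF assms(1,4,5), of "(1/3, 1/2)"]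
      assms(6)[of "(1/3, 1/2)"] by simp
  then show ?thesis
    using assms(3,5) by (rule corner_map_inj)
qed

section \<open>Charts of an arbitrary cover\<close>

lemma edge_maps_L: "edge_maps L = lifted_cells unit_interval U p (edge_maps (fin_complex F))"
  and square_maps_L: "square_maps L = lifted_cells unit_square U p (square_maps (fin_complex F))"
  by (simp_all add: lifted_complex_def)

lemma chartE:
  fixes C :: "'m::metric_space set"
  assumes "K \<in> charts C (lifted_cells C U p \<Psi>)"
  obtains \<psi> h where "\<psi> \<in> \<Psi>" "self_isometry C h" "continuous_map (top_of_set C) U K" "\<And>x. x \<in> C \<Longrightarrow> p (K x) = \<psi> (h x)"
proof -
  obtain \<phi> h where \<phi>: "\<phi> \<in> lifted_cells C U p \<Psi>" and h: "self_isometry C h" and K: "\<forall>x\<in>C. K x = \<phi> (h x)"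
    using assms unfolding charts_def mem_Collect_eq by (elim bexE exE conjE) (rule that)
  obtain \<psi> where \<psi>: "\<psi> \<in> \<Psi>" "continuous_map (top_of_set C) U \<phi>" "\<forall>x\<in>C. p (\<phi> x) = \<psi> x"
    using \<phi> unfolding lifted_cells_def mem_Collect_eq by (elim bexE conjE) (rule that)
  have c: "continuous_map (top_of_set C) U (\<lambda>x. \<phi> (h x))"
    using continuous_map_compose[OF self_isometry_continuous[OF h] \<psi>(2)] by (simp add: o_def)
  have "continuous_map (top_of_set C) U K"
    by (rule continuous_map_eq[OF c]) (use K in simp)
  moreover have "p (K x) = \<psi> (h x)" if "x \<in> C" for x
    using bspec[OF K that] bspec[OF \<psi>(3) self_isometry_in[OF h that]] by simp
  ultimately show thesis
    using that[OF \<psi>(1) h] by blast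
qed

lemma chartI:
  fixes C :: "'m::metric_space set"
  assumes "\<psi> \<in> \<Psi>" "self_isometry C h" "\<And>x. x \<in> C \<Longrightarrow> h (h x) = x" "continuous_map (top_of_set C) U K"
    "\<And>x. x \<in> C \<Longrightarrow> p (K x) = \<psi> (h x)"
  shows "K \<in> charts C (lifted_cells C U p \<Psi>)"
proof -
  have "continuous_map (top_of_set C) U (\<lambda>x. K (h x))"
    using continuous_map_compose[OF self_isometry_continuous[OF assms(2)] assms(4)] by (simp add: o_def)
  moreover have "\<forall>x\<in>C. p (K (h x)) = \<psi> x"
    using assms(3,5) self_isometry_in[OF assms(2)] by simp
  ultimately have "(\<lambda>x. K (h x)) \<in> lifted_cells C U p \<Psi>"
    unfolding lifted_cells_def using assms(1) by blast
  moreover have "\<forall>x\<in>C. K x = K (h (h x))"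
    using assms(3) by simp
  ultimately show ?thesis
    unfolding charts_def mem_Collect_eq using assms(2) by (intro bexI[of _ "\<lambda>x. K (h x)"] exI[of _ h] conjI)
qed

lemma square_chart_cases:
  assumes "K \<in> square_charts"
  obtains q where "q \<in> corners F" "\<And>s t. s \<in> unit_interval \<Longrightarrow> t \<in> unit_interval \<Longrightarrow> p (K (s, t)) = corner_map F q (s, t)"
    | q where "q \<in> corners F" "\<And>s t. s \<in> unit_interval \<Longrightarrow> t \<in> unit_interval \<Longrightarrow> p (K (s, t)) = corner_map F q (s, 1 - t)"
    | q where "q \<in> corners F" "\<And>s t. s \<in> unit_interval \<Longrightarrow> t \<in> unit_interval \<Longrightarrow> p (K (s, t)) = corner_map F q (t, s)"
    | q where "q \<in> corners F" "\<And>s t. s \<in> unit_interval \<Longrightarrow> t \<in> unit_interval \<Longrightarrow> p (K (s, t)) = corner_map F q (t, 1 - s)"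
proof -
  obtain \<psi> h where \<psi>: "\<psi> \<in> square_maps (fin_complex F)" and h: "self_isometry unit_square h"
    and K: "\<And>x. x \<in> unit_square \<Longrightarrow> p (K x) = \<psi> (h x)"
    using chartE[OF assms[unfolded square_maps_L]] by metis
  obtain i k where ik: "i < num_fins F" "k < fin_length F i" and eq: "\<psi> = square_map F i k"
    using \<psi> unfolding square_maps_eq by blast
  have K': "p (K (s, t)) = square_map F i k (h (s, t))" if "s \<in> unit_interval" "t \<in> unit_interval" for s t
    using K[of "(s, t)"] that eq by simp
  show thesis
    using ik h
  proof (cases rule: square_chart_corner)
    case (1 q)
    show thesis
      by (rule that(1)[OF 1(1)]) (simp only: K' 1(2))
  next
    case (2 q)
    show thesis
      by (rule that(2)[OF 2(1)]) (simp only: K' 2(2))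
  next
    case (3 q)
    show thesis
      by (rule that(3)[OF 3(1)]) (simp only: K' 3(2))
  next
    case (4 q)
    show thesis
      by (rule that(4)[OF 4(1)]) (simp only: K' 4(2))
  qed
qed

lemma square_chart_continuous: "K \<in> square_charts \<Longrightarrow> continuous_map (top_of_set unit_square) U K"
  unfolding square_maps_L by (erule chartE)

lemma corner_map_outer:
  assumes "(i, k, b) \<in> corners F"
  shows "corner_map F (i, k, b) (0, 1) = Fin i (Vertex k) 1"
  using corner_map_side[OF assms, of 1] by (simp add: fin_point_def)

lemma square_chart_base:
  assumes K: "K \<in> square_charts" "p (K (0, 0)) = Base y"
  obtains q where "q \<in> corners F" "\<And>s t. s \<in> unit_interval \<Longrightarrow> t \<in> unit_interval \<Longrightarrow> p (K (s, t)) = corner_map F q (s, t)"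
    | q where "q \<in> corners F" "\<And>s t. s \<in> unit_interval \<Longrightarrow> t \<in> unit_interval \<Longrightarrow> p (K (s, t)) = corner_map F q (t, s)"
proof -
  have no: "corner_map F q (0, 1) \<noteq> Base y" if "q \<in> corners F" for q
    using corner_map_side[OF that, of 1] by (cases q) (simp add: fin_point_def)
  show thesis
    using K(1)
  proof (cases rule: square_chart_cases)
    case (2 q)
    then show thesis
      using no[OF 2(1)] 2(2)[of 0 0] K(2) by simp
  next
    case (4 q)
    then show thesis
      using no[OF 4(1)] 4(2)[of 0 0] K(2) by simp
  qed (rule that; assumption)+
qed

lemma square_chart_outer:
  assumes K: "K \<in> square_charts" "p (K (0, 0)) = Fin i (Vertex k) r"
  obtains b where "(i, k, b) \<in> corners F"
      "\<And>s t. s \<in> unit_interval \<Longrightarrow> t \<in> unit_interval \<Longrightarrow> p (K (s, t)) = corner_map F (i, k, b) (s, 1 - t)"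
    | b where "(i, k, b) \<in> corners F"
      "\<And>s t. s \<in> unit_interval \<Longrightarrow> t \<in> unit_interval \<Longrightarrow> p (K (s, t)) = corner_map F (i, k, b) (t, 1 - s)"
proof -
  have eq: "\<exists>b. q = (i, k, b)" if "q \<in> corners F" "corner_map F q (0, 1) = Fin i (Vertex k) r" for q
    using corner_map_side[OF that(1), of 1] that(2) by (cases q) (simp add: fin_point_def)
  show thesis
    using K(1)
  proof (cases rule: square_chart_cases)
    case (1 q)
    then show thesis
      using corner_map_origin[OF 1(1)] 1(2)[of 0 0] K(2) by simp
  next
    case (2 q)
    then obtain b where "q = (i, k, b)"
      using eq[OF 2(1)] 2(2)[of 0 0] K(2) by auto
    then show thesis
      using that(1)[of b] 2 by blast
  next
    case (3 q)
    then show thesis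
      using corner_map_origin[OF 3(1)] 3(2)[of 0 0] K(2) by simp
  next
    case (4 q)
    then obtain b where "q = (i, k, b)"
      using eq[OF 4(1)] 4(2)[of 0 0] K(2) by auto
    then show thesis
      using that(2)[of b] 4 by blast
  qed
qed

lemma square_chart_at:
  assumes "K \<in> square_charts"
  obtains v where "p (K (0, 0)) = Base (Vertex v)" | i k where "p (K (0, 0)) = Fin i (Vertex k) 1"
  using assms
proof (cases rule: square_chart_cases)
  case (1 q)
  then show thesis
    using corner_map_origin[OF 1(1)] 1(2)[of 0 0] that(1) by simp
next
  case (2 q)
  then show thesis
    using corner_map_side[OF 2(1), of 1] 2(2)[of 0 0] that(2) by (cases q) (simp add: fin_point_def)
next
  case (3 q)
  then show thesis
    using corner_map_origin[OF 3(1)] 3(2)[of 0 0] that(1) by simp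
next
  case (4 q)
  then show thesis
    using corner_map_side[OF 4(1), of 1] 4(2)[of 0 0] that(2) by (cases q) (simp add: fin_point_def)
qed

lemma square_chartI:
  assumes q: "q \<in> corners F" and K: "continuous_map (top_of_set unit_square) U K"
    and eq: "\<And>x. x \<in> unit_square \<Longrightarrow> p (K x) = corner_map F q (fst x, if b then 1 - snd x else snd x)"
  shows "K \<in> square_charts"
proof -
  obtain i k a where ika: "q = (i, k, a)"
    by (metis prod_cases3)
  let ?k = "if a then k else circle_prev (fin_length F i) k"
  let ?h = "\<lambda>x :: real \<times> real. (if \<not> a then 1 - fst x else fst x, if b then 1 - snd x else snd x)"
  have "square_map F i ?k \<in> square_maps (fin_complex F)"
    using q circle_prev_less by (auto simp: ika corners_def square_maps_eq)
  moreover have "p (K x) = square_map F i ?k (?h x)" if "x \<in> unit_square" for x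
    using eq[OF that] by (simp add: ika)
  ultimately show ?thesis
    unfolding square_maps_L using self_isometry_square_flips[of "\<not> a" b] K
    by (intro chartI[where h = ?h]) (auto simp: prod_eq_iff)
qed

lemma corner_lift_chart:
  assumes "x \<in> topspace U" "p x = Base (Vertex (dart_src G (corner_dart F q)))" "q \<in> corners F"
  shows "corner_lift x q \<in> square_charts"
  by (rule square_chartI[where b = False, OF assms(3) corner_lift(1)[OF assms]]) (simp add: corner_lift(3)[OF assms])

text \<open>
  The lift of a square that starts at a point of the outer boundary, turned upside down.
\<close>

definition outer_lift where
  "outer_lift x q = (SOME K. continuous_map (top_of_set unit_square) U K \<and> K (0, 0) = x \<and>
     (\<forall>y\<in>unit_square. p (K y) = corner_map F q (fst y, 1 - snd y)))"

lemma outer_lift: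
  assumes "x \<in> topspace U" "p x = Fin i (Vertex k) 1" "(i, k, b) \<in> corners F"
  shows "continuous_map (top_of_set unit_square) U (outer_lift x (i, k, b))" "outer_lift x (i, k, b) (0, 0) = x"
    "\<And>y. y \<in> unit_square \<Longrightarrow> p (outer_lift x (i, k, b) y) = corner_map F (i, k, b) (fst y, 1 - snd y)"
proof -
  have "p x = corner_map F (i, k, b) (fst (0 :: real, 0 :: real), 1 - snd (0 :: real, 0 :: real))"
    using assms(2) corner_map_outer[OF assms(3)] by (simp del: corner_map.simps)
  then obtain K where "continuous_map (top_of_set unit_square) U K" "K (0, 0) = x"
    "\<And>y. y \<in> unit_square \<Longrightarrow> p (K y) = corner_map F (i, k, b) (fst y, 1 - snd y)"
    using covering_map_square_lift[OF covering continuous_square_rev(2)[OF continuous_corner_map[OF assms(3)]] assms(1)] by blast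
  then have "\<exists>K. continuous_map (top_of_set unit_square) U K \<and> K (0, 0) = x \<and>
     (\<forall>y\<in>unit_square. p (K y) = corner_map F (i, k, b) (fst y, 1 - snd y))"
    by (intro exI[of _ K] conjI ballI)
  from someI_ex[OF this] show "continuous_map (top_of_set unit_square) U (outer_lift x (i, k, b))" "outer_lift x (i, k, b) (0, 0) = x"
    "\<And>y. y \<in> unit_square \<Longrightarrow> p (outer_lift x (i, k, b) y) = corner_map F (i, k, b) (fst y, 1 - snd y)"
    unfolding outer_lift_def[symmetric] by blast+
qed

lemma outer_lift_chart:
  assumes "x \<in> topspace U" "p x = Fin i (Vertex k) 1" "(i, k, b) \<in> corners F"
  shows "outer_lift x (i, k, b) \<in> square_charts"
  by (rule square_chartI[where b = True, OF assms(3) outer_lift(1)[OF assms]]) (simp only: outer_lift(3)[OF assms] if_True)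

lemma dart_lift_chart:
  assumes "x \<in> topspace U" "p x = Base (Vertex (dart_src G d))" "d \<in> darts G"
  shows "dart_lift x d \<in> edge_charts"
proof -
  let ?h = "\<lambda>s :: real. if snd d then s else 1 - s"
  have "self_isometry unit_interval ?h"
    using self_isometry_interval_refl self_isometry_interval_rev by (cases "snd d") simp_all
  moreover have "(\<lambda>t. Base (edge_map G (fst d) t)) \<in> edge_maps (fin_complex F)"
    using assms(3) by (auto simp: fin_complex_def darts_def)
  ultimately show ?thesis
    unfolding edge_maps_L using dart_lift(1,3)[OF assms]
    by (intro chartI[where h = ?h]) (auto simp: dart_map_def)
qed

text \<open>
  The lifts of vertical edges, in both directions.
\<close>

definition is_vertical where
  "is_vertical c \<longleftrightarrow> is_path c \<and> (\<exists>q\<in>corners F. (\<forall>t\<in>unit_interval. p (c t) = vertical_map F q t) \<or>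
     (\<forall>t\<in>unit_interval. p (c t) = vertical_map F q (1 - t)))"

lemma edge_chart_cases:
  assumes "c \<in> edge_charts"
  obtains (base) d where "d \<in> darts G" "\<And>s. s \<in> unit_interval \<Longrightarrow> p (c s) = Base (dart_map G d s)"
    | (outer) q where "q \<in> corners F" "\<And>s. s \<in> unit_interval \<Longrightarrow> p (c s) = corner_map F q (s, 1)"
    | (vertical) "is_vertical c"
proof -
  obtain \<psi> h where \<psi>: "\<psi> \<in> edge_maps (fin_complex F)" and h: "self_isometry unit_interval h" and c: "is_path c"
    and K: "\<And>x. x \<in> unit_interval \<Longrightarrow> p (c x) = \<psi> (h x)"
    using chartE[OF assms[unfolded edge_maps_L]] by metis
  note h = self_isometry_interval[OF h]
  from \<psi> show thesis
  proof (cases rule: edge_maps_cases)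
    case (base e)
    have d: "(e, True) \<in> darts G" "dart_rev (e, True) \<in> darts G"
      using base by (simp_all add: darts_def dart_rev_def)
    show thesis
      using h
    proof
      assume "\<forall>s\<in>unit_interval. h s = s"
      then show thesis
        using that(1)[OF d(1)] K base by simp
    next
      assume "\<forall>s\<in>unit_interval. h s = 1 - s"
      then show thesis
        using that(1)[OF d(2)] K base by (simp add: dart_map_rev)
    qed
  next
    case (outer i k)
    show thesis
      using h
    proof
      assume "\<forall>s\<in>unit_interval. h s = s"
      then show thesis
        using that(2)[OF outer(1)] K outer by (simp del: corner_map.simps)
    next
      assume "\<forall>s\<in>unit_interval. h s = 1 - s"
      then show thesis
        using that(2)[OF corner_flip_in[OF outer(1)]] K outer(2) corner_map_flip[OF outer(1)] by (simp del: corner_map.simps corner_flip.simps)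
    qed
  next
    case (vertical i k)
    show thesis
      using h
    proof
      assume "\<forall>s\<in>unit_interval. h s = s"
      then have "\<forall>t\<in>unit_interval. p (c t) = vertical_map F (i, k, True) t"
        using K vertical(2) by simp
      then show thesis
        using that(3) c vertical(1) unfolding is_vertical_def by blast
    next
      assume "\<forall>s\<in>unit_interval. h s = 1 - s"
      then have "\<forall>t\<in>unit_interval. p (c t) = vertical_map F (i, k, True) (1 - t)"
        using K vertical(2) by simp
      then show thesis
        using that(3) c vertical(1) unfolding is_vertical_def by blast
    qed
  qed
qed

lemma is_vertical_rev:
  assumes "is_vertical c"
  shows "is_vertical (\<lambda>t. c (1 - t))"
proof -
  obtain q where c: "is_path c" and q: "q \<in> corners F" and or: "(\<forall>t\<in>unit_interval. p (c t) = vertical_map F q t) \<or>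
     (\<forall>t\<in>unit_interval. p (c t) = vertical_map F q (1 - t))"
    using assms unfolding is_vertical_def by blast
  have "(\<forall>t\<in>unit_interval. p (c (1 - t)) = vertical_map F q t) \<or>
     (\<forall>t\<in>unit_interval. p (c (1 - t)) = vertical_map F q (1 - t))"
    using or by auto
  then show ?thesis
    unfolding is_vertical_def using continuous_path_rev[OF c] q by blast
qed

text \<open>
  At \<open>1/3\<close> a vertical edge is in the interior of a fin, which tells it from other edges.
\<close>

lemma is_vertical_middle: "is_vertical c \<Longrightarrow> \<exists>i k. p (c (1/3)) = Fin i (Vertex k) (1/3) \<or> p (c (1/3)) = Fin i (Vertex k) (2/3)"
  unfolding is_vertical_def by (auto simp: fin_point_def)

lemma corner_lift_vertical:
  assumes "x \<in> topspace U" "p x = Base (Vertex (dart_src G (corner_dart F q)))" "q \<in> corners F"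
  shows "is_vertical (\<lambda>t. corner_lift x q (0, t))"
proof -
  have "\<forall>t\<in>unit_interval. p (corner_lift x q (0, t)) = vertical_map F q t"
    using corner_lift(3)[OF assms] corner_map_side[OF assms(3)] by simp
  then show ?thesis
    unfolding is_vertical_def using continuous_square_slices(2)[OF corner_lift(1)[OF assms], of 0] assms(3) by auto
qed

lemma outer_lift_vertical:
  assumes "x \<in> topspace U" "p x = Fin i (Vertex k) 1" "(i, k, b) \<in> corners F"
  shows "is_vertical (\<lambda>t. outer_lift x (i, k, b) (0, t))"
proof -
  have "\<forall>t\<in>unit_interval. p (outer_lift x (i, k, b) (0, t)) = vertical_map F (i, k, b) (1 - t)"
    using outer_lift(3)[OF assms] corner_map_side[OF assms(3)] by (simp del: corner_map.simps vertical_map.simps)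
  then show ?thesis
    unfolding is_vertical_def using continuous_square_slices(2)[OF outer_lift(1)[OF assms], of 0] assms(3)
    by (intro conjI bexI[of _ "(i, k, b)"] disjI2) auto
qed

section \<open>Recognizing vertical edges\<close>

text \<open>
  The edge \<open>c\<close> is a side of each square with a corner at \<open>c 0\<close>, and there is such a square. This is
  invariant under isomorphisms.
\<close>

definition in_all_squares where
  "in_all_squares c \<longleftrightarrow> (\<exists>K\<in>square_charts. K (0, 0) = c 0) \<and>
     (\<forall>K\<in>square_charts. K (0, 0) = c 0 \<longrightarrow> (\<forall>t\<in>unit_interval. K (0, t) = c t) \<or> (\<forall>t\<in>unit_interval. K (t, 0) = c t))"

text \<open>
  A point over the outer boundary lies on a single vertical edge, and both squares there
  contain it.
\<close>

lemma outer_vertical_in_all_squares: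
  assumes c: "is_path c" and q: "(i, k, b) \<in> corners F" "\<And>t. t \<in> unit_interval \<Longrightarrow> p (c t) = vertical_map F (i, k, b) (1 - t)"
  shows "in_all_squares c"
  unfolding in_all_squares_def
proof (intro conjI ballI impI)
  have c0: "c 0 \<in> topspace U" "p (c 0) = Fin i (Vertex k) 1"
    using path_in[OF c, of 0] q(2)[of 0] by (auto simp: fin_point_def)
  show "\<exists>K\<in>square_charts. K (0, 0) = c 0"
    using outer_lift_chart[OF c0 q(1)] outer_lift(2)[OF c0 q(1)] by blast
  fix K assume K: "K \<in> square_charts" "K (0, 0) = c 0"
  note Kc = square_chart_continuous[OF K(1)]
  have vm: "vertical_map F (i, k, b') t = vertical_map F (i, k, b) t" for b' t
    by simp
  have "p (K (0, 0)) = Fin i (Vertex k) 1"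
    using K c0 by simp
  from K(1) this show "(\<forall>t\<in>unit_interval. K (0, t) = c t) \<or> (\<forall>t\<in>unit_interval. K (t, 0) = c t)"
  proof (cases rule: square_chart_outer)
    case (1 b')
    have e: "p (K (0, t)) = p (c t)" if "t \<in> unit_interval" for t
      using 1(2)[of 0 t] q(2)[OF that] corner_map_side[OF 1(1), of "1 - t"] that vm[of b'] by simp
    have "K (0, t) = c t" if "t \<in> unit_interval" for t
      by (rule path_unique[OF continuous_square_slices(2)[OF Kc] c e]) (use K that in auto)
    then show ?thesis
      by blast
  next
    case (2 b')
    have e: "p (K (t, 0)) = p (c t)" if "t \<in> unit_interval" for t
      using 2(2)[of t 0] q(2)[OF that] corner_map_side[OF 2(1), of "1 - t"] that vm[of b'] by simp
    have "K (t, 0) = c t" if "t \<in> unit_interval" for t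
      by (rule path_unique[OF continuous_square_slices(1)[OF Kc] c e]) (use K that in auto)
    then show ?thesis
      by blast
  qed
qed

text \<open>
  Otherwise two squares that share a vertical edge at \<open>c 0\<close> share the edge \<open>c\<close> too. At the base
  graph this contradicts that geodesics do not backtrack, and at the outer boundary that the two
  edges of the boundary leave in different directions.
\<close>

lemma in_all_squares_vertical:
  assumes c: "is_path c" and all: "in_all_squares c"
  shows "is_vertical c"
proof -
  have D: "(\<forall>t\<in>unit_interval. K (0, t) = c t) \<or> (\<forall>t\<in>unit_interval. K (t, 0) = c t)"
    if "K \<in> square_charts" "K (0, 0) = c 0" for K
    using all that unfolding in_all_squares_def by blast
  obtain K where K: "K \<in> square_charts" "K (0, 0) = c 0"
    using all unfolding in_all_squares_def by blast
  have c0: "c 0 \<in> topspace U"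
    using path_in[OF c] by simp
  have vert: "is_vertical c" if "is_vertical c'" "\<forall>t\<in>unit_interval. c' t = c t" for c'
    using that c unfolding is_vertical_def by (metis (no_types, lifting))
  from K(1) show ?thesis
  proof (cases rule: square_chart_at)
    case (1 v)
    obtain q where q: "q \<in> corners F" "dart_src G (corner_dart F q) = v"
      using K(1) 1
    proof (cases rule: square_chart_base)
      case (1 q)
      then show thesis
        using that[of q] 1(2)[of 0 0] corner_map_origin[OF 1(1)] \<open>p (K (0, 0)) = Base (Vertex v)\<close> by simp
    next
      case (2 q)
      then show thesis
        using that[of q] 2(2)[of 0 0] corner_map_origin[OF 2(1)] \<open>p (K (0, 0)) = Base (Vertex v)\<close> by simp
    qed
    have v: "p (c 0) = Base (Vertex v)"
      using K(2) 1 by simp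
    have q1: "p (c 0) = Base (Vertex (dart_src G (corner_dart F q)))"
      using q v by simp
    have q2: "corner_opp q \<in> corners F" "p (c 0) = Base (Vertex (dart_src G (corner_dart F (corner_opp q))))"
      using q v corner_src_opp[OF q(1)] by simp_all
    show ?thesis
    proof (rule ccontr)
      assume n: "\<not> is_vertical c"
      have "\<forall>t\<in>unit_interval. corner_lift (c 0) q (t, 0) = c t"
        using D[OF corner_lift_chart[OF c0 q1 q(1)] corner_lift(2)[OF c0 q1 q(1)]] vert[OF corner_lift_vertical[OF c0 q1 q(1)]] n
        by blast
      then have "corner_lift (c 0) q (1/3, 0) = c (1/3)"
        by (rule bspec) simp
      moreover have "\<forall>t\<in>unit_interval. corner_lift (c 0) (corner_opp q) (t, 0) = c t"
        using D[OF corner_lift_chart[OF c0 q2(2,1)] corner_lift(2)[OF c0 q2(2,1)]] vert[OF corner_lift_vertical[OF c0 q2(2,1)]] n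
        by blast
      then have "corner_lift (c 0) (corner_opp q) (1/3, 0) = c (1/3)"
        by (rule bspec) simp
      ultimately have "Base (dart_map G (corner_dart F q) (1/3)) = Base (dart_map G (corner_dart F (corner_opp q)) (1/3))"
        using corner_lift(3)[OF c0 q1 q(1), of "(1/3, 0)"] corner_lift(3)[OF c0 q2(2,1), of "(1/3, 0)"]
          corner_map_bottom[OF q(1), of "1/3"] corner_map_bottom[OF q2(1), of "1/3"] by simp
      then have "corner_dart F q = corner_dart F (corner_opp q)"
        by (intro dart_map_inj[of G]) simp
      then show False
        using corner_dart_opp_neq[OF q(1)] by simp
    qed
  next
    case (2 i k)
    obtain b where q: "(i, k, b) \<in> corners F"
      using K(1) 2 by (cases rule: square_chart_outer) (rule that; assumption)+
    then have q': "(i, k, b') \<in> corners F" for b'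
      by (simp add: corners_def)
    have v: "p (c 0) = Fin i (Vertex k) 1"
      using K(2) 2 by simp
    show ?thesis
    proof (rule ccontr)
      assume n: "\<not> is_vertical c"
      have "p (c (1/3)) = corner_map F (i, k, b') (1/3, 1)" for b'
      proof -
        have "\<forall>t\<in>unit_interval. outer_lift (c 0) (i, k, b') (t, 0) = c t"
          using D[OF outer_lift_chart[OF c0 v q'] outer_lift(2)[OF c0 v q']] vert[OF outer_lift_vertical[OF c0 v q']] n
          by blast
        then have "outer_lift (c 0) (i, k, b') (1/3, 0) = c (1/3)"
          by (rule bspec) simp
        then have "p (c (1/3)) = p (outer_lift (c 0) (i, k, b') (1/3, 0))"
          by simp
        then show ?thesis
          using outer_lift(3)[OF c0 v q', of "(1/3, 0)"] by (simp del: corner_map.simps)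
      qed
      then have "corner_map F (i, k, b) (1/3, 1) = corner_map F (corner_opp (i, k, b)) (1/3, 1)"
        by (metis corner_opp.simps)
      then show False
        using corner_map_top(1)[OF q] by blast
    qed
  qed
qed

end

section \<open>Local isomorphisms induced by an isomorphism of covers\<close>

lemma local_isoI:
  assumes "v \<in> items S" "level S v = 0" "v' \<in> items S'" "level S' v' = 0"
    and sub: "r \<subseteq> at_vertex S v \<times> at_vertex S' v'"
    and total: "\<And>x. x \<in> at_vertex S v \<Longrightarrow> \<exists>y. (x, y) \<in> r" "\<And>y. y \<in> at_vertex S' v' \<Longrightarrow> \<exists>x. (x, y) \<in> r"
    and unique: "\<And>x y y'. (x, y) \<in> r \<Longrightarrow> (x, y') \<in> r \<Longrightarrow> y = y'" "\<And>x x' y. (x, y) \<in> r \<Longrightarrow> (x', y) \<in> r \<Longrightarrow> x = x'"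
    and str: "\<And>x y. (x, y) \<in> r \<Longrightarrow> level S x = level S' y \<and> (att S x, att S' y) \<in> r \<and> (opp S x, opp S' y) \<in> r"
  shows "local_iso S S' v v' r"
proof -
  have "r O r\<inverse> = Id_on (at_vertex S v)"
  proof (intro set_eqI iffI; clarify)
    fix x x' y assume "(x, y) \<in> r" "(x', y) \<in> r"
    then have "x = x'" "x \<in> at_vertex S v"
      using unique(2) sub by blast+
    then show "(x, x') \<in> Id_on (at_vertex S v)"
      by blast
  next
    fix x assume "x \<in> at_vertex S v"
    then obtain y where "(x, y) \<in> r"
      using total by blast
    then show "(x, x) \<in> r O r\<inverse>"
      by blast
  qed
  moreover have "r\<inverse> O r = Id_on (at_vertex S' v')"
  proof (intro set_eqI iffI; clarify)
    fix y y' x assume "(x, y) \<in> r" "(x, y') \<in> r"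
    then have "y = y'" "y \<in> at_vertex S' v'"
      using unique(1) sub by blast+
    then show "(y, y') \<in> Id_on (at_vertex S' v')"
      by blast
  next
    fix y assume "y \<in> at_vertex S' v'"
    then obtain x where "(x, y) \<in> r"
      using total by blast
    then show "(y, y) \<in> r\<inverse> O r"
      by blast
  qed
  ultimately show ?thesis
    using assms(1-5) str unfolding local_iso_def by blast
qed

lemma (in fin_graph) at_vertex_fin_structure:
  "v \<in> verts G \<Longrightarrow> at_vertex (fin_structure F) (VertexItem v) =
     {VertexItem v} \<union> {DartItem d | d. d \<in> darts G \<and> dart_src G d = v} \<union>
     {CornerItem q | q. q \<in> corners F \<and> dart_src G (corner_dart F q) = v}"
proof (rule set_eqI)
  fix x assume v: "v \<in> verts G"
  show "x \<in> at_vertex (fin_structure F) (VertexItem v) \<longleftrightarrow> x \<in> {VertexItem v} \<union> {DartItem d | d. d \<in> darts G \<and> dart_src G d = v} \<union>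
     {CornerItem q | q. q \<in> corners F \<and> dart_src G (corner_dart F q) = v}"
    using v by (cases x) (auto simp: at_vertex_def fin_structure_def image_iff simp del: split_paired_Ex split_paired_All)
qed

locale covering_iso = C1: fin_covering F1 U1 p1 + C2: fin_covering F2 U2 p2
  for F1 :: "('v1, 'e1) fin_data" and U1 :: "'a1 topology" and p1
    and F2 :: "('v2, 'e2) fin_data" and U2 :: "'a2 topology" and p2 +
  fixes f :: "'a1 \<Rightarrow> 'a2" and g :: "'a2 \<Rightarrow> 'a1"
  assumes homeo: "homeomorphic_maps U1 U2 f g"
    and cubical: "cubical_map (lifted_complex U1 p1 (fin_complex F1)) (lifted_complex U2 p2 (fin_complex F2)) f"
      "cubical_map (lifted_complex U2 p2 (fin_complex F2)) (lifted_complex U1 p1 (fin_complex F1)) g"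
begin

lemma symmetric: "covering_iso F2 U2 p2 F1 U1 p1 g f"
proof unfold_locales
  show "homeomorphic_maps U2 U1 g f"
    using homeo homeomorphic_maps_sym by blast
qed (use cubical in auto)

lemma f_in: "x \<in> topspace U1 \<Longrightarrow> f x \<in> topspace U2"
  and gf: "x \<in> topspace U1 \<Longrightarrow> g (f x) = x"
  and fg: "y \<in> topspace U2 \<Longrightarrow> f (g y) = y"
  using homeo by (auto simp: homeomorphic_maps_def continuous_map_def)

lemma path_image: "C1.is_path c \<Longrightarrow> C2.is_path (\<lambda>t. f (c t))"
  using continuous_map_compose[of "top_of_set unit_interval" U1 c U2 f] homeo
  by (simp add: homeomorphic_maps_def o_def)

lemma square_image:
  "continuous_map (top_of_set unit_square) U1 K \<Longrightarrow> continuous_map (top_of_set unit_square) U2 (\<lambda>t. f (K t))"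
  using continuous_map_compose[of "top_of_set unit_square" U1 K U2 f] homeo
  by (simp add: homeomorphic_maps_def o_def)

lemma edge_chart_image: "c \<in> C1.edge_charts \<Longrightarrow> (\<lambda>t. f (c t)) \<in> C2.edge_charts"
  using cubical(1) unfolding cubical_map_def by (blast intro: charts_image)

lemma square_chart_image: "K \<in> C1.square_charts \<Longrightarrow> (\<lambda>t. f (K t)) \<in> C2.square_charts"
  using cubical(1) unfolding cubical_map_def by (blast intro: charts_image)

lemma square_chart_image': "K \<in> C2.square_charts \<Longrightarrow> (\<lambda>t. g (K t)) \<in> C1.square_charts"
  using cubical(2) unfolding cubical_map_def by (blast intro: charts_image)

lemma in_all_squares_image:
  assumes c: "C1.is_path c" and all: "C1.in_all_squares c"
  shows "C2.in_all_squares (\<lambda>t. f (c t))"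
  unfolding C2.in_all_squares_def
proof (intro conjI ballI impI)
  obtain K where K: "K \<in> C1.square_charts" "K (0, 0) = c 0"
    using all unfolding C1.in_all_squares_def by blast
  show "\<exists>K\<in>C2.square_charts. K (0, 0) = f (c 0)"
    using square_chart_image[OF K(1)] K(2) by (intro bexI[of _ "\<lambda>t. f (K t)"]) simp
  fix K assume K: "K \<in> C2.square_charts" "K (0, 0) = f (c 0)"
  have c0: "c 0 \<in> topspace U1"
    by (rule C1.path_in[OF c]) simp
  have "g (K (0, 0)) = c 0"
    using K(2) gf[OF c0] by simp
  then have D: "(\<forall>t\<in>unit_interval. g (K (0, t)) = c t) \<or> (\<forall>t\<in>unit_interval. g (K (t, 0)) = c t)"
    by (rule mp[OF bspec[OF conjunct2[OF all[unfolded C1.in_all_squares_def]] square_chart_image'[OF K(1)]]])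
  have KU: "K (s, t) \<in> topspace U2" if "s \<in> unit_interval" "t \<in> unit_interval" for s t
    by (rule C2.square_in[OF C2.square_chart_continuous[OF K(1)]]) (use that in simp)
  have eq: "f (c t) = K y" if "g (K y) = c t" "K y \<in> topspace U2" for t y
    using fg[OF that(2)] that(1) by simp
  from D show "(\<forall>t\<in>unit_interval. K (0, t) = f (c t)) \<or> (\<forall>t\<in>unit_interval. K (t, 0) = f (c t))"
  proof
    assume a: "\<forall>t\<in>unit_interval. g (K (0, t)) = c t"
    have "K (0, t) = f (c t)" if "t \<in> unit_interval" for t
      using eq[OF bspec[OF a that] KU[OF _ that]] by simp
    then show ?thesis
      by blast
  next
    assume a: "\<forall>t\<in>unit_interval. g (K (t, 0)) = c t"
    have "K (t, 0) = f (c t)" if "t \<in> unit_interval" for t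
      using eq[OF bspec[OF a that] KU[OF that]] by simp
    then show ?thesis
      by blast
  qed
qed

text \<open>
  The criterion for vertical edges applies at their outer ends, so a vertical edge is first
  traversed downwards.
\<close>

lemma vertical_image:
  assumes "C1.is_vertical c"
  shows "C2.is_vertical (\<lambda>t. f (c t))"
proof -
  have down: "C2.is_vertical (\<lambda>t. f (c t))"
    if c: "C1.is_path c" and q: "q \<in> corners F1" "\<forall>t\<in>unit_interval. p1 (c t) = vertical_map F1 q (1 - t)" for c q
  proof -
    obtain i k b where ikb: "q = (i, k, b)"
      by (metis prod_cases3)
    have "C1.in_all_squares c"
      by (rule C1.outer_vertical_in_all_squares[OF c]) (use q ikb in blast)+
    then show ?thesis
      by (intro C2.in_all_squares_vertical path_image[OF c] in_all_squares_image[OF c])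
  qed
  obtain q where c: "C1.is_path c" and q: "q \<in> corners F1"
    and or: "(\<forall>t\<in>unit_interval. p1 (c t) = vertical_map F1 q t) \<or>
     (\<forall>t\<in>unit_interval. p1 (c t) = vertical_map F1 q (1 - t))"
    using assms unfolding C1.is_vertical_def by blast
  from or show ?thesis
  proof
    assume a: "\<forall>t\<in>unit_interval. p1 (c t) = vertical_map F1 q t"
    have "\<forall>t\<in>unit_interval. p1 (c (1 - t)) = vertical_map F1 q (1 - t)"
      using a by auto
    from down[OF continuous_path_rev[OF c] q this]
    show ?thesis
      using C2.is_vertical_rev[of "\<lambda>t. f (c (1 - t))"] by simp
  next
    assume "\<forall>t\<in>unit_interval. p1 (c t) = vertical_map F1 q (1 - t)"
    then show ?thesis
      by (rule down[OF c q])
  qed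
qed

lemma vertical_image':
  assumes "C2.is_vertical c"
  shows "C1.is_vertical (\<lambda>t. g (c t))"
proof -
  interpret S: covering_iso F2 U2 p2 F1 U1 p1 g f
    by (rule symmetric)
  show ?thesis
    using S.vertical_image[OF assms] .
qed

lemma base_not_vertical:
  assumes c: "C1.is_path c" and "p1 (c (1/3)) = Base y"
  shows "\<not> C2.is_vertical (\<lambda>t. f (c t))"
proof
  assume "C2.is_vertical (\<lambda>t. f (c t))"
  then have "C1.is_vertical (\<lambda>t. g (f (c t)))"
    by (rule vertical_image')
  moreover have "g (f (c (1/3))) = c (1/3)"
    by (rule gf[OF C1.path_in[OF c]]) simp
  ultimately show False
    using C1.is_vertical_middle[of "\<lambda>t. g (f (c t))"] assms(2) by auto
qed

text \<open>
  If \<open>f x\<close> lies over the base graph, then the image of an edge of the base graph is an edge of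
  the base graph, as it is not vertical.
\<close>

lemma base_edge:
  assumes x: "x \<in> topspace U1" "p1 x = Base (Vertex (dart_src C1.G d))" "d \<in> darts C1.G"
    and w: "p2 (f x) = Base (Vertex w)"
  shows "\<exists>d'\<in>darts C2.G. dart_src C2.G d' = w \<and> (\<forall>s\<in>unit_interval. f (C1.dart_lift x d s) = C2.dart_lift (f x) d' s)"
proof -
  note l = C1.dart_lift[OF x]
  have nv: "\<not> C2.is_vertical (\<lambda>t. f (C1.dart_lift x d t))"
    by (rule base_not_vertical[OF l(1)]) (rule l(3), simp)
  have "(\<lambda>t. f (C1.dart_lift x d t)) \<in> C2.edge_charts"
    by (rule edge_chart_image[OF C1.dart_lift_chart[OF x]])
  then show ?thesis
  proof (cases rule: C2.edge_chart_cases)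
    case (base d')
    have "dart_src C2.G d' = w"
      using base(2)[of 0] w l(2) by (simp add: dart_map_0)
    moreover have "f (C1.dart_lift x d s) = C2.dart_lift (f x) d' s" if "s \<in> unit_interval" for s
      using C2.dart_lift_eq[OF path_image[OF l(1)] base(1) base(2) that] l(2) by simp
    ultimately show ?thesis
      using base(1) by blast
  next
    case (outer q)
    then show ?thesis
      using outer(2)[of 0] w l(2) C2.corner_map_side[OF outer(1), of 1] by (cases q) (simp add: fin_point_def)
  next
    case vertical
    then show ?thesis
      using nv by blast
  qed
qed

lemma base_corner:
  assumes x: "x \<in> topspace U1" "p1 x = Base (Vertex (dart_src C1.G (corner_dart F1 q)))" "q \<in> corners F1"
    and w: "p2 (f x) = Base (Vertex w)"
  shows "\<exists>q'\<in>corners F2. dart_src C2.G (corner_dart F2 q') = w \<and>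
    (\<forall>y\<in>unit_square. f (C1.corner_lift x q y) = C2.corner_lift (f x) q' y)"
proof -
  note l = C1.corner_lift[OF x]
  have K: "(\<lambda>t. f (C1.corner_lift x q t)) \<in> C2.square_charts"
    by (rule square_chart_image[OF C1.corner_lift_chart[OF x]])
  have "p2 (f (C1.corner_lift x q (0, 0))) = Base (Vertex w)"
    using l(2) w by simp
  from K this show ?thesis
  proof (cases rule: C2.square_chart_base)
    case (1 q')
    have "dart_src C2.G (corner_dart F2 q') = w"
      using 1(2)[of 0 0] l(2) w C2.corner_map_origin[OF 1(1)] by simp
    moreover have "p2 (f (C1.corner_lift x q y)) = corner_map F2 q' y" if "y \<in> unit_square" for y
      using 1(2)[of "fst y" "snd y"] that by (simp add: mem_Times_iff)
    then have "f (C1.corner_lift x q y) = C2.corner_lift (f x) q' y" if "y \<in> unit_square" for y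
      using C2.corner_lift_eq[OF square_image[OF l(1)] 1(1) _ that] l(2) by simp
    ultimately show ?thesis
      using 1(1) by blast
  next
    case (2 q')
    have "C2.is_vertical (\<lambda>t. f (C1.corner_lift x q (0, t)))"
      by (rule vertical_image[OF C1.corner_lift_vertical[OF x]])
    from C2.is_vertical_middle[OF this] show ?thesis
      using 2(2)[of 0 "1/3"] C2.corner_map_bottom[OF 2(1), of "1/3"] by auto
  qed
qed

definition dart_match where
  "dart_match x d d' \<longleftrightarrow> d \<in> darts C1.G \<and> p1 x = Base (Vertex (dart_src C1.G d)) \<and>
     d' \<in> darts C2.G \<and> p2 (f x) = Base (Vertex (dart_src C2.G d')) \<and>
     (\<forall>s\<in>unit_interval. f (C1.dart_lift x d s) = C2.dart_lift (f x) d' s)"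

definition corner_match where
  "corner_match x q q' \<longleftrightarrow> q \<in> corners F1 \<and> p1 x = Base (Vertex (dart_src C1.G (corner_dart F1 q))) \<and>
     q' \<in> corners F2 \<and> p2 (f x) = Base (Vertex (dart_src C2.G (corner_dart F2 q'))) \<and>
     (\<forall>y\<in>unit_square. f (C1.corner_lift x q y) = C2.corner_lift (f x) q' y)"

text \<open>
  The local isomorphism that \<open>f\<close> induces at \<open>x\<close>.
\<close>

definition link where
  "link x = {(VertexItem v, VertexItem w) | v w. p1 x = Base (Vertex v) \<and> p2 (f x) = Base (Vertex w)} \<union>
     {(DartItem d, DartItem d') | d d'. dart_match x d d'} \<union>
     {(CornerItem q, CornerItem q') | q q'. corner_match x q q'}"

lemma dart_match_ex:
  assumes "x \<in> topspace U1" "p1 x = Base (Vertex (dart_src C1.G d))" "d \<in> darts C1.G" "p2 (f x) = Base (Vertex w)"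
  shows "\<exists>d'. dart_match x d d'"
  using base_edge[OF assms] assms unfolding dart_match_def by auto

lemma corner_match_ex:
  assumes "x \<in> topspace U1" "p1 x = Base (Vertex (dart_src C1.G (corner_dart F1 q)))" "q \<in> corners F1"
    "p2 (f x) = Base (Vertex w)"
  shows "\<exists>q'. corner_match x q q'"
proof -
  obtain q' where "q' \<in> corners F2" "dart_src C2.G (corner_dart F2 q') = w"
    "\<forall>y\<in>unit_square. f (C1.corner_lift x q y) = C2.corner_lift (f x) q' y"
    using base_corner[OF assms] by (elim bexE conjE) (rule that)
  then have "corner_match x q q'"
    using assms unfolding corner_match_def by (intro conjI) simp_all
  then show ?thesis
    by blast
qed

lemma dart_match_unique:
  assumes "x \<in> topspace U1" "dart_match x d d'" "dart_match x d d''"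
  shows "d' = d''"
proof -
  have "C2.dart_lift (f x) d' s = C2.dart_lift (f x) d'' s" if "s \<in> unit_interval" for s
  proof -
    have "\<forall>s\<in>unit_interval. f (C1.dart_lift x d s) = C2.dart_lift (f x) d' s"
      "\<forall>s\<in>unit_interval. f (C1.dart_lift x d s) = C2.dart_lift (f x) d'' s"
      using assms(2,3) unfolding dart_match_def by blast+
    from bspec[OF this(1) that] bspec[OF this(2) that] show ?thesis
      by simp
  qed
  then show ?thesis
    using C2.dart_lift_inj[OF f_in[OF assms(1)]] assms(2,3) unfolding dart_match_def by blast
qed

lemma corner_match_unique:
  assumes "x \<in> topspace U1" "corner_match x q q'" "corner_match x q q''"
  shows "q' = q''"
proof -
  have "C2.corner_lift (f x) q' y = C2.corner_lift (f x) q'' y" if "y \<in> unit_square" for y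
  proof -
    have "\<forall>y\<in>unit_square. f (C1.corner_lift x q y) = C2.corner_lift (f x) q' y"
      "\<forall>y\<in>unit_square. f (C1.corner_lift x q y) = C2.corner_lift (f x) q'' y"
      using assms(2,3) unfolding corner_match_def by blast+
    from bspec[OF this(1) that] bspec[OF this(2) that] show ?thesis
      by simp
  qed
  then show ?thesis
    using C2.corner_lift_inj[OF f_in[OF assms(1)]] assms(2,3) unfolding corner_match_def by blast
qed

lemma corner_match_dart:
  assumes x: "x \<in> topspace U1" and m: "corner_match x q q'"
  shows "dart_match x (corner_dart F1 q) (corner_dart F2 q')"
proof -
  note q = m[unfolded corner_match_def]
  have "f (C1.dart_lift x (corner_dart F1 q) s) = C2.dart_lift (f x) (corner_dart F2 q') s" if s: "s \<in> unit_interval" for s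
  proof -
    have "(s, 0) \<in> unit_square"
      using s by simp
    then have "f (C1.corner_lift x q (s, 0)) = C2.corner_lift (f x) q' (s, 0)"
      using q by blast
    then show ?thesis
      using C1.corner_lift_bottom[OF x _ _ s] C2.corner_lift_bottom[OF f_in[OF x] _ _ s] q by simp
  qed
  then show ?thesis
    using q C1.corner_dart_in C2.corner_dart_in unfolding dart_match_def by blast
qed

text \<open>
  Opposite corners have a common vertical edge, so their images do, too. That these images are
  not equal follows from the same fact for the inverse of \<open>f\<close>.
\<close>

lemma corner_match_opp_aux:
  assumes x: "x \<in> topspace U1" and m: "corner_match x q q'"
  shows "\<exists>q''\<in>{q', corner_opp q'}. corner_match x (corner_opp q) q''"
proof -
  note q = m[unfolded corner_match_def]
  have oq: "corner_opp q \<in> corners F1" "p1 x = Base (Vertex (dart_src C1.G (corner_dart F1 (corner_opp q))))"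
    using q C1.corner_src_opp by simp_all
  obtain q'' where m': "corner_match x (corner_opp q) q''"
    using corner_match_ex[OF x oq(2,1)] q by blast
  note q'' = m'[unfolded corner_match_def]
  have i: "(0, 1/3) \<in> unit_square" "1/3 \<in> unit_interval"
    by simp_all
  have "f (C1.corner_lift x q (0, 1/3)) = C2.corner_lift (f x) q' (0, 1/3)"
    "f (C1.corner_lift x (corner_opp q) (0, 1/3)) = C2.corner_lift (f x) q'' (0, 1/3)"
    using q q'' i by blast+
  moreover have "C1.corner_lift x q (0, 1/3) = C1.corner_lift x (corner_opp q) (0, 1/3)"
    using C1.corner_lift_side[OF x _ _ i(2)] q by blast
  ultimately have "p2 (C2.corner_lift (f x) q' (0, 1/3)) = p2 (C2.corner_lift (f x) q'' (0, 1/3))"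
    by simp
  then have "vertical_map F2 q' (1/3) = vertical_map F2 q'' (1/3)"
    using C2.corner_lift(3)[OF f_in[OF x] _ _ i(1)] C2.corner_map_side q q'' by metis
  then have "q'' = q' \<or> q'' = corner_opp q'"
    by (intro vertical_map_eq[of "1/3"]) simp_all
  then show ?thesis
    using m' by blast
qed

text \<open>
  At the other end of a dart, \<open>f\<close> matches the reversed darts.
\<close>

lemma dart_match_step:
  assumes x: "x \<in> topspace U1" and m: "dart_match x d d'"
  shows "dart_match (C1.dart_lift x d 1) (dart_rev d) (dart_rev d')"
    "f (C1.dart_lift x d 1) = C2.dart_lift (f x) d' 1"
proof -
  note d = m[unfolded dart_match_def]
  have d1: "p1 x = Base (Vertex (dart_src C1.G d))" "d \<in> darts C1.G"
    and d2: "p2 (f x) = Base (Vertex (dart_src C2.G d'))" "d' \<in> darts C2.G"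
    and eq: "\<And>s. s \<in> unit_interval \<Longrightarrow> f (C1.dart_lift x d s) = C2.dart_lift (f x) d' s"
    using d by blast+
  show e: "f (C1.dart_lift x d 1) = C2.dart_lift (f x) d' 1"
    using eq[of 1] by simp
  have "f (C1.dart_lift (C1.dart_lift x d 1) (dart_rev d) s) = C2.dart_lift (f (C1.dart_lift x d 1)) (dart_rev d') s"
    if "s \<in> unit_interval" for s
    unfolding e C1.dart_lift_rev[OF x d1 that] C2.dart_lift_rev[OF f_in[OF x] d2 that]
    by (rule eq) (use that in auto)
  then show "dart_match (C1.dart_lift x d 1) (dart_rev d) (dart_rev d')"
    using C1.dart_lift_end(2)[OF x d1] C2.dart_lift_end(2)[OF f_in[OF x] d2] d1(2) d2(2) e
    unfolding dart_match_def by simp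
qed

lemma corner_match_step:
  assumes x: "x \<in> topspace U1" and m: "corner_match x q q'"
  shows "corner_match (C1.dart_lift x (corner_dart F1 q) 1) (corner_flip F1 q) (corner_flip F2 q')"
proof -
  note q = m[unfolded corner_match_def]
  have q1: "p1 x = Base (Vertex (dart_src C1.G (corner_dart F1 q)))" "q \<in> corners F1"
    and q2: "p2 (f x) = Base (Vertex (dart_src C2.G (corner_dart F2 q')))" "q' \<in> corners F2"
    and eq: "\<And>y. y \<in> unit_square \<Longrightarrow> f (C1.corner_lift x q y) = C2.corner_lift (f x) q' y"
    using q by blast+
  have e: "f (C1.dart_lift x (corner_dart F1 q) 1) = C2.dart_lift (f x) (corner_dart F2 q') 1"
    using dart_match_step(2)[OF x corner_match_dart[OF x m]] .
  have "f (C1.corner_lift (C1.dart_lift x (corner_dart F1 q) 1) (corner_flip F1 q) y) =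
      C2.corner_lift (f (C1.dart_lift x (corner_dart F1 q) 1)) (corner_flip F2 q') y"
    if y: "y \<in> unit_square" for y
    unfolding e C1.corner_lift_flip[OF x q1 y] C2.corner_lift_flip[OF f_in[OF x] q2 y]
    by (rule eq) (use y in \<open>auto simp: mem_Times_iff\<close>)
  moreover have "p1 (C1.dart_lift x (corner_dart F1 q) 1) = Base (Vertex (dart_src C1.G (corner_dart F1 (corner_flip F1 q))))"
    using C1.dart_lift_end(2)[OF x q1(1) C1.corner_dart_in[OF q1(2)]] C1.corner_dart_flip[OF q1(2)] by simp
  moreover have "p2 (f (C1.dart_lift x (corner_dart F1 q) 1)) = Base (Vertex (dart_src C2.G (corner_dart F2 (corner_flip F2 q'))))"
    using C2.dart_lift_end(2)[OF f_in[OF x] q2(1) C2.corner_dart_in[OF q2(2)]] C2.corner_dart_flip[OF q2(2)] e by simp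
  ultimately show ?thesis
    using C1.corner_flip_in[OF q1(2)] C2.corner_flip_in[OF q2(2)] unfolding corner_match_def by blast
qed

lemma inverse_eq: "a \<in> topspace U1 \<Longrightarrow> b \<in> topspace U2 \<Longrightarrow> f a = b \<longleftrightarrow> g b = a"
  using gf fg by blast

lemma dart_match_sym:
  assumes x: "x \<in> topspace U1"
  shows "covering_iso.dart_match F2 U2 p2 F1 U1 p1 g (f x) d' d \<longleftrightarrow> dart_match x d d'"
proof -
  interpret S: covering_iso F2 U2 p2 F1 U1 p1 g f
    by (rule symmetric)
  have "(\<forall>s\<in>unit_interval. f (C1.dart_lift x d s) = C2.dart_lift (f x) d' s) \<longleftrightarrow>
      (\<forall>s\<in>unit_interval. g (C2.dart_lift (f x) d' s) = C1.dart_lift x d s)"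
    if "d \<in> darts C1.G" "p1 x = Base (Vertex (dart_src C1.G d))" "d' \<in> darts C2.G" "p2 (f x) = Base (Vertex (dart_src C2.G d'))"
    by (intro ball_cong refl inverse_eq C1.path_in[OF C1.dart_lift(1)[OF x that(2,1)]] C2.path_in[OF C2.dart_lift(1)[OF f_in[OF x] that(4,3)]])
  then show ?thesis
    unfolding S.dart_match_def dart_match_def gf[OF x] by blast
qed

lemma corner_match_sym:
  assumes x: "x \<in> topspace U1"
  shows "covering_iso.corner_match F2 U2 p2 F1 U1 p1 g (f x) q' q \<longleftrightarrow> corner_match x q q'"
proof -
  interpret S: covering_iso F2 U2 p2 F1 U1 p1 g f
    by (rule symmetric)
  have "(\<forall>y\<in>unit_square. f (C1.corner_lift x q y) = C2.corner_lift (f x) q' y) \<longleftrightarrow>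
      (\<forall>y\<in>unit_square. g (C2.corner_lift (f x) q' y) = C1.corner_lift x q y)"
    if "q \<in> corners F1" "p1 x = Base (Vertex (dart_src C1.G (corner_dart F1 q)))"
      "q' \<in> corners F2" "p2 (f x) = Base (Vertex (dart_src C2.G (corner_dart F2 q')))"
    by (intro ball_cong refl inverse_eq C1.square_in[OF C1.corner_lift(1)[OF x that(2,1)]]
        C2.square_in[OF C2.corner_lift(1)[OF f_in[OF x] that(4,3)]])
  then show ?thesis
    unfolding S.corner_match_def corner_match_def gf[OF x] by blast
qed

lemma corner_match_opp:
  assumes x: "x \<in> topspace U1" and m: "corner_match x q q'"
  shows "corner_match x (corner_opp q) (corner_opp q')"
proof -
  interpret S: covering_iso F2 U2 p2 F1 U1 p1 g f
    by (rule symmetric)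
  \<comment> \<open>Otherwise the inverse of \<open>f\<close> matches \<open>q'\<close> with two corners.\<close>
  have "\<not> corner_match x (corner_opp q) q'"
  proof
    assume m': "corner_match x (corner_opp q) q'"
    have "S.corner_match (f x) q' q" "S.corner_match (f x) q' (corner_opp q)"
      using m m' corner_match_sym[OF x] by blast+
    then have "q = corner_opp q"
      by (rule S.corner_match_unique[OF f_in[OF x]])
    then show False
      using corner_opp_neq[of q] by simp
  qed
  then show ?thesis
    using corner_match_opp_aux[OF x m] by blast
qed

lemma local_iso_link:
  assumes x: "x \<in> topspace U1" and v: "p1 x = Base (Vertex v)" and w: "p2 (f x) = Base (Vertex w)"
    and vw: "v \<in> verts C1.G" "w \<in> verts C2.G"
  shows "local_iso (fin_structure F1) (fin_structure F2) (VertexItem v) (VertexItem w) (link x)"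
proof -
  interpret S: covering_iso F2 U2 p2 F1 U1 p1 g f
    by (rule symmetric)
  note a1 = C1.at_vertex_fin_structure[OF vw(1)] and a2 = C2.at_vertex_fin_structure[OF vw(2)]
  have mem: "(VertexItem v', z) \<in> link x \<longleftrightarrow> v' = v \<and> z = VertexItem w"
    "(DartItem d, z) \<in> link x \<longleftrightarrow> (\<exists>d'. dart_match x d d' \<and> z = DartItem d')"
    "(CornerItem q, z) \<in> link x \<longleftrightarrow> (\<exists>q'. corner_match x q q' \<and> z = CornerItem q')"
    "(z', VertexItem w') \<in> link x \<longleftrightarrow> w' = w \<and> z' = VertexItem v"
    "(z', DartItem d2) \<in> link x \<longleftrightarrow> (\<exists>d'. dart_match x d' d2 \<and> z' = DartItem d')"
    "(z', CornerItem q2) \<in> link x \<longleftrightarrow> (\<exists>q'. corner_match x q' q2 \<and> z' = CornerItem q')" for v' z z' d q w' d2 q2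
    unfolding link_def using v w by (auto simp del: split_paired_Ex split_paired_All)
  have dm: "d \<in> darts C1.G" "dart_src C1.G d = v" "d' \<in> darts C2.G" "dart_src C2.G d' = w" if "dart_match x d d'" for d d'
    using that v w unfolding dart_match_def by simp_all
  have cm: "q \<in> corners F1" "dart_src C1.G (corner_dart F1 q) = v" "q' \<in> corners F2" "dart_src C2.G (corner_dart F2 q') = w"
    if "corner_match x q q'" for q q'
    using that v w unfolding corner_match_def by simp_all
  have gfx: "p1 (g (f x)) = Base (Vertex v)"
    using gf[OF x] v by simp
  show ?thesis
  proof (rule local_isoI)
    show "VertexItem v \<in> items (fin_structure F1)" "level (fin_structure F1) (VertexItem v) = 0"
      "VertexItem w \<in> items (fin_structure F2)" "level (fin_structure F2) (VertexItem w) = 0"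
      using vw by (simp_all add: fin_structure_def)
    show "link x \<subseteq> at_vertex (fin_structure F1) (VertexItem v) \<times> at_vertex (fin_structure F2) (VertexItem w)"
    proof
      fix z assume z: "z \<in> link x"
      obtain a b where ab: "z = (a, b)"
        by (cases z)
      show "z \<in> at_vertex (fin_structure F1) (VertexItem v) \<times> at_vertex (fin_structure F2) (VertexItem w)"
      proof (cases a)
        case (VertexItem v')
        then show ?thesis
          using z unfolding ab a1 a2 by (simp add: mem)
      next
        case (DartItem d)
        then obtain d' where b: "b = DartItem d'" and m: "dart_match x d d'"
          using z unfolding ab DartItem mem by blast
        show ?thesis
          unfolding ab DartItem b a1 a2 using dm[OF m] by blast
      next
        case (CornerItem q)
        then obtain q' where b: "b = CornerItem q'" and m: "corner_match x q q'"
          using z unfolding ab CornerItem mem by blast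
        show ?thesis
          unfolding ab CornerItem b a1 a2 using cm[OF m] by blast
      qed
    qed
    show "\<exists>b. (a, b) \<in> link x" if a: "a \<in> at_vertex (fin_structure F1) (VertexItem v)" for a
    proof (cases a)
      case (VertexItem v')
      then show ?thesis
        using a unfolding a1 by (simp add: mem)
    next
      case (DartItem d)
      then have "d \<in> darts C1.G" "dart_src C1.G d = v"
        using a unfolding a1 by blast+
      then show ?thesis
        using dart_match_ex[OF x _ _ w, of d] v unfolding DartItem mem by blast
    next
      case (CornerItem q)
      then have "q \<in> corners F1" "dart_src C1.G (corner_dart F1 q) = v"
        using a unfolding a1 by blast+
      then show ?thesis
        using corner_match_ex[OF x _ _ w, of q] v unfolding CornerItem mem by blast
    qed
    show "\<exists>a. (a, b) \<in> link x" if b: "b \<in> at_vertex (fin_structure F2) (VertexItem w)" for b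
    proof (cases b)
      case (VertexItem v')
      then show ?thesis
        using b unfolding a2 by (simp add: mem)
    next
      case (DartItem d)
      then have "d \<in> darts C2.G" "dart_src C2.G d = w"
        using b unfolding a2 by blast+
      then show ?thesis
        using S.dart_match_ex[OF f_in[OF x] _ _ gfx, of d] w unfolding DartItem mem dart_match_sym[OF x] by blast
    next
      case (CornerItem q)
      then have "q \<in> corners F2" "dart_src C2.G (corner_dart F2 q) = w"
        using b unfolding a2 by blast+
      then show ?thesis
        using S.corner_match_ex[OF f_in[OF x] _ _ gfx, of q] w unfolding CornerItem mem corner_match_sym[OF x] by blast
    qed
    show "b = b'" if "(a, b) \<in> link x" "(a, b') \<in> link x" for a b b'
    proof (cases a)
      case (VertexItem v')
      then show ?thesis
        using that by (simp add: mem)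
    next
      case (DartItem d)
      then show ?thesis
        using that[unfolded DartItem mem] dart_match_unique[OF x] by blast
    next
      case (CornerItem q)
      then show ?thesis
        using that[unfolded CornerItem mem] corner_match_unique[OF x] by blast
    qed
    show "a = a'" if "(a, b) \<in> link x" "(a', b) \<in> link x" for a a' b
    proof (cases b)
      case (VertexItem v')
      then show ?thesis
        using that by (simp add: mem)
    next
      case (DartItem d)
      then show ?thesis
        using that[unfolded DartItem mem] S.dart_match_unique[OF f_in[OF x], unfolded dart_match_sym[OF x]] by blast
    next
      case (CornerItem q)
      then show ?thesis
        using that[unfolded CornerItem mem] S.corner_match_unique[OF f_in[OF x], unfolded corner_match_sym[OF x]] by blast
    qed
    show "level (fin_structure F1) a = level (fin_structure F2) b \<and>
        (att (fin_structure F1) a, att (fin_structure F2) b) \<in> link x \<and>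
        (opp (fin_structure F1) a, opp (fin_structure F2) b) \<in> link x" if ab: "(a, b) \<in> link x" for a b
    proof (cases a)
      case (VertexItem v')
      then show ?thesis
        using ab by (simp add: mem fin_structure_def)
    next
      case (DartItem d)
      then obtain d' where "b = DartItem d'" "dart_match x d d'"
        using ab unfolding DartItem mem by blast
      then show ?thesis
        using DartItem dm by (simp add: mem fin_structure_def del: split_paired_Ex split_paired_All)
    next
      case (CornerItem q)
      then obtain q' where "b = CornerItem q'" "corner_match x q q'"
        using ab unfolding CornerItem mem by blast
      then show ?thesis
        using CornerItem corner_match_dart[OF x] corner_match_opp[OF x]
        by (simp add: mem fin_structure_def del: split_paired_Ex split_paired_All corner_dart.simps)
    qed
  qed
qed

text \<open>
  The local isomorphisms that \<open>f\<close> induces at both ends of an edge agree on it. Only one inclusion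
  is shown; the other one is the same fact for the reversed dart.
\<close>

lemma flip_germ_link:
  assumes x: "x \<in> topspace U1" and m: "dart_match x d d'"
  shows "flip_germ (fin_structure F1) (fin_structure F2) (germ (fin_structure F1) (DartItem d) (link x)) \<subseteq>
    germ (fin_structure F1) (DartItem (dart_rev d)) (link (C1.dart_lift x d 1))"
proof
  fix z assume "z \<in> flip_germ (fin_structure F1) (fin_structure F2) (germ (fin_structure F1) (DartItem d) (link x))"
  then obtain a b where ab: "(a, b) \<in> link x" "a \<in> at_dart (fin_structure F1) (DartItem d)"
    and z: "z = (flip (fin_structure F1) a, flip (fin_structure F2) b)"
    unfolding flip_germ_def germ_def by auto
  from ab(2) have "a = DartItem d \<or> (\<exists>q. a = CornerItem q \<and> corner_dart F1 q = d)"
    by (cases a) (auto simp: at_dart_def fin_structure_def simp del: split_paired_Ex split_paired_All)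
  then show "z \<in> germ (fin_structure F1) (DartItem (dart_rev d)) (link (C1.dart_lift x d 1))"
  proof (elim disjE exE conjE)
    assume a: "a = DartItem d"
    then obtain d2 where b: "b = DartItem d2" "dart_match x d d2"
      using ab(1) unfolding a link_def by blast
    from dart_match_step(1)[OF x b(2)] have "(DartItem (dart_rev d), DartItem (dart_rev d2)) \<in> link (C1.dart_lift x d 1)"
      unfolding link_def by blast
    moreover have "d \<in> darts C1.G"
      using b(2) by (simp add: dart_match_def)
    ultimately show ?thesis
      unfolding z a b germ_def by (simp add: fin_structure_def at_dart_def)
  next
    fix q assume a: "a = CornerItem q" and q: "corner_dart F1 q = d"
    then obtain q' where b: "b = CornerItem q'" "corner_match x q q'"
      using ab(1) unfolding a link_def by blast
    from corner_match_step[OF x b(2)] have "(CornerItem (corner_flip F1 q), CornerItem (corner_flip F2 q')) \<in> link (C1.dart_lift x d 1)"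
      unfolding q link_def by blast
    moreover have "q \<in> corners F1"
      using b(2) by (simp add: corner_match_def)
    ultimately show ?thesis
      unfolding z a b germ_def using C1.corner_flip_in C1.corner_dart_flip q
      by (simp add: fin_structure_def at_dart_def del: corner_dart.simps corner_flip.simps)
  qed
qed

lemma bisimulation_links:
  "bisimulation (fin_structure F1) (fin_structure F2)
     {(VertexItem v, VertexItem w, link x) | v w x. x \<in> topspace U1 \<and> p1 x = Base (Vertex v) \<and> p2 (f x) = Base (Vertex w)}"
  (is "bisimulation ?S1 ?S2 ?\<Psi>")
proof -
  have verts: "v \<in> verts C1.G" if "x \<in> topspace U1" "p1 x = Base (Vertex v)" for x v
    using C1.mapping_cylinder_points(5)[OF covering_map_in_topspace[OF C1.covering that(1)]] that(2) by blast
  have verts': "w \<in> verts C2.G" if "x \<in> topspace U2" "p2 x = Base (Vertex w)" for x w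
    using C2.mapping_cylinder_points(5)[OF covering_map_in_topspace[OF C2.covering that(1)]] that(2) by blast
  have main: "local_iso ?S1 ?S2 (VertexItem v) (VertexItem w) (link x) \<and>
      (\<forall>d\<in>at_vertex ?S1 (VertexItem v). level ?S1 d = 1 \<longrightarrow>
        (\<exists>w' r'. (att ?S1 (flip ?S1 d), w', r') \<in> ?\<Psi> \<and> germ ?S1 (flip ?S1 d) r' = flip_germ ?S1 ?S2 (germ ?S1 d (link x))))"
    if x: "x \<in> topspace U1" and v: "p1 x = Base (Vertex v)" and w: "p2 (f x) = Base (Vertex w)" for x v w
  proof (intro conjI ballI impI)
    note li = local_iso_link[OF x v w verts[OF x v] verts'[OF f_in[OF x] w]]
    show "local_iso ?S1 ?S2 (VertexItem v) (VertexItem w) (link x)"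
      by (rule li)
    fix y assume y: "y \<in> at_vertex ?S1 (VertexItem v)" "level ?S1 y = 1"
    then obtain d where yd: "y = DartItem d" and d: "d \<in> darts C1.G" "dart_src C1.G d = v"
      unfolding C1.at_vertex_fin_structure[OF verts[OF x v]] by (auto simp: fin_structure_def)
    have pd: "p1 x = Base (Vertex (dart_src C1.G d))"
      using v d by simp
    obtain d' where m: "dart_match x d d'"
      using dart_match_ex[OF x pd d(1) w] by blast
    let ?x = "C1.dart_lift x d 1"
    note x' = C1.dart_lift_end[OF x pd d(1)]
    have d': "p2 (f x) = Base (Vertex (dart_src C2.G d'))" "d' \<in> darts C2.G"
      using m by (simp_all add: dart_match_def)
    have w': "p2 (f ?x) = Base (Vertex (dart_src C2.G (dart_rev d')))"
      using C2.dart_lift_end(2)[OF f_in[OF x] d'] dart_match_step(2)[OF x m] by simp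
    have mem: "(VertexItem (dart_src C1.G (dart_rev d)), VertexItem (dart_src C2.G (dart_rev d')), link ?x) \<in> ?\<Psi>"
      using x' w' by blast
    note li' = local_iso_link[OF x' w' verts[OF x'] verts'[OF f_in[OF x'(1)] w']]
    have return: "C1.dart_lift ?x (dart_rev d) 1 = x"
      using C1.dart_lift_rev[OF x pd d(1), of 1] C1.dart_lift(2)[OF x pd d(1)] by simp
    have sub: "flip_germ ?S1 ?S2 (germ ?S1 (DartItem d) (link x)) \<subseteq> germ ?S1 (DartItem (dart_rev d)) (link ?x)"
      by (rule flip_germ_link[OF x m])
    have "flip_germ ?S1 ?S2 (germ ?S1 (DartItem (dart_rev d)) (link ?x)) \<subseteq> germ ?S1 (DartItem d) (link x)"
      using flip_germ_link[OF x'(1) dart_match_step(1)[OF x m]] return by simp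
    then have "flip_germ ?S1 ?S2 (flip_germ ?S1 ?S2 (germ ?S1 (DartItem (dart_rev d)) (link ?x))) \<subseteq>
        flip_germ ?S1 ?S2 (germ ?S1 (DartItem d) (link x))"
      unfolding flip_germ_def by (rule image_mono)
    moreover have "flip_germ ?S1 ?S2 (flip_germ ?S1 ?S2 (germ ?S1 (DartItem (dart_rev d)) (link ?x))) = germ ?S1 (DartItem (dart_rev d)) (link ?x)"
      by (rule flip_germ_flip_germ[OF C1.wf_fin_structure C2.wf_fin_structure li']) (simp add: fin_structure_def)
    ultimately have "germ ?S1 (DartItem (dart_rev d)) (link ?x) = flip_germ ?S1 ?S2 (germ ?S1 (DartItem d) (link x))"
      using sub by blast
    moreover have "flip ?S1 y = DartItem (dart_rev d)" "att ?S1 (flip ?S1 y) = VertexItem (dart_src C1.G (dart_rev d))"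
      by (simp_all add: yd fin_structure_def)
    ultimately show "\<exists>w' r'. (att ?S1 (flip ?S1 y), w', r') \<in> ?\<Psi> \<and> germ ?S1 (flip ?S1 y) r' = flip_germ ?S1 ?S2 (germ ?S1 y (link x))"
      unfolding yd[symmetric] using mem by (intro exI[of _ "VertexItem (dart_src C2.G (dart_rev d'))"] exI[of _ "link ?x"]) (simp add: yd)
  qed
  show ?thesis
    unfolding bisimulation_def
  proof (clarify)
    fix v w x
    assume "x \<in> topspace U1" "p1 x = Base (Vertex v)" "p2 (f x) = Base (Vertex w)"
    then show "local_iso ?S1 ?S2 (VertexItem v) (VertexItem w) (link x) \<and>
      (\<forall>d\<in>at_vertex ?S1 (VertexItem v). level ?S1 d = 1 \<longrightarrow>
        (\<exists>w' r'. (att ?S1 (flip ?S1 d), w', r') \<in> ?\<Psi> \<and> germ ?S1 (flip ?S1 d) r' = flip_germ ?S1 ?S2 (germ ?S1 d (link x))))"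
      by (rule main)
  qed
qed

section \<open>Vertices over the base graph sent to the outer boundary\<close>

lemma outer_edge:
  assumes x: "x \<in> topspace U1" "p1 x = Base (Vertex (dart_src C1.G d))" "d \<in> darts C1.G"
    and w: "p2 (f x) = Fin i (Vertex k) 1"
  shows "\<exists>b. (i, k, b) \<in> corners F2 \<and> (\<forall>s\<in>unit_interval. f (C1.dart_lift x d s) = C2.outer_lift (f x) (i, k, b) (s, 0))"
proof -
  note l = C1.dart_lift[OF x]
  have nv: "\<not> C2.is_vertical (\<lambda>t. f (C1.dart_lift x d t))"
    by (rule base_not_vertical[OF l(1)]) (rule l(3), simp)
  have "(\<lambda>t. f (C1.dart_lift x d t)) \<in> C2.edge_charts"
    by (rule edge_chart_image[OF C1.dart_lift_chart[OF x]])
  then show ?thesis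
  proof (cases rule: C2.edge_chart_cases)
    case (base d')
    then show ?thesis
      using base(2)[of 0] w l(2) by simp
  next
    case (outer q)
    have "vertical_map F2 q 1 = Fin i (Vertex k) 1"
      using outer(2)[of 0] w l(2) C2.corner_map_side[OF outer(1), of 1] by simp
    then obtain b where q: "q = (i, k, b)"
      by (cases q) (auto simp: fin_point_def)
    note o = outer(1)[unfolded q]
    note ol = C2.outer_lift[OF f_in[OF x(1)] w o]
    have e: "p2 (f (C1.dart_lift x d s)) = p2 (C2.outer_lift (f x) (i, k, b) (s, 0))" if "s \<in> unit_interval" for s
      using ol(3)[of "(s, 0)"] outer(2)[OF that] that unfolding q by (simp del: corner_map.simps)
    have "f (C1.dart_lift x d s) = C2.outer_lift (f x) (i, k, b) (s, 0)" if "s \<in> unit_interval" for s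
      by (rule C2.path_unique[OF path_image[OF l(1)] continuous_square_slices(1)[OF ol(1)] e])
        (use that l(2) ol(2) in simp_all)
    then show ?thesis
      using o by blast
  next
    case vertical
    then show ?thesis
      using nv by blast
  qed
qed

lemma outer_corner:
  assumes x: "x \<in> topspace U1" "p1 x = Base (Vertex (dart_src C1.G (corner_dart F1 q)))" "q \<in> corners F1"
    and w: "p2 (f x) = Fin i (Vertex k) 1"
  shows "\<exists>b. (i, k, b) \<in> corners F2 \<and> (\<forall>y\<in>unit_square. f (C1.corner_lift x q y) = C2.outer_lift (f x) (i, k, b) y)"
proof -
  note l = C1.corner_lift[OF x]
  have K: "(\<lambda>t. f (C1.corner_lift x q t)) \<in> C2.square_charts"
    by (rule square_chart_image[OF C1.corner_lift_chart[OF x]])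
  have "p2 (f (C1.corner_lift x q (0, 0))) = Fin i (Vertex k) 1"
    using l(2) w by simp
  from K this show ?thesis
  proof (cases rule: C2.square_chart_outer)
    case (1 b)
    note ol = C2.outer_lift[OF f_in[OF x(1)] w 1(1)]
    have e: "p2 (f (C1.corner_lift x q y)) = p2 (C2.outer_lift (f x) (i, k, b) y)" if "y \<in> unit_square" for y
      using 1(2)[of "fst y" "snd y"] ol(3)[OF that] that by (simp add: mem_Times_iff del: corner_map.simps)
    have "f (C1.corner_lift x q y) = C2.outer_lift (f x) (i, k, b) y" if "y \<in> unit_square" for y
      by (rule C2.square_unique[OF square_image[OF l(1)] ol(1) e]) (use that l(2) ol(2) in simp_all)
    then show ?thesis
      using 1(1) by blast
  next
    case (2 b)
    have "C2.is_vertical (\<lambda>t. f (C1.corner_lift x q (0, t)))"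
      by (rule vertical_image[OF C1.corner_lift_vertical[OF x]])
    then obtain q' t where "p2 (f (C1.corner_lift x q (0, 1/3))) = vertical_map F2 q' t"
      unfolding C2.is_vertical_def by force
    then show ?thesis
      using 2(2)[of 0 "1/3"] C2.corner_map_top(2)[OF 2(1), of q' t] by simp
  qed
qed

text \<open>
  Squares at \<open>f x\<close> come from squares at \<open>x\<close>, and vertical edges correspond to vertical edges.
\<close>

lemma outer_lift_preimage:
  assumes x: "x \<in> topspace U1" "p1 x = Base (Vertex v)" and w: "p2 (f x) = Fin i (Vertex k) 1" and b: "(i, k, b) \<in> corners F2"
  shows "\<exists>q\<in>corners F1. dart_src C1.G (corner_dart F1 q) = v \<and>
    (\<forall>y\<in>unit_square. g (C2.outer_lift (f x) (i, k, b) y) = C1.corner_lift x q y)"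
proof -
  note ol = C2.outer_lift[OF f_in[OF x(1)] w b]
  have K: "(\<lambda>y. g (C2.outer_lift (f x) (i, k, b) y)) \<in> C1.square_charts"
    by (rule square_chart_image'[OF C2.outer_lift_chart[OF f_in[OF x(1)] w b]])
  note Kc = C1.square_chart_continuous[OF K]
  have K0: "g (C2.outer_lift (f x) (i, k, b) (0, 0)) = x"
    using ol(2) gf[OF x(1)] by simp
  have "p1 (g (C2.outer_lift (f x) (i, k, b) (0, 0))) = Base (Vertex v)"
    using K0 x(2) by simp
  from K this show ?thesis
  proof (cases rule: C1.square_chart_base)
    case (1 q)
    have "dart_src C1.G (corner_dart F1 q) = v"
      using 1(2)[of 0 0] K0 x(2) C1.corner_map_origin[OF 1(1)] by simp
    moreover have "p1 (g (C2.outer_lift (f x) (i, k, b) y)) = corner_map F1 q y" if "y \<in> unit_square" for y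
      using 1(2)[of "fst y" "snd y"] that by (simp add: mem_Times_iff)
    then have "g (C2.outer_lift (f x) (i, k, b) y) = C1.corner_lift x q y" if "y \<in> unit_square" for y
      using C1.corner_lift_eq[OF Kc 1(1) _ that] K0 by simp
    ultimately show ?thesis
      using 1(1) by blast
  next
    case (2 q)
    have "C1.is_vertical (\<lambda>t. g (C2.outer_lift (f x) (i, k, b) (0, t)))"
      by (rule vertical_image'[OF C2.outer_lift_vertical[OF f_in[OF x(1)] w b]])
    from C1.is_vertical_middle[OF this] show ?thesis
      using 2(2)[of 0 "1/3"] C1.corner_map_bottom[OF 2(1), of "1/3"] by auto
  qed
qed

end

text \<open>
  In the star of \<open>v\<close> there are a vertical edge and the two squares at it, but no further
  squares and no further edges of the base graph: \<open>v\<close> looks like a boundary point of a strip.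
\<close>

definition strip_vertex :: "('v, 'e) fin_data \<Rightarrow> 'v \<Rightarrow> bool" where
  "strip_vertex F v \<longleftrightarrow> (\<exists>q\<in>corners F. dart_src (base_graph F) (corner_dart F q) = v \<and>
     (\<forall>q'\<in>corners F. dart_src (base_graph F) (corner_dart F q') = v \<longrightarrow> q' = q \<or> q' = corner_opp q) \<and>
     (\<forall>d\<in>darts (base_graph F). dart_src (base_graph F) d = v \<longrightarrow> d = corner_dart F q \<or> d = corner_dart F (corner_opp q)))"

context covering_iso
begin

text \<open>
  The star of a vertex on the outer boundary has this form, and \<open>f\<close> carries the star of \<open>x\<close> to it.
\<close>

lemma strip_vertex_outer:
  assumes x: "x \<in> topspace U1" "p1 x = Base (Vertex v)" and w: "p2 (f x) = Fin i (Vertex k) 1"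
  shows "strip_vertex F1 v"
proof -
  have fx: "f x \<in> topspace U2"
    by (rule f_in[OF x(1)])
  have ik: "i < num_fins F2" "k < fin_length F2 i"
    using C2.mapping_cylinder_points[OF covering_map_in_topspace[OF C2.covering fx]] w by blast+
  then have b: "(i, k, b) \<in> corners F2" for b
    by (simp add: corners_def)
  have "\<forall>b. \<exists>q. q \<in> corners F1 \<and> dart_src C1.G (corner_dart F1 q) = v \<and>
    (\<forall>y\<in>unit_square. g (C2.outer_lift (f x) (i, k, b) y) = C1.corner_lift x q y)"
    using outer_lift_preimage[OF x w b] by blast
  from choice[OF this] obtain q where q: "\<And>b. q b \<in> corners F1" "\<And>b. dart_src C1.G (corner_dart F1 (q b)) = v"
    "\<And>b. \<forall>y\<in>unit_square. g (C2.outer_lift (f x) (i, k, b) y) = C1.corner_lift x (q b) y"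
    by blast
  have corner: "q' = q True \<or> q' = q False" if q': "q' \<in> corners F1" "dart_src C1.G (corner_dart F1 q') = v" for q'
  proof -
    have px: "p1 x = Base (Vertex (dart_src C1.G (corner_dart F1 q')))"
      using x q' by simp
    obtain b where b: "\<forall>y\<in>unit_square. f (C1.corner_lift x q' y) = C2.outer_lift (f x) (i, k, b) y"
      using outer_corner[OF x(1) px q'(1) w] by blast
    have "C1.corner_lift x q' y = C1.corner_lift x (q b) y" if y: "y \<in> unit_square" for y
    proof -
      have "C1.corner_lift x q' y = g (f (C1.corner_lift x q' y))"
        using gf[OF C1.square_in[OF C1.corner_lift(1)[OF x(1) px q'(1)] y]] by simp
      also have "\<dots> = C1.corner_lift x (q b) y"
        using bspec[OF b y] bspec[OF q(3) y] by simp
      finally show ?thesis .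
    qed
    moreover have "p1 x = Base (Vertex (dart_src C1.G (corner_dart F1 (q b))))"
      using x q(2) by simp
    ultimately have "q' = q b"
      using C1.corner_lift_inj[OF x(1) px q'(1) _ q(1)] by blast
    then show ?thesis
      by (cases b) auto
  qed
  have dart: "d = corner_dart F1 (q True) \<or> d = corner_dart F1 (q False)"
    if d: "d \<in> darts C1.G" "dart_src C1.G d = v" for d
  proof -
    have px: "p1 x = Base (Vertex (dart_src C1.G d))"
      using x d by simp
    obtain b where b: "\<forall>s\<in>unit_interval. f (C1.dart_lift x d s) = C2.outer_lift (f x) (i, k, b) (s, 0)"
      using outer_edge[OF x(1) px d(1) w] by blast
    have pq: "p1 x = Base (Vertex (dart_src C1.G (corner_dart F1 (q b))))"
      using x q(2) by simp
    have "C1.dart_lift x d s = C1.dart_lift x (corner_dart F1 (q b)) s" if s: "s \<in> unit_interval" for s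
    proof -
      have s0: "(s, 0) \<in> unit_square"
        using s by simp
      have "C1.dart_lift x d s = g (f (C1.dart_lift x d s))"
        using gf[OF C1.path_in[OF C1.dart_lift(1)[OF x(1) px d(1)] s]] by simp
      also have "\<dots> = C1.corner_lift x (q b) (s, 0)"
        using bspec[OF b s] bspec[OF q(3) s0] by simp
      also have "\<dots> = C1.dart_lift x (corner_dart F1 (q b)) s"
        by (rule C1.corner_lift_bottom[OF x(1) pq q(1) s])
      finally show ?thesis .
    qed
    then have "d = corner_dart F1 (q b)"
      by (rule C1.dart_lift_inj[OF x(1) px d(1) pq C1.corner_dart_in[OF q(1)]])
    then show ?thesis
      by (cases b) auto
  qed
  have "corner_opp (q True) = q True \<or> corner_opp (q True) = q False"
    by (rule corner) (use q C1.corner_src_opp in simp_all)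
  then have qF: "q False = corner_opp (q True)"
    by (metis corner_opp_neq)
  show ?thesis
    unfolding strip_vertex_def using corner dart q unfolding qF by blast
qed

lemma outer_edge_end:
  assumes x: "x \<in> topspace U1" "p1 x = Base (Vertex (dart_src C1.G d))" "d \<in> darts C1.G"
    and w: "p2 (f x) = Fin i (Vertex k) 1"
  shows "\<exists>j m. p2 (f (C1.dart_lift x d 1)) = Fin j (Vertex m) 1"
proof -
  obtain b where b: "(i, k, b) \<in> corners F2" "\<forall>s\<in>unit_interval. f (C1.dart_lift x d s) = C2.outer_lift (f x) (i, k, b) (s, 0)"
    using outer_edge[OF x w] by blast
  have "f (C1.dart_lift x d 1) = C2.outer_lift (f x) (i, k, b) (1, 0)"
    by (rule bspec[OF b(2)]) simp
  then have "p2 (f (C1.dart_lift x d 1)) = corner_map F2 (i, k, b) (1, 1)"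
    using C2.outer_lift(3)[OF f_in[OF x(1)] w b(1), of "(1, 0)"] by (simp del: corner_map.simps)
  also have "\<dots> = corner_map F2 (corner_flip F2 (i, k, b)) (0, 1)"
    using C2.corner_map_flip[OF b(1), of 0 1] by (simp del: corner_map.simps corner_flip.simps)
  also have "\<dots> = vertical_map F2 (corner_flip F2 (i, k, b)) 1"
    by (rule C2.corner_map_side[OF C2.corner_flip_in[OF b(1)]])
  finally show ?thesis
    by (cases "corner_flip F2 (i, k, b)") (simp add: fin_point_def)
qed

text \<open>
  The neighbours of \<open>x\<close> along the base graph are sent to the outer boundary as well.
\<close>

lemma all_strip_vertices:
  assumes conn: "connected_space (mapping_cylinder F1)"
    and x: "x \<in> topspace U1" "p1 x = Base (Vertex v)" and w: "p2 (f x) = Fin i (Vertex k) 1"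
  shows "\<forall>u\<in>verts C1.G. strip_vertex F1 u"
proof -
  define V where "V = {u. \<exists>x\<in>topspace U1. p1 x = Base (Vertex u) \<and> (\<exists>i k. p2 (f x) = Fin i (Vertex k) 1)}"
  have "V = verts C1.G"
  proof (rule C1.connected_graph[OF conn])
    show "V \<subseteq> verts C1.G"
      using C1.mapping_cylinder_points(5)[OF covering_map_in_topspace[OF C1.covering]] unfolding V_def by blast
    show "V \<noteq> {}"
      using x w unfolding V_def by blast
    fix d assume d: "d \<in> darts C1.G" "dart_src C1.G d \<in> V"
    then obtain y i k where y: "y \<in> topspace U1" "p1 y = Base (Vertex (dart_src C1.G d))" "p2 (f y) = Fin i (Vertex k) 1"
      unfolding V_def by blast
    show "dart_src C1.G (dart_rev d) \<in> V"
      using outer_edge_end[OF y(1,2) d(1) y(3)] C1.dart_lift_end[OF y(1,2) d(1)] unfolding V_def by blast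
  qed
  moreover have "strip_vertex F1 u" if "u \<in> V" for u
    using that strip_vertex_outer unfolding V_def by blast
  ultimately show ?thesis
    by blast
qed

text \<open>
  The vertical edge at \<open>f x\<close> ends over the base graph; its preimage is vertical and starts over
  the base graph, so it ends on the outer boundary.
\<close>

lemma outer_symmetric:
  assumes x: "x \<in> topspace U1" "p1 x = Base (Vertex v)" and w: "p2 (f x) = Fin i (Vertex k) 1"
  shows "\<exists>y u j m. y \<in> topspace U2 \<and> p2 y = Base (Vertex u) \<and> p1 (g y) = Fin j (Vertex m) 1"
proof -
  have fx: "f x \<in> topspace U2"
    by (rule f_in[OF x(1)])
  have ik: "i < num_fins F2" "k < fin_length F2 i"
    using C2.mapping_cylinder_points[OF covering_map_in_topspace[OF C2.covering fx]] w by blast+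
  then have b: "(i, k, True) \<in> corners F2"
    by (simp add: corners_def)
  obtain q where q: "q \<in> corners F1" "dart_src C1.G (corner_dart F1 q) = v"
    "\<forall>y\<in>unit_square. g (C2.outer_lift (f x) (i, k, True) y) = C1.corner_lift x q y"
    using outer_lift_preimage[OF x w b] by blast
  note ol = C2.outer_lift[OF fx w b]
  \<comment> \<open>the lower end of the vertical edge at \<open>f x\<close>\<close>
  let ?y = "C2.outer_lift (f x) (i, k, True) (0, 1)"
  have o1: "(0, 1) \<in> unit_square"
    by simp
  have "p2 ?y = corner_map F2 (i, k, True) (0, 0)"
    using ol(3)[OF o1] by (simp del: corner_map.simps)
  then have "p2 ?y = Base (Vertex (dart_src C2.G (corner_dart F2 (i, k, True))))"
    using C2.corner_map_origin[OF b] by simp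
  moreover have "g ?y = C1.corner_lift x q (0, 1)"
    by (rule bspec[OF q(3) o1])
  then have "p1 (g ?y) = vertical_map F1 q 1"
    using C1.corner_lift(3)[OF x(1) _ q(1) o1] C1.corner_map_side[OF q(1), of 1] x(2) q(2) by simp
  then have "\<exists>j m. p1 (g ?y) = Fin j (Vertex m) 1"
    by (cases q) (simp add: fin_point_def)
  moreover have "?y \<in> topspace U2"
    by (rule C2.square_in[OF ol(1) o1])
  ultimately show ?thesis
    by blast
qed

end

section \<open>Strips\<close>

lemma strip_vertexD:
  assumes "strip_vertex F v" "q \<in> corners F" "dart_src (base_graph F) (corner_dart F q) = v"
  shows "q' \<in> corners F \<Longrightarrow> dart_src (base_graph F) (corner_dart F q') = v \<Longrightarrow> q' = q \<or> q' = corner_opp q"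
    "d \<in> darts (base_graph F) \<Longrightarrow> dart_src (base_graph F) d = v \<Longrightarrow> d = corner_dart F q \<or> d = corner_dart F (corner_opp q)"
proof -
  obtain q0 where q0: "\<And>q'. q' \<in> corners F \<Longrightarrow> dart_src (base_graph F) (corner_dart F q') = v \<Longrightarrow> q' = q0 \<or> q' = corner_opp q0"
    "\<And>d. d \<in> darts (base_graph F) \<Longrightarrow> dart_src (base_graph F) d = v \<Longrightarrow> d = corner_dart F q0 \<or> d = corner_dart F (corner_opp q0)"
    using assms(1) unfolding strip_vertex_def by blast
  have q: "q = q0 \<or> q = corner_opp q0"
    using q0(1)[OF assms(2,3)] .
  show "q' = q \<or> q' = corner_opp q" if "q' \<in> corners F" "dart_src (base_graph F) (corner_dart F q') = v"
    using q0(1)[OF that] q corner_opp_opp by metis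
  show "d = corner_dart F q \<or> d = corner_dart F (corner_opp q)" if "d \<in> darts (base_graph F)" "dart_src (base_graph F) d = v"
    using q0(2)[OF that] q corner_opp_opp by metis
qed

text \<open>
  The matching of the stars of the corners \<open>q\<close> and \<open>q'\<close> that sends \<open>q\<close> to \<open>q'\<close>.
\<close>

definition strip_link where
  "strip_link F1 F2 q q' = {(VertexItem (dart_src (base_graph F1) (corner_dart F1 q)), VertexItem (dart_src (base_graph F2) (corner_dart F2 q'))),
     (DartItem (corner_dart F1 q), DartItem (corner_dart F2 q')),
     (DartItem (corner_dart F1 (corner_opp q)), DartItem (corner_dart F2 (corner_opp q'))),
     (CornerItem q, CornerItem q'), (CornerItem (corner_opp q), CornerItem (corner_opp q'))}"

lemma strip_link_opp:
  assumes "fin_graph F1" "fin_graph F2" "q \<in> corners F1" "q' \<in> corners F2"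
  shows "strip_link F1 F2 (corner_opp q) (corner_opp q') = strip_link F1 F2 q q'"
  unfolding strip_link_def fin_graph.corner_src_opp[OF assms(1,3)] fin_graph.corner_src_opp[OF assms(2,4)] corner_opp_opp
  by blast

lemma (in fin_graph) at_vertex_strip:
  assumes "strip_vertex F v" "q \<in> corners F" "dart_src G (corner_dart F q) = v"
  shows "at_vertex (fin_structure F) (VertexItem v) =
    {VertexItem v, DartItem (corner_dart F q), DartItem (corner_dart F (corner_opp q)), CornerItem q, CornerItem (corner_opp q)}"
proof -
  have v: "v \<in> verts G"
    using dart_src_in[OF corner_dart_in[OF assms(2)]] assms(3) by simp
  have o: "corner_opp q \<in> corners F" "dart_src G (corner_dart F (corner_opp q)) = v"
    using assms corner_src_opp by simp_all
  have darts: "{DartItem d | d. d \<in> darts G \<and> dart_src G d = v} = {DartItem (corner_dart F q), DartItem (corner_dart F (corner_opp q))}"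
    using strip_vertexD(2)[OF assms] corner_dart_in[OF assms(2)] corner_dart_in[OF o(1)] assms(3) o(2) by blast
  have corners: "{CornerItem q' | q'. q' \<in> corners F \<and> dart_src G (corner_dart F q') = v} = {CornerItem q, CornerItem (corner_opp q)}"
    using strip_vertexD(1)[OF assms] assms(2,3) o by blast
  show ?thesis
    unfolding at_vertex_fin_structure[OF v] darts corners by blast
qed

text \<open>
  If all stars are those of strips, then matchings of corners can be continued without
  obstruction.
\<close>

lemma bisimulation_strips:
  assumes F: "fin_graph F1" "fin_graph F2"
    and strip: "\<forall>v\<in>verts (base_graph F1). strip_vertex F1 v" "\<forall>v\<in>verts (base_graph F2). strip_vertex F2 v"
  shows "bisimulation (fin_structure F1) (fin_structure F2)
    {(VertexItem (dart_src (base_graph F1) (corner_dart F1 q)), VertexItem (dart_src (base_graph F2) (corner_dart F2 q')),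
      strip_link F1 F2 q q') | q q'. q \<in> corners F1 \<and> q' \<in> corners F2}" (is "bisimulation ?S1 ?S2 ?\<Psi>")
proof -
  interpret C1: fin_graph F1 by fact
  interpret C2: fin_graph F2 by fact
  have s1: "strip_vertex F1 (dart_src C1.G (corner_dart F1 q))" if "q \<in> corners F1" for q
    using strip(1) C1.dart_src_in[OF C1.corner_dart_in[OF that]] by blast
  have s2: "strip_vertex F2 (dart_src C2.G (corner_dart F2 q))" if "q \<in> corners F2" for q
    using strip(2) C2.dart_src_in[OF C2.corner_dart_in[OF that]] by blast
  have main: "local_iso ?S1 ?S2 (VertexItem (dart_src C1.G (corner_dart F1 q))) (VertexItem (dart_src C2.G (corner_dart F2 q'))) (strip_link F1 F2 q q') \<and>
      (\<forall>d\<in>at_vertex ?S1 (VertexItem (dart_src C1.G (corner_dart F1 q))). level ?S1 d = 1 \<longrightarrow>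
        (\<exists>w' r'. (att ?S1 (flip ?S1 d), w', r') \<in> ?\<Psi> \<and> germ ?S1 (flip ?S1 d) r' = flip_germ ?S1 ?S2 (germ ?S1 d (strip_link F1 F2 q q'))))"
    if q: "q \<in> corners F1" "q' \<in> corners F2" for q q'
  proof (intro conjI ballI impI)
    let ?v = "dart_src C1.G (corner_dart F1 q)" and ?w = "dart_src C2.G (corner_dart F2 q')"
    note a1 = C1.at_vertex_strip[OF s1[OF q(1)] q(1) refl] and a2 = C2.at_vertex_strip[OF s2[OF q(2)] q(2) refl]
    note n = C1.corner_dart_opp_neq[OF q(1)] C2.corner_dart_opp_neq[OF q(2)]
    note n' = n[symmetric] corner_opp_neq corner_opp_neq[symmetric]
    note src = C1.corner_src_opp[OF q(1)] C2.corner_src_opp[OF q(2)]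
    show "local_iso ?S1 ?S2 (VertexItem ?v) (VertexItem ?w) (strip_link F1 F2 q q')"
    proof (rule local_isoI)
      show "VertexItem ?v \<in> items ?S1" "level ?S1 (VertexItem ?v) = 0" "VertexItem ?w \<in> items ?S2" "level ?S2 (VertexItem ?w) = 0"
        using C1.dart_src_in[OF C1.corner_dart_in[OF q(1)]] C2.dart_src_in[OF C2.corner_dart_in[OF q(2)]]
        by (simp_all add: fin_structure_def)
      show "strip_link F1 F2 q q' \<subseteq> at_vertex ?S1 (VertexItem ?v) \<times> at_vertex ?S2 (VertexItem ?w)"
        unfolding a1 a2 strip_link_def by blast
      show "\<exists>b. (a, b) \<in> strip_link F1 F2 q q'" if "a \<in> at_vertex ?S1 (VertexItem ?v)" for a
        using that unfolding a1 strip_link_def by blast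
      show "\<exists>a. (a, b) \<in> strip_link F1 F2 q q'" if "b \<in> at_vertex ?S2 (VertexItem ?w)" for b
        using that unfolding a2 strip_link_def by blast
      show "b = b'" if "(a, b) \<in> strip_link F1 F2 q q'" "(a, b') \<in> strip_link F1 F2 q q'" for a b b'
        using that n n' unfolding strip_link_def by (elim insertE emptyE) (simp_all)
      show "a = a'" if "(a, b) \<in> strip_link F1 F2 q q'" "(a', b) \<in> strip_link F1 F2 q q'" for a a' b
        using that n n' unfolding strip_link_def by (elim insertE emptyE) (simp_all)
      show "level ?S1 a = level ?S2 b \<and> (att ?S1 a, att ?S2 b) \<in> strip_link F1 F2 q q' \<and> (opp ?S1 a, opp ?S2 b) \<in> strip_link F1 F2 q q'"
        if "(a, b) \<in> strip_link F1 F2 q q'" for a b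
        using that src unfolding strip_link_def by (elim insertE emptyE) (simp_all add: fin_structure_def)
    qed
    fix y assume y: "y \<in> at_vertex ?S1 (VertexItem ?v)" "level ?S1 y = 1"
    have "y = DartItem (corner_dart F1 q) \<or> y = DartItem (corner_dart F1 (corner_opp q))"
      using y unfolding a1 by (auto simp: fin_structure_def)
    then obtain p p' where p: "p \<in> corners F1" "p' \<in> corners F2" "y = DartItem (corner_dart F1 p)"
      "strip_link F1 F2 q q' = strip_link F1 F2 p p'"
    proof
      assume "y = DartItem (corner_dart F1 q)"
      then show thesis
        by (rule that[OF q]) simp
    next
      assume "y = DartItem (corner_dart F1 (corner_opp q))"
      then show thesis
        by (intro that[of "corner_opp q" "corner_opp q'"]) (simp_all add: q strip_link_opp[OF F q])
    qed
    let ?p = "corner_flip F1 p" and ?p' = "corner_flip F2 p'"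
    note fp = C1.corner_flip_in[OF p(1)] C2.corner_flip_in[OF p(2)]
    note fd = C1.corner_dart_flip[OF p(1)] C2.corner_dart_flip[OF p(2)]
    have germ: "germ ?S1 (DartItem (corner_dart F1 p)) (strip_link F1 F2 p p') =
        {(DartItem (corner_dart F1 p), DartItem (corner_dart F2 p')), (CornerItem p, CornerItem p')}"
      if "p \<in> corners F1" "p' \<in> corners F2" for p p'
      using C1.corner_dart_opp_neq[OF that(1)] that(1) C1.corner_dart_in[OF that(1)]
      unfolding germ_def strip_link_def by (auto simp: at_dart_def fin_structure_def)
    have "flip_germ ?S1 ?S2 (germ ?S1 (DartItem (corner_dart F1 p)) (strip_link F1 F2 p p')) =
        {(DartItem (corner_dart F1 ?p), DartItem (corner_dart F2 ?p')), (CornerItem ?p, CornerItem ?p')}"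
      unfolding germ[OF p(1,2)] flip_germ_def fd by (simp add: fin_structure_def)
    then have "germ ?S1 (DartItem (corner_dart F1 ?p)) (strip_link F1 F2 ?p ?p') =
        flip_germ ?S1 ?S2 (germ ?S1 (DartItem (corner_dart F1 p)) (strip_link F1 F2 p p'))"
      unfolding germ[OF fp] by simp
    moreover have fy: "flip ?S1 y = DartItem (corner_dart F1 ?p)"
      by (simp add: p(3) fin_structure_def fd del: corner_dart.simps)
    ultimately have "germ ?S1 (flip ?S1 y) (strip_link F1 F2 ?p ?p') = flip_germ ?S1 ?S2 (germ ?S1 y (strip_link F1 F2 q q'))"
      unfolding p(4) by (simp only: p(3))
    moreover have "att ?S1 (flip ?S1 y) = VertexItem (dart_src C1.G (corner_dart F1 ?p))"
      unfolding fy by (simp add: fin_structure_def)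
    then have "(att ?S1 (flip ?S1 y), VertexItem (dart_src C2.G (corner_dart F2 ?p')), strip_link F1 F2 ?p ?p') \<in> ?\<Psi>"
      using fp by (simp only: mem_Collect_eq) blast
    ultimately show "\<exists>w' r'. (att ?S1 (flip ?S1 y), w', r') \<in> ?\<Psi> \<and> germ ?S1 (flip ?S1 y) r' = flip_germ ?S1 ?S2 (germ ?S1 y (strip_link F1 F2 q q'))"
      by blast
  qed
  show ?thesis
    unfolding bisimulation_def
  proof (clarify)
    fix q q'
    assume "q \<in> corners F1" "q' \<in> corners F2"
    from main[OF this]
    show "local_iso ?S1 ?S2 (VertexItem (dart_src C1.G (corner_dart F1 q))) (VertexItem (dart_src C2.G (corner_dart F2 q'))) (strip_link F1 F2 q q') \<and>
      (\<forall>d\<in>at_vertex ?S1 (VertexItem (dart_src C1.G (corner_dart F1 q))). level ?S1 d = 1 \<longrightarrow>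
        (\<exists>w' r'. (att ?S1 (flip ?S1 d), w', r') \<in> ?\<Psi> \<and> germ ?S1 (flip ?S1 d) r' = flip_germ ?S1 ?S2 (germ ?S1 d (strip_link F1 F2 q q'))))" .
  qed
qed

text \<open>
  Either a vertex over the base graph is sent to one over the base graph, and the local
  isomorphisms induced by \<open>f\<close> form a bisimulation, or both complexes consist of strips.
\<close>

theorem (in covering_iso) bisimilar_nonempty:
  assumes conn: "connected_space (mapping_cylinder F1)" "connected_space (mapping_cylinder F2)"
    and ne: "verts C1.G \<noteq> {}"
  shows "bisimilar (fin_structure F1) (fin_structure F2) \<noteq> {}"
proof -
  interpret S: covering_iso F2 U2 p2 F1 U1 p1 g f
    by (rule symmetric)
  obtain v where v: "v \<in> verts C1.G"
    using ne by blast
  then have vc: "VertexCell v \<in> cells F1"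
    by (simp add: cells_def)
  have "cell_map F1 (VertexCell v) (0, 0) \<in> cell_map F1 (VertexCell v) ` unit_square"
    by (rule imageI) simp
  then have "Base (Vertex v) \<in> topspace (mapping_cylinder F1)"
    unfolding C1.topspace_mapping_cylinder using vc by (intro UN_I[OF vc]) simp
  then obtain x where x: "x \<in> topspace U1" "p1 x = Base (Vertex v)"
    using covering_map_surj[OF C1.covering] by (metis imageE)
  have "Base (Vertex v) \<in> vertices (fin_complex F1)"
    using v by (simp add: fin_complex_def)
  then have "x \<in> vertices (lifted_complex U1 p1 (fin_complex F1))"
    using x by (simp add: lifted_complex_def)
  then have "f x \<in> vertices (lifted_complex U2 p2 (fin_complex F2))"
    using cubical(1) unfolding cubical_map_def by blast
  then have "p2 (f x) \<in> vertices (fin_complex F2)"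
    by (simp add: lifted_complex_def)
  then consider w where "p2 (f x) = Base (Vertex w)" | i k where "p2 (f x) = Fin i (Vertex k) 1"
    by (auto simp: fin_complex_def fin_point_def)
  then show ?thesis
  proof cases
    case (1 w)
    then show ?thesis
      using bisimilarI[OF bisimulation_links] x by blast
  next
    case (2 i k)
    have strip1: "\<forall>u\<in>verts C1.G. strip_vertex F1 u"
      by (rule all_strip_vertices[OF conn(1) x 2])
    obtain y u j m where y: "y \<in> topspace U2" "p2 y = Base (Vertex u)" "p1 (g y) = Fin j (Vertex m) 1"
      using outer_symmetric[OF x 2] by blast
    have strip2: "\<forall>u\<in>verts C2.G. strip_vertex F2 u"
      by (rule S.all_strip_vertices[OF conn(2) y])
    have "strip_vertex F1 v" "strip_vertex F2 u"
      using strip_vertex_outer[OF x 2] S.strip_vertex_outer[OF y] by blast+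
    then obtain q q' where "q \<in> corners F1" "q' \<in> corners F2"
      unfolding strip_vertex_def by blast
    then show ?thesis
      using bisimilarI[OF bisimulation_strips[OF C1.fin_graph_axioms C2.fin_graph_axioms strip1 strip2]] by blast
  qed
qed

section \<open>Common covers from a nonempty bisimulation\<close>

text \<open>
  Matchings are relations between items; this is the map on darts that such a relation
  describes.
\<close>

definition dart_partner :: "(('v1, 'e1) item \<times> ('v2, 'e2) item) set \<Rightarrow> 'e1 \<times> bool \<Rightarrow> 'e2 \<times> bool" where
  "dart_partner r d = (THE d'. (DartItem d, DartItem d') \<in> r)"

definition corner_partner :: "(('v1, 'e1) item \<times> ('v2, 'e2) item) set \<Rightarrow> nat \<times> nat \<times> bool \<Rightarrow> nat \<times> nat \<times> bool" where
  "corner_partner r q = (THE q'. (CornerItem q, CornerItem q') \<in> r)"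

context
  fixes F1 :: "('v1, 'e1) fin_data" and F2 :: "('v2, 'e2) fin_data" and v w r
  assumes F: "fin_graph F1" "fin_graph F2"
    and iso: "local_iso (fin_structure F1) (fin_structure F2) (VertexItem v) (VertexItem w) r"
begin

lemma local_iso_verts: "v \<in> verts (base_graph F1)" "w \<in> verts (base_graph F2)"
  using iso unfolding local_iso_def by (auto simp: fin_structure_def)

lemma dart_partner_eq: "(DartItem d, DartItem d') \<in> r \<Longrightarrow> dart_partner r d = d'"
  unfolding dart_partner_def by (rule the_equality) (use local_iso_right_unique[OF iso] in blast)+

lemma corner_partner_eq: "(CornerItem q, CornerItem q') \<in> r \<Longrightarrow> corner_partner r q = q'"
  unfolding corner_partner_def by (rule the_equality) (use local_iso_right_unique[OF iso] in blast)+

lemma dart_pair: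
  assumes "(DartItem d, DartItem d') \<in> r"
  shows "d \<in> darts (base_graph F1)" "dart_src (base_graph F1) d = v"
    "d' \<in> darts (base_graph F2)" "dart_src (base_graph F2) d' = w"
  using local_iso_mem(1,2)[OF iso assms]
  unfolding fin_graph.at_vertex_fin_structure[OF F(1) local_iso_verts(1)] fin_graph.at_vertex_fin_structure[OF F(2) local_iso_verts(2)]
  by blast+

lemma corner_pair:
  assumes "(CornerItem q, CornerItem q') \<in> r"
  shows "q \<in> corners F1" "dart_src (base_graph F1) (corner_dart F1 q) = v"
    "q' \<in> corners F2" "dart_src (base_graph F2) (corner_dart F2 q') = w"
    "(DartItem (corner_dart F1 q), DartItem (corner_dart F2 q')) \<in> r"
    "(CornerItem (corner_opp q), CornerItem (corner_opp q')) \<in> r"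
proof -
  show "q \<in> corners F1" "dart_src (base_graph F1) (corner_dart F1 q) = v"
    "q' \<in> corners F2" "dart_src (base_graph F2) (corner_dart F2 q') = w"
    using local_iso_mem(1,2)[OF iso assms]
    unfolding fin_graph.at_vertex_fin_structure[OF F(1) local_iso_verts(1)] fin_graph.at_vertex_fin_structure[OF F(2) local_iso_verts(2)]
    by blast+
  show "(DartItem (corner_dart F1 q), DartItem (corner_dart F2 q')) \<in> r"
    "(CornerItem (corner_opp q), CornerItem (corner_opp q')) \<in> r"
    using local_iso_mem(4,5)[OF iso assms] by (simp_all add: fin_structure_def del: corner_dart.simps)
qed

lemma dart_partner:
  assumes "d \<in> darts (base_graph F1)" "dart_src (base_graph F1) d = v"
  shows "(DartItem d, DartItem (dart_partner r d)) \<in> r"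
proof -
  have "DartItem d \<in> at_vertex (fin_structure F1) (VertexItem v)"
    unfolding fin_graph.at_vertex_fin_structure[OF F(1) local_iso_verts(1)] using assms by blast
  then obtain y where y: "(DartItem d, y) \<in> r"
    by (rule local_iso_left_total[OF iso])
  have "level (fin_structure F2) y = 1"
    using local_iso_mem(3)[OF iso y] by (simp add: fin_structure_def)
  then obtain d' where "y = DartItem d'"
    by (cases y) (simp_all add: fin_structure_def)
  then show ?thesis
    using y dart_partner_eq by blast
qed

lemma corner_partner:
  assumes "q \<in> corners F1" "dart_src (base_graph F1) (corner_dart F1 q) = v"
  shows "(CornerItem q, CornerItem (corner_partner r q)) \<in> r"
proof -
  have "CornerItem q \<in> at_vertex (fin_structure F1) (VertexItem v)"
    unfolding fin_graph.at_vertex_fin_structure[OF F(1) local_iso_verts(1)] using assms by blast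
  then obtain y where y: "(CornerItem q, y) \<in> r"
    by (rule local_iso_left_total[OF iso])
  have "level (fin_structure F2) y = 2"
    using local_iso_mem(3)[OF iso y] by (simp add: fin_structure_def)
  then obtain q' where "y = CornerItem q'"
    by (cases y) (simp_all add: fin_structure_def)
  then show ?thesis
    using y corner_partner_eq by blast
qed

end

text \<open>
  A glued set of local isomorphisms, in a form that is symmetric in both complexes: \<open>N1\<close> and \<open>N2\<close>
  give the neighbours of \<open>z\<close> along darts of the first and of the second base graph.
\<close>

locale glued = C1: fin_graph F1 + C2: fin_graph F2
  for F1 :: "('v1, 'e1) fin_data" and F2 :: "('v2, 'e2) fin_data" +
  fixes Z :: "nat set" and a1 :: "nat \<Rightarrow> 'v1" and a2 :: "nat \<Rightarrow> 'v2"
    and R :: "nat \<Rightarrow> (('v1, 'e1) item \<times> ('v2, 'e2) item) set" and N1 N2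
  assumes finite_Z: "finite Z" and Z_ne: "Z \<noteq> {}"
    and connected: "connected_space (mapping_cylinder F1)" "connected_space (mapping_cylinder F2)"
    and iso: "z \<in> Z \<Longrightarrow> local_iso (fin_structure F1) (fin_structure F2) (VertexItem (a1 z)) (VertexItem (a2 z)) (R z)"
    and step: "z \<in> Z \<Longrightarrow> (DartItem d, DartItem d') \<in> R z \<Longrightarrow> N1 z d \<in> Z \<and> N2 z d' = N1 z d \<and>
      (DartItem (dart_rev d), DartItem (dart_rev d')) \<in> R (N1 z d) \<and> N1 (N1 z d) (dart_rev d) = z"
    and corner_step: "z \<in> Z \<Longrightarrow> (CornerItem q, CornerItem q') \<in> R z \<Longrightarrow>
      (CornerItem (corner_flip F1 q), CornerItem (corner_flip F2 q')) \<in> R (N1 z (corner_dart F1 q))"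
    and minimal: "W \<subseteq> Z \<Longrightarrow> W \<noteq> {} \<Longrightarrow> (\<And>z d d'. z \<in> W \<Longrightarrow> (DartItem d, DartItem d') \<in> R z \<Longrightarrow> N1 z d \<in> W) \<Longrightarrow> W = Z"
begin

lemmas F = C1.fin_graph_axioms C2.fin_graph_axioms

lemma symmetric: "glued F2 F1 Z a2 a1 (\<lambda>z. (R z)\<inverse>) N2 N1"
proof unfold_locales
  show "local_iso (fin_structure F2) (fin_structure F1) (VertexItem (a2 z)) (VertexItem (a1 z)) ((R z)\<inverse>)" if "z \<in> Z" for z
    using local_iso_converse[OF iso[OF that]] .
  show "N2 z d' \<in> Z \<and> N1 z d = N2 z d' \<and>
      (DartItem (dart_rev d'), DartItem (dart_rev d)) \<in> (R (N2 z d'))\<inverse> \<and> N2 (N2 z d') (dart_rev d') = z"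
    if "z \<in> Z" "(DartItem d', DartItem d) \<in> (R z)\<inverse>" for z d d'
    using step[of z d d'] step[of "N1 z d" "dart_rev d" "dart_rev d'"] that by simp
  show "(CornerItem (corner_flip F2 q'), CornerItem (corner_flip F1 q)) \<in> (R (N2 z (corner_dart F2 q')))\<inverse>"
    if "z \<in> Z" "(CornerItem q', CornerItem q) \<in> (R z)\<inverse>" for z q q'
    using corner_step[of z q q'] step[OF that(1) corner_pair(5)[OF F iso[OF that(1)]], of q q'] that
    by (simp del: corner_flip.simps corner_dart.simps)
  show "W = Z" if "W \<subseteq> Z" "W \<noteq> {}" "\<And>z d' d. z \<in> W \<Longrightarrow> (DartItem d', DartItem d) \<in> (R z)\<inverse> \<Longrightarrow> N2 z d' \<in> W" for W
  proof (rule minimal[OF that(1,2)])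
    fix z d d' assume z: "z \<in> W" "(DartItem d, DartItem d') \<in> R z"
    then have "z \<in> Z"
      using that(1) by blast
    from step[OF this z(2)] show "N1 z d \<in> W"
      using that(3)[of z d' d] z by simp
  qed
qed (use finite_Z Z_ne connected in auto)

lemma fin_cover: "fin_cover F1 Z a1 N1"
proof unfold_locales
  show "finite Z"
    by (rule finite_Z)
  show a_in: "a1 z \<in> verts C1.G" if "z \<in> Z" for z
    using local_iso_verts[OF F iso[OF that]] by blast
  have pair: "(DartItem d, DartItem (dart_partner (R z) d)) \<in> R z"
    if "z \<in> Z" "d \<in> darts C1.G" "dart_src C1.G d = a1 z" for z d
    by (rule dart_partner[OF F iso[OF that(1)] that(2,3)])
  show N_in: "N1 z d \<in> Z" if "z \<in> Z" "d \<in> darts C1.G" "dart_src C1.G d = a1 z" for z d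
    using step[OF that(1) pair[OF that]] by blast
  show a_N: "a1 (N1 z d) = dart_src C1.G (dart_rev d)" if "z \<in> Z" "d \<in> darts C1.G" "dart_src C1.G d = a1 z" for z d
  proof -
    note s = step[OF that(1) pair[OF that]]
    show ?thesis
      using dart_pair(2)[OF F iso[OF conjunct1[OF s]]] s by metis
  qed
  show "N1 (N1 z d) (dart_rev d) = z" if "z \<in> Z" "d \<in> darts C1.G" "dart_src C1.G d = a1 z" for z d
    using step[OF that(1) pair[OF that]] by blast
  show "W = Z" if W: "W \<subseteq> Z" "W \<noteq> {}"
    and cl: "\<And>z d. z \<in> W \<Longrightarrow> d \<in> darts C1.G \<Longrightarrow> dart_src C1.G d = a1 z \<Longrightarrow> N1 z d \<in> W" for W
  proof (rule minimal[OF W])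
    fix z d d' assume z: "z \<in> W" "(DartItem d, DartItem d') \<in> R z"
    then have "z \<in> Z"
      using W by blast
    from dart_pair(1,2)[OF F iso[OF this] z(2)] show "N1 z d \<in> W"
      by (rule cl[OF z(1)])
  qed
  have "a1 ` Z = verts C1.G"
  proof (rule C1.connected_graph[OF connected(1)])
    show "a1 ` Z \<subseteq> verts C1.G" "a1 ` Z \<noteq> {}"
      using a_in Z_ne by auto
    fix d assume d: "d \<in> darts C1.G" "dart_src C1.G d \<in> a1 ` Z"
    then obtain z where z: "z \<in> Z" "dart_src C1.G d = a1 z"
      by blast
    show "dart_src C1.G (dart_rev d) \<in> a1 ` Z"
      unfolding a_N[OF z(1) d(1) z(2), symmetric] by (rule imageI) (rule N_in[OF z(1) d(1) z(2)])
  qed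
  then show "\<exists>z\<in>Z. a1 z = v" if "v \<in> verts C1.G" for v
    using that by (metis imageE)
qed

lemma fin_cover': "fin_cover F2 Z a2 N2"
  by (rule glued.fin_cover[OF symmetric])

lemma matched_covers:
  "matched_covers F1 F2 Z a1 N1 a2 N2 (\<lambda>z. dart_partner (R z)) (\<lambda>z. corner_partner (R z))"
proof (intro matched_covers.intro matched_covers_axioms.intro fin_cover fin_cover')
  fix z d assume z: "z \<in> Z" and d: "d \<in> darts C1.G" "dart_src C1.G d = a1 z"
  note p = dart_partner[OF F iso[OF z] d]
  note s = step[OF z p]
  show "dart_partner (R z) d \<in> darts C2.G \<and> dart_src C2.G (dart_partner (R z) d) = a2 z \<and>
      N2 z (dart_partner (R z) d) = N1 z d \<and> dart_partner (R (N1 z d)) (dart_rev d) = dart_rev (dart_partner (R z) d)"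
    using dart_pair(3,4)[OF F iso[OF z] p] s dart_partner_eq[OF F iso[OF conjunct1[OF s]]] by blast
next
  fix z q assume z: "z \<in> Z" and q: "q \<in> corners F1" "dart_src C1.G (corner_dart F1 q) = a1 z"
  note p = corner_partner[OF F iso[OF z] q]
  note cp = corner_pair[OF F iso[OF z] p]
  note s = step[OF z cp(5)]
  show "corner_partner (R z) q \<in> corners F2 \<and> corner_dart F2 (corner_partner (R z) q) = dart_partner (R z) (corner_dart F1 q) \<and>
      corner_partner (R z) (corner_opp q) = corner_opp (corner_partner (R z) q) \<and>
      corner_partner (R (N1 z (corner_dart F1 q))) (corner_flip F1 q) = corner_flip F2 (corner_partner (R z) q)"
    using cp(3) dart_partner_eq[OF F iso[OF z] cp(5)] corner_partner_eq[OF F iso[OF z] cp(6)]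
      corner_partner_eq[OF F iso[OF conjunct1[OF s]] corner_step[OF z p]] by simp
qed

lemma partner_inverse:
  assumes z: "z \<in> Z"
  shows "d \<in> darts C1.G \<Longrightarrow> dart_src C1.G d = a1 z \<Longrightarrow> dart_partner ((R z)\<inverse>) (dart_partner (R z) d) = d"
    and "q \<in> corners F1 \<Longrightarrow> dart_src C1.G (corner_dart F1 q) = a1 z \<Longrightarrow> corner_partner ((R z)\<inverse>) (corner_partner (R z) q) = q"
proof -
  note i = local_iso_converse[OF iso[OF z]]
  show "dart_partner ((R z)\<inverse>) (dart_partner (R z) d) = d" if "d \<in> darts C1.G" "dart_src C1.G d = a1 z"
    using dart_partner_eq[OF F(2,1) i] dart_partner[OF F iso[OF z] that] by blast
  show "corner_partner ((R z)\<inverse>) (corner_partner (R z) q) = q" if "q \<in> corners F1" "dart_src C1.G (corner_dart F1 q) = a1 z"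
    using corner_partner_eq[OF F(2,1) i] corner_partner[OF F iso[OF z] that] by blast
qed

lemma common_cover:
  "isomorphic_complexes (lifted_complex (fin_cover.cover F1 Z a1 N1) fst (fin_complex F1))
     (lifted_complex (fin_cover.cover F2 Z a2 N2) fst (fin_complex F2))"
proof -
  interpret S: glued F2 F1 Z a2 a1 "\<lambda>z. (R z)\<inverse>" N2 N1
    by (rule symmetric)
  show ?thesis
    by (rule matched_covers_isomorphic[OF matched_covers S.matched_covers])
      (use partner_inverse S.partner_inverse in simp_all)
qed

end

lemma level_0: "level (fin_structure F) x = 0 \<Longrightarrow> \<exists>v. x = VertexItem v"
  by (cases x) (simp_all add: fin_structure_def)

text \<open>
  The local isomorphism \<open>R z\<close> identifies the darts at \<open>z\<close> of both base graphs, which defines \<open>N2\<close>.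
\<close>

lemma bisimilar_glued:
  fixes F1 :: "('v1, 'e1) fin_data" and F2 :: "('v2, 'e2) fin_data"
  assumes F: "fin_graph F1" "fin_graph F2"
    and connected: "connected_space (mapping_cylinder F1)" "connected_space (mapping_cylinder F2)"
    and ne: "bisimilar (fin_structure F1) (fin_structure F2) \<noteq> {}"
  obtains Z a1 a2 R N1 N2 where "glued F1 F2 Z a1 a2 R N1 N2"
proof -
  interpret C1: fin_graph F1 by fact
  interpret C2: fin_graph F2 by fact
  let ?S1 = "fin_structure F1" and ?S2 = "fin_structure F2"
  show thesis
  proof (rule finite_gluing[OF C1.wf_fin_structure C2.wf_fin_structure ne])
    fix Z :: "nat set" and \<pi> N
    assume Z: "finite Z" "Z \<noteq> {}" "\<And>z. z \<in> Z \<Longrightarrow> \<pi> z \<in> bisimilar ?S1 ?S2"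
      and step: "\<And>z d. z \<in> Z \<Longrightarrow> d \<in> items ?S1 \<Longrightarrow> level ?S1 d = 1 \<Longrightarrow> att ?S1 d = fst (\<pi> z) \<Longrightarrow>
         N z d \<in> Z \<and> fst (\<pi> (N z d)) = att ?S1 (flip ?S1 d) \<and>
         germ ?S1 (flip ?S1 d) (snd (snd (\<pi> (N z d)))) = flip_germ ?S1 ?S2 (germ ?S1 d (snd (snd (\<pi> z)))) \<and>
         N (N z d) (flip ?S1 d) = z"
      and minimal: "\<And>W. W \<subseteq> Z \<Longrightarrow> W \<noteq> {} \<Longrightarrow>
         (\<And>z d. z \<in> W \<Longrightarrow> d \<in> items ?S1 \<Longrightarrow> level ?S1 d = 1 \<Longrightarrow> att ?S1 d = fst (\<pi> z) \<Longrightarrow> N z d \<in> W) \<Longrightarrow> W = Z"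
    define R where "R = (\<lambda>z. snd (snd (\<pi> z)))"
    define a1 where "a1 = (\<lambda>z. THE v. fst (\<pi> z) = VertexItem v)"
    define a2 where "a2 = (\<lambda>z. THE v. fst (snd (\<pi> z)) = VertexItem v)"
    define N1 where "N1 = (\<lambda>z d. N z (DartItem d))"
    define N2 where "N2 = (\<lambda>z d'. N1 z (THE d. (DartItem d, DartItem d') \<in> R z))"
    have iso0: "local_iso ?S1 ?S2 (fst (\<pi> z)) (fst (snd (\<pi> z))) (R z)" if "z \<in> Z" for z
      using bisimilar_local_iso[of "fst (\<pi> z)" "fst (snd (\<pi> z))" "R z"] Z(3)[OF that] by (simp add: R_def)
    have \<pi>: "fst (\<pi> z) = VertexItem (a1 z)" "fst (snd (\<pi> z)) = VertexItem (a2 z)" if z: "z \<in> Z" for z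
    proof -
      have "level ?S1 (fst (\<pi> z)) = 0" "level ?S2 (fst (snd (\<pi> z))) = 0"
        using iso0[OF z] unfolding local_iso_def by blast+
      then obtain v w where "fst (\<pi> z) = VertexItem v" "fst (snd (\<pi> z)) = VertexItem w"
        using level_0 by metis
      then show "fst (\<pi> z) = VertexItem (a1 z)" "fst (snd (\<pi> z)) = VertexItem (a2 z)"
        by (simp_all add: a1_def a2_def)
    qed
    have iso: "local_iso ?S1 ?S2 (VertexItem (a1 z)) (VertexItem (a2 z)) (R z)" if "z \<in> Z" for z
      using iso0[OF that] unfolding \<pi>[OF that] .
    have N: "N1 z d \<in> Z" "germ ?S1 (DartItem (dart_rev d)) (R (N1 z d)) = flip_germ ?S1 ?S2 (germ ?S1 (DartItem d) (R z))"
        "N1 (N1 z d) (dart_rev d) = z" if z: "z \<in> Z" and d: "(DartItem d, DartItem d') \<in> R z" for z d d'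
    proof -
      note p = dart_pair[OF F iso[OF z] d]
      have "DartItem d \<in> items ?S1" "level ?S1 (DartItem d) = 1" "att ?S1 (DartItem d) = fst (\<pi> z)"
        using p \<pi>(1)[OF z] by (simp_all add: fin_structure_def)
      moreover have "flip ?S1 (DartItem d) = DartItem (dart_rev d)"
        by (simp add: fin_structure_def)
      ultimately show "N1 z d \<in> Z" "germ ?S1 (DartItem (dart_rev d)) (R (N1 z d)) = flip_germ ?S1 ?S2 (germ ?S1 (DartItem d) (R z))"
        "N1 (N1 z d) (dart_rev d) = z"
        using step[OF z, of "DartItem d"] unfolding N1_def R_def by metis+
    qed
    have flip: "(flip ?S1 x, flip ?S2 y) \<in> R (N1 z d)" if z: "z \<in> Z" and d: "(DartItem d, DartItem d') \<in> R z"
      and xy: "(x, y) \<in> R z" "x \<in> at_dart ?S1 (DartItem d)" for z d d' x y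
    proof -
      have "(flip ?S1 x, flip ?S2 y) \<in> flip_germ ?S1 ?S2 (germ ?S1 (DartItem d) (R z))"
        using xy unfolding flip_germ_def germ_def by force
      then have "(flip ?S1 x, flip ?S2 y) \<in> germ ?S1 (DartItem (dart_rev d)) (R (N1 z d))"
        unfolding N(2)[OF z d] .
      then show ?thesis
        unfolding germ_def by blast
    qed
    have "glued F1 F2 Z a1 a2 R N1 N2"
    proof unfold_locales
      show "N1 z d \<in> Z \<and> N2 z d' = N1 z d \<and> (DartItem (dart_rev d), DartItem (dart_rev d')) \<in> R (N1 z d) \<and> N1 (N1 z d) (dart_rev d) = z"
        if z: "z \<in> Z" and d: "(DartItem d, DartItem d') \<in> R z" for z d d'
      proof -
        have "(THE d. (DartItem d, DartItem d') \<in> R z) = d"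
          by (rule the_equality, rule d) (use local_iso_left_unique[OF iso[OF z]] d in blast)
        moreover have "DartItem d \<in> at_dart ?S1 (DartItem d)"
          using dart_pair(1)[OF F iso[OF z] d] by (simp add: at_dart_def fin_structure_def)
        from flip[OF z d d this] have "(DartItem (dart_rev d), DartItem (dart_rev d')) \<in> R (N1 z d)"
          by (simp add: fin_structure_def)
        ultimately show ?thesis
          using N[OF z d] by (simp add: N2_def)
      qed
      show "(CornerItem (corner_flip F1 q), CornerItem (corner_flip F2 q')) \<in> R (N1 z (corner_dart F1 q))"
        if z: "z \<in> Z" and q: "(CornerItem q, CornerItem q') \<in> R z" for z q q'
      proof -
        note p = corner_pair[OF F iso[OF z] q]
        have "CornerItem q \<in> at_dart ?S1 (DartItem (corner_dart F1 q))"
          using p(1) by (simp add: at_dart_def fin_structure_def)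
        from flip[OF z p(5) q this] show ?thesis
          by (simp add: fin_structure_def del: corner_flip.simps corner_dart.simps)
      qed
      show "W = Z" if W: "W \<subseteq> Z" "W \<noteq> {}" and cl: "\<And>z d d'. z \<in> W \<Longrightarrow> (DartItem d, DartItem d') \<in> R z \<Longrightarrow> N1 z d \<in> W" for W
      proof (rule minimal[OF W])
        fix z x assume z: "z \<in> W" and x: "x \<in> items ?S1" "level ?S1 x = 1" "att ?S1 x = fst (\<pi> z)"
        have zZ: "z \<in> Z"
          using z W by blast
        from x(2) obtain d where d: "x = DartItem d"
          by (cases x) (simp_all add: fin_structure_def)
        have "d \<in> darts C1.G" "dart_src C1.G d = a1 z"
          using x(1,3) d \<pi>(1)[OF zZ] by (auto simp: fin_structure_def)
        then show "N z x \<in> W"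
          using cl[OF z dart_partner[OF F iso[OF zZ]]] by (simp add: N1_def d)
      qed
    qed (use Z(1,2) connected iso in auto)
    then show thesis
      by (rule that)
  qed
qed

section \<open>The common cover\<close>

lemma lifted_complex_sel:
  "complex_space (lifted_complex E p X) = E" "vertices (lifted_complex E p X) = {x \<in> topspace E. p x \<in> vertices X}"
  "edge_maps (lifted_complex E p X) = lifted_cells unit_interval E p (edge_maps X)"
  "square_maps (lifted_complex E p X) = lifted_cells unit_square E p (square_maps X)"
  by (simp_all add: lifted_complex_def)

lemma lifted_cells_empty: "C \<noteq> {} \<Longrightarrow> lifted_cells C (discrete_topology {}) p \<Psi> = {}"
  unfolding lifted_cells_def by (auto simp: continuous_map_def)

text \<open>
  Connected spaces may be empty here, and the empty complex has no nonempty covers.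
\<close>

lemma empty_covers:
  assumes "topspace (complex_space X1) = {}" "topspace (complex_space X2) = {}"
  shows "finite_index_cover (discrete_topology {}) q1 X1" "finite_index_cover (discrete_topology {}) q2 X2"
    "isomorphic_complexes (lifted_complex (discrete_topology {}) q1 X1) (lifted_complex (discrete_topology {}) q2 X2)"
proof -
  show "finite_index_cover (discrete_topology {}) q1 X1" "finite_index_cover (discrete_topology {}) q2 X2"
    using assms unfolding finite_index_cover_def covering_map_def
    by (auto simp: connected_space_def)
  have "unit_interval \<noteq> {}" "unit_square \<noteq> {}"
    by auto
  then show "isomorphic_complexes (lifted_complex (discrete_topology {}) q1 X1) (lifted_complex (discrete_topology {}) q2 X2)"
    unfolding isomorphic_complexes_def cubical_map_def maps_cells_def lifted_complex_sel lifted_cells_empty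
    by (auto simp: homeomorphic_maps_def lifted_cells_empty)
qed

text \<open>
  Every edge and every square has a vertex in the base graph.
\<close>

lemma (in fin_graph) empty_mapping_cylinder:
  assumes "verts G = {}"
  shows "topspace (mapping_cylinder F) = {}"
proof -
  have "darts G = {}"
    using dart_src_in assms by blast
  then have "arcs G = {}"
    by (auto simp: darts_def)
  moreover have "corners F = {}"
    using corner_dart_in \<open>darts G = {}\<close> by blast
  then have "\<not> (i < num_fins F \<and> k < fin_length F i)" for i k
    unfolding corners_def by blast
  then have "{SquareCell i k | i k. i < num_fins F \<and> k < fin_length F i} = {}"
    by blast
  ultimately have "cells F = {}"
    unfolding cells_def assms by blast
  then show ?thesis
    unfolding topspace_mapping_cylinder by blast
qed

theorem theorem0p1:
  fixes F1 :: "('v1, 'e1) fin_data" and F2 :: "('v2, 'e2) fin_data"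
    and U1 :: "'a1 topology" and U2 :: "'a2 topology"
    and p1 :: "'a1 \<Rightarrow> ('v1, 'e1) cylinder_point" and p2 :: "'a2 \<Rightarrow> ('v2, 'e2) cylinder_point"
  assumes "graph_with_fins F1" and "connected_space (complex_space (fin_complex F1))"
    and "graph_with_fins F2" and "connected_space (complex_space (fin_complex F2))"
    and "universal_cover U1 p1 (fin_complex F1)" and "universal_cover U2 p2 (fin_complex F2)"
    and "isomorphic_complexes (lifted_complex U1 p1 (fin_complex F1))
           (lifted_complex U2 p2 (fin_complex F2))"
  shows "\<exists>(E1 :: (('v1, 'e1) cylinder_point \<times> nat) topology) q1
          (E2 :: (('v2, 'e2) cylinder_point \<times> nat) topology) q2.
           finite_index_cover E1 q1 (fin_complex F1) \<and>
           finite_index_cover E2 q2 (fin_complex F2) \<and>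
           isomorphic_complexes (lifted_complex E1 q1 (fin_complex F1))
             (lifted_complex E2 q2 (fin_complex F2))"
proof -
  have space: "complex_space (fin_complex F) = mapping_cylinder F" for F :: "('a, 'b) fin_data"
    by (simp add: fin_complex_def)
  interpret C1: fin_graph F1
    by unfold_locales fact
  interpret C2: fin_graph F2
    by unfold_locales fact
  have cov: "covering_map U1 p1 (mapping_cylinder F1)" "covering_map U2 p2 (mapping_cylinder F2)"
    using assms(5,6) unfolding universal_cover_def space by blast+
  obtain f g where fg: "homeomorphic_maps U1 U2 f g"
    "cubical_map (lifted_complex U1 p1 (fin_complex F1)) (lifted_complex U2 p2 (fin_complex F2)) f"
    "cubical_map (lifted_complex U2 p2 (fin_complex F2)) (lifted_complex U1 p1 (fin_complex F1)) g"
    using assms(7) unfolding isomorphic_complexes_def lifted_complex_sel by blast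
  show ?thesis
  proof (cases "verts C1.G = {}")
    case True
    have X1: "topspace (mapping_cylinder F1) = {}"
      by (rule C1.empty_mapping_cylinder[OF True])
    then have "topspace U1 = {}"
      using covering_map_surj[OF cov(1)] by simp
    then have "topspace U2 = {}"
      using fg(1) unfolding homeomorphic_maps_def continuous_map_def by blast
    then have X2: "topspace (mapping_cylinder F2) = {}"
      using covering_map_surj[OF cov(2)] by simp
    show ?thesis
      using empty_covers[of "fin_complex F1" "fin_complex F2"] X1 X2 unfolding space by blast
  next
    case False
    interpret I: covering_iso F1 U1 p1 F2 U2 p2 f g
      by unfold_locales (fact cov fg)+
    have conn: "connected_space (mapping_cylinder F1)" "connected_space (mapping_cylinder F2)"
      using assms(2,4) unfolding space .
    obtain Z a1 a2 R N1 N2 where "glued F1 F2 Z a1 a2 R N1 N2"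
      by (rule bisimilar_glued[OF C1.fin_graph_axioms C2.fin_graph_axioms conn I.bisimilar_nonempty[OF conn False]])
    then interpret glued F1 F2 Z a1 a2 R N1 N2 .
    show ?thesis
      using fin_cover.finite_index_cover[OF fin_cover] fin_cover.finite_index_cover[OF fin_cover'] common_cover by blast
  qed
qed

end
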